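(* Let $\mathcal{C}$ be a non-contracting $\omega$-category, let $n\ge 0$ and let $x\in\mathcal{N}^{gl}_n(\mathcal{C})=\omega Cat(\Delta^n,\mathbb{P}\mathcal{C})$. Define a map $h_n^-(x)$ from the set of faces of the $(n+1)$-cube to $\mathcal{C}$ as follows, for a face $k_1\dots k_{n+1}$ (a word in $\{-,0,+\}$): (1) if some $k_j$ equals $+$, then $h_n^-(x)(k_1\dots k_{n+1})=t_0\,x((0))$; (2) if all $k_j\in\{-,0\}$ and the positions $j$ with $k_j=0$ are exactly $\sigma_0+1<\dots<\sigma_r+1$ (with $r\ge 0$), then $h_n^-(x)(k_1\dots k_{n+1})=x((\sigma_0\dots\sigma_r))$; (3) $h_n^-(x)(-\,-\dots-)=s_0\,x((n))$. Then $h_n^-(x)$ yields an $\omega$-functor from $I^{n+1}$ to $\mathcal{C}$. Moreover $h^-=(h^-_n)_{n\ge0}$ induces a morphism of simplicial sets from the globular nerve of $\mathcal{C}$ to its negative corner nerve $\mathcal{N}^-(\mathcal{C})$, and the map $\mathcal{N}^{gl}_{-1}(\mathcal{C})=\mathcal{C}_0\times\mathcal{C}_0\to\mathcal{N}^-_{-1}(\mathcal{C})=\mathcal{C}_0$, $(a,b)\mapsto a$, extends it to a morphism of the corresponding augmented simplicial sets. Moreover, for every $n\ge 0$, $h_n^-$ is one-to-one, and its image consists exactly of those cubes $y\in\mathcal{N}^-_n(\mathcal{C})$ such that for every $1\le i\le n+1$ the cube $\partial_i^+y$ is $0$-dimensional (i.e. all its values are $0$-morphisms of $\mathcal{C}$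).
   Context: **$\omega$-categories.** An $\omega$-category is a strict globular $\omega$-category in one-set form: a set $\mathcal C$ with operations $( *_n,s_n,t_n)_{n\ge0}$, each $(\mathcal C,*_n,s_n,t_n)$ being a category ($x*_ny$ is defined iff $t_nx=s_ny$; $s_n(x*_ny)=s_nx$, $t_n(x*_ny)=t_ny$), each pair $m<n$ giving a strict 2-category (globular identities, interchange law, $s_i,t_i$ compatible with $*_j$ for $i\ne j$), and such that each $x$ satisfies $s_nx=t_nx=x$ for some $n$; the least such $n$ is the dimension of $x$. An $n$-morphism is an element of dimension $n$; $\mathcal C_n$ is the set of $n$-morphisms. $\mathcal C$ is *non-contracting* if $s_1x,t_1x$ have dimension exactly $1$ whenever $\dim x>0$. Then $\mathbb P\mathcal C$ denotes the $\omega$-category of all morphisms of $\mathcal C$ of dimension $>0$, with $*_i^{\mathbb P\mathcal C}=*_{i+1}^{\mathcal C}$, $s_i^{\mathbb P\mathcal C}=s_{i+1}^{\mathcal C}$, $t_i^{\mathbb P\mathcal C}=t_{i+1}^{\mathcal C}$. **$\Delta^n$.** Faces of the $n$-simplex are non-empty strictly increasing sequences $(\sigma_0\dots\sigma_r)$ in $\{0,\dots,n\}$, of dimension $r$. $R(x)$ is the set of subfaces of a face $x$ (including $x$), $R(X)=\bigcup_{x\in X}R(x)$. $\Delta^n$ is the free $\omega$-category generated by the $R(x)$ with the rules: for $x$ of dimension $p\ge1$, $s_{p-1}R(x)=R(s_x)$, $t_{p-1}R(x)=R(t_x)$, where $s_x$ (resp. $t_x$) is the set of faces obtained from $x$ by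 removing one element in odd (resp. even) position (positions counted from 1); and if $X,Y\in\Delta^n$ satisfy $t_p(X)=s_p(Y)$, then $X\cup Y\in\Delta^n$ and $X*_pY=X\cup Y$. For an $\omega$-functor $x$ write $x(\sigma)$ for $x(R(\sigma))$. Thus $(n)$ is the initial state and $(0)$ the final state of $\Delta^n$. **Globular nerve.** $\mathcal N^{gl}_n(\mathcal C)=\omega Cat(\Delta^n,\mathbb P\mathcal C)$ (the set of $\omega$-functors) for $n\ge0$, with faces $\partial_i$ and degeneracies $\epsilon_i$ given by $(\partial_ix)(\sigma)=x(\delta_i\sigma)$, $(\epsilon_ix)(\sigma)=x(\eta_i\sigma)$, where $\delta_i$ is the increasing injection missing $i$ and $\eta_i$ the non-decreasing surjection hitting $i$ twice (applied elementwise, taking the image set); $\mathcal N^{gl}_{-1}(\mathcal C)=\mathcal C_0\times\mathcal C_0$, with augmentation $\partial_{-1}x=(s_0x,t_0x)$ on $\mathcal N^{gl}_0(\mathcal C)=\mathcal C_1$. **$I^n$.** Faces of the $n$-cube are words $k_1\dots k_n$ in $\{-,0,+\}$ (dimension = number of zeros). $R(x)$ is the set of subfaces of $x$, $R(X)=\bigcup_{x\in X}R(x)$. $I^n$ is the free $\omega$-category generated by the $R(x)$ with the rules: for $x$ of dimension $p\ge1$, $s_{p-1}R(x)=R(s_x)$, $t_{p-1}R(x)=R(t_x)$, where $s_x$ (resp. $t_x$) consists of the faces obtained by replacing the $i$-th zero of $x$ by $(-)^i$ (resp. $(-)^{i+1}$), $(-)^i$ being $-$ for $i$ odd and $+$ for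 $i$ even; and $t_p(X)=s_p(Y)$ implies $X\cup Y\in I^n$ and $X*_pY=X\cup Y$. Write $x(k_1\dots k_n)$ for $x(R(k_1\dots k_n))$. **Negative corner nerve.** For $n\ge0$, $\mathcal N^-_n(\mathcal C)=\omega Cat(I^{n+1},\mathcal C)^-$ is the set of $\omega$-functors $x:I^{n+1}\to\mathcal C$ such that $\dim x(u)=1$ for every $1$-morphism $u$ of $I^{n+1}$ with $s_0u=-\,-\dots-$. For $\alpha\in\{-,+\}$, $(\partial_i^\alpha x)(k_1\dots k_n)=x(k_1\dots k_{i-1}\,\alpha\,k_i\dots k_n)$. Simplicial faces are $\partial_i=\partial^-_{i+1}$ and degeneracies $\epsilon_i=\Gamma^-_{i+1}$ ($0\le i\le n$), where $\Gamma_i^-(x)(k_1\dots k_{n+2})=x(k_1\dots\max(k_i,k_{i+1})\dots k_{n+2})$ for the order $-<0<+$. $\mathcal N^-_{-1}(\mathcal C)=\mathcal C_0$ with augmentation $\partial_{-1}=s_0$ (on $\mathcal N^-_0(\mathcal C)=\mathcal C_1$). An augmented simplicial set is a simplicial set with a set $X_{-1}$ and a map $\partial_{-1}:X_0\to X_{-1}$ with $\partial_{-1}\partial_0=\partial_{-1}\partial_1$; morphisms commute with all structure maps. *)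

theory Defs
  imports Main "HOL-Library.FuncSet"
begin

section \<open>Strict globular \<open>\<omega>\<close>-categories in one-set form\<close>

text \<open>
  The composition \<^term>\<open>cmp C n x y\<close> (written \<open>x *\<^sub>n y\<close> on paper) is a total function of the logic; it is
  meaningful only when \<open>t\<^sub>n x = s\<^sub>n y\<close>, and every law below is guarded accordingly.  The operations
  are irrelevant outside the carrier.
\<close>

record 'a ocat =
  carr :: "'a set"
  cmp :: "nat \<Rightarrow> 'a \<Rightarrow> 'a \<Rightarrow> 'a"
  src :: "nat \<Rightarrow> 'a \<Rightarrow> 'a"
  tgt :: "nat \<Rightarrow> 'a \<Rightarrow> 'a"

definition one_set_category ::
    "'a set \<Rightarrow> ('a \<Rightarrow> 'a \<Rightarrow> 'a) \<Rightarrow> ('a \<Rightarrow> 'a) \<Rightarrow> ('a \<Rightarrow> 'a) \<Rightarrow> bool" where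
  "one_set_category A c s t \<longleftrightarrow>
     (\<forall>x\<in>A. s x \<in> A \<and> t x \<in> A) \<and>
     (\<forall>x\<in>A. s (s x) = s x \<and> t (s x) = s x \<and> s (t x) = t x \<and> t (t x) = t x) \<and>
     (\<forall>x\<in>A. c (s x) x = x \<and> c x (t x) = x) \<and>
     (\<forall>x\<in>A. \<forall>y\<in>A. t x = s y \<longrightarrow> c x y \<in> A \<and> s (c x y) = s x \<and> t (c x y) = t y) \<and>
     (\<forall>x\<in>A. \<forall>y\<in>A. \<forall>z\<in>A. t x = s y \<and> t y = s z \<longrightarrow> c (c x y) z = c x (c y z))"

definition omega_category :: "'a ocat \<Rightarrow> bool" where
  "omega_category C \<longleftrightarrow>
     (\<forall>n. one_set_category (carr C) (cmp C n) (src C n) (tgt C n)) \<and>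
     (\<forall>m n. m < n \<longrightarrow> (\<forall>x\<in>carr C.
        src C n (src C m x) = src C m x \<and> tgt C n (src C m x) = src C m x \<and>
        src C n (tgt C m x) = tgt C m x \<and> tgt C n (tgt C m x) = tgt C m x \<and>
        src C m (src C n x) = src C m x \<and> src C m (tgt C n x) = src C m x \<and>
        tgt C m (src C n x) = tgt C m x \<and> tgt C m (tgt C n x) = tgt C m x)) \<and>
     (\<forall>i j. i \<noteq> j \<longrightarrow> (\<forall>x\<in>carr C. \<forall>y\<in>carr C. tgt C j x = src C j y \<longrightarrow>
        src C i (cmp C j x y) = cmp C j (src C i x) (src C i y) \<and>
        tgt C i (cmp C j x y) = cmp C j (tgt C i x) (tgt C i y))) \<and>
     (\<forall>m n. m < n \<longrightarrow> (\<forall>x\<in>carr C. \<forall>y\<in>carr C. \<forall>z\<in>carr C. \<forall>w\<in>carr C.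
        tgt C n x = src C n y \<and> tgt C n z = src C n w \<and>
        tgt C m x = src C m z \<and> tgt C m y = src C m w \<longrightarrow>
        cmp C m (cmp C n x y) (cmp C n z w) = cmp C n (cmp C m x z) (cmp C m y w))) \<and>
     (\<forall>x\<in>carr C. \<exists>n. src C n x = x \<and> tgt C n x = x)"

definition dim :: "'a ocat \<Rightarrow> 'a \<Rightarrow> nat" where
  "dim C x = (LEAST n. src C n x = x \<and> tgt C n x = x)"

definition mors :: "'a ocat \<Rightarrow> nat \<Rightarrow> 'a set" where
  "mors C n = {x \<in> carr C. dim C x = n}"

definition non_contracting :: "'a ocat \<Rightarrow> bool" where
  "non_contracting C \<longleftrightarrow>
     (\<forall>x\<in>carr C. dim C x > 0 \<longrightarrow> dim C (src C 1 x) = 1 \<and> dim C (tgt C 1 x) = 1)"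

definition path_cat :: "'a ocat \<Rightarrow> 'a ocat" where
  "path_cat C = \<lparr>carr = {x \<in> carr C. dim C x > 0},
     cmp = (\<lambda>i. cmp C (Suc i)), src = (\<lambda>i. src C (Suc i)), tgt = (\<lambda>i. tgt C (Suc i))\<rparr>"

text \<open>
  The functions are extensional (\<^term>\<open>undefined\<close> outside the carrier of the domain), so that equality of
  \<open>\<omega>\<close>-functors is equality of functions and uniqueness and injectivity statements are meaningful.
\<close>

definition functors :: "'a ocat \<Rightarrow> 'b ocat \<Rightarrow> ('a \<Rightarrow> 'b) set" where
  "functors D E = {F \<in> carr D \<rightarrow>\<^sub>E carr E.
     (\<forall>p. \<forall>X\<in>carr D. F (src D p X) = src E p (F X) \<and> F (tgt D p X) = tgt E p (F X)) \<and>
     (\<forall>p. \<forall>X\<in>carr D. \<forall>Y\<in>carr D. tgt D p X = src D p Y \<longrightarrow>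
        F (cmp D p X Y) = cmp E p (F X) (F Y))}"

section \<open>\<open>\<omega>\<close>-categories generated by the faces of a polytope\<close>

text \<open>
  A face system lists the faces of a polytope, their dimensions, for each face \<open>x\<close> the set \<open>R(x)\<close> of its
  subfaces (\<open>x\<close> included), and the sets \<open>s\<^sub>x\<close> and \<open>t\<^sub>x\<close> of codimension-one faces.
\<close>

record 'f face_system =
  faces :: "'f set"
  fdim :: "'f \<Rightarrow> nat"
  sub :: "'f \<Rightarrow> 'f set"
  fsrc :: "'f \<Rightarrow> 'f set"
  ftgt :: "'f \<Rightarrow> 'f set"

definition Sub :: "'f face_system \<Rightarrow> 'f set \<Rightarrow> 'f set" where
  "Sub K X = (\<Union>x\<in>X. sub K x)"

text \<open>
  The cells are sets of faces and composition is union.  The rules \<open>s\<^sub>p\<^sub>-\<^sub>1 R(x) = R(s\<^sub>x)\<close>,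
  \<open>t\<^sub>p\<^sub>-\<^sub>1 R(x) = R(t\<^sub>x)\<close> (\<open>p\<close> the dimension of \<open>x\<close>) and \<open>X *\<^sub>p Y = X \<union> Y\<close>, together with the laws of an
  \<open>\<omega>\<close>-category, determine the source and target of every composite of the \<open>R(x)\<close>.  The following is their
  closed form for pasting schemes of simplices and cubes (Johnson, Steiner): the \<open>p\<close>-source of \<open>X\<close> is
  obtained by deleting the faces of dimension above \<open>p\<close> and those faces of some \<open>(p+1)\<close>-dimensional
  \<open>b \<in> X\<close> that do not lie in \<open>R(s\<^sub>b)\<close>.  Lemmas \<open>cell_src_simplex\<close> and \<open>cell_src_cube\<close> below recover the
  generating rules.
\<close>

definition cell_src :: "'f face_system \<Rightarrow> nat \<Rightarrow> 'f set \<Rightarrow> 'f set" where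
  "cell_src K p X = {a \<in> X. fdim K a \<le> p \<and>
     (\<forall>b\<in>X. fdim K b = Suc p \<and> a \<in> sub K b \<longrightarrow> a \<in> Sub K (fsrc K b))}"

definition cell_tgt :: "'f face_system \<Rightarrow> nat \<Rightarrow> 'f set \<Rightarrow> 'f set" where
  "cell_tgt K p X = {a \<in> X. fdim K a \<le> p \<and>
     (\<forall>b\<in>X. fdim K b = Suc p \<and> a \<in> sub K b \<longrightarrow> a \<in> Sub K (ftgt K b))}"

inductive_set cells :: "'f face_system \<Rightarrow> 'f set set" for K :: "'f face_system" where
  atom: "x \<in> faces K \<Longrightarrow> sub K x \<in> cells K"
| source: "X \<in> cells K \<Longrightarrow> cell_src K p X \<in> cells K"
| target: "X \<in> cells K \<Longrightarrow> cell_tgt K p X \<in> cells K"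
| comp: "X \<in> cells K \<Longrightarrow> Y \<in> cells K \<Longrightarrow> cell_tgt K p X = cell_src K p Y \<Longrightarrow> X \<union> Y \<in> cells K"

text \<open>
  For \<open>\<Delta>\<^sup>n\<close> and \<open>I\<^sup>n\<close> this is the standard concrete model, by sets of faces, of the free
  \<open>\<omega>\<close>-category on the generators \<open>R(x)\<close> (Street, Johnson, Crans, Steiner).
\<close>

definition cell_cat :: "'f face_system \<Rightarrow> 'f set ocat" where
  "cell_cat K = \<lparr>carr = cells K, cmp = (\<lambda>p X Y. X \<union> Y), src = cell_src K, tgt = cell_tgt K\<rparr>"

text \<open>An \<open>\<omega>\<close>-functor on \<^term>\<open>cell_cat K\<close> is determined by its values on the generators \<open>R(x)\<close>.\<close>

definition functor_ext :: "'f face_system \<Rightarrow> 'b ocat \<Rightarrow> ('f \<Rightarrow> 'b) \<Rightarrow> 'f set \<Rightarrow> 'b" where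
  "functor_ext K E f =
     (THE F. F \<in> functors (cell_cat K) E \<and> (\<forall>x\<in>faces K. F (sub K x) = f x))"

subsection \<open>Simplices\<close>

text \<open>
  The strictly increasing sequence \<open>(\<sigma>\<^sub>0 \<dots> \<sigma>\<^sub>r)\<close> is represented by the set of its entries.
\<close>

definition pos_in :: "nat \<Rightarrow> nat set \<Rightarrow> nat" where
  "pos_in v \<sigma> = card {u \<in> \<sigma>. u \<le> v}"

definition Delta :: "nat \<Rightarrow> nat set face_system" where
  "Delta n = \<lparr>faces = {\<sigma>. \<sigma> \<subseteq> {0..n} \<and> \<sigma> \<noteq> {}},
     fdim = (\<lambda>\<sigma>. card \<sigma> - 1),
     sub = (\<lambda>\<sigma>. {\<tau>. \<tau> \<subseteq> \<sigma> \<and> \<tau> \<noteq> {}}),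
     fsrc = (\<lambda>\<sigma>. {\<sigma> - {v} |v. v \<in> \<sigma> \<and> odd (pos_in v \<sigma>)}),
     ftgt = (\<lambda>\<sigma>. {\<sigma> - {v} |v. v \<in> \<sigma> \<and> even (pos_in v \<sigma>)})\<rparr>"

subsection \<open>Cubes\<close>

datatype sign = Neg | Zero | Pos

fun sign_max :: "sign \<Rightarrow> sign \<Rightarrow> sign" where
  "sign_max Neg b = b"
| "sign_max Pos b = Pos"
| "sign_max Zero b = (if b = Pos then Pos else Zero)"

definition alt_sign :: "nat \<Rightarrow> sign" where
  "alt_sign i = (if odd i then Neg else Pos)"

text \<open>
  Lists are indexed from 0.  For a position \<open>j\<close> with \<open>k ! j = Zero\<close>, this is the rank \<open>i\<close>, counted from 1,
  of that letter among the zeros of \<open>k\<close>.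
\<close>

definition zero_rank :: "sign list \<Rightarrow> nat \<Rightarrow> nat" where
  "zero_rank k j = card {l. l \<le> j \<and> k ! l = Zero}"

definition Cube :: "nat \<Rightarrow> sign list face_system" where
  "Cube n = \<lparr>faces = {k. length k = n},
     fdim = (\<lambda>k. count_list k Zero),
     sub = (\<lambda>k. {l. list_all2 (\<lambda>a b. b = Zero \<or> a = b) l k}),
     fsrc = (\<lambda>k. {k[j := alt_sign (zero_rank k j)] |j. j < length k \<and> k ! j = Zero}),
     ftgt = (\<lambda>k. {k[j := alt_sign (Suc (zero_rank k j))] |j. j < length k \<and> k ! j = Zero})\<rparr>"

subsection \<open>Sources and targets of the generators\<close>

lemma cell_src_low:
  assumes "\<And>b. b \<in> X \<Longrightarrow> fdim K b \<le> p"
  shows "cell_src K p X = X" and "cell_tgt K p X = X"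
  using assms by (fastforce simp: cell_src_def cell_tgt_def)+

lemma cell_src_top:
  assumes top: "\<And>b. b \<in> sub K x \<Longrightarrow> fdim K b = Suc p \<longleftrightarrow> b = x" and "x \<in> sub K x"
    and low: "\<And>b a. b \<in> fsrc K x \<union> ftgt K x \<Longrightarrow> a \<in> sub K b \<Longrightarrow> a \<in> sub K x \<and> fdim K a \<le> p"
  shows "cell_src K p (sub K x) = Sub K (fsrc K x)" and "cell_tgt K p (sub K x) = Sub K (ftgt K x)"
  using assms by (fastforce simp: cell_src_def cell_tgt_def Sub_def)+

lemma cell_src_simplex:
  assumes "x \<in> faces (Delta n)" and "fdim (Delta n) x = Suc p"
  shows "cell_src (Delta n) p (sub (Delta n) x) = Sub (Delta n) (fsrc (Delta n) x)"
    and "cell_tgt (Delta n) p (sub (Delta n) x) = Sub (Delta n) (ftgt (Delta n) x)"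
proof -
  have fin: "finite x" and ne: "x \<noteq> {}" and card: "card x = Suc (Suc p)"
    using assms finite_subset[of x "{0..n}"] by (auto simp: Delta_def)
  have top: "fdim (Delta n) b = Suc p \<longleftrightarrow> b = x" if "b \<in> sub (Delta n) x" for b
  proof -
    have "b \<subseteq> x" using that by (simp add: Delta_def)
    then show ?thesis using card card_subset_eq[OF fin, of b] by (auto simp: Delta_def)
  qed
  have low: "a \<in> sub (Delta n) x \<and> fdim (Delta n) a \<le> p"
    if b: "b \<in> fsrc (Delta n) x \<union> ftgt (Delta n) x" and a: "a \<in> sub (Delta n) b" for a b
  proof -
    obtain v where v: "v \<in> x" "b = x - {v}" using b by (auto simp: Delta_def)
    have a': "a \<subseteq> x - {v}" "a \<noteq> {}" using a v by (auto simp: Delta_def)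
    have "card a \<le> card (x - {v})" using a' fin by (intro card_mono) auto
    then show ?thesis using a' v card fin by (auto simp: Delta_def)
  qed
  have x: "x \<in> sub (Delta n) x" using ne by (simp add: Delta_def)
  show "cell_src (Delta n) p (sub (Delta n) x) = Sub (Delta n) (fsrc (Delta n) x)"
    using top x low by (rule cell_src_top(1))
  show "cell_tgt (Delta n) p (sub (Delta n) x) = Sub (Delta n) (ftgt (Delta n) x)"
    using top x low by (rule cell_src_top(2))
qed

lemma count_list_subface:
  assumes "list_all2 (\<lambda>a b. b = Zero \<or> a = b) l k"
  shows "count_list l Zero \<le> count_list k Zero"
    and "count_list l Zero = count_list k Zero \<Longrightarrow> l = k"
  using assms by (induction rule: list_all2_induct) (auto split: if_splits)

lemma cell_src_cube:
  assumes "fdim (Cube n) x = Suc p"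
  shows "cell_src (Cube n) p (sub (Cube n) x) = Sub (Cube n) (fsrc (Cube n) x)"
    and "cell_tgt (Cube n) p (sub (Cube n) x) = Sub (Cube n) (ftgt (Cube n) x)"
proof -
  let ?S = "\<lambda>a b. b = Zero \<or> a = b"
  have card: "count_list x Zero = Suc p" using assms by (simp add: Cube_def)
  have top: "fdim (Cube n) b = Suc p \<longleftrightarrow> b = x" if "b \<in> sub (Cube n) x" for b
    using that count_list_subface[of b x] card by (auto simp: Cube_def)
  have low: "a \<in> sub (Cube n) x \<and> fdim (Cube n) a \<le> p"
    if b: "b \<in> fsrc (Cube n) x \<union> ftgt (Cube n) x" and a: "a \<in> sub (Cube n) b" for a b
  proof -
    obtain j i where j: "j < length x" "x ! j = Zero" "b = x[j := alt_sign i]"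
      using b by (auto simp: Cube_def)
    have ab: "list_all2 ?S a b" using a by (simp add: Cube_def)
    have ax: "list_all2 ?S a x"
      using ab j by (auto simp: list_all2_conv_all_nth nth_list_update split: if_splits)
    have "a ! j = alt_sign i"
      using ab j by (auto simp: list_all2_conv_all_nth alt_sign_def split: if_splits)
    then have "a \<noteq> x" using j by (auto simp: alt_sign_def split: if_splits)
    then have "count_list a Zero < Suc p"
      using count_list_subface[OF ax] card by force
    then show ?thesis using ax by (simp add: Cube_def)
  qed
  have x: "x \<in> sub (Cube n) x" by (simp add: Cube_def list_all2_conv_all_nth)
  show "cell_src (Cube n) p (sub (Cube n) x) = Sub (Cube n) (fsrc (Cube n) x)"
    using top x low by (rule cell_src_top(1))
  show "cell_tgt (Cube n) p (sub (Cube n) x) = Sub (Cube n) (ftgt (Cube n) x)"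
    using top x low by (rule cell_src_top(2))
qed

section \<open>Augmented simplicial sets\<close>

text \<open>
  \<^term>\<open>face X n i\<close> is \<open>\<partial>\<^sub>i : X\<^sub>n\<^sub>+\<^sub>1 \<rightarrow> X\<^sub>n\<close> and \<^term>\<open>degen X n i\<close> is \<open>\<epsilon>\<^sub>i : X\<^sub>n \<rightarrow> X\<^sub>n\<^sub>+\<^sub>1\<close>;
  \<^term>\<open>augs X\<close> is \<open>X\<^sub>-\<^sub>1\<close> and \<^term>\<open>augm X\<close> is \<open>\<partial>\<^sub>-\<^sub>1\<close>.
\<close>

record 'x sset =
  simp :: "nat \<Rightarrow> 'x set"
  face :: "nat \<Rightarrow> nat \<Rightarrow> 'x \<Rightarrow> 'x"
  degen :: "nat \<Rightarrow> nat \<Rightarrow> 'x \<Rightarrow> 'x"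

record ('x, 'p) aug_sset = "'x sset" +
  augs :: "'p set"
  augm :: "'x \<Rightarrow> 'p"

definition simplicial_set :: "('x, 'm) sset_scheme \<Rightarrow> bool" where
  "simplicial_set X \<longleftrightarrow>
     (\<forall>n. \<forall>i\<le>Suc n. \<forall>x\<in>simp X (Suc n). face X n i x \<in> simp X n) \<and>
     (\<forall>n. \<forall>i\<le>n. \<forall>x\<in>simp X n. degen X n i x \<in> simp X (Suc n)) \<and>
     (\<forall>n i j. i < j \<and> j \<le> Suc (Suc n) \<longrightarrow> (\<forall>x\<in>simp X (Suc (Suc n)).
        face X n i (face X (Suc n) j x) = face X n (j - 1) (face X (Suc n) i x))) \<and>
     (\<forall>n i j. i \<le> j \<and> j \<le> n \<longrightarrow> (\<forall>x\<in>simp X n.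
        degen X (Suc n) i (degen X n j x) = degen X (Suc n) (Suc j) (degen X n i x))) \<and>
     (\<forall>n i j. i < j \<and> j \<le> Suc n \<longrightarrow> (\<forall>x\<in>simp X (Suc n).
        face X (Suc n) i (degen X (Suc n) j x) = degen X n (j - 1) (face X n i x))) \<and>
     (\<forall>n j. j \<le> n \<longrightarrow> (\<forall>x\<in>simp X n.
        face X n j (degen X n j x) = x \<and> face X n (Suc j) (degen X n j x) = x)) \<and>
     (\<forall>n i j. Suc j < i \<and> i \<le> Suc (Suc n) \<longrightarrow> (\<forall>x\<in>simp X (Suc n).
        face X (Suc n) i (degen X (Suc n) j x) = degen X n j (face X n (i - 1) x)))"

definition simplicial_map ::
    "('x, 'm) sset_scheme \<Rightarrow> ('y, 'k) sset_scheme \<Rightarrow> (nat \<Rightarrow> 'x \<Rightarrow> 'y) \<Rightarrow> bool" where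
  "simplicial_map X Y f \<longleftrightarrow> simplicial_set X \<and> simplicial_set Y \<and>
     (\<forall>n. \<forall>x\<in>simp X n. f n x \<in> simp Y n) \<and>
     (\<forall>n. \<forall>i\<le>Suc n. \<forall>x\<in>simp X (Suc n). f n (face X n i x) = face Y n i (f (Suc n) x)) \<and>
     (\<forall>n. \<forall>i\<le>n. \<forall>x\<in>simp X n. f (Suc n) (degen X n i x) = degen Y n i (f n x))"

definition aug_simplicial_set :: "('x, 'p) aug_sset \<Rightarrow> bool" where
  "aug_simplicial_set X \<longleftrightarrow> simplicial_set X \<and>
     (\<forall>x\<in>simp X 0. augm X x \<in> augs X) \<and>
     (\<forall>x\<in>simp X 1. augm X (face X 0 0 x) = augm X (face X 0 1 x))"

definition aug_simplicial_map ::
    "('x, 'p) aug_sset \<Rightarrow> ('y, 'q) aug_sset \<Rightarrow> (nat \<Rightarrow> 'x \<Rightarrow> 'y) \<Rightarrow> ('p \<Rightarrow> 'q) \<Rightarrow> bool" where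
  "aug_simplicial_map X Y f g \<longleftrightarrow> aug_simplicial_set X \<and> aug_simplicial_set Y \<and>
     simplicial_map X Y f \<and>
     (\<forall>a\<in>augs X. g a \<in> augs Y) \<and>
     (\<forall>x\<in>simp X 0. g (augm X x) = augm Y (f 0 x))"

section \<open>The globular nerve\<close>

definition delta :: "nat \<Rightarrow> nat \<Rightarrow> nat" where
  "delta i v = (if v < i then v else Suc v)"

definition eta :: "nat \<Rightarrow> nat \<Rightarrow> nat" where
  "eta i v = (if v \<le> i then v else v - 1)"

text \<open>
  \<open>\<N>\<^sub>0\<close> consists of functors on the one-cell category \<open>\<Delta>\<^sup>0\<close>; evaluation at \<open>(0)\<close> identifies it
  with \<^term>\<open>mors C 1\<close>.
\<close>

definition globular_nerve :: "'a ocat \<Rightarrow> (nat set set \<Rightarrow> 'a, 'a \<times> 'a) aug_sset" where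
  "globular_nerve C = \<lparr>
     simp = (\<lambda>n. functors (cell_cat (Delta n)) (path_cat C)),
     face = (\<lambda>n i x. functor_ext (Delta n) (path_cat C)
               (\<lambda>\<sigma>. x (sub (Delta (Suc n)) (delta i ` \<sigma>)))),
     degen = (\<lambda>n i x. functor_ext (Delta (Suc n)) (path_cat C)
               (\<lambda>\<sigma>. x (sub (Delta n) (eta i ` \<sigma>)))),
     augs = mors C 0 \<times> mors C 0,
     augm = (\<lambda>x. (src C 0 (x (sub (Delta 0) {0})), tgt C 0 (x (sub (Delta 0) {0}))))\<rparr>"

section \<open>The negative corner nerve\<close>

text \<open>
  \<^term>\<open>cube_face C m \<alpha> i\<close> takes functors on \<open>I\<^sup>m\<^sup>+\<^sup>1\<close> to functors on \<open>I\<^sup>m\<close> (\<open>1 \<le> i \<le> m + 1\<close>) and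
  \<^term>\<open>cube_conn C m i\<close> takes functors on \<open>I\<^sup>m\<close> to functors on \<open>I\<^sup>m\<^sup>+\<^sup>1\<close> (\<open>1 \<le> i \<le> m\<close>).
\<close>

definition cube_face ::
    "'a ocat \<Rightarrow> nat \<Rightarrow> sign \<Rightarrow> nat \<Rightarrow> (sign list set \<Rightarrow> 'a) \<Rightarrow> sign list set \<Rightarrow> 'a" where
  "cube_face C m \<alpha> i x = functor_ext (Cube m) C
     (\<lambda>k. x (sub (Cube (Suc m)) (take (i - 1) k @ [\<alpha>] @ drop (i - 1) k)))"

definition cube_conn ::
    "'a ocat \<Rightarrow> nat \<Rightarrow> nat \<Rightarrow> (sign list set \<Rightarrow> 'a) \<Rightarrow> sign list set \<Rightarrow> 'a" where
  "cube_conn C m i x = functor_ext (Cube (Suc m)) C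
     (\<lambda>k. x (sub (Cube m) (take (i - 1) k @ [sign_max (k ! (i - 1)) (k ! i)] @ drop (Suc i) k)))"

text \<open>Evaluation at the word \<open>0\<close> identifies the functors in degree 0 with \<^term>\<open>mors C 1\<close>.\<close>

definition corner_nerve :: "'a ocat \<Rightarrow> (sign list set \<Rightarrow> 'a, 'a) aug_sset" where
  "corner_nerve C = \<lparr>
     simp = (\<lambda>n. {x \<in> functors (cell_cat (Cube (Suc n))) C.
        \<forall>u \<in> mors (cell_cat (Cube (Suc n))) 1.
          src (cell_cat (Cube (Suc n))) 0 u = sub (Cube (Suc n)) (replicate (Suc n) Neg) \<longrightarrow>
          dim C (x u) = 1}),
     face = (\<lambda>n i x. cube_face C (Suc n) Neg (Suc i) x),
     degen = (\<lambda>n i x. cube_conn C (Suc n) (Suc i) x),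
     augs = mors C 0,
     augm = (\<lambda>x. src C 0 (x (sub (Cube 1) [Zero])))\<rparr>"

section \<open>The comparison map\<close>

text \<open>
  Positions in words are counted from 0 here, so the entries \<open>\<sigma>\<^sub>0 < \<dots> < \<sigma>\<^sub>r\<close> are exactly the list indices
  of the zeros.
\<close>

definition h_val :: "'a ocat \<Rightarrow> nat \<Rightarrow> (nat set set \<Rightarrow> 'a) \<Rightarrow> sign list \<Rightarrow> 'a" where
  "h_val C n x k =
     (if Pos \<in> set k then tgt C 0 (x (sub (Delta n) {0}))
      else if Zero \<in> set k then x (sub (Delta n) {j. j < length k \<and> k ! j = Zero})
      else src C 0 (x (sub (Delta n) {n})))"

definition h_map :: "'a ocat \<Rightarrow> nat \<Rightarrow> (nat set set \<Rightarrow> 'a) \<Rightarrow> sign list set \<Rightarrow> 'a" where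
  "h_map C n x = functor_ext (Cube (Suc n)) C (h_val C n x)"

end

theory Submission
  imports Defs "HOL-Analysis.Analysis"
begin

text \<open>
  The faces of a cube, and those of a simplex as a vertex figure of a cube, are polytopes in the space with the
  coordinates \<open>0, \<dots>, n - 1\<close>, on which there are linear functionals, the moments, such that a vector killed by
  the first \<open>p\<close> of them changes sign at least \<open>p\<close> times.  The union of the faces in the \<open>p\<close>-source (\<open>p\<close>-target) of a
  cell then consists of the lowest (highest) points, with respect to the \<open>p\<close>-th moment, of the fibres of the lower
  ones.  This gives the laws of an \<open>\<omega>\<close>-category for cells without any generators and relations.

  Forgetting the faces of \<open>I\<^sup>n\<^sup>+\<^sup>1\<close> that have a letter \<open>+\<close> takes \<open>(p + 1)\<close>-sources and targets to \<open>p\<close>-sources and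
  targets of cells of \<open>\<Delta>\<^sup>n\<close>; composing \<open>x\<close> with it gives \<open>h(x)\<close>.  Conversely, the cone over a cell of \<open>\<Delta>\<^sup>n\<close> is a cell
  of \<open>\<Delta>\<^sup>n\<^sup>+\<^sup>1\<close>, which is subdivided by the cells of \<open>I\<^sup>n\<^sup>+\<^sup>1\<close>.  A cube \<open>y\<close> whose positive faces are \<open>0\<close>-dimensional
  maps the part of the subdivided cone with a letter \<open>+\<close> to identities, so that \<open>y\<close> of the cone over a cell is a
  functor \<open>x\<close> on \<open>\<Delta>\<^sup>n\<close> with \<open>h(x) = y\<close>.
\<close>

section \<open>Sign alternation\<close>

text \<open>The cells are given by a closed formula, with no universal property at hand: a functor
  on them must be given by a formula valid for every cell, and the generators only settle
  uniqueness. The formula for boundaries is local and does not show how the two factors of a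
  composite lie with respect to each other. The moments supply an order along their fibres, and
  extremality in a fibre passes to composites through the common boundary. They are chosen as in the
  theory of cyclic polytopes: a circuit of the first \<open>q\<close> moments has
  \<open>q + 1\<close> entries of alternating signs, the same alternation as in \<open>s_x\<close>
  and \<open>t_x\<close>. The obstacle to surjectivity of h is that the faces of the cube without
  \<open>+\<close> do not compose by themselves: already over the composite of the edges
  \<open>(1 2)\<close> and \<open>(0 1)\<close> of a triangle, the squares \<open>-00\<close> and
  \<open>00-\<close> share only the edge \<open>-0-\<close>, which is not the whole 1-target of the
  first. Further faces with a \<open>+\<close> have to be added coherently. The cone over a cell,
  read in the subdivided simplex, does this at once, and flatness of the cube makes the added faces
  act as units.\<close>

text \<open>\<open>wt n k i\<close> is the binomial coefficient \<open>n - 1 - i\<close> over \<open>k\<close>, so the first \<open>p\<close> moments of \<open>d\<close> vanish iff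
  \<open>d\<close> is orthogonal to the polynomials of degree less than \<open>p\<close>.\<close>

fun wt :: "nat \<Rightarrow> nat \<Rightarrow> nat \<Rightarrow> real" where
  "wt n 0 i = 1"
| "wt n (Suc k) i = (\<Sum>j\<in>{i<..<n}. wt n k j)"

definition mom :: "nat \<Rightarrow> nat \<Rightarrow> (nat \<Rightarrow> real) \<Rightarrow> real" where
  "mom n k d = (\<Sum>i<n. d i * wt n k i)"

lemma mom_linear: "mom n k (\<lambda>i. a * d i + b * e i) = a * mom n k d + b * mom n k e"
  by (simp add: mom_def sum.distrib sum_distrib_left algebra_simps)

lemma mom_diff: "mom n k (\<lambda>i. d i - e i) = mom n k d - mom n k e"
  using mom_linear[of n k 1 d "-1" e] by simp

text \<open>Summation by parts; this is why \<open>wt\<close> is defined by iterated tail sums. One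
  moment condition on \<open>d\<close> is traded for a passage to partial sums.\<close>

lemma mom_Suc: "mom n (Suc k) d = mom n k (\<lambda>i. \<Sum>j<i. d j)"
proof -
  have "mom n (Suc k) d = (\<Sum>i<n. \<Sum>j\<in>{j\<in>{..<n}. i < j}. d i * wt n k j)"
    unfolding mom_def wt.simps sum_distrib_left
    by (intro sum.cong refl) auto
  also have "\<dots> = (\<Sum>j<n. \<Sum>i\<in>{i\<in>{..<n}. i < j}. d i * wt n k j)"
    by (rule sum.swap_restrict) auto
  also have "\<dots> = (\<Sum>j<n. \<Sum>i<j. d i * wt n k j)"
    by (intro sum.cong refl) auto
  also have "\<dots> = mom n k (\<lambda>i. \<Sum>j<i. d j)"
    by (simp add: mom_def sum_distrib_right)
  finally show ?thesis .
qed

definition alt_neg :: "bool \<Rightarrow> real \<Rightarrow> bool" where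
  "alt_neg b x \<longleftrightarrow> (if b then x < 0 else x > 0)"

lemma sum_alt_neg:
  assumes "alt_neg b (\<Sum>j\<in>A. d j)"
  shows "\<exists>j\<in>A. alt_neg b (d j)"
proof (rule ccontr)
  assume "\<not> ?thesis"
  then have *: "\<forall>j\<in>A. (if b then d j \<ge> 0 else d j \<le> 0)" by (auto simp: alt_neg_def not_less)
  show False
  proof (cases b)
    case True
    then have "sum d A \<ge> 0" using * by (intro sum_nonneg) auto
    then show False using assms True by (auto simp: alt_neg_def)
  next
    case False
    then have "sum d A \<le> 0" using * by (intro sum_nonpos) auto
    then show False using assms False by (auto simp: alt_neg_def)
  qed
qed

text \<open>A discrete Rolle argument. The partial sums \<open>D\<close> satisfy one moment
  condition less, and between consecutive alternations of \<open>D\<close> the vector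
  \<open>d\<close> must somewhere have the sign of the increment. So \<open>q\<close> vanishing
  moments force \<open>q\<close> sign changes, and the sign of the next moment makes the first
  chosen entry negative.\<close>

lemma sign_alternation_chain:
  assumes "\<forall>k<q. mom n k d = 0" and "mom n q d \<le> 0" and "\<exists>i<n. d i \<noteq> 0"
  shows "\<exists>z. (\<forall>i<q. z i < z (Suc i)) \<and> (\<forall>i\<le>q. z i < n \<and> alt_neg (even i) (d (z i)))"
  using assms
proof (induction q arbitrary: d)
  case 0
  have "\<exists>i<n. d i < 0"
  proof (rule ccontr)
    assume "\<not> ?thesis"
    then have nn: "\<forall>i\<in>{..<n}. d i \<ge> 0" by auto
    have "(\<Sum>i<n. d i) \<le> 0" using 0 by (simp add: mom_def)
    then have "(\<Sum>i<n. d i) = 0" using nn sum_nonneg[of "{..<n}" d] by (simp add: order_antisym)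
    then have "\<forall>i<n. d i = 0" using nn by (subst (asm) sum_nonneg_eq_0_iff) auto
    then show False using 0 by auto
  qed
  then obtain i where "i < n" "d i < 0" by auto
  then show ?case by (intro exI[of _ "\<lambda>_. i"]) (auto simp: alt_neg_def)
next
  case (Suc q)
  define D where "D i = (\<Sum>j<i. d j)" for i
  have m: "mom n k D = mom n (Suc k) d" for k by (simp add: mom_Suc D_def[abs_def])
  have D0: "D 0 = 0" and Dn: "D n = 0" using Suc.prems(1) by (auto simp: D_def mom_def)
  have "\<exists>i<n. D i \<noteq> 0"
  proof (rule ccontr)
    assume "\<not> ?thesis"
    then have z: "D i = 0" if "i \<le> n" for i using Dn that by (cases "i = n") auto
    have "d i = 0" if "i < n" for i
      using z[of i] z[of "Suc i"] that by (simp add: D_def)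
    then show False using Suc.prems by auto
  qed
  then obtain y where y: "\<forall>i<q. y i < y (Suc i)" "\<forall>i\<le>q. y i < n \<and> alt_neg (even i) (D (y i))"
    using Suc.IH[of D] Suc.prems m by auto
  \<comment> \<open>The cut points are 0, the alternations of \<open>D\<close>, and
    \<open>n\<close>. As \<open>D\<close> vanishes at both ends (at \<open>n\<close> because the
    moment of order 0 does), \<open>q + 1\<close> alternating values give \<open>q + 2\<close>
    alternating increments.\<close>
  define c where "c i = (if i = 0 then 0 else if i \<le> Suc q then y (i - 1) else n)" for i
  have "\<exists>j\<in>{c i..<c (Suc i)}. alt_neg (even i) (d j)" if i: "i \<le> Suc q" for i
  proof -
    have le: "c i \<le> c (Suc i)" using y i by (cases i) (auto simp: c_def less_imp_le)
    have "alt_neg (even i) (D (c (Suc i)) - D (c i))"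
    proof (cases i)
      case 0 then show ?thesis using y(2) D0 by (auto simp: c_def alt_neg_def)
    next
      case (Suc i')
      then have i': "i' \<le> q" using i by simp
      have a: "alt_neg (even i') (D (c i))" using y(2) i' Suc by (auto simp: c_def)
      show ?thesis
      proof (cases "i' = q")
        case True then show ?thesis using a Dn Suc by (auto simp: c_def alt_neg_def split: if_splits)
      next
        case False
        then have "Suc i' \<le> q" using i' by simp
        then have "alt_neg (odd i') (D (c (Suc i)))" using y(2)[rule_format, of "Suc i'"] Suc by (auto simp: c_def)
        then show ?thesis using a Suc by (auto simp: alt_neg_def split: if_splits)
      qed
    qed
    moreover have "D (c (Suc i)) - D (c i) = (\<Sum>j\<in>{c i..<c (Suc i)}. d j)"
      unfolding D_def lessThan_atLeast0 using le by (simp add: sum_diff_nat_ivl)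
    ultimately show ?thesis using sum_alt_neg by metis
  qed
  then obtain z where z: "\<And>i. i \<le> Suc q \<Longrightarrow> z i \<in> {c i..<c (Suc i)} \<and> alt_neg (even i) (d (z i))"
    by metis
  have "z i < z (Suc i)" if "i < Suc q" for i using z[of i] z[of "Suc i"] that by auto
  moreover have "z i < n" if "i \<le> Suc q" for i
  proof -
    have "c (Suc i) \<le> n" using that y(2) by (auto simp: c_def less_imp_le)
    then show ?thesis using z[OF that] by auto
  qed
  ultimately show ?case using z by (intro exI[of _ z]) auto
qed

text \<open>Positions are counted from 0 here.\<close>

definition pos :: "nat set \<Rightarrow> nat \<Rightarrow> nat" where
  "pos Z z = card {y \<in> Z. y < z}"

lemma chain_pos:
  fixes z :: "nat \<Rightarrow> nat"
  assumes "\<forall>i<q. z i < z (Suc i)"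
  shows "card (z ` {..q}) = Suc q" and "i \<le> q \<Longrightarrow> pos (z ` {..q}) (z i) = i"
proof -
  have lt: "z i < z j" if "i < j" "j \<le> q" for i j
    using that
  proof (induction j)
    case (Suc j)
    have "z j < z (Suc j)" using assms Suc.prems by simp
    then show ?case using Suc by (cases "i = j") auto
  qed auto
  have inj: "inj_on z {..q}"
    by (rule inj_onI) (metis atMost_iff lt nat_neq_iff)
  then show "card (z ` {..q}) = Suc q" by (simp add: card_image)
  assume i: "i \<le> q"
  have eq: "{y \<in> z ` {..q}. y < z i} = z ` {..<i}"
  proof (intro equalityI subsetI)
    fix y assume "y \<in> {y \<in> z ` {..q}. y < z i}"
    then obtain x where x: "y = z x" "x \<le> q" "z x < z i" by auto
    then have "x < i" using lt[of i x] by (cases x i rule: linorder_cases) auto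
    then show "y \<in> z ` {..<i}" using x by auto
  qed (use i lt in auto)
  show "pos (z ` {..q}) (z i) = i"
  proof -
    have "inj_on z {..<i}" by (rule inj_on_subset[OF inj]) (use i in auto)
    then show ?thesis by (simp add: pos_def eq card_image)
  qed
qed

lemma sign_alternation:
  assumes "\<forall>k<q. mom n k d = 0" and "mom n q d \<le> 0" and "\<exists>i<n. d i \<noteq> 0"
  shows "\<exists>Z\<subseteq>{..<n}. card Z = Suc q \<and> (\<forall>z\<in>Z. alt_neg (even (pos Z z)) (d z))"
proof -
  obtain z where z: "\<forall>i<q. z i < z (Suc i)" "\<forall>i\<le>q. z i < n \<and> alt_neg (even i) (d (z i))"
    using sign_alternation_chain[OF assms] by blast
  show ?thesis
    using z chain_pos[OF z(1)] by (intro exI[of _ "z ` {..q}"]) auto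
qed

text \<open>Fewer linear conditions than coordinates leave a nonzero solution; each step of the
  induction eliminates one condition with a pivot coordinate.\<close>

lemma kernel_vector:
  fixes f :: "nat \<Rightarrow> 'b \<Rightarrow> real"
  assumes "finite B" "card B > q"
  shows "\<exists>d. (\<exists>i\<in>B. d i \<noteq> 0) \<and> (\<forall>i. i \<notin> B \<longrightarrow> d i = 0) \<and> (\<forall>k<q. (\<Sum>i\<in>B. d i * f k i) = 0)"
  using assms
proof (induction q arbitrary: B f)
  case 0
  then have "B \<noteq> {}" by auto
  then show ?case by (intro exI[of _ "\<lambda>i. if i \<in> B then 1 else 0"]) auto
next
  case (Suc q)
  show ?case
  proof (cases "\<exists>p\<in>B. f q p \<noteq> 0")
    case False
    then obtain p where p: "p \<in> B" using Suc.prems by fastforce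
    have "finite (B-{p})" "card (B-{p}) > q" using Suc.prems p by auto
    from Suc.IH[OF this, of f] obtain d where d: "\<exists>i\<in>B-{p}. d i \<noteq> 0" "\<forall>i. i \<notin> B-{p} \<longrightarrow> d i = 0"
        "\<forall>k<q. (\<Sum>i\<in>B-{p}. d i * f k i) = 0"
      by (elim exE conjE)
    have "(\<Sum>i\<in>B. d i * f k i) = (\<Sum>i\<in>B-{p}. d i * f k i)" for k
      using d(2) p Suc.prems(1) by (simp add: sum.remove)
    then show ?thesis using d False by (intro exI[of _ d]) (auto simp: less_Suc_eq)
  next
    case True
    then obtain p where p: "p \<in> B" "f q p \<noteq> 0" by auto
    have "finite (B-{p})" "card (B-{p}) > q" using Suc.prems p by auto
    from Suc.IH[OF this, of "\<lambda>k i. f k i - f k p * f q i / f q p"]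
    obtain d where d: "\<exists>i\<in>B-{p}. d i \<noteq> 0" "\<forall>i. i \<notin> B-{p} \<longrightarrow> d i = 0"
        "\<forall>k<q. (\<Sum>i\<in>B-{p}. d i * (f k i - f k p * f q i / f q p)) = 0"
      by (elim exE conjE)
    define S where "S = (\<Sum>i\<in>B-{p}. d i * f q i)"
    \<comment> \<open>The entry at the pivot is the one that satisfies the eliminated
      condition.\<close>
    define e where "e = d(p := - S / f q p)"
    have sum: "(\<Sum>i\<in>B. e i * f k i) = - S / f q p * f k p + (\<Sum>i\<in>B-{p}. d i * f k i)" for k
      using p Suc.prems(1) by (simp add: sum.remove e_def)
    have "(\<Sum>i\<in>B. e i * f k i) = 0" if "k < Suc q" for k
    proof (cases "k = q")
      case True then show ?thesis using sum[of k] p by (simp add: S_def)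
    next
      case False
      then have "(\<Sum>i\<in>B-{p}. d i * (f k i - f k p * f q i / f q p)) = 0" using d(3) that by auto
      moreover have "(\<Sum>i\<in>B-{p}. d i * (f k i - f k p * f q i / f q p))
          = (\<Sum>i\<in>B-{p}. d i * f k i) - f k p / f q p * S"
        by (simp add: S_def sum_distrib_left sum_subtractf[symmetric] algebra_simps)
      ultimately show ?thesis using sum[of k] by (simp add: field_simps)
    qed
    then show ?thesis using d(1,2) p by (intro exI[of _ e]) (auto simp: e_def)
  qed
qed

text \<open>Existence is a dimension count. The signs come from \<open>sign_alternation\<close>,
  whose \<open>q + 1\<close> alternating positions must fill \<open>B\<close>. If the moment of
  order \<open>q\<close> vanished as well, the vector and its negative would have the same
  signs.\<close>

lemma alternating_circuit:
  assumes B: "B \<subseteq> {..<n}" "card B = Suc q"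
  shows "\<exists>d. (\<forall>i. i \<notin> B \<longrightarrow> d i = 0) \<and> (\<forall>k<q. mom n k d = 0) \<and> mom n q d < 0 \<and>
    (\<forall>z\<in>B. alt_neg (even (pos B z)) (d z))"
proof -
  have fin: "finite B" using B finite_subset by blast
  obtain d where d: "\<exists>i\<in>B. d i \<noteq> 0" "\<forall>i. i \<notin> B \<longrightarrow> d i = 0" "\<forall>k<q. (\<Sum>i\<in>B. d i * wt n k i) = 0"
    using kernel_vector[OF fin, of q "wt n"] B by auto
  have m: "mom n k d = (\<Sum>i\<in>B. d i * wt n k i)" for k
    unfolding mom_def using B d(2) by (intro sum.mono_neutral_right) auto
  have key: "\<forall>z\<in>B. alt_neg (even (pos B z)) (e z)"
    if e: "\<forall>k<q. mom n k e = 0" "mom n q e \<le> 0" "\<exists>i\<in>B. e i \<noteq> 0" "\<forall>i. i \<notin> B \<longrightarrow> e i = 0" for e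
  proof -
    have "\<exists>i<n. e i \<noteq> 0" using e B by auto
    then obtain Z where Z: "Z \<subseteq> {..<n}" "card Z = Suc q" "\<forall>z\<in>Z. alt_neg (even (pos Z z)) (e z)"
      using sign_alternation[of q n e] e by auto
    have "Z \<subseteq> B" using Z(3) e(4) by (force simp: alt_neg_def split: if_splits)
    then have "Z = B" using Z(2) B(2) fin by (intro card_subset_eq) auto
    then show ?thesis using Z by simp
  qed
  have neg: "mom n k (\<lambda>i. - d i) = - mom n k d" for k
    using mom_linear[of n k "-1" d 0 d] by simp
  have ne: "mom n q d \<noteq> 0"
  proof
    assume 0: "mom n q d = 0"
    have "\<forall>z\<in>B. alt_neg (even (pos B z)) (d z)" using key[of d] d m 0 by auto
    moreover have "\<forall>z\<in>B. alt_neg (even (pos B z)) (- d z)" using key[of "\<lambda>i. - d i"] d m 0 neg by auto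
    moreover obtain i where "i \<in> B" using d(1) by auto
    ultimately have "alt_neg (even (pos B i)) (d i)" "alt_neg (even (pos B i)) (- d i)" by blast+
    then show False by (auto simp: alt_neg_def split: if_splits)
  qed
  show ?thesis
  proof (cases "mom n q d < 0")
    case True then show ?thesis using key[of d] d m by (intro exI[of _ d]) auto
  next
    case False
    then have "mom n q (\<lambda>i. - d i) < 0" using ne neg by auto
    then show ?thesis using key[of "\<lambda>i. - d i"] d m neg by (intro exI[of _ "\<lambda>i. - d i"]) auto
  qed
qed

text \<open>The exchange step: adding an element of \<open>c\<close> and dropping the next element outside \<open>c\<close> above it
  (or, if there is none, the largest one) leaves the positions of the other elements outside \<open>c\<close> unchanged.\<close>

lemma exchange:
  assumes "finite Z" "finite c" "card c \<le> card Z"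
    and "\<forall>z\<in>Z - c. P (even (pos Z z)) z"
  shows "\<exists>b. c \<subseteq> b \<and> b \<subseteq> c \<union> Z \<and> card b = card Z \<and> (\<forall>z\<in>b - c. P (even (pos b z)) z)"
  using assms
proof (induction "card (c - Z)" arbitrary: Z)
  case 0
  then show ?case by (intro exI[of _ Z]) auto
next
  case (Suc m)
  then obtain e where e: "e \<in> c" "e \<notin> Z" by (metis Diff_iff card.empty equals0I nat.distinct(1))
  have ne: "Z - c \<noteq> {}"
  proof
    assume "Z - c = {}"
    then have "Z \<subset> c" using e by auto
    then have "card Z < card c" using Suc.prems psubset_card_mono by blast
    then show False using Suc.prems by simp
  qed
  have "\<exists>f\<in>Z - c. \<forall>z\<in>Z - c - {f}. (e < z \<longleftrightarrow> f < z)"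
  proof (cases "\<exists>f\<in>Z - c. e < f")
    case True
    define M where "M = Min {f \<in> Z - c. e < f}"
    have m: "M \<in> {f \<in> Z - c. e < f}" unfolding M_def using True Suc.prems(1) by (intro Min_in) auto
    have le: "M \<le> z" if "z \<in> Z - c" "e < z" for z unfolding M_def using Suc.prems(1) that by (intro Min_le) auto
    have "(e < z) = (M < z)" if "z \<in> Z - c - {M}" for z
      using le[of z] that m by (cases "e < z") auto
    then show ?thesis using m by blast
  next
    case False
    define M where "M = Max (Z - c)"
    have m: "M \<in> Z - c" unfolding M_def using ne Suc.prems(1) by (intro Max_in) auto
    have le: "z \<le> M" if "z \<in> Z - c" for z unfolding M_def using Suc.prems(1) that by (intro Max_ge) auto
    have "(e < z) = (M < z)" if "z \<in> Z - c - {M}" for z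
    proof -
      have "\<not> e < z" using False that by blast
      moreover have "\<not> M < z" using le[of z] that by (simp add: not_less)
      ultimately show ?thesis by simp
    qed
    then show ?thesis using m by blast
  qed
  then obtain f where f: "f \<in> Z - c" "\<forall>z\<in>Z - c - {f}. (e < z \<longleftrightarrow> f < z)" by auto
  define Z' where "Z' = insert e (Z - {f})"
  have fin': "finite Z'" using Suc.prems by (simp add: Z'_def)
  have card': "card Z' = card Z"
  proof -
    have "Suc (card (Z - {f})) = card Z" using f Suc.prems(1) by (intro card_Suc_Diff1) auto
    moreover have "card Z' = Suc (card (Z - {f}))"
      unfolding Z'_def using e Suc.prems(1) by (intro card_insert_disjoint) auto
    ultimately show ?thesis by simp
  qed
  have pos': "pos Z' z = pos Z z" if z: "z \<in> Z' - c" for z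
  proof -
    have "z \<in> Z - c - {f}" using z e by (auto simp: Z'_def)
    then have z': "e < z \<longleftrightarrow> f < z" using f(2) by blast
    show ?thesis
    proof (cases "e < z")
      case True
      have "{y \<in> Z'. y < z} = insert e ({y \<in> Z. y < z} - {f})" using True by (auto simp: Z'_def)
      moreover have "Suc (card ({y \<in> Z. y < z} - {f})) = card {y \<in> Z. y < z}"
        using True z' f Suc.prems(1) by (intro card_Suc_Diff1) auto
      moreover have "card (insert e ({y \<in> Z. y < z} - {f})) = Suc (card ({y \<in> Z. y < z} - {f}))"
        using e Suc.prems(1) by (intro card_insert_disjoint) auto
      ultimately show ?thesis by (simp add: pos_def)
    next
      case False
      then have "{y \<in> Z'. y < z} = {y \<in> Z. y < z}" using z' by (auto simp: Z'_def)
      then show ?thesis by (simp add: pos_def)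
    qed
  qed
  have "c - Z' = (c - Z) - {e}" using f by (auto simp: Z'_def)
  then have "m = card (c - Z')"
    using Suc.hyps(2) Suc.prems(2) e card_Suc_Diff1[of "c - Z" e] by simp
  moreover have "\<forall>z\<in>Z' - c. P (even (pos Z' z)) z" using pos' Suc.prems(4) e by (auto simp: Z'_def)
  ultimately obtain b where "c \<subseteq> b" "b \<subseteq> c \<union> Z'" "card b = card Z'" "\<forall>z\<in>b - c. P (even (pos b z)) z"
    using Suc.hyps(1)[of Z'] fin' card' Suc.prems by auto
  moreover have "c \<union> Z' \<subseteq> c \<union> Z" using e by (auto simp: Z'_def)
  ultimately show ?case using card' by (intro exI[of _ b]) auto
qed

section \<open>Cells and their boundaries\<close>

text \<open>\<open>True\<close> stands for sources, \<open>False\<close> for targets.\<close>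

definition bd :: "'f face_system \<Rightarrow> bool \<Rightarrow> nat \<Rightarrow> 'f set \<Rightarrow> 'f set" where
  "bd K s = (if s then cell_src K else cell_tgt K)"

definition fbd :: "'f face_system \<Rightarrow> bool \<Rightarrow> 'f \<Rightarrow> 'f set" where
  "fbd K s = (if s then fsrc K else ftgt K)"

definition down :: "'f face_system \<Rightarrow> 'f set \<Rightarrow> bool" where
  "down K X \<longleftrightarrow> (\<forall>a\<in>X. sub K a \<subseteq> X)"

lemma bd_iff:
  "a \<in> bd K s p X \<longleftrightarrow> a \<in> X \<and> fdim K a \<le> p \<and>
     (\<forall>b\<in>X. fdim K b = Suc p \<and> a \<in> sub K b \<longrightarrow> a \<in> Sub K (fbd K s b))"
  by (simp add: bd_def fbd_def cell_src_def cell_tgt_def)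

lemma bd_subset: "bd K s p X \<subseteq> X"
  by (auto simp: bd_iff)

lemma bd_dim: "a \<in> bd K s p X \<Longrightarrow> fdim K a \<le> p"
  by (simp add: bd_iff)

lemma bd_low: "(\<And>a. a \<in> X \<Longrightarrow> fdim K a \<le> p) \<Longrightarrow> bd K s p X = X"
  by (fastforce simp: bd_iff)

lemma bd_bd_ge: "p \<le> q \<Longrightarrow> bd K s q (bd K s' p X) = bd K s' p X"
  by (rule bd_low) (auto dest: bd_dim)

lemma bd_True: "bd K True = cell_src K" and bd_False: "bd K False = cell_tgt K"
  by (simp_all add: bd_def)

lemma cells_bd: "X \<in> cells K \<Longrightarrow> bd K s p X \<in> cells K"
  by (simp add: bd_def cells.source cells.target)

lemma cells_comp:
  "X \<in> cells K \<Longrightarrow> Y \<in> cells K \<Longrightarrow> bd K False p X = bd K True p Y \<Longrightarrow> X \<union> Y \<in> cells K"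
  by (auto simp: bd_def intro: cells.comp)

lemma cells_comp':
  "X \<in> cells K \<Longrightarrow> Y \<in> cells K \<Longrightarrow> bd K (\<not> s) p X = bd K s p Y \<Longrightarrow> X \<union> Y \<in> cells K"
  using cells_comp[of X K Y p] cells_comp[of Y K X p] by (cases s) (auto simp: Un_commute)

lemma cells_induct [consumes 1, case_names atom bd comp]:
  assumes "X \<in> cells K"
    and "\<And>x. x \<in> faces K \<Longrightarrow> P (sub K x)"
    and "\<And>X s p. X \<in> cells K \<Longrightarrow> P X \<Longrightarrow> P (bd K s p X)"
    and "\<And>X Y p. X \<in> cells K \<Longrightarrow> P X \<Longrightarrow> Y \<in> cells K \<Longrightarrow> P Y \<Longrightarrow>
      bd K False p X = bd K True p Y \<Longrightarrow> P (X \<union> Y)"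
  shows "P X"
  using assms(1)
proof (induction rule: cells.induct)
  case (source X p) then show ?case using assms(3)[of X True p] by (simp add: bd_def)
next
  case (target X p) then show ?case using assms(3)[of X False p] by (simp add: bd_def)
next
  case (comp X Y p) then show ?case using assms(4)[of X Y p] by (simp add: bd_def)
qed (use assms(2) in auto)

text \<open>The laws of boundaries and composites that later arguments use, separated from the
  geometry. The Boolean \<open>s\<close> covers both orders of a composite: for \<open>False\<close>
  the set \<open>Y\<close> is the first factor.\<close>

locale pasting =
  fixes K :: "'f face_system"
  assumes sub_face: "a \<in> faces K \<Longrightarrow> b \<in> sub K a \<Longrightarrow> b \<in> faces K"
    and sub_self: "a \<in> faces K \<Longrightarrow> a \<in> sub K a"
    and cells_faces: "X \<in> cells K \<Longrightarrow> X \<subseteq> faces K"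
    and cells_down: "X \<in> cells K \<Longrightarrow> down K X"
    and bd_bd: "X \<in> cells K \<Longrightarrow> q < p \<Longrightarrow> bd K s q (bd K s' p X) = bd K s q X"
    and comp_inter: "X \<in> cells K \<Longrightarrow> Y \<in> cells K \<Longrightarrow> bd K (\<not> s) p X = bd K s p Y \<Longrightarrow> X \<inter> Y = bd K s p Y"
    and comp_bd: "X \<in> cells K \<Longrightarrow> Y \<in> cells K \<Longrightarrow> bd K (\<not> s) p X = bd K s p Y \<Longrightarrow>
      bd K s p (X \<union> Y) = bd K s p X"
    and comp_bd_high: "X \<in> cells K \<Longrightarrow> Y \<in> cells K \<Longrightarrow> bd K (\<not> s) p X = bd K s p Y \<Longrightarrow>
      p < q \<Longrightarrow> bd K s' q (X \<union> Y) = bd K s' q X \<union> bd K s' q Y"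
    and comp_bd_low: "X \<in> cells K \<Longrightarrow> Y \<in> cells K \<Longrightarrow> bd K (\<not> s) p X = bd K s p Y \<Longrightarrow>
      q < p \<Longrightarrow> bd K s' q (X \<union> Y) = bd K s' q X"

section \<open>Fibres of the moments and extremal points of polytopes\<close>

definition same :: "nat \<Rightarrow> nat \<Rightarrow> (nat \<Rightarrow> real) \<Rightarrow> (nat \<Rightarrow> real) \<Rightarrow> bool" where
  "same n q x y \<longleftrightarrow> (\<forall>k<q. mom n k x = mom n k y)"

lemma same_refl: "same n q x x" and same_sym: "same n q x y \<Longrightarrow> same n q y x"
  and same_trans: "same n q x y \<Longrightarrow> same n q y z \<Longrightarrow> same n q x z"
  and same_mono: "same n q x y \<Longrightarrow> p \<le> q \<Longrightarrow> same n p x y"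
  and same_mom: "same n q x y \<Longrightarrow> p < q \<Longrightarrow> mom n p x = mom n p y"
  by (auto simp: same_def)

definition below :: "bool \<Rightarrow> real \<Rightarrow> real \<Rightarrow> bool" where
  "below s x y \<longleftrightarrow> (if s then x < y else y < x)"

lemma below_irrefl: "\<not> below s x x" and below_trans: "below s x y \<Longrightarrow> below s y z \<Longrightarrow> below s x z"
  and below_asym: "below s x y \<Longrightarrow> \<not> below s y x" and below_Not: "below (\<not> s) x y \<longleftrightarrow> below s y x"
  by (auto simp: below_def split: if_splits)

definition seg :: "real \<Rightarrow> (nat \<Rightarrow> real) \<Rightarrow> (nat \<Rightarrow> real) \<Rightarrow> nat \<Rightarrow> real" where
  "seg t x y = (\<lambda>i. (1 - t) * x i + t * y i)"

lemma mom_seg: "mom n k (seg t x y) = (1 - t) * mom n k x + t * mom n k y"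
  unfolding seg_def by (rule mom_linear)

lemma same_seg: "same n q x y \<Longrightarrow> same n q z w \<Longrightarrow> same n q (seg t x z) (seg t y w)"
  by (simp add: same_def mom_seg)

lemma below_seg:
  "below s a b \<Longrightarrow> 0 < t \<Longrightarrow> below s ((1 - t) * b + t * a) b"
  by (auto simp: below_def algebra_simps)

lemma below_seg':
  "below s a b \<Longrightarrow> t < 1 \<Longrightarrow> below s ((1 - t) * a + t * c) ((1 - t) * b + t * c)"
  by (auto simp: below_def)

text \<open>
  A realisation of the faces by polytopes.  The \<open>p\<close>-source of a complex is the set of its lowest points
  with respect to the moment of order \<open>p + sh\<close> in the fibres of the moments of lower order, and the
  \<open>p\<close>-target is the set of the highest points.
\<close>

locale polytope_geometry =
  fixes K :: "'f face_system" and n sh :: nat and cl inn :: "'f \<Rightarrow> (nat \<Rightarrow> real) set"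
  assumes finite_faces: "finite (faces K)"
    and sub_faces: "a \<in> faces K \<Longrightarrow> b \<in> sub K a \<Longrightarrow> b \<in> faces K"
    and sub_refl: "a \<in> faces K \<Longrightarrow> a \<in> sub K a"
    and sub_trans: "a \<in> faces K \<Longrightarrow> b \<in> sub K a \<Longrightarrow> c \<in> sub K b \<Longrightarrow> c \<in> sub K a"
    and inn_nonempty: "a \<in> faces K \<Longrightarrow> \<exists>x. x \<in> inn a"
    and inn_cl: "a \<in> faces K \<Longrightarrow> x \<in> inn a \<Longrightarrow> x \<in> cl a"
    and carrier: "a \<in> faces K \<Longrightarrow> x \<in> cl a \<Longrightarrow> \<exists>c\<in>sub K a. x \<in> inn c"
    and inn_sub: "c \<in> faces K \<Longrightarrow> e \<in> faces K \<Longrightarrow> x \<in> inn c \<Longrightarrow> x \<in> cl e \<Longrightarrow> c \<in> sub K e"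
    and sub_cl: "e \<in> faces K \<Longrightarrow> c \<in> sub K e \<Longrightarrow> cl c \<subseteq> cl e"
    and convex_cl: "a \<in> faces K \<Longrightarrow> x \<in> cl a \<Longrightarrow> y \<in> cl a \<Longrightarrow> 0 \<le> t \<Longrightarrow> t \<le> 1 \<Longrightarrow> seg t x y \<in> cl a"
    and inn_seg: "a \<in> faces K \<Longrightarrow> x \<in> cl a \<Longrightarrow> y \<in> inn a \<Longrightarrow> 0 < t \<Longrightarrow> t \<le> 1 \<Longrightarrow> seg t x y \<in> inn a"
    and compact_cl: "a \<in> faces K \<Longrightarrow> compact (cl a)"
    and descend: "b \<in> faces K \<Longrightarrow> fdim K b = Suc p \<Longrightarrow> c \<in> sub K b \<Longrightarrow> c \<notin> Sub K (fbd K s b) \<Longrightarrow> x \<in> inn c \<Longrightarrow>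
      \<exists>y\<in>cl b. same n (p + sh) y x \<and> below s (mom n (p + sh) y) (mom n (p + sh) x)"
    and descend_top: "c \<in> faces K \<Longrightarrow> p < fdim K c \<Longrightarrow> x \<in> inn c \<Longrightarrow>
      \<exists>y\<in>cl c. same n (p + sh) y x \<and> below s (mom n (p + sh) y) (mom n (p + sh) x)"
    and extend: "e \<in> faces K \<Longrightarrow> c \<in> sub K e \<Longrightarrow> fdim K c \<le> p \<Longrightarrow> x \<in> inn c \<Longrightarrow> y \<in> cl e \<Longrightarrow>
      same n (p + sh) y x \<Longrightarrow> y \<noteq> x \<Longrightarrow> \<not> below s (mom n (p + sh) x) (mom n (p + sh) y) \<Longrightarrow>
      \<exists>b\<in>sub K e. fdim K b = Suc p \<and> c \<in> sub K b \<and> c \<notin> Sub K (fbd K s b)"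
begin

definition rl :: "'f set \<Rightarrow> (nat \<Rightarrow> real) set" where
  "rl X = (\<Union>a\<in>X. cl a)"

definition covers :: "'f set \<Rightarrow> bool" where
  "covers X \<longleftrightarrow> (\<forall>s p. \<forall>x\<in>rl X. \<exists>y\<in>rl (bd K s p X). same n (p + sh) y x)"

definition extremal :: "'f set \<Rightarrow> bool" where
  "extremal X \<longleftrightarrow> (\<forall>s p. \<forall>x\<in>rl X. \<forall>y\<in>rl (bd K s p X). same n (p + sh) y x \<longrightarrow>
     y = x \<or> below s (mom n (p + sh) y) (mom n (p + sh) x))"

text \<open>The invariant of cells. \<open>covers\<close> and \<open>extremal\<close> together say
  that the boundary of order p contains exactly the lowest or highest point of every fibre. In
  contrast to the formula for \<open>bd\<close>, this is a statement that survives gluing.\<close>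

definition good :: "'f set \<Rightarrow> bool" where
  "good X \<longleftrightarrow> X \<subseteq> faces K \<and> down K X \<and> (\<forall>s p. down K (bd K s p X)) \<and> covers X \<and> extremal X"

lemma rl_mono: "X \<subseteq> Y \<Longrightarrow> rl X \<subseteq> rl Y"
  by (auto simp: rl_def)

lemma rl_Un: "rl (X \<union> Y) = rl X \<union> rl Y"
  by (auto simp: rl_def)

lemma inn_rl: "X \<subseteq> faces K \<Longrightarrow> down K X \<Longrightarrow> c \<in> faces K \<Longrightarrow> x \<in> inn c \<Longrightarrow> x \<in> rl X \<Longrightarrow> c \<in> X"
  using inn_sub by (fastforce simp: rl_def down_def)

lemma in_rl: "X \<subseteq> faces K \<Longrightarrow> c \<in> X \<Longrightarrow> x \<in> inn c \<Longrightarrow> x \<in> rl X"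
  using inn_cl by (fastforce simp: rl_def)

lemma good_faces: "good X \<Longrightarrow> X \<subseteq> faces K"
  and good_down: "good X \<Longrightarrow> down K X"
  and good_down_bd: "good X \<Longrightarrow> down K (bd K s p X)"
  by (auto simp: good_def)

lemma good_covers: "good X \<Longrightarrow> x \<in> rl X \<Longrightarrow> \<exists>y\<in>rl (bd K s p X). same n (p + sh) y x"
  by (simp add: good_def covers_def)

lemma good_extremal: "good X \<Longrightarrow> x \<in> rl X \<Longrightarrow> y \<in> rl (bd K s p X) \<Longrightarrow> same n (p + sh) y x \<Longrightarrow>
    y = x \<or> below s (mom n (p + sh) y) (mom n (p + sh) x)"
  by (simp add: good_def extremal_def)

lemma good_unique: "good X \<Longrightarrow> x \<in> rl (bd K s p X) \<Longrightarrow> y \<in> rl (bd K s p X) \<Longrightarrow> same n (p + sh) y x \<Longrightarrow> y = x"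
proof -
  assume X: "good X" and x: "x \<in> rl (bd K s p X)" and y: "y \<in> rl (bd K s p X)" and sm: "same n (p + sh) y x"
  have "x \<in> rl X" "y \<in> rl X" using x y rl_mono[OF bd_subset] by blast+
  then have "y = x \<or> below s (mom n (p + sh) y) (mom n (p + sh) x)"
    "x = y \<or> below s (mom n (p + sh) x) (mom n (p + sh) y)"
    using good_extremal[OF X _ y sm] good_extremal[OF X _ x same_sym[OF sm]] by blast+
  then show ?thesis using below_asym by blast
qed

text \<open>For a single face, \<open>extend\<close> turns a point that violates extremality into a
  face removing \<open>c\<close> from the boundary, and \<open>descend\<close> conversely turns a
  removing face into a point further out.\<close>

lemma good_atom:
  assumes a: "a \<in> faces K"
  shows "good (sub K a)"
proof -
  let ?X = "sub K a"
  have X: "?X \<subseteq> faces K" using sub_faces[OF a] by blast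
  have dn: "down K ?X" using sub_trans[OF a] by (auto simp: down_def)
  have rlX: "rl ?X = cl a" using sub_cl[OF a] sub_refl[OF a] by (auto simp: rl_def)
  have ext: "y = x \<or> below s (mom n (p + sh) y) (mom n (p + sh) x)"
    if c: "c \<in> bd K s p ?X" and y: "y \<in> inn c" and x: "x \<in> cl a" and sm: "same n (p + sh) y x" for s p c x y
  proof (rule ccontr)
    assume neg: "\<not> ?thesis"
    have c': "c \<in> sub K a" "fdim K c \<le> p" using c by (auto simp: bd_iff)
    obtain b where "b \<in> sub K a" "fdim K b = Suc p" "c \<in> sub K b" "c \<notin> Sub K (fbd K s b)"
      using extend[OF a c' y x same_sym[OF sm], of s] neg by auto
    then show False using c by (auto simp: bd_iff)
  qed
  have descend': "\<exists>y\<in>cl a. same n (p + sh) y x \<and> below s (mom n (p + sh) y) (mom n (p + sh) x)"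
    if c: "c \<in> sub K a" "c \<notin> bd K s p ?X" and x: "x \<in> inn c" for s p c x
  proof (cases "fdim K c \<le> p")
    case True
    then obtain b where b: "b \<in> sub K a" "fdim K b = Suc p" "c \<in> sub K b" "c \<notin> Sub K (fbd K s b)"
      using c by (auto simp: bd_iff)
    then show ?thesis using descend[OF _ b(2-4) x] X sub_cl[OF a b(1)] by blast
  next
    case False
    then show ?thesis using descend_top[of c p x s] X x sub_cl[OF a c(1)] c(1) by (meson not_le subsetD)
  qed
  \<comment> \<open>If a subface \<open>c'\<close> of \<open>c\<close> were outside the boundary, a
    point of it could be moved further out. Averaging this move with an interior point of
    \<open>c\<close> would move an interior point of \<open>c\<close> too, against
    extremality.\<close>
  have dnb: "down K (bd K s p ?X)" for s p
    unfolding down_def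
  proof (intro ballI subsetI)
    fix c c' assume c: "c \<in> bd K s p ?X" and c': "c' \<in> sub K c"
    have cX: "c \<in> sub K a" using c by (simp add: bd_iff)
    then have c'X: "c' \<in> sub K a" using dn c' by (auto simp: down_def)
    show "c' \<in> bd K s p ?X"
    proof (rule ccontr)
      assume n: "c' \<notin> bd K s p ?X"
      obtain x where x: "x \<in> inn c'" using inn_nonempty X c'X by blast
      obtain y where y: "y \<in> cl a" "same n (p + sh) y x" "below s (mom n (p + sh) y) (mom n (p + sh) x)"
        using descend'[OF c'X n x] by auto
      obtain u where u: "u \<in> inn c" using inn_nonempty X cX by blast
      have xc: "x \<in> cl c" using inn_cl[OF _ x] sub_cl[OF _ c'] X c'X cX by blast
      define x' where "x' = seg (1/2) x u"
      define y' where "y' = seg (1/2) y u"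
      have "x' \<in> inn c" unfolding x'_def using inn_seg[OF _ xc u] X cX by auto
      moreover have "y' \<in> cl a" unfolding y'_def
      proof (rule convex_cl[OF a y(1)])
        have "c \<in> faces K" using X cX by blast
        then show "u \<in> cl a" using inn_cl[OF _ u] sub_cl[OF a cX] by blast
      qed auto
      moreover have "same n (p + sh) x' y'" unfolding x'_def y'_def by (rule same_seg[OF same_sym[OF y(2)] same_refl])
      moreover have b: "below s (mom n (p + sh) y') (mom n (p + sh) x')"
        unfolding x'_def y'_def mom_seg using y(3) by (intro below_seg') auto
      ultimately have "x' = y' \<or> below s (mom n (p + sh) x') (mom n (p + sh) y')" using ext[OF c] by blast
      then show False using b below_asym below_irrefl by metis
    qed
  qed
  have inn_carrier: "\<exists>c\<in>Y. y \<in> inn c" if "down K Y" "Y \<subseteq> faces K" "y \<in> rl Y" for Y y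
    using that carrier unfolding rl_def down_def by blast
  have "extremal ?X"
    unfolding extremal_def
    using ext inn_carrier[OF dnb] bd_subset[of K _ _ ?X] X unfolding rlX by (meson order_trans)
  moreover have "covers ?X"
    unfolding covers_def
  proof (intro allI ballI)
    \<comment> \<open>The moment attains its extremum on the compact fibre, and a face carrying an
      extremal point cannot be left in the direction given by \<open>descend'\<close>.\<close>
    fix s p x assume x: "x \<in> rl ?X"
    define S where "S = {y \<in> cl a. same n (p + sh) y x}"
    have cont: "continuous_on A (mom n k)" for k A
      unfolding mom_def by (intro continuous_intros continuous_on_product_coordinates continuous_on_subset[OF continuous_on_product_coordinates]) auto
    have "S = cl a \<inter> (\<Inter>k<p+sh. {y. mom n k y = mom n k x})" by (auto simp: S_def same_def)
    moreover have "closed {y. mom n k y = mom n k x}" for k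
      by (rule closed_Collect_eq) (auto intro: cont)
    ultimately have "compact S" using compact_cl[OF a] by (auto intro!: compact_Int_closed)
    moreover have "x \<in> S" using x by (auto simp: S_def same_refl rlX)
    moreover have cont': "continuous_on S (\<lambda>y. if s then mom n (p + sh) y else - mom n (p + sh) y)"
      by (cases s) (auto intro!: cont continuous_on_minus)
    ultimately obtain y where y: "y \<in> S"
      "\<forall>z\<in>S. (if s then mom n (p + sh) y else - mom n (p + sh) y) \<le> (if s then mom n (p + sh) z else - mom n (p + sh) z)"
      using continuous_attains_inf[of S "\<lambda>y. if s then mom n (p + sh) y else - mom n (p + sh) y"] by blast
    have ya: "y \<in> cl a" "same n (p + sh) y x" using y by (auto simp: S_def)
    obtain c where c: "c \<in> sub K a" "y \<in> inn c" using carrier[OF a ya(1)] by auto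
    have "c \<in> bd K s p ?X"
    proof (rule ccontr)
      assume "c \<notin> bd K s p ?X"
      then obtain z where z: "z \<in> cl a" "same n (p + sh) z y" "below s (mom n (p + sh) z) (mom n (p + sh) y)"
        using descend'[OF c(1) _ c(2)] by blast
      then have "z \<in> S" using ya by (auto simp: S_def intro: same_trans)
      then show False using y(2) z(3) by (force simp: below_def split: if_splits)
    qed
    then show "\<exists>y\<in>rl (bd K s p ?X). same n (p + sh) y x"
      by (intro bexI[of _ y] ya(2) in_rl[of "bd K s p ?X" c y])
        (use ya c(2) bd_subset[of K s p ?X] X in auto)
  qed
  ultimately show ?thesis using X dn dnb by (simp add: good_def)
qed

text \<open>Globularity. A face of the q-boundary that is lost at order p would give a second point
  of its fibre with the same moment of order q, against extremality. The other inclusion has to move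
  a witness from \<open>X\<close> into the p-boundary, which is done by a limit.\<close>

lemma good_bd_bd:
  assumes X: "good X" and qp: "q < p"
  shows "bd K s q (bd K s' p X) = bd K s q X"
proof (intro equalityI subsetI)
  fix c assume c: "c \<in> bd K s q X"
  have cX: "c \<in> X" "c \<in> faces K" using c X good_faces by (auto simp: bd_iff)
  have "c \<in> bd K s' p X"
  proof (rule ccontr)
    assume "c \<notin> bd K s' p X"
    then obtain b where b: "b \<in> X" "fdim K b = Suc p" "c \<in> sub K b" "c \<notin> Sub K (fbd K s' b)"
      using c qp by (auto simp: bd_iff)
    obtain x where x: "x \<in> inn c" using inn_nonempty cX by auto
    obtain y where y: "y \<in> cl b" "same n (p + sh) y x" "below s' (mom n (p + sh) y) (mom n (p + sh) x)"
      using descend[OF _ b(2-4) x] b(1) X good_faces by blast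
    have "x \<in> rl (bd K s q X)"
      using bd_subset[of K s q X] good_faces[OF X] by (intro in_rl[OF _ c x]) auto
    moreover have "y \<in> rl X" using y b by (auto simp: rl_def)
    moreover have "same n (q + sh) x y" using y(2) qp by (auto intro: same_mono same_sym)
    ultimately have "x = y \<or> below s (mom n (q + sh) x) (mom n (q + sh) y)" using good_extremal[OF X] by blast
    moreover have "mom n (q + sh) x = mom n (q + sh) y" using same_mom[OF y(2)] qp by auto
    ultimately show False using y(3) below_irrefl by metis
  qed
  moreover have "bd K s' p X \<subseteq> X" by (rule bd_subset)
  moreover have "fdim K c \<le> q" "\<forall>b\<in>X. fdim K b = Suc q \<and> c \<in> sub K b \<longrightarrow> c \<in> Sub K (fbd K s b)"
    using c by (simp_all add: bd_iff)
  ultimately show "c \<in> bd K s q (bd K s' p X)"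
    unfolding bd_iff[of c K s q] by blast
next
  fix c assume c: "c \<in> bd K s q (bd K s' p X)"
  let ?Y = "bd K s' p X"
  have Y: "?Y \<subseteq> faces K" "down K ?Y" "finite ?Y"
  proof -
    show "?Y \<subseteq> faces K" using bd_subset[of K s' p X] good_faces[OF X] by (rule order_trans)
    then show "finite ?Y" using finite_faces by (rule finite_subset)
    show "down K ?Y" by (rule good_down_bd[OF X])
  qed
  have cY: "c \<in> ?Y" "c \<in> faces K" "fdim K c \<le> q" using c Y by (auto simp: bd_iff[of c K s q])
  show "c \<in> bd K s q X"
  proof (rule ccontr)
    assume "c \<notin> bd K s q X"
    then obtain b where b: "b \<in> X" "fdim K b = Suc q" "c \<in> sub K b" "c \<notin> Sub K (fbd K s b)"
      using cY bd_subset[of K s' p X] by (auto simp: bd_iff[of c K s q])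
    have bf: "b \<in> faces K" using b X good_faces by blast
    obtain x where x: "x \<in> inn c" using inn_nonempty cY by auto
    obtain y where y: "y \<in> cl b" "same n (q + sh) y x" "below s (mom n (q + sh) y) (mom n (q + sh) x)"
      using descend[OF bf b(2-4) x] by auto
    have xb: "x \<in> cl b" using inn_cl[OF cY(2) x] sub_cl[OF bf b(3)] by auto
    \<comment> \<open>The points \<open>seg (t k) x y\<close> approach \<open>x\<close> inside
      \<open>b\<close>. Their representatives in the p-boundary fall infinitely often into one face
      \<open>f\<close>, and a limit of these is \<open>x\<close> by uniqueness in the fibre. Hence
      \<open>c\<close> is a face of \<open>f\<close>, and the descent from \<open>x\<close> can be
      repeated there.\<close>
    define t where "t k = inverse (real (Suc k))" for k
    have t: "0 < t k" "t k \<le> 1" for k by (auto simp: t_def divide_simps)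
    have "\<exists>z e. e \<in> ?Y \<and> z \<in> cl e \<and> same n (p + sh) z (seg (t k) x y)" for k
    proof -
      have "seg (t k) x y \<in> rl X" using convex_cl[OF bf xb y(1), of "t k"] t[of k] b(1) by (auto simp: rl_def)
      from good_covers[OF X this, of s' p] show ?thesis by (auto simp: rl_def)
    qed
    then obtain z e where ze: "\<And>k. e k \<in> ?Y \<and> z k \<in> cl (e k) \<and> same n (p + sh) (z k) (seg (t k) x y)" by metis
    have "finite (range e)" using ze Y(3) by (auto intro: finite_subset)
    then obtain k0 where k0: "infinite {k. e k = e k0}"
      using pigeonhole_infinite[of UNIV e] by auto
    define f where "f = e k0"
    have f: "f \<in> ?Y" "f \<in> faces K" using ze Y by (auto simp: f_def)
    define r where "r = enumerate {k. e k = f}"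
    have r: "strict_mono r" "e (r k) = f" for k
      using k0 strict_mono_enumerate[of "{k. e k = f}"] enumerate_in_set[of "{k. e k = f}" k]
      by (auto simp: r_def f_def)
    have "seq_compact (cl f)" using compact_cl[OF f(2)] compact_imp_seq_compact by blast
    moreover have "\<forall>k. z (r k) \<in> cl f"
    proof
      fix k show "z (r k) \<in> cl f" using ze[of "r k"] r(2)[of k] by simp
    qed
    ultimately obtain l r' where l: "l \<in> cl f" "strict_mono r'" "((\<lambda>k. z (r k)) \<circ> r') \<longlonglongrightarrow> l"
      by (rule seq_compactE)
    define w where "w k = z (r (r' k))" for k
    define u where "u k = t (r (r' k))" for k
    have wl: "w \<longlonglongrightarrow> l" using l(3) by (simp add: w_def[abs_def] comp_def)
    have w: "w k \<in> cl f" "same n (p + sh) (w k) (seg (u k) x y)" for k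
      using ze[of "r (r' k)"] r by (auto simp: w_def u_def)
    have ul: "u \<longlonglongrightarrow> 0"
    proof -
      have "t \<longlonglongrightarrow> 0" unfolding t_def by (rule LIMSEQ_inverse_real_of_nat)
      then have "(t \<circ> (r \<circ> r')) \<longlonglongrightarrow> 0"
        using r(1) l(2) by (intro LIMSEQ_subseq_LIMSEQ strict_mono_o)
      then show ?thesis by (simp add: u_def[abs_def] comp_def)
    qed
    have cont: "continuous_on UNIV (mom n k)" for k
      unfolding mom_def by (intro continuous_intros continuous_on_product_coordinates)
    have "same n (p + sh) l x"
      unfolding same_def
    proof (intro allI impI)
      fix k assume k: "k < p + sh"
      have "(\<lambda>i. mom n k (w i)) \<longlonglongrightarrow> mom n k l"
        by (rule continuous_on_tendsto_compose[OF cont[of k] wl]) auto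
      moreover have "(\<lambda>i. (1 - u i) * mom n k x + u i * mom n k y) \<longlonglongrightarrow> (1 - 0) * mom n k x + 0 * mom n k y"
        by (intro tendsto_intros ul)
      moreover have "mom n k (w i) = (1 - u i) * mom n k x + u i * mom n k y" for i
        using same_mom[OF w(2) k] by (simp add: mom_seg)
      ultimately show "mom n k l = mom n k x" using LIMSEQ_unique by fastforce
    qed
    moreover have "l \<in> rl ?Y" "x \<in> rl ?Y" using l f in_rl[OF Y(1) cY(1) x] by (auto simp: rl_def)
    ultimately have "l = x" using good_unique[OF X] by blast
    then have cf: "c \<in> sub K f" using inn_sub[OF cY(2) f(2) x] l by auto
    \<comment> \<open>As q < p, the representative shares the moment of order q with the point of
      the segment and so still lies beyond \<open>x\<close>.\<close>
    have m: "mom n (q + sh) (w 0) = mom n (q + sh) (seg (u 0) x y)" using same_mom[OF w(2)[of 0]] qp by auto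
    have sm: "same n (q + sh) (w 0) x"
    proof -
      have "same n (q + sh) (seg (u 0) x y) (seg (u 0) x x)" using y(2) by (intro same_seg same_refl)
      moreover have "seg (u 0) x x = x" by (auto simp: seg_def algebra_simps)
      ultimately show ?thesis using same_mono[OF w(2)[of 0], of "q + sh"] qp by (auto intro: same_trans)
    qed
    have bl: "below s (mom n (q + sh) (w 0)) (mom n (q + sh) x)"
      unfolding m mom_seg using below_seg[OF y(3)] t by (auto simp: u_def)
    have ne: "w 0 \<noteq> x" using bl below_irrefl by metis
    obtain b' where b': "b' \<in> sub K f" "fdim K b' = Suc q" "c \<in> sub K b'" "c \<notin> Sub K (fbd K s b')"
      using extend[OF f(2) cf cY(3) x w(1)[of 0] sm ne, of s] bl below_asym by blast
    have "b' \<in> ?Y" using b'(1) f(1) Y(2) by (auto simp: down_def)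
    then show False using c b' by (auto simp: bd_iff[of c K s q])
  qed
qed

text \<open>Boundaries of order at least p fix \<open>bd K s p X\<close>, and those of lower order
  are boundaries of \<open>X\<close>; what remains is uniqueness in the fibres.\<close>

lemma good_bd:
  assumes X: "good X"
  shows "good (bd K s p X)"
proof -
  let ?Y = "bd K s p X"
  have YX: "rl ?Y \<subseteq> rl X" by (intro rl_mono bd_subset)
  have b: "bd K s' q ?Y = (if q < p then bd K s' q X else ?Y)" for s' q
    using good_bd_bd[OF X, of q p s' s] bd_bd_ge[of p q K s' s X] by (cases "q < p") simp_all
  have "down K (bd K s' q ?Y)" for s' q using b good_down_bd[OF X] by auto
  moreover have "covers ?Y"
    unfolding covers_def b using good_covers[OF X] YX by (auto intro: same_refl)
  moreover have "extremal ?Y"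
    unfolding extremal_def b
  proof (intro allI ballI impI)
    fix s' q x y assume x: "x \<in> rl ?Y" and y: "y \<in> rl (if q < p then bd K s' q X else ?Y)" and sm: "same n (q + sh) y x"
    show "y = x \<or> below s' (mom n (q + sh) y) (mom n (q + sh) x)"
    proof (cases "q < p")
      case True then show ?thesis using good_extremal[OF X _ _ sm] x y YX by auto
    next
      case False
      then have "same n (p + sh) y x" using sm by (auto intro: same_mono)
      then show ?thesis using good_unique[OF X x] y False by auto
    qed
  qed
  ultimately show ?thesis using X bd_subset[of K s p X] unfolding good_def by blast
qed

context
  fixes X Y s p
  assumes X: "good X" and Y: "good Y" and comp: "bd K (\<not> s) p X = bd K s p Y"
begin

text \<open>The common boundary separates the factors fibrewise: \<open>z\<close> is the last point
  of the fibre in \<open>X\<close> and the first one in \<open>Y\<close>. This is the order between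
  the factors that the formula for \<open>bd\<close> hides.\<close>

lemma interface:
  assumes "x \<in> rl X" "y \<in> rl Y" "same n (p + sh) x y"
  obtains z where "z \<in> rl (bd K s p Y)" "same n (p + sh) z x"
    "x = z \<or> below s (mom n (p + sh) x) (mom n (p + sh) z)" "z = y \<or> below s (mom n (p + sh) z) (mom n (p + sh) y)"
proof -
  obtain z where z: "z \<in> rl (bd K s p Y)" "same n (p + sh) z y" using good_covers[OF Y assms(2)] by blast
  have zx: "same n (p + sh) z x" using z(2) assms(3) by (auto intro: same_trans same_sym)
  show ?thesis
    using that[OF z(1) zx] good_extremal[OF Y assms(2) z] good_extremal[OF X assms(1) _ zx, of "\<not> s"] z(1) comp
    by (auto simp: below_Not)
qed

text \<open>A point of both factors lies on both sides of the interface point of its fibre and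
  therefore equals it; this is applied to an interior point of a common face.\<close>

lemma good_comp_inter: "X \<inter> Y = bd K s p Y"
proof (intro equalityI subsetI)
  fix c assume c: "c \<in> X \<inter> Y"
  have cf: "c \<in> faces K" using c X good_faces by blast
  obtain x where x: "x \<in> inn c" using inn_nonempty[OF cf] by auto
  have xX: "x \<in> rl X" "x \<in> rl Y" using in_rl x c X Y good_faces by blast+
  obtain z where "z \<in> rl (bd K s p Y)"
    "x = z \<or> below s (mom n (p + sh) x) (mom n (p + sh) z)" "z = x \<or> below s (mom n (p + sh) z) (mom n (p + sh) x)"
    using interface[OF xX same_refl] by blast
  then have "x \<in> rl (bd K s p Y)" using below_asym by blast
  then show "c \<in> bd K s p Y"
    by (intro inn_rl[OF _ good_down_bd[OF Y] cf x]) (use good_faces[OF Y] bd_subset[of K s p Y] in auto)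
next
  fix c assume c: "c \<in> bd K s p Y"
  then have "c \<in> bd K (\<not> s) p X" using comp by simp
  then show "c \<in> X \<inter> Y" using c by (simp add: bd_iff)
qed

lemma good_comp_bd: "bd K s p (X \<union> Y) = bd K s p X"
proof (intro equalityI subsetI)
  fix a assume a: "a \<in> bd K s p (X \<union> Y)"
  show "a \<in> bd K s p X"
  proof (cases "a \<in> X")
    case True then show ?thesis using a by (auto simp: bd_iff)
  next
    case False
    then have "a \<in> bd K s p Y" using a by (auto simp: bd_iff)
    then show ?thesis using False good_comp_inter by blast
  qed
next
  fix a assume a: "a \<in> bd K s p X"
  have "a \<in> Sub K (fbd K s b)" if b: "b \<in> X \<union> Y" "fdim K b = Suc p" "a \<in> sub K b" for b
  proof (cases "b \<in> X")
    case True then show ?thesis using a b by (auto simp: bd_iff)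
  next
    case False
    then have "b \<in> Y" using b by auto
    moreover have "a \<in> Y" using \<open>b \<in> Y\<close> b(3) good_down[OF Y] by (auto simp: down_def)
    then have "a \<in> bd K s p Y" using a good_comp_inter bd_subset[of K s p X] by blast
    ultimately show ?thesis using b by (auto simp: bd_iff)
  qed
  then show "a \<in> bd K s p (X \<union> Y)" using a by (auto simp: bd_iff)
qed

text \<open>For p < q both q-boundaries contain the interface, so a face of one factor cannot delete
  anything belonging to the other.\<close>

lemma good_comp_bd_high:
  assumes pq: "p < q"
  shows "bd K s' q (X \<union> Y) = bd K s' q X \<union> bd K s' q Y"
proof -
  have "bd K s p Y \<subseteq> bd K s' q Y" using good_bd_bd[OF Y pq, of s s'] bd_subset[of K s p "bd K s' q Y"] by simp
  moreover have "bd K (\<not> s) p X \<subseteq> bd K s' q X"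
    using good_bd_bd[OF X pq, of "\<not> s" s'] bd_subset[of K "\<not> s" p "bd K s' q X"] by simp
  ultimately have M: "X \<inter> Y \<subseteq> bd K s' q X" "X \<inter> Y \<subseteq> bd K s' q Y"
    unfolding good_comp_inter comp by auto
  show ?thesis
  proof (intro equalityI subsetI)
    fix a assume "a \<in> bd K s' q (X \<union> Y)" then show "a \<in> bd K s' q X \<union> bd K s' q Y" by (auto simp: bd_iff)
  next
    fix a assume a: "a \<in> bd K s' q X \<union> bd K s' q Y"
    have aX: "a \<in> bd K s' q X" if "a \<in> X" using that a M by (auto simp: bd_iff)
    have aY: "a \<in> bd K s' q Y" if "a \<in> Y" using that a M by (auto simp: bd_iff)
    have "a \<in> Sub K (fbd K s' b)" if b: "b \<in> X \<union> Y" "fdim K b = Suc q" "a \<in> sub K b" for b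
    proof (cases "b \<in> X")
      case True
      then have "a \<in> X" using b(3) good_down[OF X] by (auto simp: down_def)
      then show ?thesis using aX b True by (auto simp: bd_iff)
    next
      case False
      then have "b \<in> Y" "a \<in> Y" using b good_down[OF Y] by (auto simp: down_def)
      then show ?thesis using aY b by (auto simp: bd_iff)
    qed
    then show "a \<in> bd K s' q (X \<union> Y)" using a by (auto simp: bd_iff)
  qed
qed

lemma good_comp_bd_low:
  assumes qp: "q < p"
  shows "bd K s' q (X \<union> Y) = bd K s' q X" "bd K s' q X = bd K s' q Y"
proof -
  show eq: "bd K s' q X = bd K s' q Y"
    using good_bd_bd[OF X qp, of s' "\<not> s"] good_bd_bd[OF Y qp, of s' s] comp by simp
  show "bd K s' q (X \<union> Y) = bd K s' q X"
  proof (intro equalityI subsetI)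
    fix a assume "a \<in> bd K s' q (X \<union> Y)" then show "a \<in> bd K s' q X" using eq by (auto simp: bd_iff)
  next
    fix a assume a: "a \<in> bd K s' q X"
    then have "a \<in> bd K s' q Y" using eq by simp
    then show "a \<in> bd K s' q (X \<union> Y)" using a by (auto simp: bd_iff)
  qed
qed

end

lemma good_comp:
  assumes X: "good X" and Y: "good Y" and comp: "bd K (\<not> s) p X = bd K s p Y"
  shows "good (X \<union> Y)"
proof -
  have comp': "bd K (\<not> (\<not> s)) p Y = bd K (\<not> s) p X" using comp by simp
  have same: "bd K s' p (X \<union> Y) = (if s' = s then bd K s p X else bd K (\<not> s) p Y)" for s'
    using good_comp_bd[OF X Y comp] good_comp_bd[OF Y X comp'] by (auto simp: Un_commute)
  note high = good_comp_bd_high[OF X Y comp]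
  note low = good_comp_bd_low[OF X Y comp]
  have "down K (bd K s' q (X \<union> Y))" for s' q
  proof (cases q p rule: linorder_cases)
    case less then show ?thesis using low(1)[OF less, of s'] good_down_bd[OF X, of s' q] by simp
  next
    case equal then show ?thesis using same good_down_bd[OF X] good_down_bd[OF Y] by simp
  next
    case greater
    then show ?thesis
      unfolding high[OF greater] using good_down_bd[OF X, of s' q] good_down_bd[OF Y, of s' q]
      unfolding down_def by blast
  qed
  moreover have "\<exists>y\<in>rl (bd K s' q (X \<union> Y)). same n (q + sh) y x" if x: "x \<in> rl (X \<union> Y)" for s' q x
  proof (cases q p rule: linorder_cases)
    case less
    then show ?thesis
      using low[OF less, of s'] good_covers[OF X, of x s' q] good_covers[OF Y, of x s' q] x unfolding rl_Un by auto
  next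
    case greater
    then show ?thesis using good_covers[OF X] good_covers[OF Y] x unfolding high[OF greater] rl_Un by blast
  next
    case equal
    \<comment> \<open>A point of \<open>Y\<close> is first moved to the interface, which lies in
      \<open>X\<close>, and then within \<open>X\<close>.\<close>
    have cov: "\<exists>y\<in>rl (bd K s p X). same n (p + sh) y x" if X: "good X" and Y: "good Y"
      and comp: "bd K (\<not> s) p X = bd K s p Y" and x: "x \<in> rl X \<union> rl Y" for X Y s
    proof (cases "x \<in> rl X")
      case True then show ?thesis using good_covers[OF X] by blast
    next
      case False
      then obtain z where z: "z \<in> rl (bd K s p Y)" "same n (p + sh) z x" using good_covers[OF Y] x by blast
      then have "z \<in> rl X" using comp rl_mono[OF bd_subset] by (metis subsetD)
      then show ?thesis using good_covers[OF X] z(2) same_trans by blast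
    qed
    show ?thesis
      using cov[OF X Y comp] cov[OF Y X comp'] x unfolding equal same rl_Un by auto
  qed
  moreover have "y = x \<or> below s' (mom n (q + sh) y) (mom n (q + sh) x)"
    if x: "x \<in> rl (X \<union> Y)" and y: "y \<in> rl (bd K s' q (X \<union> Y))" and sm: "same n (q + sh) y x" for s' q x y
  proof (cases q p rule: linorder_cases)
    case less
    then have "y \<in> rl (bd K s' q X)" "y \<in> rl (bd K s' q Y)" using low[OF less, of s'] y by simp_all
    then show ?thesis
      using good_extremal[OF X _ _ sm] good_extremal[OF Y _ _ sm] x unfolding rl_Un by blast
  next
    case equal
    have ext: "y = x \<or> below s (mom n (p + sh) y) (mom n (p + sh) x)"
      if X: "good X" and Y: "good Y" and comp: "bd K (\<not> s) p X = bd K s p Y"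
        and x: "x \<in> rl X \<union> rl Y" and y: "y \<in> rl (bd K s p X)" and sm: "same n (p + sh) y x" for X Y s
    proof (cases "x \<in> rl X")
      case True then show ?thesis using good_extremal[OF X _ y sm] by blast
    next
      case False
      then have xY: "x \<in> rl Y" using x by auto
      have yX: "y \<in> rl X" using y rl_mono[OF bd_subset] by blast
      obtain z where z: "z \<in> rl (bd K s p Y)" "same n (p + sh) z y"
        "y = z \<or> below s (mom n (p + sh) y) (mom n (p + sh) z)" "z = x \<or> below s (mom n (p + sh) z) (mom n (p + sh) x)"
        using interface[OF X Y comp yX xY sm] by blast
      then show ?thesis using below_trans by blast
    qed
    show ?thesis
      using ext[OF X Y comp] ext[OF Y X comp'] x y sm unfolding equal same rl_Un by (auto split: if_splits)
  next
    case greater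
    \<comment> \<open>Above order p, two points of different factors in one fibre agree in the
      moment of order p, so both coincide with the interface point between them.\<close>
    have mixed: "y = x" if x: "x \<in> rl X" and y: "y \<in> rl Y" and sm: "same n (q + sh) x y" for x y
    proof -
      have m: "mom n (p + sh) x = mom n (p + sh) y" "same n (p + sh) x y"
        using sm greater by (auto intro: same_mono same_mom)
      obtain z where
        "x = z \<or> below s (mom n (p + sh) x) (mom n (p + sh) z)" "z = y \<or> below s (mom n (p + sh) z) (mom n (p + sh) y)"
        using interface[OF X Y comp x y m(2)] by blast
      then show ?thesis using m(1) below_asym below_irrefl below_trans by metis
    qed
    have sub: "rl (bd K s' q X) \<subseteq> rl X" "rl (bd K s' q Y) \<subseteq> rl Y" by (auto intro!: rl_mono bd_subset)
    show ?thesis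
      using good_extremal[OF X _ _ sm] good_extremal[OF Y _ _ sm] mixed[of x y] mixed[of y x] sm same_sym[OF sm] x y sub
      unfolding high[OF greater] rl_Un by blast
  qed
  ultimately show ?thesis
    using good_faces[OF X] good_faces[OF Y] good_down[OF X] good_down[OF Y]
    unfolding good_def covers_def extremal_def by (auto simp: down_def)
qed

lemma cells_good: "X \<in> cells K \<Longrightarrow> good X"
proof (induction rule: cells_induct)
  case (comp X Y p) then show ?case using good_comp[of X Y True p] by simp
qed (auto intro: good_atom good_bd)

sublocale pasting K
proof
  fix X Y s p q s' assume "X \<in> cells K" "Y \<in> cells K" "bd K (\<not> s) p X = bd K s p Y"
  note * = cells_good[OF this(1)] cells_good[OF this(2)] this(3)
  show "X \<inter> Y = bd K s p Y" by (rule good_comp_inter[OF *])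
  show "bd K s p (X \<union> Y) = bd K s p X" by (rule good_comp_bd[OF *])
  show "p < q \<Longrightarrow> bd K s' q (X \<union> Y) = bd K s' q X \<union> bd K s' q Y" by (rule good_comp_bd_high[OF *])
  show "q < p \<Longrightarrow> bd K s' q (X \<union> Y) = bd K s' q X" by (rule good_comp_bd_low(1)[OF *])
next
  fix X s s' q p assume X: "X \<in> cells K"
  show "q < (p::nat) \<Longrightarrow> bd K s q (bd K s' p X) = bd K s q X" by (rule good_bd_bd[OF cells_good[OF X]])
  show "X \<subseteq> faces K" by (rule good_faces[OF cells_good[OF X]])
  show "down K X" by (rule good_down[OF cells_good[OF X]])
qed (auto intro: sub_faces sub_refl)

end

section \<open>Cubes\<close>

definition zs :: "sign list \<Rightarrow> nat set" where
  "zs k = {j. j < length k \<and> k ! j = Zero}"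

text \<open>The letter that \<open>s_x\<close> (for \<open>True\<close>) or \<open>t_x\<close> (for
  \<open>False\<close>) puts at a zero preceded by \<open>i\<close> others. Counting starts at 0
  here, which shifts the parity with respect to \<open>alt_sign\<close>.\<close>

definition bsgn :: "bool \<Rightarrow> nat \<Rightarrow> sign" where
  "bsgn s i = (if even i = s then Neg else Pos)"

lemma bsgn_Zero [simp]: "bsgn s i \<noteq> Zero" "Zero \<noteq> bsgn s i"
  by (auto simp: bsgn_def)

lemma zs_less: "j \<in> zs k \<Longrightarrow> j < length k" and zs_Zero: "j \<in> zs k \<Longrightarrow> k ! j = Zero"
  by (auto simp: zs_def)

lemma zs_subset: "zs k \<subseteq> {..<length k}"
  by (auto simp: zs_def)

lemma finite_zs [simp]: "finite (zs k)"
  by (rule finite_subset[OF zs_subset]) simp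

lemma Cube_faces [simp]: "faces (Cube n) = {k. length k = n}"
  by (simp add: Cube_def)

lemma Cube_fdim [simp]: "fdim (Cube n) k = card (zs k)"
  by (simp add: Cube_def zs_def count_list_eq_length_filter length_filter_conv_card eq_commute)

lemma Cube_sub: "l \<in> sub (Cube n) k \<longleftrightarrow> length l = length k \<and> (\<forall>j<length k. k ! j = Zero \<or> l ! j = k ! j)"
  by (auto simp: Cube_def list_all2_conv_all_nth)

lemma zero_rank_pos: "j \<in> zs k \<Longrightarrow> zero_rank k j = Suc (pos (zs k) j)"
proof -
  assume j: "j \<in> zs k"
  have "{l. l \<le> j \<and> k ! l = Zero} = insert j {y \<in> zs k. y < j}"
    using j by (auto simp: zs_def)
  then show ?thesis by (simp add: zero_rank_def pos_def)
qed

lemma alt_sign_bsgn: "alt_sign (Suc i) = bsgn True i" "alt_sign (Suc (Suc i)) = bsgn False i"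
  by (auto simp: alt_sign_def bsgn_def)

lemma Cube_fbd: "fbd (Cube n) s k = {k[j := bsgn s (pos (zs k) j)] |j. j \<in> zs k}"
proof (cases s)
  case True
  have "alt_sign (zero_rank k j) = bsgn s (pos (zs k) j)" if "j \<in> zs k" for j
    using True zero_rank_pos[OF that] alt_sign_bsgn by simp
  then have "{k[j := alt_sign (zero_rank k j)] |j. j \<in> zs k} = {k[j := bsgn s (pos (zs k) j)] |j. j \<in> zs k}"
    by force
  then show ?thesis using True by (simp add: fbd_def Cube_def zs_def)
next
  case False
  have "alt_sign (Suc (zero_rank k j)) = bsgn s (pos (zs k) j)" if "j \<in> zs k" for j
    using False zero_rank_pos[OF that] alt_sign_bsgn by simp
  then have "{k[j := alt_sign (Suc (zero_rank k j))] |j. j \<in> zs k} = {k[j := bsgn s (pos (zs k) j)] |j. j \<in> zs k}"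
    by force
  then show ?thesis using False by (simp add: fbd_def Cube_def zs_def)
qed

lemma Cube_Sub_fbd:
  assumes "a \<in> sub (Cube n) b"
  shows "a \<in> Sub (Cube n) (fbd (Cube n) s b) \<longleftrightarrow> (\<exists>j\<in>zs b. a ! j = bsgn s (pos (zs b) j))"
proof
  assume "a \<in> Sub (Cube n) (fbd (Cube n) s b)"
  then obtain j where j: "j \<in> zs b" "a \<in> sub (Cube n) (b[j := bsgn s (pos (zs b) j)])"
    by (auto simp: Sub_def Cube_fbd)
  then have "a ! j = bsgn s (pos (zs b) j)" using zs_less[of j b] by (auto simp: Cube_sub)
  then show "\<exists>j\<in>zs b. a ! j = bsgn s (pos (zs b) j)" using j by auto
next
  assume "\<exists>j\<in>zs b. a ! j = bsgn s (pos (zs b) j)"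
  then obtain j where j: "j \<in> zs b" "a ! j = bsgn s (pos (zs b) j)" by auto
  then have "a \<in> sub (Cube n) (b[j := bsgn s (pos (zs b) j)])"
    using assms zs_less[OF j(1)] by (force simp: Cube_sub nth_list_update)
  then show "a \<in> Sub (Cube n) (fbd (Cube n) s b)" using j by (auto simp: Sub_def Cube_fbd)
qed

lemma zs_mono: "a \<in> sub (Cube n) b \<Longrightarrow> zs a \<subseteq> zs b"
  by (auto simp: Cube_sub zs_def)

section \<open>Realisation of the faces of a cube by boxes\<close>

definition fills :: "sign \<Rightarrow> real \<Rightarrow> bool" where
  "fills c v \<longleftrightarrow> (case c of Neg \<Rightarrow> v = 0 | Zero \<Rightarrow> 0 \<le> v \<and> v \<le> 1 | Pos \<Rightarrow> v = 1)"

definition fills_inn :: "sign \<Rightarrow> real \<Rightarrow> bool" where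
  "fills_inn c v \<longleftrightarrow> (case c of Neg \<Rightarrow> v = 0 | Zero \<Rightarrow> 0 < v \<and> v < 1 | Pos \<Rightarrow> v = 1)"

text \<open>Points are functions on all naturals, equal to 0 beyond the word: equality of points is
  then equality of functions, and compactness is that of a product.\<close>

definition cube_cl :: "sign list \<Rightarrow> (nat \<Rightarrow> real) set" where
  "cube_cl k = {x. \<forall>i. if i < length k then fills (k ! i) (x i) else x i = 0}"

definition cube_inn :: "sign list \<Rightarrow> (nat \<Rightarrow> real) set" where
  "cube_inn k = {x. \<forall>i. if i < length k then fills_inn (k ! i) (x i) else x i = 0}"

lemma fills_convex: "fills c u \<Longrightarrow> fills c v \<Longrightarrow> 0 \<le> t \<Longrightarrow> t \<le> 1 \<Longrightarrow> fills c ((1 - t) * u + t * v)"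
proof -
  assume a: "fills c u" "fills c v" "0 \<le> t" "t \<le> 1"
  have "0 \<le> (1 - t) * u + t * v \<and> (1 - t) * u + t * v \<le> 1" if "0 \<le> u" "u \<le> 1" "0 \<le> v" "v \<le> 1"
    using that a convex_bound_le[of u 1 v "1 - t" t] by auto
  then show ?thesis using a by (auto simp: fills_def split: sign.splits)
qed

lemma fills_inn_convex: "fills c u \<Longrightarrow> fills_inn c v \<Longrightarrow> 0 < t \<Longrightarrow> t \<le> 1 \<Longrightarrow> fills_inn c ((1 - t) * u + t * v)"
proof -
  assume a: "fills c u" "fills_inn c v" "0 < t" "t \<le> 1"
  have "0 < (1 - t) * u + t * v \<and> (1 - t) * u + t * v < 1" if "0 \<le> u" "u \<le> 1" "0 < v" "v < 1"
  proof -
    have "(1 - t) * u \<ge> 0" "t * v > 0" "(1 - t) * u \<le> 1 - t" "t * v < t"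
      using that a by (auto intro: mult_left_le)
    then show ?thesis by simp
  qed
  then show ?thesis using a by (auto simp: fills_def fills_inn_def split: sign.splits)
qed

lemma cube_compact: "compact (cube_cl k)"
proof -
  have "cube_cl k = Pi\<^sub>E UNIV (\<lambda>i. if i < length k then {v. fills (k ! i) v} else {0})"
  proof (intro set_eqI)
    fix x
    have "(if i < length k then fills (k ! i) (x i) else x i = 0) \<longleftrightarrow>
      x i \<in> (if i < length k then {v. fills (k ! i) v} else {0})" for i by simp
    then show "x \<in> cube_cl k \<longleftrightarrow> x \<in> Pi\<^sub>E UNIV (\<lambda>i. if i < length k then {v. fills (k ! i) v} else {0})"
      unfolding cube_cl_def PiE_iff by simp
  qed
  moreover have "compact {v. fills c v}" for c
  proof -
    have "{v. fills c v} = (case c of Neg \<Rightarrow> {0} | Zero \<Rightarrow> {0..1} | Pos \<Rightarrow> {1})"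
      by (auto simp: fills_def split: sign.splits)
    then show ?thesis by (auto split: sign.splits)
  qed
  then have "compactin (product_topology (\<lambda>i. euclidean) UNIV)
      (Pi\<^sub>E UNIV (\<lambda>i. if i < length k then {v. fills (k ! i) v} else {0::real}))"
    unfolding compactin_PiE by (auto simp: compactin_euclidean_iff)
  ultimately show ?thesis by (simp add: euclidean_product_topology)
qed

text \<open>\<open>Z\<close> is alternating for \<open>c\<close> if moving against the signs of a circuit supported on \<open>Z\<close> does not leave
  the cube at \<open>c\<close>.\<close>

definition alternating :: "bool \<Rightarrow> sign list \<Rightarrow> nat set \<Rightarrow> bool" where
  "alternating s c Z \<longleftrightarrow> (\<forall>z\<in>Z. c ! z \<noteq> bsgn s (pos Z z))"

lemma not_Sub_fbd:
  "c \<in> sub (Cube n) b \<Longrightarrow> c \<notin> Sub (Cube n) (fbd (Cube n) s b) \<longleftrightarrow> alternating s c (zs b)"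
  by (auto simp: Cube_Sub_fbd alternating_def)

text \<open>\<open>exchange\<close> replaces elements of \<open>Z\<close> until all zeros of
  \<open>c\<close> belong to it; the result is the set of zeros of a face between \<open>c\<close>
  and \<open>e\<close>.\<close>

lemma alternating_extend:
  assumes c: "c \<in> sub (Cube n) e" and Z: "Z \<subseteq> zs e" "card (zs c) \<le> card Z" and alt: "alternating s c Z"
  shows "\<exists>b\<in>sub (Cube n) e. card (zs b) = card Z \<and> c \<in> sub (Cube n) b \<and> alternating s c (zs b)"
proof -
  have "\<exists>B. zs c \<subseteq> B \<and> B \<subseteq> zs c \<union> Z \<and> card B = card Z \<and>
      (\<forall>z\<in>B - zs c. c ! z \<noteq> bsgn s (if even (pos B z) then 0 else 1))"
  proof (rule exchange)
    show "finite Z" using Z(1) finite_zs by (rule finite_subset)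
    show "\<forall>z\<in>Z - zs c. c ! z \<noteq> bsgn s (if even (pos Z z) then 0 else 1)"
      using alt by (auto simp: alternating_def bsgn_def)
  qed (use Z in auto)
  then obtain B where B: "zs c \<subseteq> B" "B \<subseteq> zs c \<union> Z" "card B = card Z"
    "\<forall>z\<in>B - zs c. c ! z \<noteq> bsgn s (if even (pos B z) then 0 else 1)" by (elim exE conjE)
  have Be: "B \<subseteq> zs e" using B(2) Z(1) zs_mono[OF c] by auto
  have len: "length c = length e" using c by (simp add: Cube_sub)
  define b where "b = map (\<lambda>i. if i \<in> B then Zero else c ! i) [0..<length c]"
  have "B \<subseteq> {..<length c}" using Be zs_subset[of e] len by auto
  moreover have "\<And>i. i < length c \<Longrightarrow> c ! i = Zero \<Longrightarrow> i \<in> B" using B(1) by (auto simp: zs_def)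
  ultimately have zb: "zs b = B" unfolding b_def zs_def by (auto split: if_splits)
  have "b \<in> sub (Cube n) e" using c Be zs_Zero[of _ e] len by (auto simp: Cube_sub b_def)
  moreover have "c \<in> sub (Cube n) b" by (auto simp: Cube_sub b_def)
  moreover have "alternating s c (zs b)"
    unfolding alternating_def zb
  proof
    fix z assume z: "z \<in> B"
    show "c ! z \<noteq> bsgn s (pos B z)"
    proof (cases "z \<in> zs c")
      case True then show ?thesis using zs_Zero by auto
    next
      case False then show ?thesis using B(4) z by (auto simp: bsgn_def split: if_splits)
    qed
  qed
  ultimately show ?thesis using zb B(3) by auto
qed

text \<open>The quantifier over faces between \<open>c\<close> and \<open>e\<close> becomes one over
  subsets of the zeros of \<open>e\<close>, which may miss zeros of \<open>c\<close>. The bound on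
  the dimension is absorbed, since any p + 1 zeros of \<open>c\<close> form an alternating set. Most
  later computations of boundaries of cubes rest on this form.\<close>

lemma cube_bd_atom:
  assumes e: "length e = n"
  shows "c \<in> bd (Cube n) s p (sub (Cube n) e) \<longleftrightarrow>
    c \<in> sub (Cube n) e \<and> (\<forall>Z\<subseteq>zs e. card Z = Suc p \<longrightarrow> \<not> alternating s c Z)"
proof (intro iffI conjI allI impI notI)
  assume c: "c \<in> bd (Cube n) s p (sub (Cube n) e)"
  then show c': "c \<in> sub (Cube n) e" by (simp add: bd_iff)
  fix Z assume Z: "Z \<subseteq> zs e" "card Z = Suc p" "alternating s c Z"
  have "card (zs c) \<le> card Z" using c Z by (simp add: bd_iff)
  then obtain b where "b \<in> sub (Cube n) e" "card (zs b) = Suc p" "c \<in> sub (Cube n) b" "alternating s c (zs b)"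
    using alternating_extend[OF c' Z(1) _ Z(3)] Z(2) by auto
  moreover from this have "c \<notin> Sub (Cube n) (fbd (Cube n) s b)" by (simp add: not_Sub_fbd)
  ultimately show False using c by (auto simp: bd_iff)
next
  assume c: "c \<in> sub (Cube n) e \<and> (\<forall>Z\<subseteq>zs e. card Z = Suc p \<longrightarrow> \<not> alternating s c Z)"
  have "card (zs c) \<le> p"
  proof (rule ccontr)
    assume "\<not> ?thesis"
    then obtain Z where Z: "Z \<subseteq> zs c" "card Z = Suc p" by (metis not_less_eq_eq obtain_subset_with_card_n)
    moreover have "alternating s c Z" using Z(1) zs_Zero by (auto simp: alternating_def)
    ultimately show False using c zs_mono by blast
  qed
  moreover have "c \<in> Sub (Cube n) (fbd (Cube n) s b)"
    if b: "b \<in> sub (Cube n) e" "card (zs b) = Suc p" "c \<in> sub (Cube n) b" for b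
    using c b zs_mono[OF b(1)] not_Sub_fbd[OF b(3)] by blast
  ultimately show "c \<in> bd (Cube n) s p (sub (Cube n) e)" using c by (auto simp: bd_iff)
qed

lemma small_move:
  assumes "finite B" and "\<forall>z\<in>B. if d z < 0 then x z > 0 else x z < (1::real)" and "\<forall>z\<in>B. 0 \<le> x z \<and> x z \<le> 1"
  shows "\<exists>t>0. \<forall>z\<in>B. 0 \<le> x z + t * d z \<and> x z + t * d z \<le> 1"
  using assms
proof (induction B rule: finite_induct)
  case empty then show ?case by (intro exI[of _ 1]) auto
next
  case (insert b B)
  then obtain t where t: "t > 0" "\<forall>z\<in>B. 0 \<le> x z + t * d z \<and> x z + t * d z \<le> 1" by auto
  have shrink: "0 \<le> x z + u * d z \<and> x z + u * d z \<le> 1"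
    if "0 \<le> x z + t * d z \<and> x z + t * d z \<le> 1" "0 \<le> x z \<and> x z \<le> 1" "0 \<le> u" "u \<le> t" "t > 0" for z u t
  proof (cases "d z \<ge> 0")
    case True
    then have "u * d z \<le> t * d z" "u * d z \<ge> 0" using that by (auto intro: mult_right_mono)
    then show ?thesis using that by linarith
  next
    case False
    then have "u * d z \<ge> t * d z" "u * d z \<le> 0" using that by (auto intro: mult_right_mono_neg mult_nonneg_nonpos)
    then show ?thesis using that by linarith
  qed
  obtain v where v: "v > 0" "0 \<le> x b + v * d b \<and> x b + v * d b \<le> 1"
  proof (cases "d b < 0")
    case True
    then have "x b + (x b / - d b) * d b = 0" by (simp add: field_simps)
    then show ?thesis using that[of "x b / - d b"] True insert.prems by (auto simp: divide_pos_neg)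
  next
    case False
    show ?thesis
    proof (cases "d b = 0")
      case True then show ?thesis using that[of 1] insert.prems by auto
    next
      case False
      then have "x b + ((1 - x b) / d b) * d b = 1" by (simp add: field_simps)
      then show ?thesis using that[of "(1 - x b) / d b"] False \<open>\<not> d b < 0\<close> insert.prems by auto
    qed
  qed
  define u where "u = min t v"
  have "0 \<le> x z + u * d z \<and> x z + u * d z \<le> 1" if "z \<in> insert b B" for z
  proof (cases "z = b")
    case True then show ?thesis using shrink[of z v u] v t insert.prems by (auto simp: u_def)
  next
    case False then show ?thesis using shrink[of z t u] t v insert.prems that by (auto simp: u_def)
  qed
  then show ?case using t v by (intro exI[of _ u]) (auto simp: u_def)
qed

text \<open>A move along the circuit on \<open>B\<close> keeps the moments of order below
  \<open>q\<close>, and alternation says that at every coordinate of \<open>B\<close> it points into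
  the cube.\<close>

lemma cube_descend:
  assumes b: "c \<in> sub (Cube n) b" "length b = n" and B: "B \<subseteq> zs b" "card B = Suc q" and alt: "alternating s c B" and x: "x \<in> cube_inn c"
  shows "\<exists>y\<in>cube_cl b. same n q y x \<and> below s (mom n q y) (mom n q x)"
proof -
  have Bn: "B \<subseteq> {..<n}" using zs_subset[of b] B b by auto
  obtain d0 where d0: "\<forall>i. i \<notin> B \<longrightarrow> d0 i = 0" "\<forall>k<q. mom n k d0 = 0" "mom n q d0 < 0"
     "\<forall>z\<in>B. alt_neg (even (pos B z)) (d0 z)"
    using alternating_circuit[OF Bn B(2)] by blast
  \<comment> \<open>Negating the circuit exchanges lowest and highest, hence sources and
    targets.\<close>
  define d where "d i = (if s then d0 i else - d0 i)" for i
  have md: "mom n k d = (if s then mom n k d0 else - mom n k d0)" for k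
    using mom_linear[of n k "-1" d0 0 d0] by (auto simp: d_def[abs_def])
  have d: "\<forall>i. i \<notin> B \<longrightarrow> d i = 0" "\<forall>k<q. mom n k d = 0" "below s (mom n q d) 0"
     "\<forall>z\<in>B. alt_neg (even (pos B z) = s) (d z)"
    using d0 md by (auto simp: d_def below_def alt_neg_def)
  have len: "length c = n" using b by (simp add: Cube_sub)
  have x01: "0 \<le> x z \<and> x z \<le> 1" for z
  proof -
    have "if z < n then fills_inn (c ! z) (x z) else x z = 0" using x len by (simp add: cube_inn_def)
    then show ?thesis by (auto simp: fills_inn_def split: if_splits sign.splits)
  qed
  have "\<forall>z\<in>B. if d z < 0 then x z > 0 else x z < 1"
  proof
    fix z assume z: "z \<in> B"
    then have "c ! z \<noteq> bsgn s (pos B z)" "fills_inn (c ! z) (x z)"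
      using alt x Bn len by (auto simp: alternating_def cube_inn_def)
    then show "if d z < 0 then x z > 0 else x z < 1"
      using d(4) z by (cases "c ! z") (auto simp: bsgn_def fills_inn_def alt_neg_def split: if_splits)
  qed
  then obtain t where t: "t > 0" "\<forall>z\<in>B. 0 \<le> x z + t * d z \<and> x z + t * d z \<le> 1"
    using small_move[of B d x] x01 B finite_subset[OF B(1)] by auto
  define y where "y i = 1 * x i + t * d i" for i
  have my: "mom n k y = mom n k x + t * mom n k d" for k
    unfolding y_def[abs_def] mom_linear by simp
  have "y \<in> cube_cl b"
    unfolding cube_cl_def
  proof (intro CollectI allI)
    fix i
    show "if i < length b then fills (b ! i) (y i) else y i = 0"
    proof (cases "i \<in> B")
      case True
      then have "b ! i = Zero" "i < length b" using B by (auto simp: zs_def)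
      then show ?thesis using t True by (auto simp: fills_def y_def)
    next
      case False
      then have "y i = x i" using d by (simp add: y_def)
      moreover have "if i < length b then fills_inn (c ! i) (x i) else x i = 0"
        using x len b by (auto simp: cube_inn_def)
      ultimately show ?thesis using b(1) x01[of i]
        by (auto simp: Cube_sub fills_def fills_inn_def split: sign.splits)
    qed
  qed
  moreover have "same n q y x" using d(2) my by (simp add: same_def)
  moreover have "below s (mom n q y) (mom n q x)" using d(3) my t(1)
    by (auto simp: below_def mult_less_0_iff split: if_splits)
  ultimately show ?thesis by blast
qed

text \<open>\<open>sign_alternation\<close> applies to the difference of the two points, and the
  sign of an entry excludes one letter of \<open>c\<close>: a coordinate that can decrease is not at
  \<open>-\<close>, one that can increase is not at \<open>+\<close>.\<close>

lemma cube_extend: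
  assumes e: "length e = n" "c \<in> sub (Cube n) e" "card (zs c) \<le> q" and x: "x \<in> cube_inn c" and y: "y \<in> cube_cl e"
    and sm: "same n q y x" "y \<noteq> x" "\<not> below s (mom n q x) (mom n q y)"
  shows "\<exists>b\<in>sub (Cube n) e. card (zs b) = Suc q \<and> c \<in> sub (Cube n) b \<and> alternating s c (zs b)"
proof -
  have len: "length c = n" using e by (simp add: Cube_sub)
  define d where "d i = (if s then y i - x i else x i - y i)" for i
  have md: "mom n k d = (if s then mom n k y - mom n k x else mom n k x - mom n k y)" for k
    by (auto simp: d_def[abs_def] mom_diff)
  have "\<forall>k<q. mom n k d = 0" using sm by (auto simp: md same_def)
  moreover have "mom n q d \<le> 0" using sm(3) by (auto simp: md below_def split: if_splits)
  moreover have "\<exists>i<n. d i \<noteq> 0"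
  proof -
    obtain i where i: "y i \<noteq> x i" using sm(2) by auto
    have "i < n"
    proof (rule ccontr)
      assume "\<not> i < n"
      then have "x i = 0" "y i = 0" using x y e len by (simp_all add: cube_inn_def cube_cl_def)
      then show False using i by simp
    qed
    then show ?thesis using i by (auto simp: d_def)
  qed
  ultimately have "\<exists>Z\<subseteq>{..<n}. card Z = Suc q \<and> (\<forall>z\<in>Z. alt_neg (even (pos Z z)) (d z))"
    by (rule sign_alternation)
  then obtain Z where Z: "Z \<subseteq> {..<n}" "card Z = Suc q" "\<forall>z\<in>Z. alt_neg (even (pos Z z)) (d z)"
    by (elim exE conjE)
  have at: "z \<in> zs e \<and> c ! z \<noteq> bsgn s (pos Z z)" if z: "z \<in> Z" for z
  proof -
    have zn: "z < n" using z Z by auto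
    have f: "fills_inn (c ! z) (x z)" "fills (e ! z) (y z)" "e ! z = Zero \<or> c ! z = e ! z"
      using x y e zn len by (auto simp: cube_inn_def cube_cl_def Cube_sub)
    have a: "alt_neg (even (pos Z z)) (d z)" using Z(3) z by blast
    then have "e ! z = Zero"
      using f by (cases "e ! z") (auto simp: fills_def fills_inn_def alt_neg_def d_def split: if_splits)
    moreover have "0 \<le> y z \<and> y z \<le> 1" using f \<open>e ! z = Zero\<close> by (auto simp: fills_def)
    then have "c ! z \<noteq> bsgn s (pos Z z)"
      using f(1) a by (cases "c ! z") (auto simp: fills_inn_def alt_neg_def d_def bsgn_def split: if_splits)
    ultimately show ?thesis using zn e by (simp add: zs_def)
  qed
  then have "Z \<subseteq> zs e" "alternating s c Z" by (auto simp: alternating_def)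
  then show ?thesis using alternating_extend[OF e(2) _ _, of Z s] e(3) Z(2) by auto
qed

lemma cube_carrier:
  assumes "length a = n" "x \<in> cube_cl a"
  shows "\<exists>c\<in>sub (Cube n) a. x \<in> cube_inn c"
proof -
  define c where "c = map (\<lambda>i. if x i = 0 then Neg else if x i = 1 then Pos else Zero) [0..<n]"
  have "x \<in> cube_inn c"
    using assms by (auto simp: cube_inn_def cube_cl_def fills_def fills_inn_def c_def split: sign.splits if_splits)
      (metis order_less_le sign.exhaust)+
  moreover have "c \<in> sub (Cube n) a"
    unfolding Cube_sub
  proof (intro conjI allI impI)
    show "length c = length a" using assms by (simp add: c_def)
    fix j assume j: "j < length a"
    then have "fills (a ! j) (x j)" using assms by (auto simp: cube_cl_def)
    then show "a ! j = Zero \<or> c ! j = a ! j"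
      using j assms by (cases "a ! j") (auto simp: fills_def c_def)
  qed
  ultimately show ?thesis by blast
qed

lemma cube_inn_sub:
  assumes "length c = n" "length e = n" "x \<in> cube_inn c" "x \<in> cube_cl e"
  shows "c \<in> sub (Cube n) e"
  unfolding Cube_sub
proof (intro conjI allI impI)
  fix j assume j: "j < length e"
  then have "fills (e ! j) (x j)" "fills_inn (c ! j) (x j)" using assms by (auto simp: cube_cl_def cube_inn_def)
  then show "e ! j = Zero \<or> c ! j = e ! j" by (auto simp: fills_def fills_inn_def split: sign.splits)
qed (use assms in simp)

lemma fills_inn_fills: "fills_inn c v \<Longrightarrow> fills c v"
  by (auto simp: fills_def fills_inn_def split: sign.splits)

text \<open>Here \<open>sh\<close> is 0: the boundary of order p is governed by the moment of order
  p itself.\<close>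

interpretation cube: polytope_geometry "Cube n" n 0 cube_cl cube_inn for n
proof
  show "finite (faces (Cube n))"
    using finite_lists_length_eq[of "{Neg, Zero, Pos}" n]
    by (rule rev_finite_subset) (auto, metis sign.exhaust)
next
  fix a :: "sign list" assume a: "a \<in> faces (Cube n)"
  show "\<exists>x. x \<in> cube_inn a"
    by (rule exI[of _ "\<lambda>i. if i < length a then (case a ! i of Neg \<Rightarrow> 0 | Zero \<Rightarrow> 1/2 | Pos \<Rightarrow> 1) else 0"])
      (auto simp: cube_inn_def fills_inn_def split: sign.splits)
  show "a \<in> sub (Cube n) a" by (simp add: Cube_sub)
  show "compact (cube_cl a)" by (rule cube_compact)
  fix b assume b: "b \<in> sub (Cube n) a"
  show "b \<in> faces (Cube n)" using a b by (simp add: Cube_sub)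
  show "c \<in> sub (Cube n) b \<Longrightarrow> c \<in> sub (Cube n) a" for c using b by (simp add: Cube_sub) metis
next
  fix a x assume a: "a \<in> faces (Cube n)"
  show "x \<in> cube_inn a \<Longrightarrow> x \<in> cube_cl a"
    by (auto simp: cube_inn_def cube_cl_def intro: fills_inn_fills)
  show "x \<in> cube_cl a \<Longrightarrow> \<exists>c\<in>sub (Cube n) a. x \<in> cube_inn c" using a cube_carrier by auto
  show "x \<in> cube_cl a \<Longrightarrow> y \<in> cube_cl a \<Longrightarrow> 0 \<le> t \<Longrightarrow> t \<le> 1 \<Longrightarrow> seg t x y \<in> cube_cl a" for y t
    by (auto simp: cube_cl_def seg_def intro: fills_convex)
  show "x \<in> cube_cl a \<Longrightarrow> y \<in> cube_inn a \<Longrightarrow> 0 < t \<Longrightarrow> t \<le> 1 \<Longrightarrow> seg t x y \<in> cube_inn a" for y t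
    by (auto simp: cube_cl_def cube_inn_def seg_def intro: fills_inn_convex)
next
  fix c e x assume "c \<in> faces (Cube n)" "e \<in> faces (Cube n)" "x \<in> cube_inn c" "x \<in> cube_cl e"
  then show "c \<in> sub (Cube n) e" using cube_inn_sub by auto
next
  fix e c assume e: "e \<in> faces (Cube n)" "c \<in> sub (Cube n) e"
  have "fills (e ! i) v" if "fills (c ! i) v" "i < length e" for i v
  proof -
    have "e ! i = Zero \<or> c ! i = e ! i" using e that by (auto simp: Cube_sub)
    then show ?thesis using that by (auto simp: fills_def split: sign.splits)
  qed
  then show "cube_cl c \<subseteq> cube_cl e" using e by (auto simp: cube_cl_def Cube_sub)
next
  fix b p c s x
  assume "b \<in> faces (Cube n)" "fdim (Cube n) b = Suc p" "c \<in> sub (Cube n) b"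
    "c \<notin> Sub (Cube n) (fbd (Cube n) s b)" "x \<in> cube_inn c"
  then show "\<exists>y\<in>cube_cl b. same n (p + 0) y x \<and> below s (mom n (p + 0) y) (mom n (p + 0) x)"
    using cube_descend[of c n b "zs b" p s x] not_Sub_fbd by auto
next
  fix c p x s assume c: "c \<in> faces (Cube n)" "p < fdim (Cube n) c" "x \<in> cube_inn c"
  then obtain B where B: "B \<subseteq> zs c" "card B = Suc p"
    by (metis Cube_fdim Suc_leI obtain_subset_with_card_n)
  moreover have "alternating s c B" using B(1) zs_Zero by (auto simp: alternating_def)
  ultimately show "\<exists>y\<in>cube_cl c. same n (p + 0) y x \<and> below s (mom n (p + 0) y) (mom n (p + 0) x)"
    using cube_descend[of c n c B p s x] c by (auto simp: Cube_sub)
next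
  fix e c p x y s
  assume "e \<in> faces (Cube n)" "c \<in> sub (Cube n) e" "fdim (Cube n) c \<le> p" "x \<in> cube_inn c" "y \<in> cube_cl e"
    "same n (p + 0) y x" "y \<noteq> x" "\<not> below s (mom n (p + 0) x) (mom n (p + 0) y)"
  then show "\<exists>b\<in>sub (Cube n) e. fdim (Cube n) b = Suc p \<and> c \<in> sub (Cube n) b \<and> c \<notin> Sub (Cube n) (fbd (Cube n) s b)"
    using cube_extend[of e n c p x y s] not_Sub_fbd by fastforce
qed

section \<open>Simplices\<close>

lemma Delta_faces [simp]: "faces (Delta n) = {\<sigma>. \<sigma> \<subseteq> {0..n} \<and> \<sigma> \<noteq> {}}"
  and Delta_fdim [simp]: "fdim (Delta n) \<sigma> = card \<sigma> - 1"
  and Delta_sub [simp]: "sub (Delta n) \<sigma> = {\<tau>. \<tau> \<subseteq> \<sigma> \<and> \<tau> \<noteq> {}}"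
  by (simp_all add: Delta_def)

lemma pos_in_pos: "finite \<sigma> \<Longrightarrow> v \<in> \<sigma> \<Longrightarrow> pos_in v \<sigma> = Suc (pos \<sigma> v)"
proof -
  assume a: "finite \<sigma>" "v \<in> \<sigma>"
  have "{u \<in> \<sigma>. u \<le> v} = insert v {y \<in> \<sigma>. y < v}" using a by auto
  then show ?thesis using a by (simp add: pos_in_def pos_def)
qed

lemma Delta_Sub_fbd:
  assumes "finite \<sigma>" "\<tau> \<subseteq> \<sigma>" "\<tau> \<noteq> {}"
  shows "\<tau> \<in> Sub (Delta n) (fbd (Delta n) s \<sigma>) \<longleftrightarrow> (\<exists>v\<in>\<sigma> - \<tau>. even (pos \<sigma> v) = s)"
proof -
  have "fbd (Delta n) s \<sigma> = {\<sigma> - {v} |v. v \<in> \<sigma> \<and> odd (pos_in v \<sigma>) = s}"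
    by (auto simp: fbd_def Delta_def)
  then have "\<tau> \<in> Sub (Delta n) (fbd (Delta n) s \<sigma>) \<longleftrightarrow> (\<exists>v\<in>\<sigma>. odd (pos_in v \<sigma>) = s \<and> \<tau> \<subseteq> \<sigma> - {v})"
    using assms unfolding Sub_def by simp blast
  also have "\<dots> \<longleftrightarrow> (\<exists>v\<in>\<sigma> - \<tau>. even (pos \<sigma> v) = s)"
    using assms pos_in_pos[OF assms(1)] by auto
  finally show ?thesis .
qed

text \<open>The faces of a cube through the vertex \<open>-...-\<close> correspond to sets of
  positions, the vertex itself to the empty set.\<close>

definition word :: "nat \<Rightarrow> nat set \<Rightarrow> sign list" where
  "word m \<sigma> = map (\<lambda>i. if i \<in> \<sigma> then Zero else Neg) [0..<m]"

lemma length_word [simp]: "length (word m \<sigma>) = m"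
  and nth_word [simp]: "i < m \<Longrightarrow> word m \<sigma> ! i = (if i \<in> \<sigma> then Zero else Neg)"
  and Pos_word [simp]: "Pos \<notin> set (word m \<sigma>)"
  by (auto simp: word_def)

lemma zs_word: "\<sigma> \<subseteq> {..<m} \<Longrightarrow> zs (word m \<sigma>) = \<sigma>"
  by (auto simp: zs_def split: if_splits)

lemma word_zs: "length k = m \<Longrightarrow> Pos \<notin> set k \<Longrightarrow> word m (zs k) = k"
  by (rule nth_equalityI) (auto simp: zs_def, metis nth_mem sign.exhaust)

lemma Pos_sub: "a \<in> sub (Cube m) b \<Longrightarrow> Pos \<in> set b \<Longrightarrow> Pos \<in> set a"
  unfolding Cube_sub by (metis in_set_conv_nth sign.distinct(6))

lemma sub_no_Pos:
  assumes "length a = length b" "Pos \<notin> set a" "Pos \<notin> set b"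
  shows "a \<in> sub (Cube m) b \<longleftrightarrow> zs a \<subseteq> zs b"
proof
  assume "zs a \<subseteq> zs b"
  have "b ! j = Zero \<or> a ! j = b ! j" if "j < length b" for j
  proof (cases "a ! j")
    case Zero then show ?thesis using \<open>zs a \<subseteq> zs b\<close> that assms by (auto simp: zs_def)
  next
    case Neg
    then show ?thesis using that assms(3) by (metis nth_mem sign.exhaust)
  next
    case Pos then show ?thesis using that assms by (metis nth_mem)
  qed
  then show "a \<in> sub (Cube m) b" using assms by (simp add: Cube_sub)
qed (rule zs_mono)

text \<open>Without a \<open>+\<close>, the only way to shrink \<open>b\<close> is to turn zeros
  into \<open>-\<close>, and the parity rule for doing so is the one for removing entries from the
  set of zeros. So sources and targets correspond with the same Boolean.\<close>

lemma Sub_fbd_no_Pos: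
  assumes "a \<in> sub (Cube m) b" "Pos \<notin> set a" "zs a \<noteq> {}"
  shows "a \<in> Sub (Cube m) (fbd (Cube m) s b) \<longleftrightarrow> zs a \<in> Sub (Delta n) (fbd (Delta n) s (zs b))"
proof -
  have "a ! j = bsgn s (pos (zs b) j) \<longleftrightarrow> j \<notin> zs a \<and> even (pos (zs b) j) = s" if "j \<in> zs b" for j
  proof -
    have "j < length a" using that zs_less[of j b] assms(1) by (simp add: Cube_sub)
    then have "a ! j \<noteq> Pos" "j \<notin> zs a \<longleftrightarrow> a ! j \<noteq> Zero"
      using assms(2) nth_mem[of j a] by (metis, auto simp: zs_def)
    then show ?thesis by (cases "a ! j") (auto simp: bsgn_def)
  qed
  then show ?thesis
    using Delta_Sub_fbd[OF finite_zs zs_mono[OF assms(1)] assms(3), of n s] Cube_Sub_fbd[OF assms(1), of s] by auto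
qed

text \<open>The moment of order 0 is the sum of the coordinates. Any value strictly between 0 and 1
  would do in place of 1/2: the slice then misses the vertex \<open>-...-\<close> and all faces with
  a letter \<open>+\<close>.\<close>

definition simplex_cl :: "nat \<Rightarrow> nat set \<Rightarrow> (nat \<Rightarrow> real) set" where
  "simplex_cl n \<sigma> = {x \<in> cube_cl (word (Suc n) \<sigma>). mom (Suc n) 0 x = 1/2}"

definition simplex_inn :: "nat \<Rightarrow> nat set \<Rightarrow> (nat \<Rightarrow> real) set" where
  "simplex_inn n \<sigma> = {x \<in> cube_inn (word (Suc n) \<sigma>). mom (Suc n) 0 x = 1/2}"

text \<open>\<open>\<Delta>\<^sup>n\<close> is realised as the vertex figure of \<open>I\<^sup>n\<^sup>+\<^sup>1\<close> at the vertex all of whose letters are \<open>-\<close>.\<close>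

lemma simplex_face_word:
  assumes "\<sigma> \<subseteq> {0..n}" "\<sigma> \<noteq> {}"
  shows "zs (word (Suc n) \<sigma>) = \<sigma>" "finite \<sigma>" "card \<sigma> = Suc (fdim (Delta n) \<sigma>)"
proof -
  show "zs (word (Suc n) \<sigma>) = \<sigma>" using assms(1) by (intro zs_word) auto
  show "finite \<sigma>" using assms(1) finite_subset by blast
  then show "card \<sigma> = Suc (fdim (Delta n) \<sigma>)" using assms(2) by (simp add: card_gt_0_iff)
qed

lemma simplex_carrier:
  assumes "\<sigma> \<subseteq> {0..n}" and x: "x \<in> simplex_cl n \<sigma>"
  shows "\<exists>\<tau>\<in>sub (Delta n) \<sigma>. x \<in> simplex_inn n \<tau>"
proof -
  let ?w = "word (Suc n) \<sigma>"
  have x': "x \<in> cube_cl ?w" "(\<Sum>i<Suc n. x i) = 1/2" using x by (auto simp: simplex_cl_def mom_def)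
  obtain c where c: "c \<in> sub (Cube (Suc n)) ?w" "x \<in> cube_inn c" using cube_carrier[OF _ x'(1)] by auto
  have len: "length c = Suc n" using c(1) by (simp add: Cube_sub)
  have f: "fills_inn (c ! i) (x i)" if "i < Suc n" for i using c(2) that len by (auto simp: cube_inn_def)
  then have nn: "x i \<ge> 0" if "i < Suc n" for i
    using f[OF that] by (auto simp: fills_inn_def split: sign.splits)
  have "Pos \<notin> set c"
  proof
    assume "Pos \<in> set c"
    then obtain i where i: "i < Suc n" "c ! i = Pos" using len by (auto simp: in_set_conv_nth)
    then have "x i = 1" using f[of i] by (simp add: fills_inn_def)
    moreover have "x i \<le> (\<Sum>i<Suc n. x i)" using nn i by (intro member_le_sum) auto
    ultimately show False using x' by simp
  qed
  moreover have "zs c \<noteq> {}"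
  proof
    assume z: "zs c = {}"
    have "x i = 0" if "i < Suc n" for i
      using f[OF that] that z len \<open>Pos \<notin> set c\<close> nth_mem[of i c]
      by (cases "c ! i") (auto simp: fills_inn_def zs_def)
    then show False using x' by simp
  qed
  moreover have "zs c \<subseteq> \<sigma>" using zs_mono[OF c(1)] zs_word[of \<sigma> "Suc n"] assms(1)
    by (simp add: atLeast0AtMost lessThan_Suc_atMost)
  moreover have "word (Suc n) (zs c) = c" using len \<open>Pos \<notin> set c\<close> by (rule word_zs)
  ultimately show ?thesis using c(2) x' by (intro bexI[of _ "zs c"]) (auto simp: simplex_inn_def mom_def)
qed

lemma simplex_sub_word:
  assumes "\<sigma> \<subseteq> {0..n}" "\<tau> \<subseteq> {0..n}"
  shows "word (Suc n) \<tau> \<in> sub (Cube (Suc n)) (word (Suc n) \<sigma>) \<longleftrightarrow> \<tau> \<subseteq> \<sigma>"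
proof -
  have "zs (word (Suc n) \<sigma>) = \<sigma>" "zs (word (Suc n) \<tau>) = \<tau>" using assms by (auto intro!: zs_word)
  then show ?thesis by (subst sub_no_Pos) auto
qed

text \<open>The slice fixes the moment of order 0, so the boundary of order p is governed by the
  moment of order p + 1; hence the value 1 of \<open>sh\<close>.\<close>

interpretation simplex: polytope_geometry "Delta n" "Suc n" 1 "simplex_cl n" "simplex_inn n" for n
proof
  show "finite (faces (Delta n))" by (rule finite_subset[of _ "Pow {0..n}"]) auto
next
  fix a assume a: "a \<in> faces (Delta n)"
  let ?x = "\<lambda>i. if i \<in> a then 1 / (2 * real (card a)) else 0"
  have fin: "finite a" "card a > 0" using a simplex_face_word(2)[of a n] by (auto simp: card_gt_0_iff)
  have "1 / (2 * real (card a)) < 1" using fin(2) by (simp add: divide_simps)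
  moreover have "i < Suc n" if "i \<in> a" for i using a that by auto
  ultimately have "?x \<in> cube_inn (word (Suc n) a)"
    using fin by (auto simp: cube_inn_def fills_inn_def)
  moreover have "mom (Suc n) 0 ?x = 1/2"
  proof -
    have "mom (Suc n) 0 ?x = (\<Sum>i\<in>a. 1 / (2 * real (card a)))"
      unfolding mom_def using a
      by (intro sum.mono_neutral_cong_right) (auto simp: fin(1))
    then show ?thesis using fin by (simp add: card_gt_0_iff)
  qed
  ultimately show "\<exists>x. x \<in> simplex_inn n a" by (auto simp: simplex_inn_def)
  have "closed {x. mom (Suc n) 0 x = 1/2}"
    unfolding mom_def by (intro closed_Collect_eq continuous_intros continuous_on_product_coordinates)
  moreover have "simplex_cl n a = cube_cl (word (Suc n) a) \<inter> {x. mom (Suc n) 0 x = 1/2}" by (auto simp: simplex_cl_def)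
  ultimately show "compact (simplex_cl n a)" using cube_compact by (auto intro: compact_Int_closed)
next
  fix a x assume a: "a \<in> faces (Delta n)"
  note w = cube.inn_cl[of "word (Suc n) a" "Suc n"] cube.convex_cl[of "word (Suc n) a" "Suc n"]
    cube.inn_seg[of "word (Suc n) a" "Suc n"]
  show "x \<in> simplex_inn n a \<Longrightarrow> x \<in> simplex_cl n a"
    using w(1) by (auto simp: simplex_inn_def simplex_cl_def)
  show "x \<in> simplex_cl n a \<Longrightarrow> \<exists>c\<in>sub (Delta n) a. x \<in> simplex_inn n c" using a simplex_carrier by auto
  have mid: "mom (Suc n) 0 (seg t x y) = 1/2" if "mom (Suc n) 0 x = 1/2" "mom (Suc n) 0 y = 1/2" for t x y
    unfolding mom_seg that by (simp add: field_simps)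
  show "x \<in> simplex_cl n a \<Longrightarrow> y \<in> simplex_cl n a \<Longrightarrow> 0 \<le> t \<Longrightarrow> t \<le> 1 \<Longrightarrow> seg t x y \<in> simplex_cl n a" for y t
    using w(2) mid by (auto simp: simplex_cl_def)
  show "x \<in> simplex_cl n a \<Longrightarrow> y \<in> simplex_inn n a \<Longrightarrow> 0 < t \<Longrightarrow> t \<le> 1 \<Longrightarrow> seg t x y \<in> simplex_inn n a" for y t
    using w(3) mid by (auto simp: simplex_cl_def simplex_inn_def)
next
  fix c e x assume a: "c \<in> faces (Delta n)" "e \<in> faces (Delta n)" "x \<in> simplex_inn n c" "x \<in> simplex_cl n e"
  then have "word (Suc n) c \<in> sub (Cube (Suc n)) (word (Suc n) e)"
    by (intro cube_inn_sub[of _ _ _ x]) (auto simp: simplex_inn_def simplex_cl_def)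
  then show "c \<in> sub (Delta n) e" using a simplex_sub_word[of e n c] by auto
next
  fix e c assume e: "e \<in> faces (Delta n)" "c \<in> sub (Delta n) e"
  then have "c \<subseteq> {0..n}" by auto
  then have "word (Suc n) c \<in> sub (Cube (Suc n)) (word (Suc n) e)" using e simplex_sub_word[of e n c] by auto
  then show "simplex_cl n c \<subseteq> simplex_cl n e"
    using cube.sub_cl[of "word (Suc n) e" "Suc n" "word (Suc n) c"] by (auto simp: simplex_cl_def)
next
  fix b p c s x
  assume b: "b \<in> faces (Delta n)" "fdim (Delta n) b = Suc p" "c \<in> sub (Delta n) b"
    and n: "c \<notin> Sub (Delta n) (fbd (Delta n) s b)" and x: "x \<in> simplex_inn n c"
  let ?b = "word (Suc n) b" and ?c = "word (Suc n) c"
  have c: "c \<subseteq> {0..n}" "c \<noteq> {}" using b by auto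
  have z: "zs ?b = b" "zs ?c = c" "card b = Suc (Suc p)"
    using b(1,2) c simplex_face_word(1)[of b n] simplex_face_word(1)[of c n] by simp_all
  have sub: "?c \<in> sub (Cube (Suc n)) ?b"
    using b(1,3) c by (subst simplex_sub_word) (simp_all del: Delta_fdim)
  have "?c \<notin> Sub (Cube (Suc n)) (fbd (Cube (Suc n)) s ?b)"
    using Sub_fbd_no_Pos[OF sub, of s n] n z c by auto
  then obtain y where y: "y \<in> cube_cl ?b" "same (Suc n) (p + 1) y x"
      "below s (mom (Suc n) (p + 1) y) (mom (Suc n) (p + 1) x)"
    using cube.descend[of ?b "Suc n" "p + 1" ?c s x] z sub x by (auto simp: simplex_inn_def)
  moreover have "mom (Suc n) 0 y = 1/2" using same_mom[OF y(2), of 0] x by (simp add: simplex_inn_def)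
  ultimately show "\<exists>y\<in>simplex_cl n b. same (Suc n) (p + 1) y x \<and> below s (mom (Suc n) (p + 1) y) (mom (Suc n) (p + 1) x)"
    by (auto simp: simplex_cl_def)
next
  fix c p x s assume c: "c \<in> faces (Delta n)" "p < fdim (Delta n) c" and x: "x \<in> simplex_inn n c"
  let ?c = "word (Suc n) c"
  have "card (zs ?c) > p + 1" using c simplex_face_word(1)[of c n] by auto
  then obtain y where y: "y \<in> cube_cl ?c" "same (Suc n) (p + 1) y x"
      "below s (mom (Suc n) (p + 1) y) (mom (Suc n) (p + 1) x)"
    using cube.descend_top[of ?c "Suc n" "p + 1" x s] x by (auto simp: simplex_inn_def)
  moreover have "mom (Suc n) 0 y = 1/2" using same_mom[OF y(2), of 0] x by (simp add: simplex_inn_def)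
  ultimately show "\<exists>y\<in>simplex_cl n c. same (Suc n) (p + 1) y x \<and> below s (mom (Suc n) (p + 1) y) (mom (Suc n) (p + 1) x)"
    by (auto simp: simplex_cl_def)
next
  fix e c p x y s
  assume e: "e \<in> faces (Delta n)" "c \<in> sub (Delta n) e" "fdim (Delta n) c \<le> p" "x \<in> simplex_inn n c"
    "y \<in> simplex_cl n e" "same (Suc n) (p + 1) y x" "y \<noteq> x" "\<not> below s (mom (Suc n) (p + 1) x) (mom (Suc n) (p + 1) y)"
  let ?e = "word (Suc n) e" and ?c = "word (Suc n) c"
  have c: "c \<subseteq> {0..n}" "c \<noteq> {}" using e by auto
  have z: "zs ?e = e" "zs ?c = c" "card c \<le> Suc p"
    using e(1,3) c simplex_face_word(1)[of e n] simplex_face_word(1)[of c n] by simp_all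
  have sub: "?c \<in> sub (Cube (Suc n)) ?e"
    using e(1,2) c by (subst simplex_sub_word) simp_all
  obtain b where b: "b \<in> sub (Cube (Suc n)) ?e" "card (zs b) = Suc (p + 1)" "?c \<in> sub (Cube (Suc n)) b"
    "?c \<notin> Sub (Cube (Suc n)) (fbd (Cube (Suc n)) s b)"
    using cube.extend[of ?e "Suc n" ?c "p + 1" x y s] e z sub by (auto simp: simplex_inn_def simplex_cl_def)
  have "zs b \<subseteq> e" "c \<subseteq> zs b" using zs_mono[OF b(1)] zs_mono[OF b(3)] z by auto
  moreover have "c \<notin> Sub (Delta n) (fbd (Delta n) s (zs b))"
    using Sub_fbd_no_Pos[OF b(3), of s n] b(4) z c by auto
  ultimately show "\<exists>b\<in>sub (Delta n) e. fdim (Delta n) b = Suc p \<and> c \<in> sub (Delta n) b \<and> c \<notin> Sub (Delta n) (fbd (Delta n) s b)"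
    using b(2) c by (intro bexI[of _ "zs b"]) auto
qed auto

section \<open>Collapsing the faces with a plus sign\<close>

text \<open>Passage to the vertex figure at \<open>-...-\<close>: a face through this vertex goes to
  the set of its directions, while the vertex itself and the faces not containing it
  disappear.\<close>

definition col :: "sign list set \<Rightarrow> nat set set" where
  "col X = {zs k |k. k \<in> X \<and> Pos \<notin> set k \<and> zs k \<noteq> {}}"

lemma col_iff: "X \<subseteq> faces (Cube m) \<Longrightarrow> \<sigma> \<in> col X \<longleftrightarrow> \<sigma> \<subseteq> {..<m} \<and> \<sigma> \<noteq> {} \<and> word m \<sigma> \<in> X"
proof
  assume X: "X \<subseteq> faces (Cube m)" and "\<sigma> \<in> col X"
  then obtain k where k: "k \<in> X" "Pos \<notin> set k" "zs k \<noteq> {}" "\<sigma> = zs k" "length k = m" by (auto simp: col_def)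
  then show "\<sigma> \<subseteq> {..<m} \<and> \<sigma> \<noteq> {} \<and> word m \<sigma> \<in> X" using word_zs[of k m] zs_subset[of k] by simp
next
  assume "\<sigma> \<subseteq> {..<m} \<and> \<sigma> \<noteq> {} \<and> word m \<sigma> \<in> X"
  then show "\<sigma> \<in> col X" using zs_word[of \<sigma> m] unfolding col_def by force
qed

lemma col_Un: "col (X \<union> Y) = col X \<union> col Y"
  by (auto simp: col_def)

lemma col_mono: "X \<subseteq> Y \<Longrightarrow> col X \<subseteq> col Y"
  by (auto simp: col_def)

lemma col_bd_0: "col (bd (Cube m) s 0 X) = {}"
  by (auto simp: col_def bd_iff)

text \<open>Every face containing a face without \<open>+\<close> is itself without
  \<open>+\<close>, so the test for the boundary sees the same faces on both sides. The order drops
  by one because r + 1 zeros make a simplex of dimension r.\<close>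

lemma col_bd:
  assumes X: "X \<subseteq> faces (Cube (Suc n))"
  shows "col (bd (Cube (Suc n)) s (Suc p) X) = bd (Delta n) s p (col X)"
proof (intro set_eqI)
  fix \<sigma>
  let ?K = "Cube (Suc n)" and ?w = "word (Suc n)"
  show "\<sigma> \<in> col (bd ?K s (Suc p) X) \<longleftrightarrow> \<sigma> \<in> bd (Delta n) s p (col X)"
  proof (cases "\<sigma> \<subseteq> {..<Suc n} \<and> \<sigma> \<noteq> {}")
    case False
    then have "\<sigma> \<notin> col X" using col_iff[OF X] by auto
    then show ?thesis using col_mono[OF bd_subset, of ?K s "Suc p" X] by (auto simp: bd_iff[of \<sigma>])
  next
    case True
    then have z: "zs (?w \<sigma>) = \<sigma>" "finite \<sigma>" using zs_word finite_subset by blast+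
    have "(\<forall>b\<in>X. card (zs b) = Suc (Suc p) \<and> ?w \<sigma> \<in> sub ?K b \<longrightarrow> ?w \<sigma> \<in> Sub ?K (fbd ?K s b)) \<longleftrightarrow>
      (\<forall>\<tau>\<in>col X. card \<tau> - 1 = Suc p \<and> \<sigma> \<in> sub (Delta n) \<tau> \<longrightarrow> \<sigma> \<in> Sub (Delta n) (fbd (Delta n) s \<tau>))"
      (is "?L \<longleftrightarrow> ?R")
    proof
      assume L: ?L
      show ?R
      proof (intro ballI impI)
        fix \<tau> assume "\<tau> \<in> col X" and t: "card \<tau> - 1 = Suc p \<and> \<sigma> \<in> sub (Delta n) \<tau>"
        then have t': "\<tau> \<subseteq> {..<Suc n}" "?w \<tau> \<in> X" using col_iff[OF X] by auto
        then have zt: "zs (?w \<tau>) = \<tau>" using zs_word by blast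
        have sub: "?w \<sigma> \<in> sub ?K (?w \<tau>)" using t z zt by (subst sub_no_Pos) auto
        then have "?w \<sigma> \<in> Sub ?K (fbd ?K s (?w \<tau>))" using L t' t zt by auto
        then show "\<sigma> \<in> Sub (Delta n) (fbd (Delta n) s \<tau>)"
          using Sub_fbd_no_Pos[OF sub, of s n] z zt True by auto
      qed
    next
      assume R: ?R
      show ?L
      proof (intro ballI impI)
        fix b assume b: "b \<in> X" and bb: "card (zs b) = Suc (Suc p) \<and> ?w \<sigma> \<in> sub ?K b"
        then have sub: "?w \<sigma> \<in> sub ?K b" by simp
        have nP: "Pos \<notin> set b" using Pos_sub[OF sub] by auto
        have "\<sigma> \<subseteq> zs b" using zs_mono[OF sub] z by simp
        moreover have "zs b \<in> col X" using b nP \<open>\<sigma> \<subseteq> zs b\<close> True by (auto simp: col_def)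
        ultimately have "\<sigma> \<in> Sub (Delta n) (fbd (Delta n) s (zs b))" using R bb True by auto
        then show "?w \<sigma> \<in> Sub ?K (fbd ?K s b)" using Sub_fbd_no_Pos[OF sub, of s n] z True by auto
      qed
    qed
    moreover have "card \<sigma> \<le> Suc p \<longleftrightarrow> card \<sigma> - 1 \<le> p" by auto
    ultimately show ?thesis
      unfolding col_iff[OF order_trans[OF bd_subset X]] bd_iff[of _ ?K] bd_iff[of \<sigma> "Delta n"] col_iff[OF X]
      using True z by simp
  qed
qed

lemma col_sub_word: "\<sigma> \<subseteq> {..<m} \<Longrightarrow> col (sub (Cube m) (word m \<sigma>)) = sub (Delta n) \<sigma>"
proof (intro set_eqI)
  fix \<tau> assume s: "\<sigma> \<subseteq> {..<m}"
  have "sub (Cube m) (word m \<sigma>) \<subseteq> faces (Cube m)" by (auto simp: Cube_sub)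
  note * = col_iff[OF this, of \<tau>]
  show "\<tau> \<in> col (sub (Cube m) (word m \<sigma>)) \<longleftrightarrow> \<tau> \<in> sub (Delta n) \<sigma>"
  proof (cases "\<tau> \<subseteq> {..<m}")
    case True
    then show ?thesis using * s sub_no_Pos[of "word m \<tau>" "word m \<sigma>" m] by (auto simp: zs_word)
  next
    case False then show ?thesis using * s by auto
  qed
qed

lemma col_sub_Pos: "Pos \<in> set k \<Longrightarrow> col (sub (Cube m) k) = {}"
  using Pos_sub by (fastforce simp: col_def)

lemma col_sub_no_Pos: "length k = m \<Longrightarrow> Pos \<notin> set k \<Longrightarrow> col (sub (Cube m) k) = sub (Delta n) (zs k)"
  using col_sub_word[of "zs k" m n] word_zs[of k m] zs_subset[of k] by simp

lemma Delta_bd_atom: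
  assumes "\<sigma> \<subseteq> {0..n}"
  shows "bd (Delta n) s p (sub (Delta n) \<sigma>) = col (bd (Cube (Suc n)) s (Suc p) (sub (Cube (Suc n)) (word (Suc n) \<sigma>)))"
proof -
  have "sub (Cube (Suc n)) (word (Suc n) \<sigma>) \<subseteq> faces (Cube (Suc n))" by (auto simp: Cube_sub)
  then show ?thesis using col_bd[of _ n s p] col_sub_word[of \<sigma> "Suc n" n] assms
    by (metis atLeast0AtMost lessThan_Suc_atMost)
qed

section \<open>Maps of cells\<close>

text \<open>An omega-functor between categories of cells, with both kinds of boundary in one clause;
  preservation of composition is stated as preservation of unions.\<close>

definition cell_map :: "'f face_system \<Rightarrow> 'g face_system \<Rightarrow> ('f set \<Rightarrow> 'g set) \<Rightarrow> bool" where
  "cell_map K L \<Phi> \<longleftrightarrow> (\<forall>X\<in>cells K. \<Phi> X \<in> cells L \<and> (\<forall>s p. \<Phi> (bd K s p X) = bd L s p (\<Phi> X))) \<and>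
     (\<forall>X\<in>cells K. \<forall>Y\<in>cells K. \<Phi> (X \<union> Y) = \<Phi> X \<union> \<Phi> Y)"

lemma cell_mapD:
  assumes "cell_map K L \<Phi>" "X \<in> cells K"
  shows "\<Phi> X \<in> cells L" "\<Phi> (bd K s p X) = bd L s p (\<Phi> X)"
    and "Y \<in> cells K \<Longrightarrow> \<Phi> (X \<union> Y) = \<Phi> X \<union> \<Phi> Y"
  using assms by (auto simp: cell_map_def)

text \<open>The laws of \<open>pasting\<close> compute the boundaries of boundaries and composites
  in the same way on both sides, so commutation spreads from the generators to all cells.\<close>

lemma cell_map_image:
  assumes K: "pasting K" and L: "pasting L"
    and atom: "\<And>a. a \<in> faces K \<Longrightarrow> \<phi> ` sub K a \<in> cells L"
    and bd_atom: "\<And>a s p. a \<in> faces K \<Longrightarrow> \<phi> ` bd K s p (sub K a) = bd L s p (\<phi> ` sub K a)"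
  shows "cell_map K L ((`) \<phi>)"
proof -
  interpret K: pasting K by fact
  interpret L: pasting L by fact
  have "\<phi> ` X \<in> cells L \<and> (\<forall>s p. \<phi> ` bd K s p X = bd L s p (\<phi> ` X))" if "X \<in> cells K" for X
    using that
  proof (induction rule: cells_induct)
    case (atom x) then show ?case using assms(3,4) by auto
  next
    case (bd X s p)
    have "\<phi> ` bd K s' q (bd K s p X) = bd L s' q (\<phi> ` bd K s p X)" for s' q
    proof (cases "q < p")
      case True
      then show ?thesis using bd K.bd_bd[OF bd(1) True] L.bd_bd[OF _ True] by simp
    next
      case False
      then show ?thesis using bd bd_bd_ge[of p q K s' s X] bd_bd_ge[of p q L s' s "\<phi> ` X"] by simp
    qed
    then show ?case using bd cells_bd by metis
  next
    case (comp X Y p)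
    have c1: "bd K (\<not> True) p X = bd K True p Y" using comp by simp
    have c2: "bd L (\<not> True) p (\<phi> ` X) = bd L True p (\<phi> ` Y)" using comp by (metis c1)
    have d1: "bd K (\<not> False) p Y = bd K False p X" and d2: "bd L (\<not> False) p (\<phi> ` Y) = bd L False p (\<phi> ` X)"
      using c1 c2 by simp_all
    have XY: "\<phi> ` X \<in> cells L" "\<phi> ` Y \<in> cells L" using comp by auto
    have "\<phi> ` bd K s q (X \<union> Y) = bd L s q (\<phi> ` X \<union> \<phi> ` Y)" for s q
    proof (cases q p rule: linorder_cases)
      case less
      then show ?thesis using K.comp_bd_low[OF comp(1,2) c1 less] L.comp_bd_low[OF XY c2 less] comp by simp
    next
      case equal
      show ?thesis
      proof (cases s)
        case True
        then show ?thesis using K.comp_bd[OF comp(1,2) c1] L.comp_bd[OF XY c2] comp equal by simp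
      next
        case False
        then show ?thesis using K.comp_bd[OF comp(2,1) d1] L.comp_bd[OF XY(2,1) d2] comp equal by (simp add: Un_commute)
      qed
    next
      case greater
      then show ?thesis
        using K.comp_bd_high[OF comp(1,2) c1 greater] L.comp_bd_high[OF XY c2 greater] comp by (simp add: image_Un)
    qed
    moreover have "\<phi> ` X \<union> \<phi> ` Y \<in> cells L" using cells_comp'[OF XY c2] .
    ultimately show ?case by (simp add: image_Un)
  qed
  then show ?thesis by (simp add: cell_map_def image_Un)
qed

text \<open>The test for the boundary compares a face only with faces containing it, so it can be
  carried out inside each \<open>sub K a\<close>. Thus a subdivision, given by a preimage, commutes
  with boundaries of arbitrary closed sets as soon as it does so on generators.\<close>

lemma preimage_bd:
  assumes X: "down K X" "X \<subseteq> faces K"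
    and \<rho>: "\<And>w. w \<in> S \<Longrightarrow> w \<in> sub L w" "\<And>w l. l \<in> S \<Longrightarrow> w \<in> sub L l \<Longrightarrow> w \<in> S \<and> \<rho> w \<in> sub K (\<rho> l)"
    and K: "\<And>a. a \<in> faces K \<Longrightarrow> a \<in> sub K a"
    and atom: "\<And>a. a \<in> faces K \<Longrightarrow> {w\<in>S. \<rho> w \<in> bd K s p (sub K a)} = bd L s p {w\<in>S. \<rho> w \<in> sub K a}"
  shows "{w\<in>S. \<rho> w \<in> bd K s p X} = bd L s p {w\<in>S. \<rho> w \<in> X}"
proof (intro equalityI subsetI)
  fix w assume "w \<in> {w\<in>S. \<rho> w \<in> bd K s p X}"
  then have w: "w \<in> S" "\<rho> w \<in> bd K s p X" "\<rho> w \<in> X" by (auto simp: bd_iff)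
  have local: "w \<in> bd L s p {w\<in>S. \<rho> w \<in> sub K a}" if a: "a \<in> X" "\<rho> w \<in> sub K a" for a
  proof -
    have "sub K a \<subseteq> X" using a X by (auto simp: down_def)
    then have "\<rho> w \<in> bd K s p (sub K a)" using w a by (auto simp: bd_iff)
    then show ?thesis using atom[of a] a X w by blast
  qed
  have "w \<in> Sub L (fbd L s l)" if l: "l \<in> S" "\<rho> l \<in> X" "fdim L l = Suc p" "w \<in> sub L l" for l
  proof -
    have "w \<in> bd L s p {w\<in>S. \<rho> w \<in> sub K (\<rho> l)}" using local l \<rho>(2) by blast
    moreover have "\<rho> l \<in> sub K (\<rho> l)" using K l X by blast
    ultimately show ?thesis using l by (auto simp: bd_iff)
  qed
  moreover have "fdim L w \<le> p" using local[OF w(3)] K w X by (auto simp: bd_iff)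
  ultimately show "w \<in> bd L s p {w\<in>S. \<rho> w \<in> X}" using w by (auto simp: bd_iff[of w])
next
  fix w assume w: "w \<in> bd L s p {w\<in>S. \<rho> w \<in> X}"
  then have w': "w \<in> S" "\<rho> w \<in> X" by (auto simp: bd_iff)
  have local: "\<rho> w \<in> bd K s p (sub K a)" if a: "a \<in> X" "\<rho> w \<in> sub K a" for a
  proof -
    have "sub K a \<subseteq> X" using a X by (auto simp: down_def)
    then have "w \<in> bd L s p {w\<in>S. \<rho> w \<in> sub K a}" using w w' a by (auto simp: bd_iff)
    then show ?thesis using atom[of a] a X w' by blast
  qed
  have "\<rho> w \<in> Sub K (fbd K s b)" if b: "b \<in> X" "fdim K b = Suc p" "\<rho> w \<in> sub K b" for b
    using local[OF b(1,3)] b K X by (auto simp: bd_iff)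
  moreover have "fdim K (\<rho> w) \<le> p" using local[OF w'(2)] K w' X by (auto simp: bd_iff)
  ultimately show "w \<in> {w\<in>S. \<rho> w \<in> bd K s p X}" using w' by (auto simp: bd_iff)
qed

lemma pos_image:
  assumes "\<And>x y. x \<in> Z \<Longrightarrow> y \<in> Z \<Longrightarrow> x < y \<longleftrightarrow> f x < f y" and z: "z \<in> Z"
  shows "pos (f ` Z) (f z) = pos Z z"
proof -
  have inj: "inj_on f Z"
    by (rule inj_onI) (metis assms(1) less_irrefl linorder_neqE_nat)
  have "{y \<in> f ` Z. y < f z} = f ` {y \<in> Z. y < z}" using assms by auto
  then show ?thesis using inj by (simp add: pos_def card_image inj_on_subset)
qed

lemma alternating_image:
  assumes mono: "\<And>x y. x \<in> Z \<Longrightarrow> y \<in> Z \<Longrightarrow> x < y \<longleftrightarrow> f x < f y"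
    and alt: "alternating s c Z"
    and sgn: "\<And>z. z \<in> Z \<Longrightarrow> c ! z \<noteq> bsgn s (pos Z z) \<Longrightarrow> c' ! f z \<noteq> bsgn s (pos Z z)"
  shows "alternating s c' (f ` Z)" "card (f ` Z) = card Z"
proof -
  show "alternating s c' (f ` Z)"
    unfolding alternating_def
  proof
    fix z' assume "z' \<in> f ` Z"
    then obtain z where z: "z \<in> Z" "z' = f z" by auto
    then show "c' ! z' \<noteq> bsgn s (pos (f ` Z) z')"
      using pos_image[of Z f, OF mono z(1)] alt sgn by (auto simp: alternating_def)
  qed
  show "card (f ` Z) = card Z"
    by (rule card_image, rule inj_onI) (metis mono less_irrefl linorder_neqE_nat)
qed

text \<open>Removing the largest element leaves the other positions unchanged.\<close>

lemma initial_segment: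
  assumes "finite Z" "k \<le> card Z"
  shows "\<exists>W\<subseteq>Z. card W = k \<and> (\<forall>z\<in>W. pos W z = pos Z z)"
  using assms
proof (induction "card Z - k" arbitrary: Z)
  case 0 then show ?case by (intro exI[of _ Z]) auto
next
  case (Suc m)
  then have ne: "Z \<noteq> {}" by auto
  define Y where "Y = Z - {Max Z}"
  have M: "Max Z \<in> Z" using ne Suc.prems by simp
  have cY: "card Z = Suc (card Y)" unfolding Y_def using card_Suc_Diff1[OF Suc.prems(1) M] by (rule sym)
  have "pos Y z = pos Z z" if "z \<in> Y" for z
  proof -
    have "z \<le> Max Z" using that Suc.prems by (auto simp: Y_def)
    then have "{y \<in> Y. y < z} = {y \<in> Z. y < z}" by (auto simp: Y_def)
    then show ?thesis by (simp add: pos_def)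
  qed
  moreover have "m = card Y - k" "finite Y" "k \<le> card Y" using Suc.hyps(2) Suc.prems cY by (auto simp: Y_def)
  from Suc.hyps(1)[OF this] obtain W where "W \<subseteq> Y" "card W = k" "\<forall>z\<in>W. pos W z = pos Y z"
    by (elim exE conjE)
  moreover have "Y \<subseteq> Z" by (auto simp: Y_def)
  ultimately show ?case by (intro exI[of _ W]) auto
qed

lemma alternating_card:
  assumes "finite Z" "alternating s c Z" "k \<le> card Z"
  shows "\<exists>W\<subseteq>Z. card W = k \<and> alternating s c W"
  using initial_segment[OF assms(1,3)] assms(2) unfolding alternating_def by (metis subsetD)

lemma cube_bd_atomD:
  assumes "c \<in> bd (Cube n) s p (sub (Cube n) e)" "length e = n" "Z \<subseteq> zs e" "alternating s c Z" "p < card Z"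
  shows False
proof -
  have "finite Z" using assms(3) finite_zs by (rule finite_subset)
  then obtain W where "W \<subseteq> Z" "card W = Suc p" "alternating s c W"
    using alternating_card[OF _ assms(4), of "Suc p"] assms(5) by auto
  then show False using assms(1,3) cube_bd_atom[OF assms(2), of c s p] by blast
qed

subsection \<open>Inserting a letter\<close>

definition ins :: "nat \<Rightarrow> sign \<Rightarrow> sign list \<Rightarrow> sign list" where
  "ins i \<alpha> k = take i k @ [\<alpha>] @ drop i k"

lemma length_ins [simp]: "length (ins i \<alpha> k) = Suc (length k)"
  by (simp add: ins_def)

lemma nth_ins: "i \<le> length k \<Longrightarrow> ins i \<alpha> k ! j = (if j < i then k ! j else if j = i then \<alpha> else k ! (j - 1))"
  by (auto simp: ins_def nth_append nth_Cons' min_def)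

lemma delta_mono: "delta i x < delta i y \<longleftrightarrow> x < y" and delta_inj [simp]: "delta i x = delta i y \<longleftrightarrow> x = y"
  and delta_neq [simp]: "delta i x \<noteq> i"
  by (auto simp: delta_def)

lemma nth_ins_delta: "i \<le> length k \<Longrightarrow> ins i \<alpha> k ! delta i j = k ! j"
  by (simp add: nth_ins delta_def)

lemma delta_cases: "j < Suc m \<Longrightarrow> i \<le> m \<Longrightarrow> j = i \<or> (\<exists>j'<m. j = delta i j')"
proof -
  assume "j < Suc m" "i \<le> m"
  then have "j = i \<or> (j < i \<and> j < m \<and> j = delta i j) \<or> (j > i \<and> j - 1 < m \<and> j = delta i (j - 1))"
    by (auto simp: delta_def)
  then show ?thesis by blast
qed

lemma delta_less: "j < m \<Longrightarrow> i \<le> m \<Longrightarrow> delta i j < Suc m"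
  by (auto simp: delta_def)

lemma zs_ins: "i \<le> length k \<Longrightarrow> \<alpha> \<noteq> Zero \<Longrightarrow> zs (ins i \<alpha> k) = delta i ` zs k"
proof (intro equalityI subsetI)
  fix j assume i: "i \<le> length k" and "\<alpha> \<noteq> Zero" and j: "j \<in> zs (ins i \<alpha> k)"
  then obtain j' where "j' < length k" "j = delta i j'"
    using delta_cases[of j "length k" i] by (auto simp: zs_def nth_ins)
  then show "j \<in> delta i ` zs k" using j i by (auto simp: zs_def nth_ins_delta)
qed (auto simp: zs_def nth_ins_delta delta_less)

lemma ins_sub:
  assumes k: "length k = m" "i \<le> m" "\<alpha> \<noteq> Zero"
  shows "ins i \<alpha> ` sub (Cube m) k = sub (Cube (Suc m)) (ins i \<alpha> k)"
proof (intro equalityI subsetI)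
  fix c assume "c \<in> ins i \<alpha> ` sub (Cube m) k"
  then obtain a where a: "length a = m" "\<forall>j<m. k ! j = Zero \<or> a ! j = k ! j" "c = ins i \<alpha> a"
    using k by (auto simp: Cube_sub)
  have "ins i \<alpha> k ! j = Zero \<or> c ! j = ins i \<alpha> k ! j" if "j < Suc m" for j
    using delta_cases[OF that k(2)] a k by (auto simp: nth_ins_delta) (auto simp: nth_ins)
  then show "c \<in> sub (Cube (Suc m)) (ins i \<alpha> k)" using a k by (simp add: Cube_sub)
next
  fix c assume "c \<in> sub (Cube (Suc m)) (ins i \<alpha> k)"
  then have c: "length c = Suc m" "\<And>j. j < Suc m \<Longrightarrow> ins i \<alpha> k ! j = Zero \<or> c ! j = ins i \<alpha> k ! j"
    using k by (auto simp: Cube_sub)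
  define a where "a = map (\<lambda>j. c ! delta i j) [0..<m]"
  have "c ! i = \<alpha>" using c(2)[of i] k by (simp add: nth_ins)
  then have "c = ins i \<alpha> a"
    using c(1) k by (intro nth_equalityI) (auto simp: a_def nth_ins delta_def)
  moreover have "a \<in> sub (Cube m) k"
  proof -
    have "k ! j = Zero \<or> c ! delta i j = k ! j" if "j < m" for j
      using c(2)[OF delta_less[OF that k(2)]] k nth_ins_delta[of i k \<alpha> j] by simp
    then show ?thesis using k by (simp add: Cube_sub a_def)
  qed
  ultimately show "c \<in> ins i \<alpha> ` sub (Cube m) k" by auto
qed

text \<open>The inserted letter is constant and \<open>delta i\<close> preserves the order, so
  alternating sets correspond together with the positions of their elements.\<close>

lemma ins_bd:
  assumes k: "length k = m" "i \<le> m" "\<alpha> \<noteq> Zero"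
  shows "ins i \<alpha> ` bd (Cube m) s p (sub (Cube m) k) = bd (Cube (Suc m)) s p (ins i \<alpha> ` sub (Cube m) k)"
proof -
  have key: "c \<in> bd (Cube m) s p (sub (Cube m) k) \<longleftrightarrow> ins i \<alpha> c \<in> bd (Cube (Suc m)) s p (sub (Cube (Suc m)) (ins i \<alpha> k))"
    if c: "c \<in> sub (Cube m) k" for c
  proof -
    have len: "length c = m" using c k by (simp add: Cube_sub)
    have "(\<exists>Z\<subseteq>zs k. card Z = Suc p \<and> alternating s c Z) \<longleftrightarrow>
      (\<exists>Z\<subseteq>zs (ins i \<alpha> k). card Z = Suc p \<and> alternating s (ins i \<alpha> c) Z)"
    proof
      assume "\<exists>Z\<subseteq>zs k. card Z = Suc p \<and> alternating s c Z"
      then obtain Z where Z: "Z \<subseteq> zs k" "card Z = Suc p" "alternating s c Z" by blast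
      show "\<exists>Z\<subseteq>zs (ins i \<alpha> k). card Z = Suc p \<and> alternating s (ins i \<alpha> c) Z"
        using alternating_image[of Z "delta i" s c "ins i \<alpha> c"] Z k len
        by (intro exI[of _ "delta i ` Z"]) (auto simp: delta_mono nth_ins_delta zs_ins)
    next
      assume "\<exists>Z\<subseteq>zs (ins i \<alpha> k). card Z = Suc p \<and> alternating s (ins i \<alpha> c) Z"
      then obtain Z where Z: "Z \<subseteq> delta i ` zs k" "card Z = Suc p" "alternating s (ins i \<alpha> c) Z"
        using k by (auto simp: zs_ins)
      then obtain Y where Y: "Y \<subseteq> zs k" "Z = delta i ` Y" by (meson subset_imageE)
      have "card Y = Suc p" using Z(2) Y(2) by (simp add: card_image inj_on_def)
      moreover have "alternating s c Y"
        unfolding alternating_def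
      proof
        fix z assume z: "z \<in> Y"
        have "pos Z (delta i z) = pos Y z" unfolding Y(2) by (rule pos_image) (auto simp: delta_mono z)
        then show "c ! z \<noteq> bsgn s (pos Y z)"
          using Z(3) z Y k len nth_ins_delta[of i c \<alpha> z] by (auto simp: alternating_def)
      qed
      ultimately show "\<exists>Z\<subseteq>zs k. card Z = Suc p \<and> alternating s c Z" using Y by blast
    qed
    moreover have "ins i \<alpha> c \<in> sub (Cube (Suc m)) (ins i \<alpha> k)" using ins_sub[OF k] c by blast
    ultimately show ?thesis using c k by (simp add: cube_bd_atom) blast
  qed
  show ?thesis
  proof (intro equalityI subsetI)
    fix w assume "w \<in> ins i \<alpha> ` bd (Cube m) s p (sub (Cube m) k)"
    then obtain c where c: "c \<in> bd (Cube m) s p (sub (Cube m) k)" "w = ins i \<alpha> c" by blast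
    have "c \<in> sub (Cube m) k" using c(1) by (simp add: bd_iff)
    then show "w \<in> bd (Cube (Suc m)) s p (ins i \<alpha> ` sub (Cube m) k)"
      using key c ins_sub[OF k] by simp
  next
    fix w assume w: "w \<in> bd (Cube (Suc m)) s p (ins i \<alpha> ` sub (Cube m) k)"
    have "w \<in> ins i \<alpha> ` sub (Cube m) k" using w by (simp only: bd_iff)
    then obtain c where "c \<in> sub (Cube m) k" "w = ins i \<alpha> c" by blast
    then show "w \<in> ins i \<alpha> ` bd (Cube m) s p (sub (Cube m) k)" using key w ins_sub[OF k] by auto
  qed
qed

lemma cell_map_ins:
  assumes "i \<le> m" "\<alpha> \<noteq> Zero"
  shows "cell_map (Cube m) (Cube (Suc m)) ((`) (ins i \<alpha>))"
proof (rule cell_map_image[OF cube.pasting_axioms cube.pasting_axioms])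
  fix a assume a: "a \<in> faces (Cube m)"
  then show "ins i \<alpha> ` sub (Cube m) a \<in> cells (Cube (Suc m))"
    using ins_sub[of a m i \<alpha>] assms cells.atom[of "ins i \<alpha> a" "Cube (Suc m)"] by simp
  show "ins i \<alpha> ` bd (Cube m) s p (sub (Cube m) a) = bd (Cube (Suc m)) s p (ins i \<alpha> ` sub (Cube m) a)" for s p
    using a assms ins_bd by simp
qed

subsection \<open>Merging two adjacent letters\<close>

definition mg :: "nat \<Rightarrow> sign list \<Rightarrow> sign list" where
  "mg i k = take i k @ [sign_max (k ! i) (k ! Suc i)] @ drop (Suc (Suc i)) k"

lemma length_mg: "Suc i < length k \<Longrightarrow> length (mg i k) = length k - 1"
  by (simp add: mg_def)

lemma nth_mg: "Suc i < length k \<Longrightarrow> mg i k ! j =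
    (if j < i then k ! j else if j = i then sign_max (k ! i) (k ! Suc i) else k ! Suc j)"
  by (auto simp: mg_def nth_append nth_Cons' min_def)

lemma sign_max_simps:
  "sign_max a b = Neg \<longleftrightarrow> a = Neg \<and> b = Neg"
  "sign_max a b = Pos \<longleftrightarrow> a = Pos \<or> b = Pos"
  "sign_max a b = Zero \<longleftrightarrow> a \<noteq> Pos \<and> b \<noteq> Pos \<and> (a = Zero \<or> b = Zero)"
  by (cases a; cases b; simp)+

lemma zs_mg:
  assumes "Suc i < length k" "k ! i \<noteq> Pos" "k ! Suc i \<noteq> Pos"
  shows "zs (mg i k) = eta i ` zs k"
proof (intro equalityI subsetI)
  fix j assume j: "j \<in> zs (mg i k)"
  consider "j < i" | "j = i" | "j > i" by linarith
  then show "j \<in> eta i ` zs k"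
  proof cases
    case 1 then show ?thesis using j assms by (intro image_eqI[of _ _ j]) (auto simp: zs_def nth_mg eta_def)
  next
    case 2
    then have "k ! i = Zero \<or> k ! Suc i = Zero" using j assms by (auto simp: zs_def nth_mg sign_max_simps)
    then show ?thesis
    proof
      assume "k ! i = Zero" then show ?thesis using 2 assms by (intro image_eqI[of _ _ i]) (auto simp: zs_def eta_def)
    next
      assume "k ! Suc i = Zero" then show ?thesis using 2 assms by (intro image_eqI[of _ _ "Suc i"]) (auto simp: zs_def eta_def)
    qed
  next
    case 3 then show ?thesis using j assms by (intro image_eqI[of _ _ "Suc j"]) (auto simp: zs_def nth_mg eta_def length_mg)
  qed
next
  fix j assume "j \<in> eta i ` zs k"
  then show "j \<in> zs (mg i k)" using assms by (auto simp: zs_def nth_mg eta_def length_mg sign_max_simps le_less split: if_splits)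
qed

text \<open>\<open>W\<close> takes its head from \<open>Z1\<close> and its tail from
  \<open>Z2\<close>. In the tail the parity of positions survives: the heads differ in parity, and
  \<open>M\<close> has one element less than the part of \<open>Z2\<close> that it replaces.\<close>

lemma splice_pos:
  assumes fin: "finite Z1" "finite Z2" and M: "M \<subseteq> {a..b}" and ab: "a \<le> b"
    and R: "card {z \<in> Z2. a \<le> z \<and> z \<le> b} = Suc (card M)"
    and par: "odd (card {z \<in> Z1. z < a} + card {z \<in> Z2. z < a})"
    and W: "W = {z \<in> Z1. z < a} \<union> M \<union> {z \<in> Z2. b < z}"
  shows "z \<in> Z1 \<Longrightarrow> z < a \<Longrightarrow> pos W z = pos Z1 z"
    and "z \<in> Z2 \<Longrightarrow> b < z \<Longrightarrow> even (pos W z) = even (pos Z2 z)"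
proof -
  have Mf: "finite M" using M finite_subset by blast
  show "pos W z = pos Z1 z" if "z \<in> Z1" "z < a"
  proof -
    have "{y \<in> W. y < z} = {y \<in> Z1. y < z}" using that M ab by (auto simp: W)
    then show ?thesis by (simp add: pos_def)
  qed
  show "even (pos W z) = even (pos Z2 z)" if z: "z \<in> Z2" "b < z"
  proof -
    let ?H = "{y \<in> Z2. b < y \<and> y < z}"
    have "{y \<in> W. y < z} = ({y \<in> Z1. y < a} \<union> M) \<union> ?H" using z M ab by (auto simp: W)
    moreover have "card (({y \<in> Z1. y < a} \<union> M) \<union> ?H) = card ({y \<in> Z1. y < a} \<union> M) + card ?H"
      using fin Mf M ab by (intro card_Un_disjoint) auto
    moreover have "card ({y \<in> Z1. y < a} \<union> M) = card {y \<in> Z1. y < a} + card M"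
      using fin Mf M by (intro card_Un_disjoint) auto
    moreover have "{y \<in> Z2. y < z} = ({y \<in> Z2. y < a} \<union> {y \<in> Z2. a \<le> y \<and> y \<le> b}) \<union> ?H" using z ab by auto
    moreover have "card (({y \<in> Z2. y < a} \<union> {y \<in> Z2. a \<le> y \<and> y \<le> b}) \<union> ?H) =
        card ({y \<in> Z2. y < a} \<union> {y \<in> Z2. a \<le> y \<and> y \<le> b}) + card ?H"
      using fin ab by (intro card_Un_disjoint) auto
    moreover have "card ({y \<in> Z2. y < a} \<union> {y \<in> Z2. a \<le> y \<and> y \<le> b}) =
        card {y \<in> Z2. y < a} + card {y \<in> Z2. a \<le> y \<and> y \<le> b}"
      using fin by (intro card_Un_disjoint) auto
    ultimately show ?thesis using par R unfolding pos_def by presburger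
  qed
qed

text \<open>Two alternating sets that differ in parity when they pass through \<open>{a..b}\<close> can be cut there and
  recombined; the two recombinations have \<open>2 p\<close> elements in total, and not \<open>p\<close> each.\<close>

lemma splice:
  assumes fin: "finite Z1" "finite Z2" and M: "M \<subseteq> {a..b}" and ab: "a \<le> b"
    and R1: "card {z \<in> Z1. a \<le> z \<and> z \<le> b} = Suc (card M)" and R2: "card {z \<in> Z2. a \<le> z \<and> z \<le> b} = Suc (card M)"
    and card: "card Z1 = Suc p" "card Z2 = Suc p"
    and par: "odd (card {z \<in> Z1. z < a} + card {z \<in> Z2. z < a})"
    and alt: "alternating s c1 Z1" "alternating s c2 Z2"
    and c: "\<And>z. z \<in> Z1 \<union> Z2 \<Longrightarrow> z < a \<or> b < z \<Longrightarrow> c1 ! z = c ! z \<and> c2 ! z = c ! z"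
    and cM: "\<And>z. z \<in> M \<Longrightarrow> c ! z = Zero"
  shows "\<exists>W. W \<subseteq> Z1 \<union> Z2 \<union> M \<and> W \<inter> {a..b} \<subseteq> M \<and> alternating s c W \<and> p < card W"
proof -
  have Mf: "finite M" using M finite_subset by blast
  define W1 where "W1 = {z \<in> Z1. z < a} \<union> M \<union> {z \<in> Z2. b < z}"
  define W2 where "W2 = {z \<in> Z2. z < a} \<union> M \<union> {z \<in> Z1. b < z}"
  have cW: "card (({z \<in> A. z < a} \<union> M) \<union> {z \<in> B. b < z}) = card {z \<in> A. z < a} + card M + card {z \<in> B. b < z}"
    if "finite A" "finite B" for A B
  proof -
    have "card (({z \<in> A. z < a} \<union> M) \<union> {z \<in> B. b < z}) = card ({z \<in> A. z < a} \<union> M) + card {z \<in> B. b < z}"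
      using that Mf M ab by (intro card_Un_disjoint) auto
    moreover have "card ({z \<in> A. z < a} \<union> M) = card {z \<in> A. z < a} + card M"
      using that Mf M by (intro card_Un_disjoint) auto
    ultimately show ?thesis by simp
  qed
  have cZ: "card Z = card {z \<in> Z. z < a} + card {z \<in> Z. a \<le> z \<and> z \<le> b} + card {z \<in> Z. b < z}" if "finite Z" for Z
  proof -
    have "Z = ({z \<in> Z. z < a} \<union> {z \<in> Z. a \<le> z \<and> z \<le> b}) \<union> {z \<in> Z. b < z}" using ab by auto
    then have "card Z = card ({z \<in> Z. z < a} \<union> {z \<in> Z. a \<le> z \<and> z \<le> b}) + card {z \<in> Z. b < z}"
      using that ab by (subst card_Un_disjoint[symmetric]) auto
    moreover have "card ({z \<in> Z. z < a} \<union> {z \<in> Z. a \<le> z \<and> z \<le> b}) = card {z \<in> Z. z < a} + card {z \<in> Z. a \<le> z \<and> z \<le> b}"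
      using that by (intro card_Un_disjoint) auto
    ultimately show ?thesis by simp
  qed
  have alt1: "alternating s c W1"
    unfolding alternating_def
  proof
    fix z assume z: "z \<in> W1"
    then consider "z \<in> Z1" "z < a" | "z \<in> M" | "z \<in> Z2" "b < z" by (auto simp: W1_def)
    then show "c ! z \<noteq> bsgn s (pos W1 z)"
    proof cases
      case 1 then show ?thesis using splice_pos(1)[OF fin M ab R2 par W1_def 1] alt(1) c[of z] by (auto simp: alternating_def)
    next
      case 2 then show ?thesis using cM by auto
    next
      case 3 then show ?thesis using splice_pos(2)[OF fin M ab R2 par W1_def 3] alt(2) c[of z] by (auto simp: alternating_def bsgn_def)
    qed
  qed
  have par': "odd (card {z \<in> Z2. z < a} + card {z \<in> Z1. z < a})" using par by simp
  have alt2: "alternating s c W2"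
    unfolding alternating_def
  proof
    fix z assume z: "z \<in> W2"
    then consider "z \<in> Z2" "z < a" | "z \<in> M" | "z \<in> Z1" "b < z" by (auto simp: W2_def)
    then show "c ! z \<noteq> bsgn s (pos W2 z)"
    proof cases
      case 1 then show ?thesis using splice_pos(1)[OF fin(2,1) M ab R1 par' W2_def 1] alt(2) c[of z] by (auto simp: alternating_def)
    next
      case 2 then show ?thesis using cM by auto
    next
      case 3 then show ?thesis using splice_pos(2)[OF fin(2,1) M ab R1 par' W2_def 3] alt(1) c[of z] by (auto simp: alternating_def bsgn_def)
    qed
  qed
  have "p < card W1 \<or> p < card W2"
    using cW[OF fin] cW[OF fin(2,1)] cZ[OF fin(1)] cZ[OF fin(2)] R1 R2 card par unfolding W1_def W2_def by presburger
  moreover have "W1 \<subseteq> Z1 \<union> Z2 \<union> M \<and> W1 \<inter> {a..b} \<subseteq> M" "W2 \<subseteq> Z1 \<union> Z2 \<union> M \<and> W2 \<inter> {a..b} \<subseteq> M"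
    by (auto simp: W1_def W2_def)
  ultimately show ?thesis using alt1 alt2 by blast
qed

definition unmg :: "nat \<Rightarrow> sign \<Rightarrow> sign \<Rightarrow> sign list \<Rightarrow> sign list" where
  "unmg i a b c = take i c @ [a, b] @ drop (Suc i) c"

lemma length_unmg: "i < length c \<Longrightarrow> length (unmg i a b c) = Suc (length c)"
  by (simp add: unmg_def)

lemma nth_unmg: "i < length c \<Longrightarrow> unmg i a b c ! j =
    (if j < i then c ! j else if j = i then a else if j = Suc i then b else c ! (j - 1))"
  by (cases "j < i"; cases "j = i"; cases "j = Suc i")
    (auto simp: unmg_def nth_append nth_Cons' min_def less_Suc_eq Suc_diff_Suc numeral_2_eq_2)

lemma mg_unmg: "i < length c \<Longrightarrow> sign_max a b = c ! i \<Longrightarrow> mg i (unmg i a b c) = c"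
  by (rule nth_equalityI) (auto simp: length_mg length_unmg nth_mg nth_unmg)

lemma mg_sub:
  assumes e: "length e = Suc m" "i < m" and c: "c \<in> sub (Cube (Suc m)) e"
  shows "mg i c \<in> sub (Cube m) (mg i e)"
proof -
  have len: "length c = Suc m" using c e by (simp add: Cube_sub)
  have c': "e ! j = Zero \<or> c ! j = e ! j" if "j < Suc m" for j using c e that by (simp add: Cube_sub)
  have "mg i e ! j = Zero \<or> mg i c ! j = mg i e ! j" if j: "j < m" for j
  proof (cases "j = i")
    case True
    have "e ! i = Zero \<or> c ! i = e ! i" "e ! Suc i = Zero \<or> c ! Suc i = e ! Suc i" using c'[of i] c'[of "Suc i"] e by auto
    then have "sign_max (e ! i) (e ! Suc i) = Zero \<or> sign_max (c ! i) (c ! Suc i) = sign_max (e ! i) (e ! Suc i)"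
      by (cases "e ! i"; cases "e ! Suc i"; cases "c ! i"; cases "c ! Suc i") simp_all
    then show ?thesis using True e len by (simp add: nth_mg)
  next
    case False
    then show ?thesis using c'[of j] c'[of "Suc j"] j e len by (auto simp: nth_mg)
  qed
  then show ?thesis using e len by (simp add: Cube_sub length_mg)
qed

text \<open>On a set with at most one element in the block, merging is injective and monotone, so it
  carries alternating sets to alternating sets.\<close>

lemma mg_project:
  assumes e: "length e = Suc m" "i < m" and Z: "Z \<subseteq> zs e" "\<not> (i \<in> Z \<and> Suc i \<in> Z)" and alt: "alternating s c Z"
    and blk: "\<And>z. z \<in> Z \<Longrightarrow> z = i \<or> z = Suc i \<Longrightarrow> mg i e ! i = Zero \<and>
        (c ! z \<noteq> bsgn s (pos Z z) \<longrightarrow> c' ! i \<noteq> bsgn s (pos Z z))"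
    and c: "\<And>z. z \<in> Z \<Longrightarrow> z < i \<Longrightarrow> c ! z = c' ! z" "\<And>z. z \<in> Z \<Longrightarrow> Suc i < z \<Longrightarrow> c ! z = c' ! (z - 1)"
  shows "eta i ` Z \<subseteq> zs (mg i e)" "alternating s c' (eta i ` Z)" "card (eta i ` Z) = card Z"
proof -
  have mono: "x < y \<longleftrightarrow> eta i x < eta i y" if "x \<in> Z" "y \<in> Z" for x y
  proof -
    have "(x = i \<and> y = Suc i) = False" "(y = i \<and> x = Suc i) = False" using Z(2) that by auto
    then show ?thesis by (auto simp: eta_def)
  qed
  have "c' ! eta i z \<noteq> bsgn s (pos Z z)" if "z \<in> Z" "c ! z \<noteq> bsgn s (pos Z z)" for z
    using blk[of z] c[of z] that by (cases "z = i \<or> z = Suc i") (auto simp: eta_def)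
  from alternating_image[of Z "eta i" s c c', OF mono alt this]
  show "alternating s c' (eta i ` Z)" "card (eta i ` Z) = card Z" by auto
  show "eta i ` Z \<subseteq> zs (mg i e)"
  proof
    fix j assume "j \<in> eta i ` Z"
    then obtain z where z: "z \<in> Z" "j = eta i z" by auto
    have "z \<in> zs e" using z Z by auto
    then show "j \<in> zs (mg i e)"
      using z blk[of z] e by (cases "z = i \<or> z = Suc i") (auto simp: zs_def eta_def nth_mg length_mg)
  qed
qed

text \<open>An alternating set for the merged word would lift to one for \<open>c\<close> along a
  section of \<open>eta i\<close>: of the two letters in the block, one is a zero of
  \<open>e\<close> at which \<open>c\<close> avoids the forbidden sign.\<close>

lemma mg_bd_image:
  assumes e: "length e = Suc m" "i < m" and c: "c \<in> bd (Cube (Suc m)) s p (sub (Cube (Suc m)) e)"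
  shows "mg i c \<in> bd (Cube m) s p (sub (Cube m) (mg i e))"
proof (rule ccontr)
  assume n: "\<not> ?thesis"
  have cs: "c \<in> sub (Cube (Suc m)) e" using c by (simp add: bd_iff)
  have len: "length c = Suc m" "length (mg i e) = m" using cs e by (auto simp: Cube_sub length_mg)
  obtain Z where Z: "Z \<subseteq> zs (mg i e)" "card Z = Suc p" "alternating s (mg i c) Z"
    using n cube_bd_atom[OF len(2), of "mg i c" s p] mg_sub[OF e cs] by blast
  have c': "e ! j = Zero \<or> c ! j = e ! j" if "j < Suc m" for j using cs e that by (simp add: Cube_sub)
  have "\<exists>u. (u = i \<or> u = Suc i) \<and> (i \<in> Z \<longrightarrow> e ! u = Zero \<and> c ! u \<noteq> bsgn s (pos Z i))"
  proof (cases "i \<in> Z")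
    case True
    have "sign_max (e ! i) (e ! Suc i) = Zero" "sign_max (c ! i) (c ! Suc i) \<noteq> bsgn s (pos Z i)"
      using True Z e len by (auto simp: zs_def nth_mg alternating_def)
    moreover have "e ! i = Zero \<or> c ! i = e ! i" "e ! Suc i = Zero \<or> c ! Suc i = e ! Suc i" using c'[of i] c'[of "Suc i"] e by auto
    moreover have "bsgn s (pos Z i) = Neg \<or> bsgn s (pos Z i) = Pos" by (auto simp: bsgn_def)
    ultimately have "e ! i = Zero \<and> c ! i \<noteq> bsgn s (pos Z i) \<or> e ! Suc i = Zero \<and> c ! Suc i \<noteq> bsgn s (pos Z i)"
      by (cases "e ! i"; cases "e ! Suc i"; cases "c ! i"; cases "c ! Suc i") auto
    then show ?thesis by blast
  qed auto
  then obtain u where u: "u = i \<or> u = Suc i" "i \<in> Z \<Longrightarrow> e ! u = Zero \<and> c ! u \<noteq> bsgn s (pos Z i)" by blast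
  define f where "f j = (if j < i then j else if j = i then u else Suc j)" for j
  have mono: "x < y \<longleftrightarrow> f x < f y" for x y using u(1) by (auto simp: f_def)
  have fc: "c ! f z \<noteq> bsgn s (pos Z z)" if "z \<in> Z" "mg i c ! z \<noteq> bsgn s (pos Z z)" for z
    using that u(2) e len by (auto simp: f_def nth_mg split: if_splits)
  have "f ` Z \<subseteq> zs e"
  proof
    fix j assume "j \<in> f ` Z"
    then obtain z where z: "z \<in> Z" "j = f z" by auto
    then have "z \<in> zs (mg i e)" using Z by auto
    then show "j \<in> zs e" using z u e by (auto simp: zs_def f_def nth_mg length_mg split: if_splits)
  qed
  moreover have "alternating s c (f ` Z)" "card (f ` Z) = card Z"
    using alternating_image[of Z f s "mg i c" c, OF mono Z(3) fc] by auto
  ultimately show False using cube_bd_atomD[OF c e(1), of "f ` Z"] Z(2) by simp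
qed

text \<open>If no lift of \<open>c'\<close> lies in the boundary, each lift has an alternating set,
  and this set must use the block in an essential way, since otherwise it would project to one for
  \<open>c'\<close>. Where one lift does not suffice for a contradiction, the sets of two lifts pass
  the block with opposite parities, and \<open>splice\<close> makes of them a set that does
  project.\<close>

lemma mg_bd_surj:
  assumes e: "length e = Suc m" "i < m" and c': "c' \<in> bd (Cube m) s p (sub (Cube m) (mg i e))"
  shows "\<exists>c\<in>bd (Cube (Suc m)) s p (sub (Cube (Suc m)) e). mg i c = c'"
proof (rule ccontr)
  assume no: "\<not> ?thesis"
  have le: "length (mg i e) = m" using e by (simp add: length_mg)
  have cs: "c' \<in> sub (Cube m) (mg i e)" using c' by (simp add: bd_iff)
  have len: "length c' = m" using cs le by (simp add: Cube_sub)
  have il: "i < length c'" using len e by simp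
  have nb: "\<not> (Z \<subseteq> zs (mg i e) \<and> alternating s c' Z \<and> p < card Z)" for Z
    using cube_bd_atomD[OF c' le] by blast
  have c'j: "mg i e ! j = Zero \<or> c' ! j = mg i e ! j" if "j < m" for j using cs le that by (simp add: Cube_sub)
  have bad: "\<exists>Z\<subseteq>zs e. card Z = Suc p \<and> alternating s (unmg i a b c') Z"
    if ab: "sign_max a b = c' ! i" "e ! i = Zero \<or> a = e ! i" "e ! Suc i = Zero \<or> b = e ! Suc i" for a b
  proof -
    let ?c = "unmg i a b c'"
    have "e ! j = Zero \<or> ?c ! j = e ! j" if "j < Suc m" for j
    proof -
      consider "j < i" | "j = i" | "j = Suc i" | "Suc i < j" by linarith
      then show ?thesis
      proof cases
        case 1 then show ?thesis using c'j[of j] e il by (auto simp: nth_unmg nth_mg)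
      next
        case 4
        then obtain j' where "j = Suc j'" "i < j'" by (cases j) auto
        then show ?thesis using c'j[of j'] e il that by (auto simp: nth_unmg nth_mg)
      qed (use ab il in \<open>auto simp: nth_unmg\<close>)
    qed
    then have "?c \<in> sub (Cube (Suc m)) e" using e len by (simp add: Cube_sub length_unmg)
    moreover have "mg i ?c = c'" using il ab(1) by (rule mg_unmg)
    ultimately show ?thesis using no cube_bd_atom[OF e(1), of ?c s p] by blast
  qed
  have outside: "unmg i a b c' ! z = c' ! z" if "z < i" for a b z using that il by (simp add: nth_unmg)
  have outside': "unmg i a b c' ! z = c' ! (z - 1)" if "Suc i < z" for a b z using that il by (simp add: nth_unmg)
  text \<open>An alternating set meeting the block harmlessly would project to one for \<open>c'\<close>.\<close>
  have proj: False if "Z \<subseteq> zs e" "\<not> (i \<in> Z \<and> Suc i \<in> Z)" "alternating s (unmg i a b c') Z" "p < card Z"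
      "\<And>z. z \<in> Z \<Longrightarrow> z = i \<or> z = Suc i \<Longrightarrow> mg i e ! i = Zero \<and>
        (unmg i a b c' ! z \<noteq> bsgn s (pos Z z) \<longrightarrow> c' ! i \<noteq> bsgn s (pos Z z))" for Z a b
    using mg_project[OF e that(1,2,3,5) outside outside'] nb[of "eta i ` Z"] that(4) by auto
  have mi: "mg i e ! i = sign_max (e ! i) (e ! Suc i)" using e by (simp add: nth_mg)
  have c'i: "sign_max (e ! i) (e ! Suc i) = Zero \<or> c' ! i = sign_max (e ! i) (e ! Suc i)" using c'j[of i] e mi by simp
  have two: "bsgn s (pos Z i) \<noteq> bsgn s (pos Z (Suc i))" if "i \<in> Z" "Suc i \<in> Z" "finite Z" for Z
  proof -
    have "{y \<in> Z. y < Suc i} = insert i {y \<in> Z. y < i}" using that by auto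
    then have "pos Z (Suc i) = Suc (pos Z i)" using that by (simp add: pos_def)
    then show ?thesis by (auto simp: bsgn_def)
  qed
  have fin: "finite Z" if "Z \<subseteq> zs e" for Z using that finite_zs by (rule finite_subset)
  have zin: "z \<in> Z \<Longrightarrow> Z \<subseteq> zs e \<Longrightarrow> e ! z = Zero" for z Z using zs_Zero by blast
  \<comment> \<open>In the block of \<open>e\<close> the letter at \<open>v\<close> is fixed and the
    one at \<open>u\<close> is free. The lifts with \<open>+\<close> and with \<open>-\<close> at
    \<open>u\<close> have alternating sets containing \<open>u\<close> at positions of opposite
    parity; after splicing, nothing of the block is left.\<close>
  have case1: False if u: "u = i \<or> u = Suc i" and v: "v = i \<or> v = Suc i" "u \<noteq> v" "e ! v \<noteq> Zero"
      and b1: "\<exists>Z\<subseteq>zs e. card Z = Suc p \<and> alternating s (unmg i a1 b1 c') Z" "unmg i a1 b1 c' ! u = Pos"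
      and b2: "\<exists>Z\<subseteq>zs e. card Z = Suc p \<and> alternating s (unmg i a2 b2 c') Z" "unmg i a2 b2 c' ! u = Neg" for u v a1 b1 a2 b2
  proof -
    obtain Z1 where Z1: "Z1 \<subseteq> zs e" "card Z1 = Suc p" "alternating s (unmg i a1 b1 c') Z1" using b1 by blast
    obtain Z2 where Z2: "Z2 \<subseteq> zs e" "card Z2 = Suc p" "alternating s (unmg i a2 b2 c') Z2" using b2 by blast
    have v': "v \<notin> Z1" "v \<notin> Z2" using v(3) zin Z1 Z2 by blast+
    have u': "u \<in> Z1" "u \<in> Z2"
      using proj[OF Z1(1) _ Z1(3)] proj[OF Z2(1) _ Z2(3)] u v(1,2) v' Z1(2) Z2(2) by auto
    have "bsgn s (pos Z1 u) = Neg" "bsgn s (pos Z2 u) = Pos"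
      using Z1(3) Z2(3) u' b1(2) b2(2) by (auto simp: alternating_def bsgn_def split: if_splits)
    then have par: "odd (card {z \<in> Z1. z < u} + card {z \<in> Z2. z < u})" by (auto simp: bsgn_def pos_def split: if_splits)
    have "{z \<in> Z1. u \<le> z \<and> z \<le> u} = {u}" "{z \<in> Z2. u \<le> z \<and> z \<le> u} = {u}" using u' by auto
    then have R: "card {z \<in> Z1. u \<le> z \<and> z \<le> u} = Suc (card {})" "card {z \<in> Z2. u \<le> z \<and> z \<le> u} = Suc (card {})"
      by simp_all
    have agree: "unmg i a1 b1 c' ! z = unmg i a1 b1 c' ! z \<and> unmg i a2 b2 c' ! z = unmg i a1 b1 c' ! z"
      if "z \<in> Z1 \<union> Z2" "z < u \<or> u < z" for z
    proof -
      have "z \<noteq> u" "z \<noteq> v" using that v' by auto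
      then have "z < i \<or> Suc i < z" using u v(1,2) by auto
      then show ?thesis using outside outside' by auto
    qed
    have "\<exists>W. W \<subseteq> Z1 \<union> Z2 \<union> {} \<and> W \<inter> {u..u} \<subseteq> {} \<and> alternating s (unmg i a1 b1 c') W \<and> p < card W"
      by (rule splice[OF fin[OF Z1(1)] fin[OF Z2(1)] _ _ R Z1(2) Z2(2) par Z1(3) Z2(3) agree]) auto
    then obtain W where W: "W \<subseteq> Z1 \<union> Z2" "u \<notin> W" "alternating s (unmg i a1 b1 c') W" "p < card W"
      by auto
    have "W \<subseteq> zs e" "v \<notin> W" using W(1) Z1(1) Z2(1) v' by auto
    then show False using proj[OF _ _ W(3,4)] u v(1,2) W(2) by auto
  qed
  consider (A) "e ! i = Pos" "e ! Suc i = Zero" | (B) "e ! i = Zero" "e ! Suc i = Pos"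
    | (C) "e ! i \<noteq> Zero" "e ! Suc i \<noteq> Zero" | (D) "e ! i = Zero" "e ! Suc i = Neg" | (E) "e ! i = Neg" "e ! Suc i = Zero"
    | (F) "e ! i = Zero" "e ! Suc i = Zero"
    by (cases "e ! i"; cases "e ! Suc i") auto
  then show False
  proof cases
    case A
    then have "c' ! i = Pos" using c'i by simp
    then show False using case1[of "Suc i" i, OF _ _ _ _ bad[of Pos Pos] _ bad[of Pos Neg]] A il by (auto simp: nth_unmg)
  next
    case B
    then have "c' ! i = Pos" using c'i by simp
    then show False using case1[of i "Suc i", OF _ _ _ _ bad[of Pos Pos] _ bad[of Neg Pos]] B il by (auto simp: nth_unmg)
  next
    case C
    then have "c' ! i = sign_max (e ! i) (e ! Suc i)" using c'i by (auto simp: sign_max_simps)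
    then obtain Z where Z: "Z \<subseteq> zs e" "card Z = Suc p" "alternating s (unmg i (e ! i) (e ! Suc i) c') Z" using bad by metis
    have "i \<notin> Z" "Suc i \<notin> Z" using C zin Z(1) by blast+
    then show False by (intro proj[OF Z(1) _ Z(3)]) (use Z(2) in auto)
  next
    case D
    then obtain Z where Z: "Z \<subseteq> zs e" "card Z = Suc p" "alternating s (unmg i (c' ! i) Neg c') Z"
      using bad[of "c' ! i" Neg] by (cases "c' ! i") auto
    have "Suc i \<notin> Z" using D zin[of "Suc i" Z] Z(1) by auto
    then show False by (intro proj[OF Z(1) _ Z(3)]) (use Z(2) D mi il in \<open>auto simp: nth_unmg\<close>)
  next
    case E
    then obtain Z where Z: "Z \<subseteq> zs e" "card Z = Suc p" "alternating s (unmg i Neg (c' ! i) c') Z"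
      using bad[of Neg "c' ! i"] by auto
    have "i \<notin> Z" using E zin[of "i" Z] Z(1) by auto
    then show False by (intro proj[OF Z(1) _ Z(3)]) (use Z(2) E mi il in \<open>auto simp: nth_unmg\<close>)
  next
    case F
    show False
    proof (cases "c' ! i = Zero")
      case False
      then obtain Z where Z: "Z \<subseteq> zs e" "card Z = Suc p" "alternating s (unmg i (c' ! i) (c' ! i) c') Z"
        using bad[of "c' ! i" "c' ! i"] F by (cases "c' ! i") auto
      \<comment> \<open>Consecutive positions forbid opposite letters, so the same letter at both of
        them would have to be a zero.\<close>
      have "\<not> (i \<in> Z \<and> Suc i \<in> Z)"
      proof
        assume a: "i \<in> Z \<and> Suc i \<in> Z"
        then have "c' ! i \<noteq> bsgn s (pos Z i)" "c' ! i \<noteq> bsgn s (pos Z (Suc i))"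
          using Z(3) il by (auto simp: alternating_def nth_unmg)
        then show False using two[OF _ _ fin[OF Z(1)]] a False by (cases "c' ! i") (auto simp: bsgn_def split: if_splits)
      qed
      then show False by (intro proj[OF Z(1) _ Z(3)]) (use Z(2) F mi il in \<open>auto simp: nth_unmg\<close>)
    next
      case True
      \<comment> \<open>The lifts \<open>0-\<close> and \<open>-0\<close> force both positions of
        the block into their sets. Splicing keeps only \<open>i\<close>, where the lift
        \<open>0-\<close> has a zero, and the result projects.\<close>
      obtain Z1 where Z1: "Z1 \<subseteq> zs e" "card Z1 = Suc p" "alternating s (unmg i Zero Neg c') Z1"
        using bad[of Zero Neg] F True by auto
      obtain Z2 where Z2: "Z2 \<subseteq> zs e" "card Z2 = Suc p" "alternating s (unmg i Neg Zero c') Z2"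
        using bad[of Neg Zero] F True by auto
      have b: "i \<in> Z1 \<and> Suc i \<in> Z1" "i \<in> Z2 \<and> Suc i \<in> Z2"
        using proj[OF Z1(1) _ Z1(3)] proj[OF Z2(1) _ Z2(3)] Z1(2) Z2(2) True F mi by auto
      have "Neg \<noteq> bsgn s (pos Z1 (Suc i))" "Neg \<noteq> bsgn s (pos Z2 i)"
        using Z1(3) Z2(3) b il by (auto simp: alternating_def nth_unmg)
      moreover have "bsgn s (pos Z1 i) \<noteq> bsgn s (pos Z1 (Suc i))" using two b fin Z1(1) by blast
      ultimately have par: "odd (card {z \<in> Z1. z < i} + card {z \<in> Z2. z < i})"
        by (auto simp: bsgn_def pos_def split: if_splits)
      have "{z \<in> Z1. i \<le> z \<and> z \<le> Suc i} = {i, Suc i}" "{z \<in> Z2. i \<le> z \<and> z \<le> Suc i} = {i, Suc i}" using b by auto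
      then have R: "card {z \<in> Z1. i \<le> z \<and> z \<le> Suc i} = Suc (card {i})" "card {z \<in> Z2. i \<le> z \<and> z \<le> Suc i} = Suc (card {i})"
        by simp_all
      have agree: "unmg i Zero Neg c' ! z = unmg i Zero Neg c' ! z \<and> unmg i Neg Zero c' ! z = unmg i Zero Neg c' ! z"
        if "z < i \<or> Suc i < z" for z
        using that outside outside' by auto
      have "\<exists>W. W \<subseteq> Z1 \<union> Z2 \<union> {i} \<and> W \<inter> {i..Suc i} \<subseteq> {i} \<and> alternating s (unmg i Zero Neg c') W \<and> p < card W"
        by (rule splice[OF fin[OF Z1(1)] fin[OF Z2(1)] _ _ R Z1(2) Z2(2) par Z1(3) Z2(3) agree])
          (use il in \<open>auto simp: nth_unmg\<close>)
      then obtain W where W: "W \<subseteq> Z1 \<union> Z2 \<union> {i}" "W \<inter> {i..Suc i} \<subseteq> {i}" "alternating s (unmg i Zero Neg c') W" "p < card W"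
        by blast
      have "W \<subseteq> zs e" "Suc i \<notin> W" using W(1,2) Z1(1) Z2(1) b by auto
      then show False using proj[OF _ _ W(3,4)] True F mi by auto
    qed
  qed
qed

text \<open>A boundary of sufficiently high order is the whole set, so surjectivity on subfaces is a
  case of \<open>mg_bd_surj\<close>.\<close>

lemma mg_sub_image:
  assumes e: "length e = Suc m" "i < m"
  shows "mg i ` sub (Cube (Suc m)) e = sub (Cube m) (mg i e)"
proof -
  have "bd (Cube k) s k (sub (Cube k) a) = sub (Cube k) a" if "length a = k" for s k a
  proof (rule bd_low)
    fix b assume "b \<in> sub (Cube k) a"
    then show "fdim (Cube k) b \<le> k" using that card_mono[OF _ zs_subset[of b]] by (simp add: Cube_sub)
  qed
  then have "c' \<in> bd (Cube m) True (Suc m) (sub (Cube m) (mg i e))" if "c' \<in> sub (Cube m) (mg i e)" for c'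
  proof -
    have "bd (Cube m) True (Suc m) (sub (Cube m) (mg i e)) = sub (Cube m) (mg i e)"
    proof (rule bd_low)
      fix b assume "b \<in> sub (Cube m) (mg i e)"
      then show "fdim (Cube m) b \<le> Suc m" using e card_mono[OF _ zs_subset[of b]] by (simp add: Cube_sub length_mg)
    qed
    then show ?thesis using that by simp
  qed
  then show ?thesis using mg_sub[OF e] mg_bd_surj[OF e] bd_subset by (fastforce simp: image_iff)
qed

lemma cell_map_mg:
  assumes "i < m"
  shows "cell_map (Cube (Suc m)) (Cube m) ((`) (mg i))"
proof (rule cell_map_image[OF cube.pasting_axioms cube.pasting_axioms])
  fix a assume a: "a \<in> faces (Cube (Suc m))"
  then have s: "mg i ` sub (Cube (Suc m)) a = sub (Cube m) (mg i a)" using mg_sub_image assms by simp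
  then show "mg i ` sub (Cube (Suc m)) a \<in> cells (Cube m)"
    using a assms cells.atom[of "mg i a" "Cube m"] by (simp add: length_mg)
  show "mg i ` bd (Cube (Suc m)) s p (sub (Cube (Suc m)) a) = bd (Cube m) s p (mg i ` sub (Cube (Suc m)) a)" for s p
    unfolding s using a assms mg_bd_image[of a m i _ s p] mg_bd_surj[of a m i _ s p] by (fastforce simp: image_iff)
qed

section \<open>Functors on categories of cells\<close>

lemma functors_cell_iff:
  "F \<in> functors (cell_cat K) E \<longleftrightarrow> F \<in> cells K \<rightarrow>\<^sub>E carr E \<and>
     (\<forall>X\<in>cells K. \<forall>p. F (bd K True p X) = src E p (F X) \<and> F (bd K False p X) = tgt E p (F X)) \<and>
     (\<forall>p. \<forall>X\<in>cells K. \<forall>Y\<in>cells K. bd K False p X = bd K True p Y \<longrightarrow> F (X \<union> Y) = cmp E p (F X) (F Y))"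
  by (auto simp: functors_def cell_cat_def bd_True bd_False)

lemma functorD:
  assumes "F \<in> functors (cell_cat K) E" "X \<in> cells K"
  shows "F X \<in> carr E" "F (bd K True p X) = src E p (F X)" "F (bd K False p X) = tgt E p (F X)"
    and "Y \<in> cells K \<Longrightarrow> bd K False p X = bd K True p Y \<Longrightarrow> F (X \<union> Y) = cmp E p (F X) (F Y)"
  using assms by (auto simp: functors_cell_iff)

lemma functor_outside: "F \<in> functors (cell_cat K) E \<Longrightarrow> X \<notin> cells K \<Longrightarrow> F X = undefined"
  unfolding functors_cell_iff by (elim conjE) (rule PiE_arb)

lemma functor_eqI:
  assumes F: "F \<in> functors (cell_cat K) E" and G: "G \<in> functors (cell_cat K) E"
    and eq: "\<And>x. x \<in> faces K \<Longrightarrow> F (sub K x) = G (sub K x)"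
  shows "F = G"
proof (rule ext)
  fix X
  show "F X = G X"
  proof (cases "X \<in> cells K")
    case True
    then show ?thesis
    proof (induction rule: cells_induct)
      case (bd X s p)
      have "F (bd K True p X) = G (bd K True p X)" "F (bd K False p X) = G (bd K False p X)"
        unfolding functorD(2,3)[OF F bd(1)] functorD(2,3)[OF G bd(1)] bd(2) by (rule refl)+
      then show ?case by (cases s) simp_all
    next
      case (comp X Y p)
      show ?case
        unfolding functorD(4)[OF F comp(1,2,3)] functorD(4)[OF G comp(1,2,3)] comp(4,5) by (rule refl)
    qed (rule eq)
  next
    case False then show ?thesis using functor_outside[OF F] functor_outside[OF G] by simp
  qed
qed

lemma functor_ext_eqI:
  assumes "F \<in> functors (cell_cat K) E" "\<And>x. x \<in> faces K \<Longrightarrow> F (sub K x) = f x"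
  shows "functor_ext K E f = F"
  unfolding functor_ext_def
proof (rule the_equality)
  show "F \<in> functors (cell_cat K) E \<and> (\<forall>x\<in>faces K. F (sub K x) = f x)" using assms by blast
  fix G assume "G \<in> functors (cell_cat K) E \<and> (\<forall>x\<in>faces K. G (sub K x) = f x)"
  then show "G = F" using assms by (intro functor_eqI[of G K E F]) auto
qed

definition pb :: "'f face_system \<Rightarrow> ('f set \<Rightarrow> 'g set) \<Rightarrow> ('g set \<Rightarrow> 'b) \<Rightarrow> 'f set \<Rightarrow> 'b" where
  "pb K \<Phi> F = (\<lambda>X\<in>cells K. F (\<Phi> X))"

lemma pb_apply: "X \<in> cells K \<Longrightarrow> pb K \<Phi> F X = F (\<Phi> X)"
  by (simp add: pb_def)

lemma pb_functor:
  assumes "cell_map K L \<Phi>" "F \<in> functors (cell_cat L) E"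
  shows "pb K \<Phi> F \<in> functors (cell_cat K) E"
  unfolding functors_cell_iff
proof (intro conjI ballI allI impI)
  show "pb K \<Phi> F \<in> cells K \<rightarrow>\<^sub>E carr E"
    using cell_mapD(1)[OF assms(1)] functorD(1)[OF assms(2)] by (auto simp: pb_def)
  fix X p assume X: "X \<in> cells K"
  show "pb K \<Phi> F (bd K True p X) = src E p (pb K \<Phi> F X)" "pb K \<Phi> F (bd K False p X) = tgt E p (pb K \<Phi> F X)"
    using X cells_bd[OF X] cell_mapD[OF assms(1) X] functorD[OF assms(2)] by (simp_all add: pb_apply)
  fix Y assume Y: "Y \<in> cells K" and c: "bd K False p X = bd K True p Y"
  have "X \<union> Y \<in> cells K" using cells_comp X Y c by blast
  moreover have "bd L False p (\<Phi> X) = bd L True p (\<Phi> Y)"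
    using c cell_mapD(2)[OF assms(1) X] cell_mapD(2)[OF assms(1) Y] by metis
  ultimately show "pb K \<Phi> F (X \<union> Y) = cmp E p (pb K \<Phi> F X) (pb K \<Phi> F Y)"
    using X Y cell_mapD[OF assms(1) X] cell_mapD(1)[OF assms(1) Y] functorD(4)[OF assms(2)] by (simp add: pb_apply)
qed

lemma functor_ext_pb:
  assumes "cell_map K L \<Phi>" "F \<in> functors (cell_cat L) E" "\<And>x. x \<in> faces K \<Longrightarrow> f x = F (\<Phi> (sub K x))"
  shows "functor_ext K E f = pb K \<Phi> F"
  using pb_functor[OF assms(1,2)] assms(3) by (intro functor_ext_eqI) (auto simp: pb_apply cells.atom)

lemma pb_pb:
  "cell_map K L \<Phi> \<Longrightarrow> pb K \<Phi> (pb L \<Psi> F) = pb K (\<lambda>X. \<Psi> (\<Phi> X)) F"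
  by (auto simp: pb_def cell_mapD(1) intro!: restrict_ext)

lemma pb_cong: "(\<And>X. X \<in> cells K \<Longrightarrow> \<Phi> X = \<Psi> X) \<Longrightarrow> pb K \<Phi> F = pb K \<Psi> F"
  by (auto simp: pb_def intro!: restrict_ext)

lemma pb_id: "F \<in> functors (cell_cat K) E \<Longrightarrow> (\<And>X. X \<in> cells K \<Longrightarrow> \<Phi> X = X) \<Longrightarrow> pb K \<Phi> F = F"
proof (rule ext)
  fix X assume F: "F \<in> functors (cell_cat K) E" and *: "\<And>X. X \<in> cells K \<Longrightarrow> \<Phi> X = X"
  show "pb K \<Phi> F X = F X"
    using *[of X] functor_outside[OF F, of X] by (cases "X \<in> cells K") (simp_all add: pb_def)
qed

context polytope_geometry
begin

text \<open>By \<open>covers\<close>, a boundary meets the fibre of every point of the cell.\<close>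

lemma cells_nonempty: "X \<in> cells K \<Longrightarrow> X \<noteq> {}"
proof (induction rule: cells_induct)
  case (atom x) then show ?case using sub_refl by auto
next
  case (bd X s p)
  then obtain a where a: "a \<in> X" by auto
  then have "a \<in> faces K" using cells_faces[OF bd(1)] by blast
  then obtain x where "x \<in> inn a" using inn_nonempty by blast
  then have "x \<in> rl X" using in_rl[OF cells_faces[OF bd(1)] a] by blast
  then show ?case using good_covers[OF cells_good[OF bd(1)], of x s p] by (auto simp: rl_def)
qed auto

end

subsection \<open>Simplicial operators as maps of cells\<close>

lemma Delta_sub_image: "((`) f) ` sub (Delta n) \<sigma> = sub (Delta m) (f ` \<sigma>)"
  by (auto simp: subset_image_iff image_iff)

text \<open>An operator on words that lies over a map \<open>f\<close> of positions and reflects the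
  vertex \<open>-...-\<close>. Inserting \<open>-\<close> lies over \<open>delta\<close> and merging
  lies over \<open>eta\<close>, so the faces and the degeneracies of both nerves are treated
  together.\<close>

locale word_operator =
  fixes m n :: nat and \<phi> :: "sign list \<Rightarrow> sign list" and f :: "nat \<Rightarrow> nat"
  assumes Pos_iff: "length k = Suc m \<Longrightarrow> Pos \<in> set (\<phi> k) \<longleftrightarrow> Pos \<in> set k"
    and zs_\<phi>: "length k = Suc m \<Longrightarrow> Pos \<notin> set k \<Longrightarrow> zs (\<phi> k) = f ` zs k"
    and length_\<phi>: "length k = Suc m \<Longrightarrow> length (\<phi> k) = Suc n"
    and Neg_iff: "length k = Suc m \<Longrightarrow> \<phi> k = replicate (Suc n) Neg \<longleftrightarrow> k = replicate (Suc m) Neg"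
    and sub_\<phi>: "length k = Suc m \<Longrightarrow> \<phi> ` sub (Cube (Suc m)) k = sub (Cube (Suc n)) (\<phi> k)"
    and map_\<phi>: "cell_map (Cube (Suc m)) (Cube (Suc n)) ((`) \<phi>)"
begin

lemma col_\<phi>: "X \<subseteq> faces (Cube (Suc m)) \<Longrightarrow> col (\<phi> ` X) = ((`) f) ` col X"
proof (intro equalityI subsetI)
  fix \<sigma> assume X: "X \<subseteq> faces (Cube (Suc m))" and "\<sigma> \<in> col (\<phi> ` X)"
  then obtain k where k: "k \<in> X" "Pos \<notin> set (\<phi> k)" "zs (\<phi> k) \<noteq> {}" "\<sigma> = zs (\<phi> k)" by (auto simp: col_def)
  then have "length k = Suc m" using X by auto
  then have "Pos \<notin> set k" "zs (\<phi> k) = f ` zs k" using k Pos_iff zs_\<phi> by auto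
  then show "\<sigma> \<in> ((`) f) ` col X" using k by (auto simp: col_def)
next
  fix \<sigma> assume X: "X \<subseteq> faces (Cube (Suc m))" and "\<sigma> \<in> ((`) f) ` col X"
  then obtain k where k: "k \<in> X" "Pos \<notin> set k" "zs k \<noteq> {}" "\<sigma> = f ` zs k" by (auto simp: col_def)
  then have l: "length k = Suc m" using X by auto
  then have "zs (\<phi> k) = \<sigma>" "Pos \<notin> set (\<phi> k)" using k Pos_iff zs_\<phi> by auto
  moreover have "\<sigma> \<noteq> {}" using k by simp
  ultimately show "\<sigma> \<in> col (\<phi> ` X)" using k(1) unfolding col_def by blast
qed

lemma f_bound: "v \<le> m \<Longrightarrow> f v \<le> n"
proof -
  assume v: "v \<le> m"
  have "zs (word (Suc m) {v}) = {v}" using v by (intro zs_word) auto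
  then have "zs (\<phi> (word (Suc m) {v})) = {f v}" using zs_\<phi>[of "word (Suc m) {v}"] by simp
  then show ?thesis using zs_less[of "f v" "\<phi> (word (Suc m) {v})"] length_\<phi>[of "word (Suc m) {v}"] by simp
qed

text \<open>A boundary in a simplex is \<open>col\<close> of a boundary one order higher in a cube,
  where the operator on words is known to commute with boundaries. This replaces a direct study of
  simplicial operators on cells.\<close>

lemma cell_map_f: "cell_map (Delta m) (Delta n) ((`) ((`) f))"
proof (rule cell_map_image[OF simplex.pasting_axioms simplex.pasting_axioms])
  fix \<sigma> assume s: "\<sigma> \<in> faces (Delta m)"
  let ?w = "word (Suc m) \<sigma>"
  have fs: "f ` \<sigma> \<in> faces (Delta n)" using s f_bound by auto
  show "((`) f) ` sub (Delta m) \<sigma> \<in> cells (Delta n)"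
    unfolding Delta_sub_image[of f m \<sigma> n] using fs by (rule cells.atom)
  fix s p
  have z: "zs ?w = \<sigma>" using s by (intro zs_word) auto
  have "((`) f) ` bd (Delta m) s p (sub (Delta m) \<sigma>) =
      ((`) f) ` col (bd (Cube (Suc m)) s (Suc p) (sub (Cube (Suc m)) ?w))"
    using s by (subst Delta_bd_atom) auto
  also have "\<dots> = col (\<phi> ` bd (Cube (Suc m)) s (Suc p) (sub (Cube (Suc m)) ?w))"
    by (rule col_\<phi>[symmetric]) (auto simp: bd_iff Cube_sub)
  also have "\<dots> = col (bd (Cube (Suc n)) s (Suc p) (sub (Cube (Suc n)) (\<phi> ?w)))"
    using cell_mapD(2)[OF map_\<phi> cells.atom[of ?w], of s "Suc p"] sub_\<phi>[of ?w] by simp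
  also have "\<dots> = bd (Delta n) s p (col (sub (Cube (Suc n)) (\<phi> ?w)))"
    by (rule col_bd) (auto simp: Cube_sub length_\<phi>)
  also have "col (sub (Cube (Suc n)) (\<phi> ?w)) = sub (Delta n) (f ` \<sigma>)"
    using col_sub_no_Pos[of "\<phi> ?w" "Suc n" n] zs_\<phi>[of ?w] Pos_iff[of ?w] z by (simp add: length_\<phi>)
  finally show "((`) f) ` bd (Delta m) s p (sub (Delta m) \<sigma>) = bd (Delta n) s p (((`) f) ` sub (Delta m) \<sigma>)"
    unfolding Delta_sub_image[of f m \<sigma> n] .
qed

end

lemma all_Neg_iff: "length k = m \<Longrightarrow> k = replicate m Neg \<longleftrightarrow> (\<forall>j<m. k ! j = Neg)"
  by (auto simp: list_eq_iff_nth_eq)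

lemma Pos_iff_nth: "Pos \<in> set k \<longleftrightarrow> (\<exists>j<length k. k ! j = Pos)"
  by (auto simp: in_set_conv_nth)

lemma ins_all: "i \<le> length k \<Longrightarrow> (\<forall>j<Suc (length k). P (ins i \<alpha> k ! j)) \<longleftrightarrow> P \<alpha> \<and> (\<forall>j<length k. P (k ! j))"
proof -
  assume i: "i \<le> length k"
  have "set (ins i \<alpha> k) = insert \<alpha> (set k)"
  proof -
    have "set k = set (take i k) \<union> set (drop i k)" by (metis append_take_drop_id set_append)
    then show ?thesis by (simp add: ins_def)
  qed
  then have "(\<forall>x\<in>set (ins i \<alpha> k). P x) \<longleftrightarrow> P \<alpha> \<and> (\<forall>x\<in>set k. P x)" by simp
  then show ?thesis by (simp add: all_set_conv_all_nth)
qed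

lemma word_operator_ins: "i \<le> Suc n \<Longrightarrow> word_operator n (Suc n) (ins i Neg) (delta i)"
proof
  fix k :: "sign list" assume i: "i \<le> Suc n" and k: "length k = Suc n"
  show "Pos \<in> set (ins i Neg k) \<longleftrightarrow> Pos \<in> set k"
    using ins_all[of i k "\<lambda>x. x \<noteq> Pos" Neg] i k unfolding Pos_iff_nth by auto
  show "Pos \<notin> set k \<Longrightarrow> zs (ins i Neg k) = delta i ` zs k" using i k by (simp add: zs_ins)
  show "length (ins i Neg k) = Suc (Suc n)" using k by simp
  show "ins i Neg k = replicate (Suc (Suc n)) Neg \<longleftrightarrow> k = replicate (Suc n) Neg"
    using ins_all[of i k "\<lambda>x. x = Neg" Neg] i k all_Neg_iff[of "ins i Neg k" "Suc (Suc n)"] all_Neg_iff[of k "Suc n"] by simp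
  show "ins i Neg ` sub (Cube (Suc n)) k = sub (Cube (Suc (Suc n))) (ins i Neg k)" using ins_sub[of k "Suc n" i Neg] i k by simp
next
  assume "i \<le> Suc n" then show "cell_map (Cube (Suc n)) (Cube (Suc (Suc n))) ((`) (ins i Neg))"
    by (rule cell_map_ins) simp
qed

lemma mg_ex:
  assumes "Suc i < length k" "\<And>a b. P (sign_max a b) \<longleftrightarrow> P a \<or> P b"
  shows "(\<exists>j<length k - 1. P (mg i k ! j)) \<longleftrightarrow> (\<exists>j<length k. P (k ! j))"
proof
  assume "\<exists>j<length k - 1. P (mg i k ! j)"
  then obtain j where j: "j < length k - 1" "P (mg i k ! j)" by auto
  then show "\<exists>j<length k. P (k ! j)"
    using assms by (auto simp: nth_mg split: if_splits intro: exI[of _ j] exI[of _ i] exI[of _ "Suc i"] exI[of _ "Suc j"])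
next
  assume "\<exists>j<length k. P (k ! j)"
  then obtain j where j: "j < length k" "P (k ! j)" by auto
  have "P (mg i k ! eta i j)"
  proof (cases "j = i \<or> j = Suc i")
    case True then show ?thesis using j assms by (auto simp: nth_mg eta_def)
  next
    case False then show ?thesis using j assms(1) by (auto simp: nth_mg eta_def)
  qed
  moreover have "eta i j < length k - 1" using j assms(1) by (auto simp: eta_def)
  ultimately show "\<exists>j<length k - 1. P (mg i k ! j)" by blast
qed

lemma word_operator_mg: "i \<le> n \<Longrightarrow> word_operator (Suc n) n (mg i) (eta i)"
proof
  fix k :: "sign list" assume i: "i \<le> n" and k: "length k = Suc (Suc n)"
  have si: "Suc i < length k" using i k by simp
  show P: "Pos \<in> set (mg i k) \<longleftrightarrow> Pos \<in> set k"
    using mg_ex[OF si, of "\<lambda>x. x = Pos"] length_mg[OF si] unfolding Pos_iff_nth by (simp add: sign_max_simps)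
  show "Pos \<notin> set k \<Longrightarrow> zs (mg i k) = eta i ` zs k" using si by (intro zs_mg) (auto simp: Pos_iff_nth)
  show l: "length (mg i k) = Suc n" using k length_mg[OF si] by simp
  show "mg i k = replicate (Suc n) Neg \<longleftrightarrow> k = replicate (Suc (Suc n)) Neg"
    using mg_ex[OF si, of "\<lambda>x. x \<noteq> Neg"] all_Neg_iff[OF l] all_Neg_iff[OF k] k by (auto simp: sign_max_simps)
  show "mg i ` sub (Cube (Suc (Suc n))) k = sub (Cube (Suc n)) (mg i k)" using i k by (intro mg_sub_image) auto
next
  assume "i \<le> n" then show "cell_map (Cube (Suc (Suc n))) (Cube (Suc n)) ((`) (mg i))" by (intro cell_map_mg) simp
qed

section \<open>The nerves\<close>

subsection \<open>Laws of \<open>\<omega>\<close>-categories\<close>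

lemma path_cat_simps [simp]:
  "carr (path_cat C) = {x \<in> carr C. Defs.dim C x > 0}" "cmp (path_cat C) p = cmp C (Suc p)"
  "src (path_cat C) p = src C (Suc p)" "tgt (path_cat C) p = tgt C (Suc p)"
  by (auto simp: path_cat_def)

lemma dim_0: "src C 0 x = x \<Longrightarrow> tgt C 0 x = x \<Longrightarrow> Defs.dim C x = 0"
  by (simp add: Defs.dim_def Least_eq_0)

lemma dim_1: "src C 1 x = x \<Longrightarrow> tgt C 1 x = x \<Longrightarrow> \<not> (src C 0 x = x \<and> tgt C 0 x = x) \<Longrightarrow> Defs.dim C x = 1"
  unfolding Defs.dim_def by (rule Least_equality) (auto simp: Suc_le_eq intro: gr0I)

locale omega =
  fixes C :: "'a ocat"
  assumes omega: "omega_category C"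
begin

lemma one: "one_set_category (carr C) (cmp C p) (src C p) (tgt C p)"
  using omega by (simp add: omega_category_def)

lemma src_carr: "x \<in> carr C \<Longrightarrow> src C p x \<in> carr C" and tgt_carr: "x \<in> carr C \<Longrightarrow> tgt C p x \<in> carr C"
  and src_src: "x \<in> carr C \<Longrightarrow> src C p (src C p x) = src C p x"
  and tgt_src: "x \<in> carr C \<Longrightarrow> tgt C p (src C p x) = src C p x"
  and src_tgt: "x \<in> carr C \<Longrightarrow> src C p (tgt C p x) = tgt C p x"
  and tgt_tgt: "x \<in> carr C \<Longrightarrow> tgt C p (tgt C p x) = tgt C p x"
  and unit_src: "x \<in> carr C \<Longrightarrow> cmp C p (src C p x) x = x" and unit_tgt: "x \<in> carr C \<Longrightarrow> cmp C p x (tgt C p x) = x"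
  using one[of p] by (auto simp: one_set_category_def)

lemma glob:
  assumes "m < n" "x \<in> carr C"
  shows "src C n (src C m x) = src C m x" "tgt C n (src C m x) = src C m x"
    "src C n (tgt C m x) = tgt C m x" "tgt C n (tgt C m x) = tgt C m x"
    "src C m (src C n x) = src C m x" "src C m (tgt C n x) = src C m x"
    "tgt C m (src C n x) = tgt C m x" "tgt C m (tgt C n x) = tgt C m x"
  using omega assms by (auto simp: omega_category_def)

lemma bd_cmp:
  assumes "i \<noteq> j" "x \<in> carr C" "y \<in> carr C" "tgt C j x = src C j y"
  shows "src C i (cmp C j x y) = cmp C j (src C i x) (src C i y)" "tgt C i (cmp C j x y) = cmp C j (tgt C i x) (tgt C i y)"
  using omega assms by (auto simp: omega_category_def)

lemma dim_fixed: "x \<in> carr C \<Longrightarrow> src C (Defs.dim C x) x = x \<and> tgt C (Defs.dim C x) x = x"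
proof -
  assume x: "x \<in> carr C"
  have "\<forall>x\<in>carr C. \<exists>n. src C n x = x \<and> tgt C n x = x" using omega unfolding omega_category_def by (elim conjE)
  then have "\<exists>n. src C n x = x \<and> tgt C n x = x" using x by (rule bspec)
  then show ?thesis unfolding Defs.dim_def by (rule LeastI_ex)
qed

lemma dim_0_iff: "x \<in> carr C \<Longrightarrow> Defs.dim C x = 0 \<longleftrightarrow> src C 0 x = x \<and> tgt C 0 x = x"
  using dim_fixed[of x] dim_0[of C x] by auto

lemma point_src: "x \<in> carr C \<Longrightarrow> Defs.dim C (src C 0 x) = 0" and point_tgt: "x \<in> carr C \<Longrightarrow> Defs.dim C (tgt C 0 x) = 0"
  using src_src[of x 0] tgt_src[of x 0] src_tgt[of x 0] tgt_tgt[of x 0] by (auto intro: dim_0)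

lemma point_fixed: "x \<in> carr C \<Longrightarrow> Defs.dim C x = 0 \<Longrightarrow> src C p x = x \<and> tgt C p x = x"
  using dim_0_iff[of x] glob(1,2)[of 0 p x] by (cases p) auto

end

subsection \<open>The globular nerve\<close>

lemma globular_simp [simp]: "simp (globular_nerve C) n = functors (cell_cat (Delta n)) (path_cat C)"
  by (simp add: globular_nerve_def)

lemma cell_map_delta: "i \<le> Suc n \<Longrightarrow> cell_map (Delta n) (Delta (Suc n)) ((`) ((`) (delta i)))"
  by (rule word_operator.cell_map_f[OF word_operator_ins])

lemma cell_map_eta: "i \<le> n \<Longrightarrow> cell_map (Delta (Suc n)) (Delta n) ((`) ((`) (eta i)))"
  by (rule word_operator.cell_map_f[OF word_operator_mg])

lemma globular_face:
  assumes "i \<le> Suc n" "x \<in> simp (globular_nerve C) (Suc n)"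
  shows "face (globular_nerve C) n i x = pb (Delta n) ((`) ((`) (delta i))) x"
  unfolding globular_nerve_def using assms Delta_sub_image[of "delta i" n _ "Suc n"]
  by (auto intro!: functor_ext_pb[OF cell_map_delta] simp del: Delta_sub)

lemma globular_degen:
  assumes "i \<le> n" "x \<in> simp (globular_nerve C) n"
  shows "degen (globular_nerve C) n i x = pb (Delta (Suc n)) ((`) ((`) (eta i))) x"
  unfolding globular_nerve_def using assms Delta_sub_image[of "eta i" "Suc n" _ n]
  by (auto intro!: functor_ext_pb[OF cell_map_eta] simp del: Delta_sub)

lemma globular_face_in: "i \<le> Suc n \<Longrightarrow> x \<in> simp (globular_nerve C) (Suc n) \<Longrightarrow> face (globular_nerve C) n i x \<in> simp (globular_nerve C) n"
  using globular_face[of i n x C] pb_functor[OF cell_map_delta] by (metis globular_simp)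

lemma globular_degen_in: "i \<le> n \<Longrightarrow> x \<in> simp (globular_nerve C) n \<Longrightarrow> degen (globular_nerve C) n i x \<in> simp (globular_nerve C) (Suc n)"
  using globular_degen[of i n x C] pb_functor[OF cell_map_eta] by (metis globular_simp)

text \<open>Faces and degeneracies are pullbacks along maps of cells, so the identities become those
  between \<open>delta\<close> and \<open>eta\<close> on numbers.\<close>

lemma simplicial_set_globular: "simplicial_set (globular_nerve C)"
  unfolding simplicial_set_def
proof (intro conjI allI ballI impI)
  fix n i x assume "i \<le> Suc n" "x \<in> simp (globular_nerve C) (Suc n)"
  then show "face (globular_nerve C) n i x \<in> simp (globular_nerve C) n" by (rule globular_face_in)
next
  fix n i x assume "i \<le> n" "x \<in> simp (globular_nerve C) n"
  then show "degen (globular_nerve C) n i x \<in> simp (globular_nerve C) (Suc n)" by (rule globular_degen_in)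
next
  fix n i j x assume ij: "i < j \<and> j \<le> Suc (Suc n)" and x: "x \<in> simp (globular_nerve C) (Suc (Suc n))"
  obtain j' where j': "j = Suc j'" using ij by (cases j) auto
  have "\<And>v. delta j (delta i v) = delta i (delta (j - 1) v)" using ij by (auto simp: delta_def)
  then show "face (globular_nerve C) n i (face (globular_nerve C) (Suc n) j x) =
      face (globular_nerve C) n (j - 1) (face (globular_nerve C) (Suc n) i x)"
    using ij x globular_face_in[of _ "Suc n" x C] unfolding j' by (simp add: globular_face pb_pb cell_map_delta image_image del: globular_simp)
next
  fix n i j x assume ij: "i \<le> j \<and> j \<le> n" and x: "x \<in> simp (globular_nerve C) n"
  have "\<And>v. eta j (eta i v) = eta i (eta (Suc j) v)" using ij by (auto simp: eta_def)
  then show "degen (globular_nerve C) (Suc n) i (degen (globular_nerve C) n j x) =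
      degen (globular_nerve C) (Suc n) (Suc j) (degen (globular_nerve C) n i x)"
    using ij x globular_degen_in[of _ n x C] by (simp add: globular_degen pb_pb cell_map_eta image_image del: globular_simp)
next
  fix n i j x assume ij: "i < j \<and> j \<le> Suc n" and x: "x \<in> simp (globular_nerve C) (Suc n)"
  obtain j' where j': "j = Suc j'" using ij by (cases j) auto
  have "\<And>v. eta j (delta i v) = delta i (eta (j - 1) v)" using ij by (auto simp: delta_def eta_def)
  then show "face (globular_nerve C) (Suc n) i (degen (globular_nerve C) (Suc n) j x) =
      degen (globular_nerve C) n (j - 1) (face (globular_nerve C) n i x)"
    using ij x globular_degen_in[of j "Suc n" x C] globular_face_in[of i n x C] unfolding j'
    by (simp add: globular_degen globular_face pb_pb cell_map_eta cell_map_delta image_image del: globular_simp)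
next
  fix n j x assume j: "j \<le> n" and x: "x \<in> simp (globular_nerve C) n"
  have *: "\<And>v. eta j (delta j v) = v" "\<And>v. eta j (delta (Suc j) v) = v" by (auto simp: delta_def eta_def)
  show "face (globular_nerve C) n j (degen (globular_nerve C) n j x) = x"
    using j x globular_degen_in[of j n x C] *(1)
    by (simp add: globular_degen globular_face pb_pb cell_map_eta cell_map_delta image_image pb_id[of x _ "path_cat C"] del: globular_simp) (simp add: pb_id)
  show "face (globular_nerve C) n (Suc j) (degen (globular_nerve C) n j x) = x"
    using j x globular_degen_in[of j n x C] *(2)
    by (simp add: globular_degen globular_face pb_pb cell_map_eta cell_map_delta image_image del: globular_simp) (simp add: pb_id)
next
  fix n i j x assume ij: "Suc j < i \<and> i \<le> Suc (Suc n)" and x: "x \<in> simp (globular_nerve C) (Suc n)"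
  obtain i' where i': "i = Suc i'" using ij by (cases i) auto
  have "\<And>v. eta j (delta i v) = delta (i - 1) (eta j v)" using ij by (auto simp: delta_def eta_def)
  then show "face (globular_nerve C) (Suc n) i (degen (globular_nerve C) (Suc n) j x) =
      degen (globular_nerve C) n j (face (globular_nerve C) n (i - 1) x)"
    using ij x globular_degen_in[of j "Suc n" x C] globular_face_in[of "i - 1" n x C] unfolding i'
    by (simp add: globular_degen globular_face pb_pb cell_map_eta cell_map_delta image_image del: globular_simp)
qed

subsection \<open>The vertex \<open>-\<dots>-\<close>\<close>

lemma pos_surj: "finite Z \<Longrightarrow> i < card Z \<Longrightarrow> \<exists>z\<in>Z. pos Z z = i"
proof -
  assume fin: "finite Z" and i: "i < card Z"
  have mono: "pos Z x < pos Z y" if "x < y" "x \<in> Z" for x y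
    unfolding pos_def using that fin by (intro psubset_card_mono) auto
  have "inj_on (pos Z) Z"
    by (rule inj_onI) (metis mono less_irrefl linorder_neqE_nat)
  then have "card (pos Z ` Z) = card Z" by (rule card_image)
  moreover have "pos Z ` Z \<subseteq> {..<card Z}"
  proof
    fix j assume "j \<in> pos Z ` Z"
    then obtain z where z: "z \<in> Z" "j = pos Z z" by auto
    have "card {y \<in> Z. y < z} < card Z" using fin z by (intro psubset_card_mono) auto
    then show "j \<in> {..<card Z}" using z by (simp add: pos_def)
  qed
  ultimately have "pos Z ` Z = {..<card Z}" by (intro card_subset_eq) auto
  then have "i \<in> pos Z ` Z" using i by simp
  then show ?thesis by auto
qed

abbreviation negs :: "nat \<Rightarrow> sign list" where
  "negs m \<equiv> replicate m Neg"

lemma zs_negs [simp]: "zs (negs m) = {}"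
  by (auto simp: zs_def)

lemma sub_negs: "sub (Cube m) (negs m) = {negs m}"
  by (auto simp: Cube_sub list_eq_iff_nth_eq)

lemma negs_no_zeros: "length k = m \<Longrightarrow> Pos \<notin> set k \<Longrightarrow> zs k = {} \<Longrightarrow> k = negs m"
  using word_zs[of k m] by (auto simp: list_eq_iff_nth_eq)

text \<open>A face of dimension p + 1 through the vertex has a zero for which the prescribed letter
  is \<open>-\<close>: the first one for sources, the second one for targets. For the target of
  order 0 there is no second zero.\<close>

lemma negs_bd:
  assumes "p > 0 \<or> s"
  shows "negs m \<in> bd (Cube m) s p X \<longleftrightarrow> negs m \<in> X"
proof
  assume v: "negs m \<in> X"
  have "negs m \<in> Sub (Cube m) (fbd (Cube m) s b)" if b: "card (zs b) = Suc p" "negs m \<in> sub (Cube m) b" for b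
  proof -
    have "(if s then 0 else 1) < card (zs b)" using b(1) assms by auto
    then obtain j where j: "j \<in> zs b" "pos (zs b) j = (if s then 0 else 1)"
      using pos_surj[OF finite_zs] by blast
    have "length b = m" using b(2) by (simp add: Cube_sub)
    then have "negs m ! j = bsgn s (pos (zs b) j)" using j zs_less[OF j(1)] by (auto simp: bsgn_def)
    then show ?thesis using j(1) Cube_Sub_fbd[OF b(2)] by blast
  qed
  then show "negs m \<in> bd (Cube m) s p X" using v by (simp add: bd_iff)
qed (simp add: bd_iff)

text \<open>The sum of the coordinates is smallest at the vertex and nowhere else, whereas the
  0-target is the highest point of the cell. So there is no other point.\<close>

lemma corner_minimal:
  assumes X: "X \<in> cells (Cube m)" and v: "negs m \<in> bd (Cube m) False 0 X"
  shows "X = {negs m}"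
proof -
  let ?z = "\<lambda>_::nat. 0 :: real"
  have z: "?z \<in> cube_cl (negs m)" by (auto simp: cube_cl_def fills_def)
  have zbd: "?z \<in> cube.rl (bd (Cube m) False 0 X)" using z v by (auto simp: cube.rl_def)
  have "c = negs m" if c: "c \<in> X" for c
  proof -
    have cf: "length c = m" using c cube.cells_faces[OF X] by auto
    obtain x where x: "x \<in> cube_inn c" using cube.inn_nonempty[of c m] cf by auto
    have f: "fills_inn (c ! i) (x i)" if "i < m" for i using x that cf by (auto simp: cube_inn_def)
    have "x \<in> cube.rl X" using cube.in_rl[OF cube.cells_faces[OF X] c x] .
    then have "?z = x \<or> below False (mom m (0 + 0) ?z) (mom m (0 + 0) x)"
      using cube.good_extremal[OF cube.cells_good[OF X] _ zbd] by (simp add: same_def)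
    moreover have "mom m 0 x \<ge> 0"
    proof -
      have "x i \<ge> 0" if "i < m" for i using f[OF that] by (auto simp: fills_inn_def split: sign.splits)
      then show ?thesis unfolding mom_def by (intro sum_nonneg) auto
    qed
    ultimately have "?z = x" by (auto simp: below_def mom_def)
    then have "x i = 0" for i by (metis (mono_tags))
    then have "c ! i = Neg" if "i < m" for i using f[OF that] by (cases "c ! i") (auto simp: fills_inn_def)
    then show ?thesis using cf by (simp add: list_eq_iff_nth_eq)
  qed
  then show ?thesis using v by (auto simp: bd_iff)
qed

text \<open>This detects whether anything survives \<open>col\<close> by looking at the 0-target; it
  governs all composites of order 0 below.\<close>

lemma negs_tgt:
  assumes X: "X \<in> cells (Cube m)"
  shows "negs m \<in> bd (Cube m) False 0 X \<longleftrightarrow> negs m \<in> X \<and> col X = {}"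
proof
  assume "negs m \<in> bd (Cube m) False 0 X"
  then show "negs m \<in> X \<and> col X = {}" using corner_minimal[OF X] by (simp add: col_def)
next
  assume v: "negs m \<in> X \<and> col X = {}"
  have "\<not> negs m \<in> sub (Cube m) b" if b: "b \<in> X" "card (zs b) = Suc 0" for b
  proof
    assume "negs m \<in> sub (Cube m) b"
    then have "Pos \<notin> set b" using Pos_sub[of "negs m" m b] by auto
    moreover have "zs b \<noteq> {}" using b(2) by auto
    ultimately have "zs b \<in> col X" using b(1) by (auto simp: col_def)
    then show False using v by simp
  qed
  then show "negs m \<in> bd (Cube m) False 0 X" using v by (auto simp: bd_iff)
qed

lemma cube_mors_1:
  assumes X: "X \<in> cells (Cube m)"
  shows "X \<in> mors (cell_cat (Cube m)) 1 \<longleftrightarrow> bd (Cube m) True 1 X = X \<and> bd (Cube m) False 1 X = X \<and>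
    \<not> (bd (Cube m) True 0 X = X \<and> bd (Cube m) False 0 X = X)" (is "_ \<longleftrightarrow> ?R")
proof -
  let ?D = "cell_cat (Cube m)"
  have s: "src ?D p Y = bd (Cube m) True p Y" "tgt ?D p Y = bd (Cube m) False p Y" for p Y
    by (simp_all add: cell_cat_def bd_True bd_False)
  have "bd (Cube m) b m X = X" for b
  proof (rule bd_low)
    fix a assume "a \<in> X"
    then have "length a = m" using cube.cells_faces[OF X] by auto
    then show "fdim (Cube m) a \<le> m" using card_mono[OF _ zs_subset[of a]] by simp
  qed
  then have P: "\<exists>p. src ?D p X = X \<and> tgt ?D p X = X" using s by blast
  have "Defs.dim ?D X = 1 \<longleftrightarrow> ?R"
  proof
    assume d: "Defs.dim ?D X = 1"
    have "src ?D (Defs.dim ?D X) X = X \<and> tgt ?D (Defs.dim ?D X) X = X"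
      unfolding Defs.dim_def using P by (rule LeastI_ex)
    moreover have "\<not> (src ?D 0 X = X \<and> tgt ?D 0 X = X)" using d dim_0[of ?D X] by auto
    ultimately show ?R using d s by simp
  next
    assume ?R
    then show "Defs.dim ?D X = 1" using s by (intro dim_1) auto
  qed
  then show ?thesis using X by (simp add: mors_def cell_cat_def)
qed

subsection \<open>The negative corner nerve\<close>

text \<open>The 1-morphisms from the vertex, with the condition on the dimension expressed by
  boundaries: a cell of dimension at most 1 that starts at the vertex is an identity only if it ends
  there. In this form the condition is transported by maps of cells.\<close>

definition corner_edge :: "nat \<Rightarrow> sign list set \<Rightarrow> bool" where
  "corner_edge m u \<longleftrightarrow> u \<in> cells (Cube m) \<and> bd (Cube m) True 1 u = u \<and> bd (Cube m) False 1 u = u \<and>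
     bd (Cube m) True 0 u = {negs m} \<and> negs m \<notin> bd (Cube m) False 0 u"

lemma corner_edge_iff:
  "corner_edge m u \<longleftrightarrow> u \<in> mors (cell_cat (Cube m)) 1 \<and> src (cell_cat (Cube m)) 0 u = sub (Cube m) (negs m)"
proof -
  have "u \<in> cells (Cube m)" if "u \<in> mors (cell_cat (Cube m)) 1" using that by (simp add: mors_def cell_cat_def)
  moreover have "src (cell_cat (Cube m)) 0 u = bd (Cube m) True 0 u" by (simp add: cell_cat_def bd_True)
  moreover have "negs m \<notin> bd (Cube m) False 0 u \<longleftrightarrow> \<not> (bd (Cube m) True 0 u = u \<and> bd (Cube m) False 0 u = u)"
    if u: "u \<in> cells (Cube m)" "bd (Cube m) True 0 u = {negs m}"
  proof
    assume "\<not> (bd (Cube m) True 0 u = u \<and> bd (Cube m) False 0 u = u)"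
    moreover have "bd (Cube m) b 0 {negs m} = {negs m}" for b by (rule bd_low) simp
    ultimately show "negs m \<notin> bd (Cube m) False 0 u" using corner_minimal[OF u(1)] by metis
  next
    assume n: "negs m \<notin> bd (Cube m) False 0 u"
    have "negs m \<in> u" using u(2) bd_subset[of "Cube m" True 0 u] by simp
    then show "\<not> (bd (Cube m) True 0 u = u \<and> bd (Cube m) False 0 u = u)" using n by metis
  qed
  ultimately show ?thesis unfolding corner_edge_def sub_negs using cube_mors_1[of u m] by (cases "u \<in> cells (Cube m)") auto
qed

lemma corner_simp:
  "x \<in> simp (corner_nerve C) n \<longleftrightarrow> x \<in> functors (cell_cat (Cube (Suc n))) C \<and> (\<forall>u. corner_edge (Suc n) u \<longrightarrow> Defs.dim C (x u) = 1)"
  unfolding corner_edge_iff by (auto simp: corner_nerve_def)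

text \<open>As the operator reflects the vertex \<open>-...-\<close>, a 1-cell that leaves this
  vertex is sent to one that leaves it again, and not to an identity.\<close>

lemma pb_corner:
  assumes w: "word_operator m n \<phi> f" and x: "x \<in> simp (corner_nerve C) n"
  shows "pb (Cube (Suc m)) ((`) \<phi>) x \<in> simp (corner_nerve C) m"
proof -
  interpret word_operator m n \<phi> f by fact
  have "corner_edge (Suc n) (\<phi> ` u)" if u: "corner_edge (Suc m) u" for u
  proof -
    have uc: "u \<in> cells (Cube (Suc m))" using u by (simp add: corner_edge_def)
    note mp = cell_mapD[OF map_\<phi> uc]
    have n: "\<phi> (negs (Suc m)) = negs (Suc n)" using Neg_iff[of "negs (Suc m)"] by (simp del: replicate_Suc)
    have "negs (Suc n) \<notin> \<phi> ` bd (Cube (Suc m)) False 0 u"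
    proof
      assume "negs (Suc n) \<in> \<phi> ` bd (Cube (Suc m)) False 0 u"
      then obtain w where w: "w \<in> bd (Cube (Suc m)) False 0 u" "negs (Suc n) = \<phi> w" by blast
      then have "length w = Suc m" using cube.cells_faces[OF uc] by (auto simp: bd_iff)
      then have "w = negs (Suc m)" using Neg_iff[of w] w(2) by simp
      then show False using w(1) u by (simp add: corner_edge_def)
    qed
    moreover have "\<phi> ` {negs (Suc m)} = {negs (Suc n)}" using n by simp
    ultimately show ?thesis
      using u mp(1) mp(2)[of True 1] mp(2)[of False 1] mp(2)[of True 0] mp(2)[of False 0]
      unfolding corner_edge_def by metis
  qed
  then show ?thesis using x pb_functor[OF map_\<phi>] unfolding corner_simp
    by (auto simp: pb_apply corner_edge_def)
qed

lemma cube_face_pb: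
  assumes "i \<le> m" "\<alpha> \<noteq> Zero" "x \<in> functors (cell_cat (Cube (Suc m))) C"
  shows "cube_face C m \<alpha> (Suc i) x = pb (Cube m) ((`) (ins i \<alpha>)) x"
  unfolding cube_face_def diff_Suc_1 ins_def[symmetric] using assms
  by (intro functor_ext_pb[OF cell_map_ins]) (auto simp: ins_sub)

lemma cube_conn_pb:
  assumes "i < m" "x \<in> functors (cell_cat (Cube m)) C"
  shows "cube_conn C m (Suc i) x = pb (Cube (Suc m)) ((`) (mg i)) x"
  unfolding cube_conn_def diff_Suc_1 mg_def[symmetric] using assms
  by (intro functor_ext_pb[OF cell_map_mg]) (auto simp: mg_sub_image)

lemma corner_face:
  assumes "i \<le> Suc n" "x \<in> simp (corner_nerve C) (Suc n)"
  shows "face (corner_nerve C) n i x = pb (Cube (Suc n)) ((`) (ins i Neg)) x"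
  using cube_face_pb[of i "Suc n" Neg x C] assms by (simp add: corner_simp) (simp add: corner_nerve_def)

lemma corner_degen:
  assumes "i \<le> n" "x \<in> simp (corner_nerve C) n"
  shows "degen (corner_nerve C) n i x = pb (Cube (Suc (Suc n))) ((`) (mg i)) x"
  using cube_conn_pb[of i "Suc n" x C] assms by (simp add: corner_simp) (simp add: corner_nerve_def)

lemma corner_face_in: "i \<le> Suc n \<Longrightarrow> x \<in> simp (corner_nerve C) (Suc n) \<Longrightarrow> face (corner_nerve C) n i x \<in> simp (corner_nerve C) n"
  using corner_face[of i n x C] pb_corner[OF word_operator_ins, of i n x C] by simp

lemma corner_degen_in: "i \<le> n \<Longrightarrow> x \<in> simp (corner_nerve C) n \<Longrightarrow> degen (corner_nerve C) n i x \<in> simp (corner_nerve C) (Suc n)"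
  using corner_degen[of i n x C] pb_corner[OF word_operator_mg, of i n x C] by simp

lemma pb_cube_cong:
  assumes "\<And>k. length k = m \<Longrightarrow> \<phi> k = \<psi> k"
  shows "pb (Cube m) (\<lambda>X. \<phi> ` X) F = pb (Cube m) (\<lambda>X. \<psi> ` X) F"
proof (rule pb_cong)
  fix X assume "X \<in> cells (Cube m)"
  then have "\<And>k. k \<in> X \<Longrightarrow> length k = m" using cube.cells_faces by fastforce
  then show "\<phi> ` X = \<psi> ` X" using assms by (intro image_cong) auto
qed

lemma sign_max_assoc: "sign_max (sign_max a b) c = sign_max a (sign_max b c)"
  by (cases a; cases b; cases c) auto

lemma sign_max_Neg [simp]: "sign_max b Neg = b"
  by (cases b) auto

lemma ins_ins:
  assumes "i \<le> j" "j \<le> length k"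
  shows "ins (Suc j) \<alpha> (ins i \<beta> k) = ins i \<beta> (ins j \<alpha> k)"
proof (rule nth_equalityI)
  fix l assume "l < length (ins (Suc j) \<alpha> (ins i \<beta> k))"
  consider "l < i" | "l = i" | "i < l" "l \<le> j" | "l = Suc j" | "Suc j < l" by linarith
  then show "ins (Suc j) \<alpha> (ins i \<beta> k) ! l = ins i \<beta> (ins j \<alpha> k) ! l" using assms by cases (auto simp: nth_ins)
qed simp

lemma mg_mg:
  assumes "i \<le> j" "Suc (Suc j) < length k"
  shows "mg j (mg i k) = mg i (mg (Suc j) k)"
proof (rule nth_equalityI)
  have l: "length (mg i k) = length k - 1" "length (mg (Suc j) k) = length k - 1" using assms by (auto simp: length_mg)
  show "length (mg j (mg i k)) = length (mg i (mg (Suc j) k))" using assms l by (simp add: length_mg)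
  fix a
  consider "a < i" | "a = i" "i < j" | "a = i" "i = j" | "i < a" "a < j" | "a = j" "i < j" | "j < a" using assms by linarith
  then show "mg j (mg i k) ! a = mg i (mg (Suc j) k) ! a"
    using assms l by cases (auto simp: nth_mg sign_max_assoc)
qed

lemma mg_ins_same:
  assumes "j < length k"
  shows "mg j (ins j Neg k) = k" "mg j (ins (Suc j) Neg k) = k"
  using assms by (auto intro!: nth_equalityI simp: length_mg nth_mg nth_ins)

lemma mg_ins_low:
  assumes "i \<le> j" "Suc j < length k"
  shows "mg (Suc j) (ins i \<alpha> k) = ins i \<alpha> (mg j k)"
proof (rule nth_equalityI)
  show "length (mg (Suc j) (ins i \<alpha> k)) = length (ins i \<alpha> (mg j k))" using assms by (simp add: length_mg)
  fix a
  consider "a < i" | "a = i" | "i < a" "a \<le> j" | "a = Suc j" | "Suc j < a" by linarith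
  then show "mg (Suc j) (ins i \<alpha> k) ! a = ins i \<alpha> (mg j k) ! a"
    using assms by cases (auto simp: nth_mg nth_ins length_mg)
qed

lemma mg_ins_high:
  assumes "j < i" "i < length k"
  shows "mg j (ins (Suc i) \<alpha> k) = ins i \<alpha> (mg j k)"
proof (rule nth_equalityI)
  show "length (mg j (ins (Suc i) \<alpha> k)) = length (ins i \<alpha> (mg j k))" using assms by (simp add: length_mg)
  fix a
  consider "a < j" | "a = j" | "j < a" "a < i" | "a = i" | "i < a" by linarith
  then show "mg j (ins (Suc i) \<alpha> k) ! a = ins i \<alpha> (mg j k) ! a"
    using assms by cases (auto simp: nth_mg nth_ins length_mg)
qed

lemma cell_map_insN: "i \<le> m \<Longrightarrow> cell_map (Cube m) (Cube (Suc m)) ((`) (ins i Neg))"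
  by (rule cell_map_ins) simp_all

lemma simplicial_set_corner: "simplicial_set (corner_nerve C)"
  unfolding simplicial_set_def
proof (intro conjI allI ballI impI)
  fix n i x assume "i \<le> Suc n" "x \<in> simp (corner_nerve C) (Suc n)"
  then show "face (corner_nerve C) n i x \<in> simp (corner_nerve C) n" by (rule corner_face_in)
next
  fix n i x assume "i \<le> n" "x \<in> simp (corner_nerve C) n"
  then show "degen (corner_nerve C) n i x \<in> simp (corner_nerve C) (Suc n)" by (rule corner_degen_in)
next
  fix n i j x assume ij: "i < j \<and> j \<le> Suc (Suc n)" and x: "x \<in> simp (corner_nerve C) (Suc (Suc n))"
  obtain j' where j': "j = Suc j'" using ij by (cases j) auto
  then have "ins j Neg (ins i Neg k) = ins i Neg (ins (j - 1) Neg k)" if "length k = Suc n" for k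
    using ij ins_ins[of i j' k Neg Neg] that by simp
  from pb_cube_cong[OF this]
  show "face (corner_nerve C) n i (face (corner_nerve C) (Suc n) j x) =
      face (corner_nerve C) n (j - 1) (face (corner_nerve C) (Suc n) i x)"
    using ij x corner_face_in[of _ "Suc n" x C] unfolding j' by (simp add: corner_face pb_pb cell_map_insN image_image)
next
  fix n i j x assume ij: "i \<le> j \<and> j \<le> n" and x: "x \<in> simp (corner_nerve C) n"
  have "mg j (mg i k) = mg i (mg (Suc j) k)" if "length k = Suc (Suc (Suc n))" for k
    using ij mg_mg[of i j k] that by simp
  from pb_cube_cong[OF this]
  show "degen (corner_nerve C) (Suc n) i (degen (corner_nerve C) n j x) =
      degen (corner_nerve C) (Suc n) (Suc j) (degen (corner_nerve C) n i x)"
    using ij x corner_degen_in[of _ n x C] by (simp add: corner_degen pb_pb cell_map_mg image_image)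
next
  fix n i j x assume ij: "i < j \<and> j \<le> Suc n" and x: "x \<in> simp (corner_nerve C) (Suc n)"
  obtain j' where j': "j = Suc j'" using ij by (cases j) auto
  then have "mg j (ins i Neg k) = ins i Neg (mg (j - 1) k)" if "length k = Suc (Suc n)" for k
    using ij mg_ins_low[of i j' k Neg] that by simp
  from pb_cube_cong[OF this]
  show "face (corner_nerve C) (Suc n) i (degen (corner_nerve C) (Suc n) j x) =
      degen (corner_nerve C) n (j - 1) (face (corner_nerve C) n i x)"
    using ij x corner_degen_in[of j "Suc n" x C] corner_face_in[of i n x C] unfolding j'
    by (simp add: corner_degen corner_face pb_pb cell_map_insN cell_map_mg image_image)
next
  fix n j x assume j: "j \<le> n" and x: "x \<in> simp (corner_nerve C) n"
  have xf: "x \<in> functors (cell_cat (Cube (Suc n))) C" using x by (simp add: corner_simp)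
  have id: "pb (Cube (Suc n)) (\<lambda>X. (\<lambda>k. k) ` X) x = x" by (rule pb_id[OF xf]) simp
  have "mg j (ins j Neg k) = k" "mg j (ins (Suc j) Neg k) = k" if "length k = Suc n" for k
    using j mg_ins_same[of j k] that by simp_all
  then have *: "pb (Cube (Suc n)) (\<lambda>X. (\<lambda>k. mg j (ins j Neg k)) ` X) x = x"
    "pb (Cube (Suc n)) (\<lambda>X. (\<lambda>k. mg j (ins (Suc j) Neg k)) ` X) x = x"
    using pb_cube_cong[of "Suc n" "\<lambda>k. mg j (ins j Neg k)" "\<lambda>k. k" x]
      pb_cube_cong[of "Suc n" "\<lambda>k. mg j (ins (Suc j) Neg k)" "\<lambda>k. k" x] id by auto
  show "face (corner_nerve C) n j (degen (corner_nerve C) n j x) = x"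
    using j x corner_degen_in[of j n x C] *(1)
    by (simp add: corner_degen corner_face pb_pb cell_map_insN cell_map_mg image_image)
  show "face (corner_nerve C) n (Suc j) (degen (corner_nerve C) n j x) = x"
    using j x corner_degen_in[of j n x C] *(2)
    by (simp add: corner_degen corner_face pb_pb cell_map_insN cell_map_mg image_image)
next
  fix n i j x assume ij: "Suc j < i \<and> i \<le> Suc (Suc n)" and x: "x \<in> simp (corner_nerve C) (Suc n)"
  obtain i' where i': "i = Suc i'" using ij by (cases i) auto
  then have "mg j (ins i Neg k) = ins (i - 1) Neg (mg j k)" if "length k = Suc (Suc n)" for k
    using ij mg_ins_high[of j i' k Neg] that by simp
  from pb_cube_cong[OF this]
  show "face (corner_nerve C) (Suc n) i (degen (corner_nerve C) (Suc n) j x) =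
      degen (corner_nerve C) n j (face (corner_nerve C) n (i - 1) x)"
    using ij x corner_degen_in[of j "Suc n" x C] corner_face_in[of "i - 1" n x C] unfolding i'
    by (simp add: corner_degen corner_face pb_pb cell_map_insN cell_map_mg image_image)
qed

section \<open>The comparison map\<close>

text \<open>Faces that survive \<open>col\<close> bring the vertex with them. Two surviving factors
  cannot be composed along order 0: the second starts at the vertex, so the first would end there
  and consist of the vertex only.\<close>

lemma col_cells:
  assumes X: "X \<in> cells (Cube (Suc n))"
  shows "col X \<noteq> {} \<Longrightarrow> negs (Suc n) \<in> X" "col X \<noteq> {} \<Longrightarrow> col X \<in> cells (Delta n)"
proof -
  have "col X \<noteq> {} \<longrightarrow> negs (Suc n) \<in> X \<and> col X \<in> cells (Delta n)"
    using X
  proof (induction rule: cells_induct)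
    case (atom k)
    show ?case
    proof (cases "Pos \<in> set k")
      case True then show ?thesis by (simp add: col_sub_Pos)
    next
      case False
      then have c: "col (sub (Cube (Suc n)) k) = sub (Delta n) (zs k)" using atom by (intro col_sub_no_Pos) auto
      have "negs (Suc n) \<in> sub (Cube (Suc n)) k" using atom False by (subst sub_no_Pos) (auto simp del: replicate_Suc)
      moreover have "sub (Delta n) (zs k) \<in> cells (Delta n)" if "sub (Delta n) (zs k) \<noteq> {}"
        using that atom zs_subset[of k] by (intro cells.atom) (auto simp: less_Suc_eq_le)
      ultimately show ?thesis using c by auto
    qed
  next
    case (bd X s p)
    show ?case
    proof (cases p)
      case 0 then show ?thesis by (simp add: col_bd_0)
    next
      case (Suc q)
      have e: "col (bd (Cube (Suc n)) s p X) = bd (Delta n) s q (col X)"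
        unfolding Suc by (rule col_bd[OF cube.cells_faces[OF bd(1)]])
      show ?thesis
      proof
        assume "col (bd (Cube (Suc n)) s p X) \<noteq> {}"
        then have "col X \<noteq> {}" using col_mono[OF bd_subset, of "Cube (Suc n)" s p X] by auto
        then show "negs (Suc n) \<in> bd (Cube (Suc n)) s p X \<and> col (bd (Cube (Suc n)) s p X) \<in> cells (Delta n)"
          using bd(2) negs_bd[of p s "Suc n" X] Suc e cells_bd[of "col X" "Delta n" s q] by simp
      qed
    qed
  next
    case (comp X Y p)
    show ?case
    proof (cases "col X = {} \<or> col Y = {}")
      case True then show ?thesis using comp by (auto simp: col_Un)
    next
      case False
      then have X: "negs (Suc n) \<in> X" "col X \<in> cells (Delta n)" and Y: "negs (Suc n) \<in> Y" "col Y \<in> cells (Delta n)"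
        using comp by auto
      show ?thesis
      proof (cases p)
        case 0
        have "negs (Suc n) \<in> bd (Cube (Suc n)) True 0 Y" using Y negs_bd[of 0 True "Suc n" Y] by simp
        then have "negs (Suc n) \<in> bd (Cube (Suc n)) False 0 X" using comp 0 by simp
        then show ?thesis using negs_tgt[OF comp(1)] False by blast
      next
        case (Suc q)
        have "bd (Delta n) False q (col X) = bd (Delta n) True q (col Y)"
          using comp(3) col_bd[OF cube.cells_faces[OF comp(1)], of False q] col_bd[OF cube.cells_faces[OF comp(2)], of True q]
          unfolding Suc by simp
        then have "col X \<union> col Y \<in> cells (Delta n)" using X Y by (intro cells_comp)
        then show ?thesis using X by (simp add: col_Un)
      qed
    qed
  qed
  then show "col X \<noteq> {} \<Longrightarrow> negs (Suc n) \<in> X" "col X \<noteq> {} \<Longrightarrow> col X \<in> cells (Delta n)" by auto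
qed

text \<open>The parity convention orients edges from the larger vertex to the smaller one, which
  makes \<open>n\<close> initial and 0 final.\<close>

lemma Delta_bd_0_atom:
  assumes "\<sigma> \<subseteq> {0..n}" "\<sigma> \<noteq> {}"
  shows "bd (Delta n) s 0 (sub (Delta n) \<sigma>) = {{if s then Max \<sigma> else Min \<sigma>}}"
proof -
  let ?u = "if s then Max \<sigma> else Min \<sigma>"
  have fin: "finite \<sigma>" using assms(1) finite_subset by blast
  have u: "?u \<in> \<sigma>" using fin assms(2) by auto
  have two: "{u} \<in> Sub (Delta n) (fbd (Delta n) s b) \<longleftrightarrow> u = (if s then Max b else Min b)"
    if b: "card b = Suc (Suc 0)" "u \<in> b" for b u
  proof -
    obtain x y where xy: "b = {x, y}" "x < y" using b(1) unfolding numeral_2_eq_2[symmetric] card_2_iff by (metis insert_commute linorder_neqE_nat)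
    have "{z \<in> {x, y}. z < x} = {}" "{z \<in> {x, y}. z < y} = {x}" using xy by auto
    then have p: "pos b x = 0" "pos b y = 1" by (simp_all add: pos_def xy(1))
    have d: "b - {x} = {y}" "b - {y} = {x}" using xy by auto
    have mm: "Max b = y" "Min b = x" using xy by simp_all
    have "{u} \<in> Sub (Delta n) (fbd (Delta n) s b) \<longleftrightarrow> (\<exists>v\<in>b - {u}. even (pos b v) = s)"
      using b(2) xy(1) by (intro Delta_Sub_fbd) auto
    moreover have "u = x \<or> u = y" using b(2) xy(1) by simp
    ultimately show ?thesis
    proof (elim disjE)
      assume "u = x" then show ?thesis using d p mm xy(2) Delta_Sub_fbd[of b "{u}" n s] b xy(1) by simp
    next
      assume "u = y" then show ?thesis using d p mm xy(2) Delta_Sub_fbd[of b "{u}" n s] b xy(1) by simp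
    qed
  qed
  have "{u} \<in> bd (Delta n) s 0 (sub (Delta n) \<sigma>) \<longleftrightarrow> u = ?u" if "u \<in> \<sigma>" for u
  proof
    assume a: "{u} \<in> bd (Delta n) s 0 (sub (Delta n) \<sigma>)"
    show "u = ?u"
    proof (rule ccontr)
      assume ne: "u \<noteq> ?u"
      let ?b = "{u, ?u}"
      have "card ?b = Suc (Suc 0)" using ne by auto
      moreover from this have "{u} \<in> Sub (Delta n) (fbd (Delta n) s ?b)" using a u that by (auto simp: bd_iff)
      ultimately have "u = (if s then Max ?b else Min ?b)" using two[of ?b u] by blast
      moreover have "(if s then Max ?b else Min ?b) = ?u" using fin that by (auto simp: max_def min_def intro: antisym)
      ultimately show False using ne by simp
    qed
  next
    assume uu: "u = ?u"
    have "{u} \<in> Sub (Delta n) (fbd (Delta n) s b)" if b: "b \<subseteq> \<sigma>" "card b - 1 = Suc 0" "u \<in> b" for b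
    proof -
      have "finite b" using b(1) fin finite_subset by blast
      have "card b = Suc (Suc 0)" using b(2) by simp
      moreover have "u = (if s then Max b else Min b)"
        using b \<open>finite b\<close> fin uu by (auto intro!: Max_eqI[symmetric] Min_eqI[symmetric] split: if_splits)
      ultimately show ?thesis using two b(3) by blast
    qed
    then show "{u} \<in> bd (Delta n) s 0 (sub (Delta n) \<sigma>)" using that by (auto simp: bd_iff)
  qed
  moreover have "\<exists>u\<in>\<sigma>. c = {u}" if "c \<in> bd (Delta n) s 0 (sub (Delta n) \<sigma>)" for c
  proof -
    have c: "c \<subseteq> \<sigma>" "c \<noteq> {}" "card c - 1 \<le> 0" using that by (auto simp: bd_iff)
    then have "card c = 1" using fin finite_subset[of c \<sigma>] by (metis One_nat_def card_0_eq diff_is_0_eq' le_antisym not_less_eq_eq le_0_eq diff_is_0_eq)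
    then show ?thesis using c(1) by (auto simp: card_1_singleton_iff)
  qed
  ultimately show ?thesis using u by blast
qed

section \<open>Extension of the comparison map to all cells\<close>

context omega
begin

text \<open>Sources, targets and composites in the path category have order at least 1 in
  \<open>C\<close>, and these leave \<open>src C 0\<close> and \<open>tgt C 0\<close> alone. Any two
  vertices are joined by an edge, so all cells have the same two ends. The choice of the vertices
  \<open>n\<close> and 0 in \<open>h_val\<close> is therefore immaterial.\<close>

lemma ends_constant:
  assumes x: "x \<in> functors (cell_cat (Delta n)) (path_cat C)" and X: "X \<in> cells (Delta n)" and k: "k \<le> n"
  shows "src C 0 (x X) = src C 0 (x (sub (Delta n) {k}))" "tgt C 0 (x X) = tgt C 0 (x (sub (Delta n) {k}))"
proof -
  note xD = functorD[OF x, simplified]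
  define e where "e b = (if b then src C 0 else tgt C 0)" for b
  have bdx: "e b (x (bd (Delta n) s p Y)) = e b (x Y)" if "Y \<in> cells (Delta n)" for b s p Y
  proof -
    have c: "x Y \<in> carr C" using xD(1)[OF that] by simp
    show ?thesis using xD(2,3)[OF that, of p] glob[of 0 "Suc p" "x Y"] c by (cases s) (auto simp: e_def)
  qed
  have sc: "sub (Delta n) \<sigma> \<in> cells (Delta n)" if "\<sigma> \<subseteq> {0..n}" "\<sigma> \<noteq> {}" for \<sigma>
    using that by (intro cells.atom) simp
  have single: "{{j}} = sub (Delta n) {j}" for j by auto
  have pt: "e b (x {{j}}) = e b (x {{i}})" if "i < j" "j \<le> n" for i j b
  proof -
    have s: "{i, j} \<subseteq> {0..n}" "{i, j} \<noteq> {}" using that by auto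
    have "bd (Delta n) True 0 (sub (Delta n) {i, j}) = {{j}}" "bd (Delta n) False 0 (sub (Delta n) {i, j}) = {{i}}"
      using that by (simp_all add: Delta_bd_0_atom[OF s] max_def min_def del: Delta_sub)
    then show ?thesis using bdx[OF sc[OF s], of b True 0] bdx[OF sc[OF s], of b False 0] by simp
  qed
  have pt': "e b (x {{j}}) = e b (x {{k}})" if "j \<le> n" for j b
    using pt[of j k b] pt[of k j b] that k by (cases j k rule: linorder_cases) auto
  have "e b (x X) = e b (x {{k}})" for b
    using X
  proof (induction rule: cells_induct)
    case (atom \<sigma>)
    then have s: "\<sigma> \<subseteq> {0..n}" "\<sigma> \<noteq> {}" "finite \<sigma>" by (auto intro: finite_subset)
    then have "Max \<sigma> \<le> n" by auto
    then show ?case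
      using bdx[OF sc[OF s(1,2)], of b True 0] pt'[of "Max \<sigma>" b] by (simp add: Delta_bd_0_atom[OF s(1,2)] del: Delta_sub)
  next
    case (bd Y s p) then show ?case using bdx[OF bd(1)] by simp
  next
    case (comp Y Z p)
    have c: "x Y \<in> carr C" "x Z \<in> carr C" using xD(1) comp by auto
    have m: "tgt C (Suc p) (x Y) = src C (Suc p) (x Z)"
      using xD(2)[OF comp(2), of p] xD(3)[OF comp(1), of p] comp(3) by simp
    let ?e = "e b (x {{k}})"
    have "e b (x (Y \<union> Z)) = cmp C (Suc p) (e b (x Y)) (e b (x Z))"
      using xD(4)[OF comp(1,2,3)] bd_cmp[OF _ c m, of 0] by (auto simp: e_def)
    moreover have "src C (Suc p) ?e = ?e" "?e \<in> carr C"
      using comp(4) c(1) glob[of 0 "Suc p" "x Y"] src_carr tgt_carr unfolding e_def by (auto split: if_splits; metis)+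
    ultimately show ?case using comp(4,5) unit_src[of ?e "Suc p"] by simp
  qed
  from this[of True] this[of False]
  show "src C 0 (x X) = src C 0 (x (sub (Delta n) {k}))" "tgt C 0 (x X) = tgt C 0 (x (sub (Delta n) {k}))"
    unfolding e_def single by auto
qed

text \<open>The closed form of h on all cells. If nothing survives \<open>col\<close>, the value is
  one of the two end states, and the vertex decides which.\<close>

definition hv :: "nat \<Rightarrow> (nat set set \<Rightarrow> 'a) \<Rightarrow> sign list set \<Rightarrow> 'a" where
  "hv n x X = (if col X \<noteq> {} then x (col X)
     else if negs (Suc n) \<in> X then src C 0 (x (sub (Delta n) {n})) else tgt C 0 (x (sub (Delta n) {0})))"

text \<open>Above order 0, \<open>col_bd\<close> reduces everything to the functor \<open>x\<close>
  one order lower. In order 0 the ends come from \<open>ends_constant\<close>, and in a composite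
  one factor has an end state as its value, which acts as a unit.\<close>

lemma hv_functor:
  assumes x: "x \<in> functors (cell_cat (Delta n)) (path_cat C)"
  shows "(\<lambda>X\<in>cells (Cube (Suc n)). hv n x X) \<in> functors (cell_cat (Cube (Suc n))) C"
proof -
  note xD = functorD[OF x, simplified]
  let ?K = "Cube (Suc n)" and ?v = "negs (Suc n)"
  define a where "a = src C 0 (x (sub (Delta n) {n}))"
  define b where "b = tgt C 0 (x (sub (Delta n) {0}))"
  have "sub (Delta n) {n} \<in> cells (Delta n)" "sub (Delta n) {0} \<in> cells (Delta n)" by (auto intro!: cells.atom simp del: Delta_sub)
  then have c: "x (sub (Delta n) {n}) \<in> carr C" "x (sub (Delta n) {0}) \<in> carr C" using xD(1) by auto
  have ab: "a \<in> carr C" "b \<in> carr C" "Defs.dim C a = 0" "Defs.dim C b = 0"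
    using c src_carr tgt_carr point_src point_tgt by (auto simp: a_def b_def)
  have fxd: "src C p a = a" "tgt C p a = a" "src C p b = b" "tgt C p b = b" for p
    using point_fixed[of a p] point_fixed[of b p] ab by auto
  have ends: "src C 0 (x X) = a" "tgt C 0 (x X) = b" if "X \<in> cells (Delta n)" for X
    using ends_constant[OF x that, of n] ends_constant[OF x that, of 0] by (auto simp: a_def b_def)
  have hv: "hv n x X = (if col X \<noteq> {} then x (col X) else if ?v \<in> X then a else b)" for X
    by (simp add: hv_def a_def b_def)
  note cc = col_cells
  have carr: "hv n x X \<in> carr C" if "X \<in> cells ?K" for X
    using xD(1)[OF cc(2)[OF that]] ab by (auto simp: hv)
  have bd: "hv n x (bd ?K s p X) = (if s then src C p else tgt C p) (hv n x X)" if X: "X \<in> cells ?K" for s p X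
  proof (cases p)
    case 0
    have "?v \<in> bd ?K s 0 X \<longleftrightarrow> ?v \<in> X \<and> (s \<or> col X = {})"
      using negs_bd[of 0 True "Suc n" X] negs_tgt[OF X] by (cases s) auto
    then show ?thesis unfolding 0 hv col_bd_0 using ends[OF cc(2)[OF X]] cc(1)[OF X] fxd by auto
  next
    case (Suc q)
    have e: "col (bd ?K s p X) = bd (Delta n) s q (col X)"
      unfolding Suc by (rule col_bd[OF cube.cells_faces[OF X]])
    show ?thesis
    proof (cases "col X = {}")
      case True
      then have "col (bd ?K s p X) = {}" using e bd_subset[of "Delta n" s q "col X"] by auto
      then show ?thesis using True negs_bd[of p s "Suc n" X] Suc fxd by (auto simp: hv)
    next
      case False
      then have cX: "col X \<in> cells (Delta n)" using cc(2)[OF X] by simp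
      have "bd (Delta n) s q (col X) \<noteq> {}" using simplex.cells_nonempty cells_bd[OF cX] by blast
      then show ?thesis using e False xD(2,3)[OF cX, of q] Suc by (auto simp: hv bd_True bd_False)
    qed
  qed
  have comp: "hv n x (X \<union> Y) = cmp C p (hv n x X) (hv n x Y)"
    if X: "X \<in> cells ?K" and Y: "Y \<in> cells ?K" and m: "bd ?K False p X = bd ?K True p Y" for p X Y
  proof (cases p)
    case 0
    have vY: "?v \<in> Y \<longleftrightarrow> ?v \<in> X \<and> col X = {}"
      using negs_bd[of 0 True "Suc n" Y] negs_tgt[OF X] m 0 by auto
    show ?thesis
    proof (cases "col X = {}")
      case True
      show ?thesis
      proof (cases "col Y = {}")
        case True
        then show ?thesis
          using \<open>col X = {}\<close> vY unit_src[of a p] unit_src[of b p] ab fxd by (auto simp: hv col_Un)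
      next
        case False
        then have "?v \<in> X" "col Y \<in> cells (Delta n)" using cc[OF Y] vY by auto
        then show ?thesis
          using True False ends(1)[of "col Y"] unit_src[of "x (col Y)" 0] xD(1)[of "col Y"] 0 by (simp add: hv col_Un)
      qed
    next
      case False
      then have "?v \<notin> Y" "col Y = {}" "col X \<in> cells (Delta n)" using cc[OF X] cc(1)[OF Y] vY by auto
      then show ?thesis
        using False ends(2)[of "col X"] unit_tgt[of "x (col X)" 0] xD(1)[of "col X"] 0 by (simp add: hv col_Un)
    qed
  next
    case (Suc q)
    have e: "bd (Delta n) False q (col X) = bd (Delta n) True q (col Y)"
      using m col_bd[OF cube.cells_faces[OF X], of False q] col_bd[OF cube.cells_faces[OF Y], of True q] Suc by simp
    have v: "?v \<in> X \<longleftrightarrow> ?v \<in> Y" using negs_bd[of p _ "Suc n" X] negs_bd[of p _ "Suc n" Y] m Suc by auto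
    have ne: "bd (Delta n) s q (col Z) \<noteq> {}" if "Z \<in> cells ?K" "col Z \<noteq> {}" for s Z
      using simplex.cells_nonempty cells_bd cc(2)[OF that] by blast
    \<comment> \<open>Both factors survive or neither does, because boundaries of cells are nonempty
      and these two are equal.\<close>
    have em: "col X = {} \<longleftrightarrow> col Y = {}"
      using ne[OF X] ne[OF Y] e bd_subset[of "Delta n" False q "col X"] bd_subset[of "Delta n" True q "col Y"] by (metis subset_empty)
    show ?thesis
    proof (cases "col X = {}")
      case True
      then show ?thesis using em v unit_src[of a p] unit_src[of b p] ab fxd by (auto simp: hv col_Un)
    next
      case False
      then show ?thesis using em xD(4)[OF cc(2)[OF X] cc(2)[OF Y] e] Suc by (auto simp: hv col_Un)
    qed
  qed
  show ?thesis
    unfolding functors_cell_iff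
  proof (intro conjI ballI allI impI)
    fix X p assume X: "X \<in> cells ?K"
    show "(\<lambda>X\<in>cells ?K. hv n x X) (bd ?K True p X) = src C p ((\<lambda>X\<in>cells ?K. hv n x X) X)"
      "(\<lambda>X\<in>cells ?K. hv n x X) (bd ?K False p X) = tgt C p ((\<lambda>X\<in>cells ?K. hv n x X) X)"
      using X cells_bd[OF X] bd[OF X, of True p] bd[OF X, of False p] by auto
    fix Y assume Y: "Y \<in> cells ?K" and m: "bd ?K False p X = bd ?K True p Y"
    show "(\<lambda>X\<in>cells ?K. hv n x X) (X \<union> Y) = cmp C p ((\<lambda>X\<in>cells ?K. hv n x X) X) ((\<lambda>X\<in>cells ?K. hv n x X) Y)"
      using X Y cells_comp[OF X Y m] comp[OF X Y m] by simp
  qed (use carr in auto)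
qed

lemma hv_atom:
  assumes "length k = Suc n"
  shows "hv n x (sub (Cube (Suc n)) k) = h_val C n x k"
proof (cases "Pos \<in> set k")
  case True
  then have "negs (Suc n) \<notin> sub (Cube (Suc n)) k" using Pos_sub[of "negs (Suc n)"] by (auto simp del: replicate_Suc)
  then show ?thesis using True col_sub_Pos[OF True, of "Suc n"] by (simp add: hv_def h_val_def del: replicate_Suc)
next
  case False
  have c: "col (sub (Cube (Suc n)) k) = sub (Delta n) (zs k)" by (rule col_sub_no_Pos[OF assms False])
  show ?thesis
  proof (cases "zs k = {}")
    case True
    then have k: "k = negs (Suc n)" using negs_no_zeros[OF assms False] by simp
    moreover have "Zero \<notin> set k" unfolding k by simp
    ultimately show ?thesis using c True False by (simp add: hv_def h_val_def sub_negs del: replicate_Suc)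
  next
    case ne: False
    then have "Zero \<in> set k" by (force simp: zs_def in_set_conv_nth)
    moreover have "sub (Delta n) (zs k) \<noteq> {}" using ne by auto
    ultimately show ?thesis using c False by (simp add: hv_def h_val_def del: Delta_sub) (simp add: zs_def)
  qed
qed

lemma h_map_eq:
  assumes "x \<in> functors (cell_cat (Delta n)) (path_cat C)"
  shows "h_map C n x = (\<lambda>X\<in>cells (Cube (Suc n)). hv n x X)"
  unfolding h_map_def using hv_functor[OF assms] by (rule functor_ext_eqI) (simp add: hv_atom cells.atom)

lemma h_map_apply:
  "x \<in> functors (cell_cat (Delta n)) (path_cat C) \<Longrightarrow> X \<in> cells (Cube (Suc n)) \<Longrightarrow> h_map C n x X = hv n x X"
  by (simp add: h_map_eq)

lemma h_map_functor:
  "x \<in> functors (cell_cat (Delta n)) (path_cat C) \<Longrightarrow> h_map C n x \<in> functors (cell_cat (Cube (Suc n))) C"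
  using hv_functor h_map_eq by simp

lemma h_unique:
  assumes x: "x \<in> functors (cell_cat (Delta n)) (path_cat C)"
  shows "\<exists>!F. F \<in> functors (cell_cat (Cube (n + 1))) C \<and>
    (\<forall>k \<in> faces (Cube (n + 1)). F (sub (Cube (n + 1)) k) = h_val C n x k)"
proof (rule ex1I[of _ "h_map C n x"])
  show "h_map C n x \<in> functors (cell_cat (Cube (n + 1))) C \<and>
      (\<forall>k \<in> faces (Cube (n + 1)). h_map C n x (sub (Cube (n + 1)) k) = h_val C n x k)"
    using h_map_functor[OF x] h_map_apply[OF x] hv_atom cells.atom[of _ "Cube (Suc n)"] by simp
next
  fix F assume F: "F \<in> functors (cell_cat (Cube (n + 1))) C \<and>
      (\<forall>k \<in> faces (Cube (n + 1)). F (sub (Cube (n + 1)) k) = h_val C n x k)"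
  show "F = h_map C n x"
  proof (rule functor_eqI)
    show "F \<in> functors (cell_cat (Cube (Suc n))) C" "h_map C n x \<in> functors (cell_cat (Cube (Suc n))) C"
      using F h_map_functor[OF x] by simp_all
    fix k assume "k \<in> faces (Cube (Suc n))"
    then show "F (sub (Cube (Suc n)) k) = h_map C n x (sub (Cube (Suc n)) k)"
      using F h_map_apply[OF x] hv_atom cells.atom[of k "Cube (Suc n)"] by simp
  qed
qed

text \<open>A corner edge contains the vertex without ending there, so it survives
  \<open>col\<close>, and its value is a morphism of the path category and has positive
  dimension.\<close>

lemma h_map_corner:
  assumes x: "x \<in> functors (cell_cat (Delta n)) (path_cat C)"
  shows "h_map C n x \<in> simp (corner_nerve C) n"
  unfolding corner_simp
proof (intro conjI allI impI)
  show "h_map C n x \<in> functors (cell_cat (Cube (Suc n))) C" by (rule h_map_functor[OF x])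
  fix u assume u: "corner_edge (Suc n) u"
  then have uc: "u \<in> cells (Cube (Suc n))" by (simp add: corner_edge_def)
  have "negs (Suc n) \<in> u" using u bd_subset[of "Cube (Suc n)" True 0 u] by (auto simp: corner_edge_def)
  then have ne: "col u \<noteq> {}" using u negs_tgt[OF uc] by (auto simp: corner_edge_def)
  then have hu: "h_map C n x u = x (col u)" using h_map_apply[OF x uc] by (simp add: hv_def)
  have c: "x (col u) \<in> carr C" "Defs.dim C (x (col u)) > 0" using functorD(1)[OF x col_cells(2)[OF uc ne]] by auto
  note hD = functorD(2,3)[OF h_map_functor[OF x] uc, of 1]
  show "Defs.dim C (h_map C n x u) = 1"
  proof (rule dim_1)
    show "src C 1 (h_map C n x u) = h_map C n x u" "tgt C 1 (h_map C n x u) = h_map C n x u"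
      using hD u by (simp_all add: corner_edge_def)
    show "\<not> (src C 0 (h_map C n x u) = h_map C n x u \<and> tgt C 0 (h_map C n x u) = h_map C n x u)"
      using c dim_0_iff[OF c(1)] hu by auto
  qed
qed

text \<open>Faces and degeneracies at once. The map \<open>f\<close> need not preserve the first and
  last vertices, but \<open>ends_constant\<close> still identifies the end states.\<close>

lemma h_map_pb:
  assumes w: "word_operator m n \<phi> f" and x: "x \<in> functors (cell_cat (Delta n)) (path_cat C)"
  shows "h_map C m (pb (Delta m) ((`) ((`) f)) x) = pb (Cube (Suc m)) ((`) \<phi>) (h_map C n x)"
proof -
  interpret word_operator m n \<phi> f by fact
  let ?y = "pb (Delta m) ((`) ((`) f)) x"
  have y: "?y \<in> functors (cell_cat (Delta m)) (path_cat C)" by (rule pb_functor[OF cell_map_f x])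
  have s: "sub (Delta m) {j} \<in> cells (Delta m)" if "j \<le> m" for j using that by (intro cells.atom) auto
  have e: "?y (sub (Delta m) {j}) = x (sub (Delta n) {f j})" if "j \<le> m" for j
    using s[OF that] Delta_sub_image[of f m "{j}" n] by (simp add: pb_apply del: Delta_sub)
  have s': "sub (Delta n) {j} \<in> cells (Delta n)" if "j \<le> n" for j using that by (intro cells.atom) auto
  have ends: "src C 0 (?y (sub (Delta m) {m})) = src C 0 (x (sub (Delta n) {n}))"
    "tgt C 0 (?y (sub (Delta m) {0})) = tgt C 0 (x (sub (Delta n) {0}))"
    using e[of m] e[of 0] ends_constant[OF x s'[OF f_bound], of m n] ends_constant[OF x s'[OF f_bound], of 0 0] by auto
  have "hv m ?y X = hv n x (\<phi> ` X)" if X: "X \<in> cells (Cube (Suc m))" for X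
  proof -
    have len: "length k = Suc m" if "k \<in> X" for k using cube.cells_faces[OF X] that by auto
    have c: "col (\<phi> ` X) = ((`) f) ` col X" by (rule col_\<phi>[OF cube.cells_faces[OF X]])
    have v: "negs (Suc n) \<in> \<phi> ` X \<longleftrightarrow> negs (Suc m) \<in> X"
      using Neg_iff len by (metis imageE image_eqI length_replicate)
    show ?thesis
      using c v ends pb_apply[OF col_cells(2)[OF X], of "(`) ((`) f)" x] by (auto simp: hv_def simp del: replicate_Suc)
  qed
  moreover have "\<phi> ` X \<in> cells (Cube (Suc n))" if "X \<in> cells (Cube (Suc m))" for X
    using cell_mapD(1)[OF map_\<phi> that] .
  ultimately show ?thesis
    unfolding h_map_eq[OF x] h_map_eq[OF y] pb_def[of "Cube (Suc m)"] by (intro restrict_ext) simp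
qed

lemma h_simplicial: "simplicial_map (globular_nerve C) (corner_nerve C) (h_map C)"
  unfolding simplicial_map_def
proof (intro conjI allI ballI impI)
  show "simplicial_set (globular_nerve C)" "simplicial_set (corner_nerve C)"
    by (rule simplicial_set_globular simplicial_set_corner)+
  show "x \<in> simp (globular_nerve C) n \<Longrightarrow> h_map C n x \<in> simp (corner_nerve C) n" for n x
    using h_map_corner by simp
  fix n i x
  show "h_map C n (face (globular_nerve C) n i x) = face (corner_nerve C) n i (h_map C (Suc n) x)"
    if i: "i \<le> Suc n" and x: "x \<in> simp (globular_nerve C) (Suc n)"
    using h_map_pb[OF word_operator_ins[OF i], of x] x h_map_corner[of x "Suc n"] i
      globular_face[OF i x] corner_face[OF i, of "h_map C (Suc n) x" C] by simp
  show "h_map C (Suc n) (degen (globular_nerve C) n i x) = degen (corner_nerve C) n i (h_map C n x)"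
    if i: "i \<le> n" and x: "x \<in> simp (globular_nerve C) n"
    using h_map_pb[OF word_operator_mg[OF i], of x] x h_map_corner[of x n] i
      globular_degen[OF i x] corner_degen[OF i, of "h_map C n x" C] by simp
qed

lemma mors_0: "x \<in> carr C \<Longrightarrow> src C 0 x \<in> mors C 0" "x \<in> carr C \<Longrightarrow> tgt C 0 x \<in> mors C 0"
  using src_carr tgt_carr point_src point_tgt by (auto simp: mors_def)

lemma h_augmented: "aug_simplicial_map (globular_nerve C) (corner_nerve C) (h_map C) (\<lambda>(a, b). a)"
proof -
  have s0: "sub (Delta 0) {0} \<in> cells (Delta 0)" by (intro cells.atom) auto
  have ag: "augm (globular_nerve C) x = (src C 0 (x (sub (Delta 0) {0})), tgt C 0 (x (sub (Delta 0) {0})))" for x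
    by (simp add: globular_nerve_def)
  have ac: "augm (corner_nerve C) x = src C 0 (x (sub (Cube 1) [Zero]))" for x by (simp add: corner_nerve_def)
  have z: "sub (Cube 1) [Zero] \<in> cells (Cube 1)" by (intro cells.atom) auto
  have "aug_simplicial_set (globular_nerve C)"
    unfolding aug_simplicial_set_def
  proof (intro conjI ballI)
    show "simplicial_set (globular_nerve C)" by (rule simplicial_set_globular)
    show "augm (globular_nerve C) x \<in> augs (globular_nerve C)" if "x \<in> simp (globular_nerve C) 0" for x
      using functorD(1)[OF _ s0, of x "path_cat C"] that mors_0 unfolding ag by (simp add: globular_nerve_def)
    fix x assume x: "x \<in> simp (globular_nerve C) 1"
    have "face (globular_nerve C) 0 i x (sub (Delta 0) {0}) = x (sub (Delta 1) {delta i 0})" if "i \<le> 1" for i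
      using globular_face[of i 0 x C] x that s0 Delta_sub_image[of "delta i" 0 "{0}" 1] by (simp add: pb_apply del: Delta_sub)
    moreover have "sub (Delta 1) {delta i 0} \<in> cells (Delta 1)" for i by (intro cells.atom) (auto simp: delta_def)
    ultimately show "augm (globular_nerve C) (face (globular_nerve C) 0 0 x) = augm (globular_nerve C) (face (globular_nerve C) 0 1 x)"
      using ends_constant[of x 1 "sub (Delta 1) {delta 0 0}" 0] ends_constant[of x 1 "sub (Delta 1) {delta 1 0}" 0] x
      unfolding ag by (simp del: Delta_sub)
  qed
  moreover have "aug_simplicial_set (corner_nerve C)"
    unfolding aug_simplicial_set_def
  proof (intro conjI ballI)
    show "simplicial_set (corner_nerve C)" by (rule simplicial_set_corner)
    show "augm (corner_nerve C) x \<in> augs (corner_nerve C)" if "x \<in> simp (corner_nerve C) 0" for x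
    proof -
      have "x \<in> functors (cell_cat (Cube 1)) C" using that by (simp add: corner_simp)
      then show ?thesis using functorD(1)[OF _ z, of x C] mors_0 unfolding ac by (simp add: corner_nerve_def)
    qed
    fix x assume x: "x \<in> simp (corner_nerve C) 1"
    then have xf: "x \<in> functors (cell_cat (Cube (Suc 1))) C" by (simp add: corner_simp)
    have "bd (Cube 1) True 0 (sub (Cube 1) [Zero]) \<subseteq> {[Neg]}"
    proof
      fix w assume "w \<in> bd (Cube 1) True 0 (sub (Cube 1) [Zero])"
      then have w: "w \<in> sub (Cube 1) [Zero]" "card (zs w) = 0"
        "\<And>b. b \<in> sub (Cube 1) [Zero] \<Longrightarrow> card (zs b) = 1 \<Longrightarrow> w \<in> sub (Cube 1) b \<Longrightarrow> w \<in> Sub (Cube 1) (fbd (Cube 1) True b)"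
        by (auto simp: bd_iff)
      have zz: "zs [Zero] = {0}" by (auto simp: zs_def)
      have "[Zero] \<in> sub (Cube 1) [Zero]" by (simp add: Cube_sub)
      then have "\<exists>j\<in>{0}. w ! j = bsgn True (pos {0} j)"
        using w(3)[of "[Zero]"] w(1) zz Cube_Sub_fbd[OF w(1), of True] by simp
      then have "w ! 0 = Neg" by (simp add: bsgn_def pos_def)
      moreover have "length w = 1" using w(1) by (simp add: Cube_sub)
      ultimately show "w \<in> {[Neg]}" by (cases w) auto
    qed
    moreover have "bd (Cube 1) True 0 (sub (Cube 1) [Zero]) \<noteq> {}" using cube.cells_nonempty cells_bd[OF z] by blast
    ultimately have b: "bd (Cube 1) True 0 (sub (Cube 1) [Zero]) = {[Neg]}" by (metis subset_singletonD)
    \<comment> \<open>Both faces of the square start at the vertex \<open>--\<close>: for either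
      value of \<open>i\<close>, inserting \<open>-\<close> into the word \<open>-\<close> gives the
      same word.\<close>
    have "src C 0 (face (corner_nerve C) 0 i x (sub (Cube 1) [Zero])) = x {ins i Neg [Neg]}" if "i \<le> 1" for i
    proof -
      have m: "cell_map (Cube 1) (Cube (Suc 1)) ((`) (ins i Neg))" using that by (intro cell_map_insN)
      have "face (corner_nerve C) 0 i x = pb (Cube 1) ((`) (ins i Neg)) x" using corner_face[of i 0 x C] x that by simp
      then have "src C 0 (face (corner_nerve C) 0 i x (sub (Cube 1) [Zero])) = pb (Cube 1) ((`) (ins i Neg)) x {[Neg]}"
        using functorD(2)[OF pb_functor[OF m xf] z, of 0] b by simp
      moreover have "{[Neg]} \<in> cells (Cube 1)" using cells_bd[OF z, of True 0] b by simp
      ultimately show ?thesis by (simp add: pb_apply)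
    qed
    from this[of 0] this[of 1]
    show "augm (corner_nerve C) (face (corner_nerve C) 0 0 x) = augm (corner_nerve C) (face (corner_nerve C) 0 1 x)"
      unfolding ac by (simp add: ins_def)
  qed
  moreover have "(case augm (globular_nerve C) x of (a, b) \<Rightarrow> a) = augm (corner_nerve C) (h_map C 0 x)"
    if "x \<in> simp (globular_nerve C) 0" for x
  proof -
    have zz: "zs [Zero] = {0}" by (auto simp: zs_def)
    have "h_map C 0 x (sub (Cube 1) [Zero]) = x (sub (Delta 0) {0})"
    proof -
      have "col (sub (Cube 1) [Zero]) = sub (Delta 0) {0}" using col_sub_no_Pos[of "[Zero]" 1 0] zz by simp
      moreover have "sub (Delta 0) {0} \<noteq> {}" by auto
      moreover have "h_map C 0 x (sub (Cube 1) [Zero]) = hv 0 x (sub (Cube 1) [Zero])"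
        using that h_map_apply[of x 0 "sub (Cube 1) [Zero]"] z by simp
      ultimately show ?thesis unfolding hv_def by simp
    qed
    then show ?thesis unfolding ag ac by simp
  qed
  moreover have "augs (globular_nerve C) = mors C 0 \<times> mors C 0" "augs (corner_nerve C) = mors C 0"
    by (simp_all add: globular_nerve_def corner_nerve_def)
  ultimately show ?thesis
    unfolding aug_simplicial_map_def using h_simplicial by auto
qed

lemma h_inj: "inj_on (h_map C n) (simp (globular_nerve C) n)"
proof (rule inj_onI)
  fix x y assume x: "x \<in> simp (globular_nerve C) n" and y: "y \<in> simp (globular_nerve C) n" and eq: "h_map C n x = h_map C n y"
  show "x = y"
  proof (rule functor_eqI)
    show "x \<in> functors (cell_cat (Delta n)) (path_cat C)" "y \<in> functors (cell_cat (Delta n)) (path_cat C)"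
      using x y by simp_all
    fix \<sigma> assume s: "\<sigma> \<in> faces (Delta n)"
    let ?w = "sub (Cube (Suc n)) (word (Suc n) \<sigma>)"
    have c: "col ?w = sub (Delta n) \<sigma>" using s by (intro col_sub_word) auto
    have ne: "sub (Delta n) \<sigma> \<noteq> {}" using s by auto
    have "?w \<in> cells (Cube (Suc n))" by (intro cells.atom) simp
    then show "x (sub (Delta n) \<sigma>) = y (sub (Delta n) \<sigma>)"
      using fun_cong[OF eq, of ?w] x y c ne by (simp add: h_map_apply hv_def del: Delta_sub)
  qed
qed

lemma h_image_faces:
  assumes x: "x \<in> functors (cell_cat (Delta n)) (path_cat C)" and i: "i \<in> {1..n + 1}" and X: "X \<in> cells (Cube n)"
  shows "cube_face C n Pos i (h_map C n x) X \<in> mors C 0"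
proof -
  obtain i' where i': "i = Suc i'" "i' \<le> n" using i by (cases i) auto
  have m: "cell_map (Cube n) (Cube (Suc n)) ((`) (ins i' Pos))" using i' by (intro cell_map_ins) auto
  let ?Y = "ins i' Pos ` X"
  have Y: "?Y \<in> cells (Cube (Suc n))" by (rule cell_mapD(1)[OF m X])
  have P: "Pos \<in> set (ins i' Pos k)" for k by (simp add: ins_def)
  have "col ?Y = {}" using P by (auto simp: col_def)
  moreover have "negs (Suc n) \<notin> ?Y"
  proof
    assume "negs (Suc n) \<in> ?Y"
    then obtain k where "negs (Suc n) = ins i' Pos k" by blast
    then have "Pos \<in> set (negs (Suc n))" using P[of k] by simp
    then show False by simp
  qed
  ultimately have "h_map C n x ?Y = tgt C 0 (x (sub (Delta n) {0}))" using h_map_apply[OF x Y] by (simp add: hv_def)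
  moreover have "sub (Delta n) {0} \<in> cells (Delta n)" by (intro cells.atom) auto
  ultimately show ?thesis
    using cube_face_pb[of i' n Pos "h_map C n x" C] i' h_map_functor[OF x] X functorD(1)[OF x, of "sub (Delta n) {0}"] mors_0
    by (simp add: pb_apply)
qed

end

section \<open>Cylinders and cones\<close>

text \<open>Cells composed from generators without taking boundaries in between. A cylinder being
  good does not pass to the cylinder over a boundary, so an induction over all cells would get stuck
  at the step for \<open>bd\<close>; pure cells have no such step.\<close>

inductive_set pure :: "'f face_system \<Rightarrow> 'f set set" for K where
  atom: "a \<in> faces K \<Longrightarrow> sub K a \<in> pure K"
| comp: "X \<in> pure K \<Longrightarrow> Y \<in> pure K \<Longrightarrow> bd K False p X = bd K True p Y \<Longrightarrow> X \<union> Y \<in> pure K"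

lemma pure_cells: "X \<in> pure K \<Longrightarrow> X \<in> cells K"
  by (induction rule: pure.induct) (auto intro: cells.atom cells_comp)

text \<open>A boundary of a composite is a boundary of one factor or a composite of boundaries of
  both.\<close>

lemma (in pasting) comp_bd_in:
  assumes X: "X \<in> cells K" and Y: "Y \<in> cells K" and m: "bd K False p X = bd K True p Y"
    and Q: "\<And>A B p. A \<in> Q \<Longrightarrow> B \<in> Q \<Longrightarrow> bd K False p A = bd K True p B \<Longrightarrow> A \<union> B \<in> Q"
    and in_Q: "\<And>s q. bd K s q X \<in> Q" "\<And>s q. bd K s q Y \<in> Q"
  shows "bd K s q (X \<union> Y) \<in> Q"
proof -
  have m1: "bd K (\<not> True) p X = bd K True p Y" and m2: "bd K (\<not> False) p Y = bd K False p X" using m by simp_all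
  show ?thesis
  proof (cases q p rule: linorder_cases)
    case less then show ?thesis using comp_bd_low[OF X Y m1 less, of s] in_Q by simp
  next
    case equal
    have "bd K True p (X \<union> Y) = bd K True p X" using comp_bd[OF X Y m1] .
    moreover have "bd K False p (X \<union> Y) = bd K False p Y" using comp_bd[OF Y X m2] by (simp add: Un_commute)
    ultimately show ?thesis using in_Q equal by (cases s) auto
  next
    case greater
    have "bd K False p (bd K s q X) = bd K True p (bd K s q Y)"
      using bd_bd[OF X greater] bd_bd[OF Y greater] m by simp
    then show ?thesis using comp_bd_high[OF X Y m1 greater, of s] Q in_Q by simp
  qed
qed

lemma cells_pure:
  assumes "pasting K" and bd_atom: "\<And>a s p. a \<in> faces K \<Longrightarrow> bd K s p (sub K a) \<in> pure K" and X: "X \<in> cells K"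
  shows "X \<in> pure K"
proof -
  interpret pasting K by fact
  have bdp: "bd K s p X \<in> pure K" if "X \<in> pure K" for s p X
    using that
  proof (induction arbitrary: s p rule: pure.induct)
    case (comp X Y q)
    show ?case
      by (rule comp_bd_in[OF pure_cells[OF comp(1)] pure_cells[OF comp(2)] comp(3)]) (auto intro: pure.comp comp)
  qed (rule bd_atom)
  show ?thesis using X by (induction rule: cells_induct) (auto intro: pure.intros bdp)
qed

text \<open>
  \<open>E\<close> raises dimensions by one, like the product with an interval or the cone, and \<open>\<beta>\<close> gives its two ends.
  The boundary of \<open>E X\<close> is \<open>U s r (bd s r X)\<close>, and all sets \<open>U s r N\<close> are iterated composites of cylinders
  over cells of lower dimension with one of the ends of \<open>N\<close>.
\<close>

locale cylinder = K: pasting K + L: pasting L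
  for K :: "'f face_system" and L :: "'g face_system" +
  fixes E :: "'f set \<Rightarrow> 'g set" and \<beta> :: "bool \<Rightarrow> 'f set \<Rightarrow> 'g set" and Q :: "'g set set" and d :: nat
  assumes all_pure: "X \<in> cells K \<Longrightarrow> X \<in> pure K"
    and fdim_bound: "a \<in> faces K \<Longrightarrow> fdim K a \<le> d"
    and Q_cells: "A \<in> Q \<Longrightarrow> A \<in> cells L"
    and Q_comp: "A \<in> Q \<Longrightarrow> B \<in> Q \<Longrightarrow> bd L False p A = bd L True p B \<Longrightarrow> A \<union> B \<in> Q"
    and E_atom: "a \<in> faces K \<Longrightarrow> E (sub K a) \<in> Q"
    and E_Un: "E (X \<union> Y) = E X \<union> E Y"
    and \<beta>_map: "cell_map K L (\<beta> b)"
    and \<beta>_Q: "N \<in> cells K \<Longrightarrow> \<beta> b N \<in> Q"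
    and \<beta>_E: "N \<in> cells K \<Longrightarrow> \<beta> b N \<subseteq> E N"
    and bd_E_0: "X \<in> cells K \<Longrightarrow> bd L s 0 (E X) = \<beta> s (bd K s 0 X)"
    and bd_E_Suc: "X \<in> cells K \<Longrightarrow> bd L s (Suc r) (E X) = E (bd K s r X) \<union> \<beta> (odd r = s) (bd K s (Suc r) X)"
    and E_dim: "c \<in> E X \<Longrightarrow> (\<And>a. a \<in> X \<Longrightarrow> fdim K a \<le> r) \<Longrightarrow> fdim L c \<le> Suc r"
begin

fun U :: "bool \<Rightarrow> nat \<Rightarrow> 'f set \<Rightarrow> 'g set" where
  "U s 0 N = \<beta> s N"
| "U s (Suc r) N = E (bd K s r N) \<union> \<beta> (odd r = s) N"

lemma E_mono: "X \<subseteq> Y \<Longrightarrow> E X \<subseteq> E Y"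
  using E_Un[of X Y] by (metis Un_absorb1 Un_upper1)

lemma bd_E: "X \<in> cells K \<Longrightarrow> bd L s r (E X) = U s r (bd K s r X)"
  using bd_E_0 bd_E_Suc K.bd_bd[of X _ "Suc _"] by (cases r) auto

text \<open>The end in \<open>U s (Suc r) N\<close> may be enlarged to
  \<open>U (\<not> s) r N\<close>, as the cylinder that this adds is contained in the one already
  present. In this form the set is a composite along order r.\<close>

lemma U_Suc: "N \<in> cells K \<Longrightarrow> U s (Suc r) N = E (bd K s r N) \<union> U (\<not> s) r N"
proof (cases r)
  case 0 then show ?thesis by simp
next
  case (Suc r')
  assume N: "N \<in> cells K"
  have "bd K (\<not> s) r' N \<subseteq> bd K s r N"
    using K.bd_bd[OF N, of r' r "\<not> s" s] bd_subset[of K "\<not> s" r' "bd K s r N"] Suc by simp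
  then have "E (bd K (\<not> s) r' N) \<subseteq> E (bd K s r N)" by (rule E_mono)
  moreover have "(odd r = s) = (odd r' = (\<not> s))" using Suc by auto
  ultimately show ?thesis using Suc by auto
qed

lemma U_subset: "N \<in> cells K \<Longrightarrow> U s r N \<subseteq> E N"
  using \<beta>_E E_mono[OF bd_subset] by (cases r) auto

text \<open>The main claim up to dimension \<open>r\<close>: the boundaries that occur in
  \<open>U\<close> have lower dimension, so this is what an induction can supply for them.\<close>

definition E_good :: "nat \<Rightarrow> bool" where
  "E_good r \<longleftrightarrow> (\<forall>N\<in>cells K. (\<forall>a\<in>N. fdim K a \<le> r) \<longrightarrow> E N \<in> Q)"

lemma Q_comp': "X \<in> Q \<Longrightarrow> Y \<in> Q \<Longrightarrow> bd L (\<not> s) p X = bd L s p Y \<Longrightarrow> X \<union> Y \<in> Q"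
  using Q_comp[of X Y p] Q_comp[of Y X p] by (cases s) (auto simp: Un_commute)

lemma U_step:
  assumes N: "N \<in> cells K" and E: "E (bd K s r N) \<in> Q" and V: "U (\<not> s) r N \<in> Q"
    and bdV: "\<And>q s'. r \<le> q \<Longrightarrow> bd L s' q (U (\<not> s) r N) = U (\<not> s) r (bd K s' q N)"
  shows "bd L (\<not> s) r (E (bd K s r N)) = bd L s r (U (\<not> s) r N)"
proof -
  have "bd L (\<not> s) r (E (bd K s r N)) = U (\<not> s) r (bd K s r N)"
    using bd_E[OF cells_bd[OF N], where s="\<not> s" and r=r] bd_bd_ge[of r r K "\<not> s" s N] by simp
  then show ?thesis using bdV[of r s] by simp
qed

text \<open>\<open>U_Suc\<close> attaches one cylinder at a time, over a boundary of order below
  \<open>r\<close>. The boundaries of high order have to be followed through the same induction, as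
  they show that the next cylinder fits.\<close>

lemma U_Q:
  assumes "\<And>j. j < r \<Longrightarrow> E_good j" "N \<in> cells K"
  shows "U s r N \<in> Q \<and> (\<forall>q\<ge>r. \<forall>s'. bd L s' q (U s r N) = U s r (bd K s' q N))"
  using assms
proof (induction r arbitrary: s N)
  case 0 then show ?case using \<beta>_Q cell_mapD(2)[OF \<beta>_map] by auto
next
  case (Suc r)
  have N: "N \<in> cells K" and IH: "U (\<not> s) r N \<in> Q" "\<And>q s'. r \<le> q \<Longrightarrow> bd L s' q (U (\<not> s) r N) = U (\<not> s) r (bd K s' q N)"
    using Suc.prems Suc.IH[of N "\<not> s"] by auto
  have E: "E (bd K s r N) \<in> Q"
    using Suc.prems(1)[of r] cells_bd[OF N] bd_dim[of _ K s r N] by (auto simp: E_good_def)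
  note m = U_step[OF N E IH]
  have bd: "bd L s' q (U s (Suc r) N) = U s (Suc r) (bd K s' q N)" if q: "Suc r \<le> q" for s' q
  proof -
    have rq: "r < q" using q by simp
    have "bd L s' q (E (bd K s r N)) = E (bd K s r N)"
    proof (rule bd_low)
      fix a assume "a \<in> E (bd K s r N)"
      then have "fdim L a \<le> Suc r" by (rule E_dim) (rule bd_dim)
      then show "fdim L a \<le> q" using q by simp
    qed
    moreover have "bd K s r (bd K s' q N) = bd K s r N" by (rule K.bd_bd[OF N rq])
    ultimately show ?thesis
      using L.comp_bd_high[OF Q_cells[OF E] Q_cells[OF IH(1)] m rq, of s'] IH(2)[of q s'] rq
      unfolding U_Suc[OF N] U_Suc[OF cells_bd[OF N]] by simp
  qed
  have "U s (Suc r) N \<in> Q" unfolding U_Suc[OF N] using Q_comp'[OF E IH(1) m] .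
  then show ?case using bd by blast
qed

text \<open>Cylinders over composable cells do not match along order p + 1 until each is completed
  by a piece of the boundary of the other: \<open>V\<close> is taken from the cylinder over
  \<open>Y\<close>, and \<open>W\<close> from that over \<open>X\<close>. The completions are
  composites along order p, and the completed cylinders are then composed along order p + 1.\<close>

lemma comp_E:
  assumes X: "X \<in> cells K" "E X \<in> Q" and Y: "Y \<in> cells K" "E Y \<in> Q" and m: "bd K False p X = bd K True p Y"
    and good: "\<And>j. j < p \<Longrightarrow> E_good j"
  defines "V \<equiv> U False p (bd K True (Suc p) Y)" and "W \<equiv> U True p (bd K False (Suc p) X)"
  shows "V \<in> Q" "W \<in> Q" "bd L False p (E X) = bd L True p V" "bd L False p W = bd L True p (E Y)"
    "bd L False (Suc p) (E X \<union> V) = bd L True (Suc p) (W \<union> E Y)" "E (X \<union> Y) = (E X \<union> V) \<union> (W \<union> E Y)"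
proof -
  let ?S = "bd K True (Suc p) Y" and ?T = "bd K False (Suc p) X"
  have S: "?S \<in> cells K" and T: "?T \<in> cells K" using X Y cells_bd by auto
  have V: "V \<in> Q" "\<And>q s'. p \<le> q \<Longrightarrow> bd L s' q V = U False p (bd K s' q ?S)"
    using U_Q[OF good S, where s=False] unfolding V_def by auto
  have W: "W \<in> Q" "\<And>q s'. p \<le> q \<Longrightarrow> bd L s' q W = U True p (bd K s' q ?T)"
    using U_Q[OF good T, where s=True] unfolding W_def by auto
  show "V \<in> Q" "W \<in> Q" by fact+
  have bS: "bd K True p ?S = bd K True p Y" and bT: "bd K False p ?T = bd K False p X"
    using K.bd_bd[OF Y(1)] K.bd_bd[OF X(1)] by auto
  show m1: "bd L False p (E X) = bd L True p V" using V(2)[where q=p and s'=True] bd_E[OF X(1), where s=False and r=p] bS m by simp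
  show m2: "bd L False p W = bd L True p (E Y)" using W(2)[where q=p and s'=False] bd_E[OF Y(1), where s=True and r=p] bT m by simp
  have m1': "bd L (\<not> True) p (E X) = bd L True p V" and m2': "bd L (\<not> True) p W = bd L True p (E Y)" using m1 m2 by simp_all
  have "bd L False (Suc p) (E X \<union> V) = bd L False (Suc p) (E X) \<union> bd L False (Suc p) V"
    by (rule L.comp_bd_high[OF Q_cells[OF X(2)] Q_cells[OF V(1)] m1']) simp
  also have "bd L False (Suc p) V = V"
    using V(2)[where q="Suc p" and s'=False] bd_bd_ge[of "Suc p" "Suc p" K False True Y] by (simp add: V_def)
  also have "bd L False (Suc p) (E X) = E (bd K False p X) \<union> W"
    using bd_E[OF X(1), where s=False and r="Suc p"] U_Suc[OF T, where s=False and r=p] bT by (simp add: W_def)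
  finally have 1: "bd L False (Suc p) (E X \<union> V) = E (bd K False p X) \<union> W \<union> V" .
  have "bd L True (Suc p) (W \<union> E Y) = bd L True (Suc p) W \<union> bd L True (Suc p) (E Y)"
    by (rule L.comp_bd_high[OF Q_cells[OF W(1)] Q_cells[OF Y(2)] m2']) simp
  also have "bd L True (Suc p) W = W"
    using W(2)[where q="Suc p" and s'=True] bd_bd_ge[of "Suc p" "Suc p" K True False X] by (simp add: W_def)
  also have "bd L True (Suc p) (E Y) = E (bd K True p Y) \<union> V"
    using bd_E[OF Y(1), where s=True and r="Suc p"] U_Suc[OF S, where s=True and r=p] bS by (simp add: V_def)
  finally show "bd L False (Suc p) (E X \<union> V) = bd L True (Suc p) (W \<union> E Y)" using 1 m by auto
  have "V \<subseteq> E Y" "W \<subseteq> E X"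
    unfolding V_def W_def using U_subset[OF S] U_subset[OF T] E_mono[OF bd_subset] by blast+
  then show "E (X \<union> Y) = (E X \<union> V) \<union> (W \<union> E Y)" unfolding E_Un by blast
qed

text \<open>Induction on the dimension, and inside it on the composition of a pure cell. Along an
  order not below the dimension a composite is trivial, since each factor is its own boundary and
  the two are equal.\<close>

lemma E_good: "E_good p"
proof (induction p rule: less_induct)
  case (less p)
  have "E X \<in> Q" if "X \<in> pure K" "\<forall>a\<in>X. fdim K a \<le> p" for X
    using that
  proof (induction rule: pure.induct)
    case (atom a) then show ?case by (intro E_atom)
  next
    case (comp X Y q)
    have X: "X \<in> cells K" "E X \<in> Q" and Y: "Y \<in> cells K" "E Y \<in> Q" using comp pure_cells by auto
    show ?case
    proof (cases "q < p")
      case True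
      then have good: "E_good j" if "j < q" for j using less that by simp
      note c = comp_E[OF X Y comp(3) good]
      show ?thesis
        using Q_comp[OF Q_comp[OF X(2) c(1,3)] Q_comp[OF c(2) Y(2) c(4)] c(5)] c(6) by simp
    next
      case False
      then have "\<And>a. a \<in> X \<union> Y \<Longrightarrow> fdim K a \<le> q" using comp.prems by (meson le_trans not_le_imp_less less_imp_le)
      then have "bd K False q X = X" "bd K True q Y = Y" by (auto intro!: bd_low)
      then show ?thesis using comp(3) X by simp
    qed
  qed
  then show ?case unfolding E_good_def using all_pure by blast
qed

lemma E_Q: "X \<in> cells K \<Longrightarrow> E X \<in> Q"
  using E_good[of d] fdim_bound K.cells_faces unfolding E_good_def by blast

lemma U_in_Q: "N \<in> cells K \<Longrightarrow> U s r N \<in> Q"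
  using U_Q E_good by blast

end

subsection \<open>Products with an interval\<close>

definition prism :: "sign list set \<Rightarrow> sign list set" where
  "prism X = {k @ [a] |k a. k \<in> X}"

lemma prism_iff [simp]: "k @ [a] \<in> prism X \<longleftrightarrow> k \<in> X"
  by (auto simp: prism_def)

lemma zs_snoc: "zs (k @ [a]) = (if a = Zero then insert (length k) (zs k) else zs k)"
  by (auto simp: zs_def nth_append less_Suc_eq)

lemma sub_snoc: "k @ [a] \<in> sub (Cube n) (l @ [c]) \<longleftrightarrow> k \<in> sub (Cube m) l \<and> (c = Zero \<or> a = c)"
  by (auto simp: Cube_sub nth_append less_Suc_eq)

lemma card_zs_snoc: "card (zs (k @ [a])) = card (zs k) + (if a = Zero then 1 else 0)"
proof -
  have "length k \<notin> zs k" by (auto simp: zs_def)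
  then show ?thesis by (simp add: zs_snoc)
qed

lemma Sub_fbd_snoc:
  assumes "k @ [a] \<in> sub (Cube n) (l @ [c])"
  shows "k @ [a] \<in> Sub (Cube n) (fbd (Cube n) s (l @ [c])) \<longleftrightarrow>
    k \<in> Sub (Cube m) (fbd (Cube m) s l) \<or> (c = Zero \<and> a = bsgn s (card (zs l)))"
proof -
  have s: "k \<in> sub (Cube m) l" using assms sub_snoc by blast
  have len: "length k = length l" using s by (simp add: Cube_sub)
  have p: "pos (zs (l @ [c])) j = pos (zs l) j" if "j \<in> zs l" for j
  proof -
    have "{y \<in> zs (l @ [c]). y < j} = {y \<in> zs l. y < j}" using zs_less[OF that] by (auto simp: zs_snoc)
    then show ?thesis by (simp add: pos_def)
  qed
  have p': "pos (zs (l @ [c])) (length l) = card (zs l)"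
  proof -
    have "{y \<in> zs (l @ [c]). y < length l} = zs l" using zs_less[of _ l] by (auto simp: zs_snoc)
    then show ?thesis by (simp add: pos_def)
  qed
  have "(\<exists>j\<in>zs (l @ [c]). (k @ [a]) ! j = bsgn s (pos (zs (l @ [c])) j)) \<longleftrightarrow>
      (\<exists>j\<in>zs l. k ! j = bsgn s (pos (zs l) j)) \<or> (c = Zero \<and> a = bsgn s (card (zs l)))"
  proof -
    have "(k @ [a]) ! j = k ! j" if "j \<in> zs l" for j using zs_less[OF that] len by (simp add: nth_append)
    moreover have "(k @ [a]) ! length l = a" using len by (simp add: nth_append)
    ultimately show ?thesis using p p' by (auto simp: zs_snoc)
  qed
  then show ?thesis using Cube_Sub_fbd[OF assms] Cube_Sub_fbd[OF s] by simp
qed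

lemma not_in_Sub_fbd: "k \<notin> Sub (Cube m) (fbd (Cube m) s k)"
proof
  assume a: "k \<in> Sub (Cube m) (fbd (Cube m) s k)"
  have "k \<in> sub (Cube m) k" by (simp add: Cube_sub)
  then show False using a zs_Zero by (auto simp: Cube_Sub_fbd)
qed

lemma ins_end: "length k = m \<Longrightarrow> ins m a k = k @ [a]"
  by (simp add: ins_def)

text \<open>A face \<open>l @ [Zero]\<close> of dimension r + 1 has r zeros before the last one, so
  its boundary puts \<open>bsgn s r\<close> at the end. Only over that end is the boundary of order
  r kept; elsewhere the order drops by one.\<close>

lemma prism_bd:
  assumes X: "X \<in> cells (Cube m)"
  shows "k @ [a] \<in> bd (Cube (Suc m)) s r (prism X) \<longleftrightarrow>
    (if a = bsgn s r then k \<in> bd (Cube m) s r X else r > 0 \<and> k \<in> bd (Cube m) s (r - 1) X)"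
proof -
  let ?K = "Cube m" and ?L = "Cube (Suc m)"
  have dn: "l \<in> X \<Longrightarrow> k \<in> sub ?K l \<Longrightarrow> k \<in> X" for k l using cube.cells_down[OF X] by (auto simp: down_def)
  have self: "k \<in> X \<Longrightarrow> k \<in> sub ?K k" for k by (simp add: Cube_sub)
  have "k @ [a] \<in> bd ?L s r (prism X) \<longleftrightarrow> k \<in> X \<and> card (zs k) + (if a = Zero then 1 else 0) \<le> r \<and>
    (\<forall>l\<in>X. \<forall>c. card (zs l) + (if c = Zero then 1 else 0) = Suc r \<and> k \<in> sub ?K l \<and> (c = Zero \<or> a = c) \<longrightarrow>
      k \<in> Sub ?K (fbd ?K s l) \<or> (c = Zero \<and> a = bsgn s (card (zs l))))" (is "_ \<longleftrightarrow> ?R")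
  proof -
    have "(\<forall>b\<in>prism X. fdim ?L b = Suc r \<and> k @ [a] \<in> sub ?L b \<longrightarrow> k @ [a] \<in> Sub ?L (fbd ?L s b)) \<longleftrightarrow>
      (\<forall>l\<in>X. \<forall>c. fdim ?L (l @ [c]) = Suc r \<and> k @ [a] \<in> sub ?L (l @ [c]) \<longrightarrow> k @ [a] \<in> Sub ?L (fbd ?L s (l @ [c])))"
      by (auto simp: prism_def)
    also have "\<dots> \<longleftrightarrow> (\<forall>l\<in>X. \<forall>c. card (zs l) + (if c = Zero then 1 else 0) = Suc r \<and> k \<in> sub ?K l \<and> (c = Zero \<or> a = c) \<longrightarrow>
      k \<in> Sub ?K (fbd ?K s l) \<or> (c = Zero \<and> a = bsgn s (card (zs l))))"
      using Sub_fbd_snoc[of k a "Suc m" _ _ s m] sub_snoc[of k a "Suc m" _ _ m] by (simp add: card_zs_snoc)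
    finally show ?thesis unfolding bd_iff by (simp add: card_zs_snoc)
  qed
  also have "\<dots> \<longleftrightarrow> (if a = bsgn s r then k \<in> bd ?K s r X else r > 0 \<and> k \<in> bd ?K s (r - 1) X)"
  proof (cases "a = Zero")
    case True
    show ?thesis
    proof (cases r)
      case 0 then show ?thesis using True by simp
    next
      case (Suc r') then show ?thesis using True by (auto simp: bd_iff)
    qed
  next
    case False
    have split: "?R \<longleftrightarrow> k \<in> bd ?K s r X \<and> (\<forall>l\<in>X. card (zs l) = r \<and> k \<in> sub ?K l \<longrightarrow> k \<in> Sub ?K (fbd ?K s l) \<or> a = bsgn s r)"
      using False by (auto simp: bd_iff)
    show ?thesis
    proof (cases "a = bsgn s r")
      case True then show ?thesis using split by simp
    next
      case ne: False
      have "(k \<in> bd ?K s r X \<and> (\<forall>l\<in>X. card (zs l) = r \<and> k \<in> sub ?K l \<longrightarrow> k \<in> Sub ?K (fbd ?K s l))) \<longleftrightarrow>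
        r > 0 \<and> k \<in> bd ?K s (r - 1) X" (is "?A \<longleftrightarrow> ?B")
      proof
        assume A: ?A
        then have "card (zs k) \<noteq> r" "card (zs k) \<le> r" "k \<in> X" using self not_in_Sub_fbd by (auto simp: bd_iff)
        then show ?B using A by (auto simp: bd_iff)
      next
        assume B: ?B
        then have "k \<in> bd ?K s r X"
          using cube.bd_bd[OF X, of "r - 1" r s s] bd_subset[of ?K s "r - 1" "bd ?K s r X"] by auto
        then show ?A using B by (auto simp: bd_iff)
      qed
      then show ?thesis using split ne by auto
    qed
  qed
  finally show ?thesis .
qed

lemma pure_ins:
  assumes "i \<le> m" "\<alpha> \<noteq> Zero" "X \<in> pure (Cube m)"
  shows "ins i \<alpha> ` X \<in> pure (Cube (Suc m))"
  using assms(3)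
proof (induction rule: pure.induct)
  case (atom a) then show ?case using assms(1,2) by (simp add: ins_sub pure.atom)
next
  case (comp X Y p)
  have "bd (Cube (Suc m)) False p (ins i \<alpha> ` X) = bd (Cube (Suc m)) True p (ins i \<alpha> ` Y)"
    using comp(3) cell_mapD(2)[OF cell_map_ins[OF assms(1,2)]] pure_cells[OF comp(1)] pure_cells[OF comp(2)] by metis
  then show ?case unfolding image_Un using comp by (intro pure.comp)
qed

lemma cylinder_prism:
  assumes "\<And>X. X \<in> cells (Cube m) \<Longrightarrow> X \<in> pure (Cube m)"
  shows "cylinder (Cube m) (Cube (Suc m)) prism (\<lambda>b. (`) (ins m (if b then Neg else Pos))) (pure (Cube (Suc m))) m"
proof (unfold_locales)
  fix X assume X: "X \<in> cells (Cube m)"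
  have len: "length k = m" if "k \<in> X" for k using cube.cells_faces[OF X] that by auto
  show "X \<in> pure (Cube m)" by (rule assms[OF X])
  have im: "k @ [a] \<in> ins m \<alpha> ` Y \<longleftrightarrow> k \<in> Y \<and> a = \<alpha>" if "Y \<subseteq> X" for k a \<alpha> Y
    using len that ins_end[of _ m \<alpha>] by (auto simp: image_iff subset_iff)
  have ext: "A = B" if "\<And>k a. k @ [a] \<in> A \<longleftrightarrow> k @ [a] \<in> B" "[] \<notin> A" "[] \<notin> B" for A B :: "sign list set"
    using that by (metis append_butlast_last_id subsetI subset_antisym)
  have nil: "[] \<notin> prism Y" "[] \<notin> ins m \<alpha> ` Y" "[] \<notin> bd (Cube (Suc m)) s r (prism Y)" for Y \<alpha> s r
    by (auto simp: prism_def ins_def bd_iff)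
  show "bd (Cube (Suc m)) s 0 (prism X) = ins m (if s then Neg else Pos) ` bd (Cube m) s 0 X" for s
    by (rule ext) (use nil in \<open>auto simp: prism_bd[OF X] im[OF bd_subset] bsgn_def\<close>)
  show "bd (Cube (Suc m)) s (Suc r) (prism X) =
      prism (bd (Cube m) s r X) \<union> ins m (if odd r = s then Neg else Pos) ` bd (Cube m) s (Suc r) X" for s r
  proof (rule ext)
    fix k a
    have "bd (Cube m) s r X \<subseteq> bd (Cube m) s (Suc r) X"
      using cube.bd_bd[OF X, of r "Suc r" s s] bd_subset[of "Cube m" s r "bd (Cube m) s (Suc r) X"] by simp
    moreover have "bsgn s (Suc r) = (if odd r = s then Neg else Pos)" by (auto simp: bsgn_def)
    ultimately show "k @ [a] \<in> bd (Cube (Suc m)) s (Suc r) (prism X) \<longleftrightarrow>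
      k @ [a] \<in> prism (bd (Cube m) s r X) \<union> ins m (if odd r = s then Neg else Pos) ` bd (Cube m) s (Suc r) X"
      unfolding prism_bd[OF X] using im[OF bd_subset, of k a _ "Cube m" s "Suc r"] by auto
  qed (use nil in auto)
  show "ins m (if b then Neg else Pos) ` X \<subseteq> prism X" for b
    using len ins_end by (auto simp: prism_def)
  show "ins m (if b then Neg else Pos) ` X \<in> pure (Cube (Suc m))" for b
    using assms[OF X] by (intro pure_ins) auto
next
  fix k :: "sign list" assume k: "k \<in> faces (Cube m)"
  then show "fdim (Cube m) k \<le> m" using card_mono[OF _ zs_subset[of k]] by simp
  have "prism (sub (Cube m) k) = sub (Cube (Suc m)) (k @ [Zero])"
  proof (intro equalityI subsetI)
    fix w assume "w \<in> sub (Cube (Suc m)) (k @ [Zero])"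
    moreover from this have "w \<noteq> []" by (auto simp: Cube_sub)
    then obtain l a where "w = l @ [a]" by (metis append_butlast_last_id)
    ultimately show "w \<in> prism (sub (Cube m) k)" using sub_snoc[of l a "Suc m" k Zero m] by simp
  qed (auto simp: prism_def sub_snoc[of _ _ "Suc m" k Zero m])
  moreover have "sub (Cube (Suc m)) (k @ [Zero]) \<in> pure (Cube (Suc m))" using k by (intro pure.atom) simp
  ultimately show "prism (sub (Cube m) k) \<in> pure (Cube (Suc m))" by simp
next
  fix a X r assume "a \<in> prism X" and d: "\<And>b. b \<in> X \<Longrightarrow> fdim (Cube m) b \<le> r"
  then obtain k c where "a = k @ [c]" "k \<in> X" by (auto simp: prism_def)
  then show "fdim (Cube (Suc m)) a \<le> Suc r" using d[of k] by (simp add: card_zs_snoc)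
qed (auto simp: prism_def intro: pure_cells pure.comp cell_map_ins)

text \<open>Induction on the dimension of the cube. A word ending in 0 is a prism, whose boundaries
  are sets \<open>U\<close> composed of pure pieces; any other word lies in a face of the cube.
  Taking pure cells for \<open>Q\<close> in the cylinder makes the induction work.\<close>

lemma cube_pure: "X \<in> cells (Cube m) \<Longrightarrow> X \<in> pure (Cube m)"
proof (induction m arbitrary: X)
  case 0
  show ?case
  proof (rule cells_pure[OF cube.pasting_axioms _ 0])
    fix a :: "sign list" and s p assume a: "a \<in> faces (Cube 0)"
    have "bd (Cube 0) s p (sub (Cube 0) a) = sub (Cube 0) a" using a by (intro bd_low) (simp add: Cube_sub zs_def)
    then show "bd (Cube 0) s p (sub (Cube 0) a) \<in> pure (Cube 0)" using pure.atom[OF a] by simp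
  qed
next
  case (Suc m)
  interpret cylinder "Cube m" "Cube (Suc m)" prism "\<lambda>b. (`) (ins m (if b then Neg else Pos))" "pure (Cube (Suc m))" m
    by (rule cylinder_prism[OF Suc.IH])
  show ?case
  proof (rule cells_pure[OF cube.pasting_axioms _ Suc.prems])
    fix w :: "sign list" and s p assume "w \<in> faces (Cube (Suc m))"
    then obtain k a where w: "w = k @ [a]" "length k = m" by (metis (mono_tags) Cube_faces length_Suc_conv_rev mem_Collect_eq)
    have kc: "sub (Cube m) k \<in> cells (Cube m)" using w by (intro cells.atom) simp
    show "bd (Cube (Suc m)) s p (sub (Cube (Suc m)) w) \<in> pure (Cube (Suc m))"
    proof (cases "a = Zero")
      case True
      have "sub (Cube (Suc m)) w = prism (sub (Cube m) k)"
      proof (intro equalityI subsetI)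
        fix v assume v: "v \<in> sub (Cube (Suc m)) w"
        then have "v \<noteq> []" using w by (auto simp: Cube_sub)
        then obtain l b where "v = l @ [b]" by (metis append_butlast_last_id)
        then show "v \<in> prism (sub (Cube m) k)" using v w True sub_snoc[of l b "Suc m" k Zero m] by simp
      qed (auto simp: prism_def w True sub_snoc[of _ _ "Suc m" k Zero m])
      then show ?thesis using bd_E[OF kc, of s p] U_in_Q[OF cells_bd[OF kc]] by simp
    next
      case False
      have "sub (Cube (Suc m)) w = ins m a ` sub (Cube m) k" using w False ins_end[of k m a] by (subst ins_sub) auto
      then have "bd (Cube (Suc m)) s p (sub (Cube (Suc m)) w) = ins m a ` bd (Cube m) s p (sub (Cube m) k)"
        using ins_bd[of k m m a s p] w False by simp
      then show ?thesis using pure_ins[of m m a] Suc.IH[OF cells_bd[OF kc]] False by simp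
    qed
  qed
qed

lemma prism_cells: "X \<in> cells (Cube m) \<Longrightarrow> prism X \<in> cells (Cube (Suc m))"
  using cylinder.E_Q[OF cylinder_prism[OF cube_pure]] pure_cells by blast

subsection \<open>Reversal of words\<close>

lemma zs_rev: "zs (rev k) = (\<lambda>j. length k - 1 - j) ` zs k"
proof (intro equalityI subsetI)
  fix j assume "j \<in> zs (rev k)"
  then have "j < length k" "k ! (length k - 1 - j) = Zero" by (auto simp: zs_def rev_nth)
  then show "j \<in> (\<lambda>j. length k - 1 - j) ` zs k"
    by (intro image_eqI[of _ _ "length k - 1 - j"]) (auto simp: zs_def)
qed (auto simp: zs_def rev_nth)

lemma sub_rev: "a \<in> sub (Cube m) b \<Longrightarrow> rev a \<in> sub (Cube m) (rev b)"
  by (auto simp: Cube_sub rev_nth)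

lemma sub_rev_iff: "rev a \<in> sub (Cube m) (rev b) \<longleftrightarrow> a \<in> sub (Cube m) b"
  using sub_rev[of a m b] sub_rev[of "rev a" m "rev b"] by auto

lemma card_zs_rev: "card (zs (rev k)) = card (zs k)"
  unfolding zs_rev by (rule card_image) (auto simp: inj_on_def zs_def)

text \<open>Reversal moves position i among p + 1 zeros to p - i, which keeps the parity rule for
  even p and exchanges its two cases for odd p. The Boolean \<open>even p = s\<close> expresses
  this.\<close>

lemma Sub_fbd_rev:
  assumes s: "a \<in> sub (Cube m) b" and c: "card (zs b) = Suc p"
  shows "rev a \<in> Sub (Cube m) (fbd (Cube m) s (rev b)) \<longleftrightarrow> a \<in> Sub (Cube m) (fbd (Cube m) (even p = s) b)"
proof -
  let ?f = "\<lambda>j. length b - 1 - j"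
  have len: "length a = length b" using s by (simp add: Cube_sub)
  have "rev a ! ?f j = bsgn s (pos (zs (rev b)) (?f j)) \<longleftrightarrow> a ! j = bsgn (even p = s) (pos (zs b) j)" if j: "j \<in> zs b" for j
  proof -
    have jl: "j < length b" using zs_less[OF j] .
    have "{y \<in> zs (rev b). y < ?f j} = ?f ` {y \<in> zs b. j < y}"
      unfolding zs_rev using jl zs_less[of _ b] by (auto simp: image_iff) fastforce
    moreover have "card (?f ` {y \<in> zs b. j < y}) = card {y \<in> zs b. j < y}"
      by (rule card_image) (auto simp: inj_on_def zs_def)
    moreover have "card (zs b) = Suc (card {y \<in> zs b. y < j} + card {y \<in> zs b. j < y})"
    proof -
      have z: "zs b = insert j ({y \<in> zs b. y < j} \<union> {y \<in> zs b. j < y})" using j by auto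
      have "card (insert j ({y \<in> zs b. y < j} \<union> {y \<in> zs b. j < y})) = Suc (card ({y \<in> zs b. y < j} \<union> {y \<in> zs b. j < y}))"
        by (rule card_insert_disjoint) auto
      moreover have "card ({y \<in> zs b. y < j} \<union> {y \<in> zs b. j < y}) = card {y \<in> zs b. y < j} + card {y \<in> zs b. j < y}"
        by (rule card_Un_disjoint) auto
      ultimately show ?thesis using arg_cong[OF z, of card] by linarith
    qed
    ultimately have "pos (zs (rev b)) (?f j) + pos (zs b) j = p" using c by (simp add: pos_def)
    then have "even (pos (zs (rev b)) (?f j)) = s \<longleftrightarrow> even (pos (zs b) j) = (even p = s)" by auto
    moreover have "rev a ! ?f j = a ! j" using jl len by (simp add: rev_nth)
    ultimately show ?thesis by (simp add: bsgn_def)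
  qed
  then show ?thesis
    unfolding Cube_Sub_fbd[OF s] Cube_Sub_fbd[OF sub_rev[OF s]] zs_rev[of b] by (auto simp: zs_rev)
qed

lemma rev_bd: "rev ` bd (Cube m) (even p = s) p X = bd (Cube m) s p (rev ` X)"
proof -
  have "a \<in> bd (Cube m) (even p = s) p X \<longleftrightarrow> rev a \<in> bd (Cube m) s p (rev ` X)" for a
  proof -
    have "(\<forall>b\<in>X. card (zs b) = Suc p \<and> a \<in> sub (Cube m) b \<longrightarrow> a \<in> Sub (Cube m) (fbd (Cube m) (even p = s) b)) \<longleftrightarrow>
      (\<forall>b\<in>X. card (zs (rev b)) = Suc p \<and> rev a \<in> sub (Cube m) (rev b) \<longrightarrow> rev a \<in> Sub (Cube m) (fbd (Cube m) s (rev b)))"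
      using Sub_fbd_rev by (auto simp: card_zs_rev sub_rev_iff)
    then show ?thesis by (auto simp: bd_iff card_zs_rev image_iff)
  qed
  then show ?thesis by (auto simp: image_iff) (metis rev_rev_ident bd_subset image_iff subsetD)
qed

text \<open>Reversal exchanges sources and targets in odd orders and is therefore not a functor, but
  it preserves the set of cells. It serves to attach coordinates on the left of a word, where prisms
  attach them on the right.\<close>

lemma rev_cells: "X \<in> cells (Cube m) \<Longrightarrow> rev ` X \<in> cells (Cube m)"
proof (induction rule: cells_induct)
  case (atom k)
  have "rev ` sub (Cube m) k = sub (Cube m) (rev k)"
    using sub_rev_iff[of _ m k] by (auto simp: image_iff) (metis rev_rev_ident)
  then show ?case using atom by (auto intro: cells.atom)
next
  case (bd X s p)
  have "rev ` bd (Cube m) s p X = bd (Cube m) (even p = s) p (rev ` X)"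
    using rev_bd[of m p "even p = s" X] by (cases "even p") auto
  then show ?case using bd cells_bd by simp
next
  case (comp X Y p)
  have "rev ` bd (Cube m) False p X = bd (Cube m) (odd p) p (rev ` X)"
    "rev ` bd (Cube m) True p Y = bd (Cube m) (even p) p (rev ` Y)"
    using rev_bd[of m p "odd p" X] rev_bd[of m p "even p" Y] by (cases "even p"; auto)+
  then have "bd (Cube m) (\<not> even p) p (rev ` X) = bd (Cube m) (even p) p (rev ` Y)" using comp(3) by simp
  then show ?case unfolding image_Un using cells_comp'[OF comp(4,5)] by blast
qed

subsection \<open>Subdividing a coordinate\<close>

definition append_cube :: "sign list set \<Rightarrow> sign list \<Rightarrow> sign list set" where
  "append_cube X b = {x @ c |x c. x \<in> X \<and> length c = length b \<and> (\<forall>j<length b. b ! j = Zero \<or> c ! j = b ! j)}"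

lemma append_cube_cells: "X \<in> cells (Cube m) \<Longrightarrow> append_cube X b \<in> cells (Cube (m + length b))"
proof (induction b rule: rev_induct)
  case Nil then show ?case by (simp add: append_cube_def)
next
  case (snoc a b)
  have IH: "append_cube X b \<in> cells (Cube (m + length b))" using snoc by simp
  have len: "length w = m + length b" if "w \<in> append_cube X b" for w using cube.cells_faces[OF IH] that by auto
  have e: "append_cube X (b @ [a]) = {w @ [c] |w c. w \<in> append_cube X b \<and> (a = Zero \<or> c = a)}"
  proof (intro equalityI subsetI)
    fix w assume "w \<in> append_cube X (b @ [a])"
    then obtain x c where w: "w = x @ c" "x \<in> X" "length c = Suc (length b)" "\<forall>j<Suc (length b). (b @ [a]) ! j = Zero \<or> c ! j = (b @ [a]) ! j"
      by (auto simp: append_cube_def)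
    obtain c' z where c: "c = c' @ [z]" "length c' = length b" using w(3) by (auto simp: length_Suc_conv_rev)
    have "\<forall>j<length b. b ! j = Zero \<or> c' ! j = b ! j" "a = Zero \<or> z = a"
      using w(4) c by (auto simp: nth_append less_Suc_eq)
    then show "w \<in> {w @ [c] |w c. w \<in> append_cube X b \<and> (a = Zero \<or> c = a)}"
      using w c unfolding append_cube_def by force
  next
    fix w assume "w \<in> {w @ [c] |w c. w \<in> append_cube X b \<and> (a = Zero \<or> c = a)}"
    then obtain x c z where "w = x @ (c @ [z])" "x \<in> X" "length c = length b" "\<forall>j<length b. b ! j = Zero \<or> c ! j = b ! j" "a = Zero \<or> z = a"
      by (auto simp: append_cube_def)
    then show "w \<in> append_cube X (b @ [a])"
      unfolding append_cube_def by (intro CollectI exI[of _ x] exI[of _ "c @ [z]"]) (auto simp: nth_append less_Suc_eq)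
  qed
  show ?case
  proof (cases "a = Zero")
    case True
    then have "append_cube X (b @ [a]) = prism (append_cube X b)" unfolding e prism_def by auto
    then show ?thesis using prism_cells[OF IH] by simp
  next
    case False
    have "append_cube X (b @ [a]) = ins (m + length b) a ` append_cube X b"
      unfolding e using False ins_end[of _ "m + length b" a] len by (auto simp: image_iff)
    then show ?thesis using cell_mapD(1)[OF cell_map_ins[of "m + length b" "m + length b" a] IH] False by simp
  qed
qed

definition bent :: "nat \<Rightarrow> sign list \<Rightarrow> bool" where
  "bent i w \<longleftrightarrow> w ! i = Pos \<or> w ! Suc i = Neg"

definition join :: "nat \<Rightarrow> sign list \<Rightarrow> sign list" where
  "join i w = take i w @ [if w ! i = Neg then Neg else if w ! Suc i = Pos then Pos else Zero] @ drop (Suc (Suc i)) w"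

text \<open>A bent word has one of \<open>--\<close>, \<open>0-\<close>, \<open>+-\<close>, \<open>+0\<close>, \<open>++\<close> at \<open>i\<close>: these are the faces of an interval divided
  into two, and \<open>join i\<close> maps each of them to the face of the interval in which it lies.\<close>

definition subdiv :: "nat \<Rightarrow> nat \<Rightarrow> sign list set \<Rightarrow> sign list set" where
  "subdiv m i X = {w \<in> {w. length w = Suc m \<and> bent i w}. join i w \<in> X}"

lemma nth_join: "Suc i < length w \<Longrightarrow> join i w ! j = (if j < i then w ! j else if j = i then
    (if w ! i = Neg then Neg else if w ! Suc i = Pos then Pos else Zero) else w ! Suc j)"
  by (auto simp: join_def nth_append nth_Cons' min_def)

lemma length_join [simp]: "Suc i < length w \<Longrightarrow> length (join i w) = length w - 1"
  by (simp add: join_def)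

lemma length2: "length w = 2 \<longleftrightarrow> (\<exists>a b. w = [a, b])"
  by (auto simp: numeral_2_eq_2 length_Suc_conv)

text \<open>The 1-target of a square consists of two consecutive edges: this is the divided
  interval, and it shows that the interval of bent words is a cell.\<close>

lemma bent_interval: "{w. length w = 2 \<and> bent 0 w} \<in> cells (Cube 2)"
proof -
  have z: "zs [Zero, Zero] = {0, 1}" by (auto simp: zs_def less_Suc_eq)
  have "w \<in> bd (Cube 2) False 1 (sub (Cube 2) [Zero, Zero]) \<longleftrightarrow> length w = 2 \<and> bent 0 w" for w
  proof -
    have "Z \<subseteq> {0, 1} \<and> card Z = 2 \<longleftrightarrow> Z = {0, 1}" for Z :: "nat set"
      using card_subset_eq[of "{0, 1::nat}" Z] by auto
    moreover have "pos {0, 1} 0 = 0" "pos {0, 1} 1 = 1"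
    proof -
      have "{y \<in> {0, 1::nat}. y < 0} = {}" "{y \<in> {0, 1::nat}. y < 1} = {0}" by auto
      then show "pos {0, 1} 0 = 0" "pos {0, 1} 1 = 1" by (simp_all add: pos_def)
    qed
    then have "\<not> alternating False w {0, 1} \<longleftrightarrow> bent 0 w"
      by (simp add: alternating_def bsgn_def bent_def)
    ultimately have "(\<forall>Z\<subseteq>zs [Zero, Zero]. card Z = Suc 1 \<longrightarrow> \<not> alternating False w Z) \<longleftrightarrow> bent 0 w"
      unfolding z Suc_1 by metis
    moreover have "w \<in> sub (Cube 2) [Zero, Zero] \<longleftrightarrow> length w = 2" by (auto simp: Cube_sub less_Suc_eq)
    ultimately show ?thesis using cube_bd_atom[of "[Zero, Zero]" 2 w False 1] by auto
  qed
  then have "{w. length w = 2 \<and> bent 0 w} = bd (Cube 2) False 1 (sub (Cube 2) [Zero, Zero])" by blast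
  then show ?thesis by (auto intro!: cells_bd cells.atom)
qed

text \<open>The divided interval is multiplied by the coordinates after it and, through reversal, by
  those before it.\<close>

lemma subdiv_zero_cells:
  assumes k: "length k = m" "i < m" "k ! i = Zero"
  shows "subdiv m i (sub (Cube m) k) \<in> cells (Cube (Suc m))"
proof -
  let ?a = "take i k" and ?b = "drop (Suc i) k"
  define A where "A = rev ` append_cube (rev ` {w. length w = 2 \<and> bent 0 w}) (rev ?a)"
  have A: "A \<in> cells (Cube (2 + i))"
    using rev_cells[OF append_cube_cells[OF rev_cells[OF bent_interval], of "rev ?a"]] k by (simp add: A_def)
  have rev_cond: "(\<forall>j<length a. rev a ! j = Zero \<or> c ! j = rev a ! j) \<longleftrightarrow> (\<forall>j<length a. a ! j = Zero \<or> rev c ! j = a ! j)"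
    if "length c = length a" for a c :: "sign list"
    using sub_rev_iff[of c 0 "rev a"] that by (simp add: Cube_sub)
  have Aiff: "w \<in> A \<longleftrightarrow> (\<exists>c x y. w = c @ [x, y] \<and> length c = i \<and> (\<forall>j<i. k ! j = Zero \<or> c ! j = k ! j) \<and> (x = Pos \<or> y = Neg))" for w
  proof -
    have "w \<in> A \<longleftrightarrow> (\<exists>x y c. w = rev ([y, x] @ c) \<and> (x = Pos \<or> y = Neg) \<and> length c = i \<and> (\<forall>j<i. rev ?a ! j = Zero \<or> c ! j = rev ?a ! j))"
    proof -
      have rv: "v \<in> rev ` S \<longleftrightarrow> rev v \<in> S" for v and S :: "sign list set" by (metis image_iff rev_rev_ident)
      have J: "rev x \<in> {w. length w = 2 \<and> bent 0 w} \<longleftrightarrow> (\<exists>a b. x = [b, a] \<and> (a = Pos \<or> b = Neg))" for x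
      proof
        assume "rev x \<in> {w. length w = 2 \<and> bent 0 w}"
        then obtain a b where "rev x = [a, b]" "bent 0 [a, b]" by (auto simp: length2)
        then show "\<exists>a b. x = [b, a] \<and> (a = Pos \<or> b = Neg)" by (auto simp: rev_swap bent_def)
      qed (auto simp: bent_def)
      have "w \<in> A \<longleftrightarrow> (\<exists>x c. rev w = x @ c \<and> (\<exists>a b. x = [b, a] \<and> (a = Pos \<or> b = Neg)) \<and> length c = i \<and> (\<forall>j<i. rev ?a ! j = Zero \<or> c ! j = rev ?a ! j))"
        unfolding A_def rv append_cube_def mem_Collect_eq rv J[unfolded mem_Collect_eq] using k by simp
      also have "\<dots> \<longleftrightarrow> (\<exists>a b c. rev w = [b, a] @ c \<and> (a = Pos \<or> b = Neg) \<and> length c = i \<and> (\<forall>j<i. rev ?a ! j = Zero \<or> c ! j = rev ?a ! j))"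
        by blast
      also have "\<dots> \<longleftrightarrow> (\<exists>x y c. w = rev ([y, x] @ c) \<and> (x = Pos \<or> y = Neg) \<and> length c = i \<and> (\<forall>j<i. rev ?a ! j = Zero \<or> c ! j = rev ?a ! j))"
        unfolding rev_swap by (rule refl)
      finally show ?thesis .
    qed
    also have "\<dots> \<longleftrightarrow> (\<exists>x y c. w = rev c @ [x, y] \<and> (x = Pos \<or> y = Neg) \<and> length c = i \<and> (\<forall>j<i. ?a ! j = Zero \<or> rev c ! j = ?a ! j))"
      using rev_cond[of _ ?a] k by (intro ex_cong1) auto
    also have "\<dots> \<longleftrightarrow> (\<exists>x y c. w = c @ [x, y] \<and> (x = Pos \<or> y = Neg) \<and> length c = i \<and> (\<forall>j<i. ?a ! j = Zero \<or> c ! j = ?a ! j))"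
    proof
      assume "\<exists>x y c. w = rev c @ [x, y] \<and> (x = Pos \<or> y = Neg) \<and> length c = i \<and> (\<forall>j<i. ?a ! j = Zero \<or> rev c ! j = ?a ! j)"
      then obtain x y c where "w = rev c @ [x, y] \<and> (x = Pos \<or> y = Neg) \<and> length c = i \<and> (\<forall>j<i. ?a ! j = Zero \<or> rev c ! j = ?a ! j)"
        by (elim exE)
      then show "\<exists>x y c. w = c @ [x, y] \<and> (x = Pos \<or> y = Neg) \<and> length c = i \<and> (\<forall>j<i. ?a ! j = Zero \<or> c ! j = ?a ! j)"
        by (intro exI[of _ x] exI[of _ y] exI[of _ "rev c"]) simp
    next
      assume "\<exists>x y c. w = c @ [x, y] \<and> (x = Pos \<or> y = Neg) \<and> length c = i \<and> (\<forall>j<i. ?a ! j = Zero \<or> c ! j = ?a ! j)"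
      then obtain x y c where "w = c @ [x, y] \<and> (x = Pos \<or> y = Neg) \<and> length c = i \<and> (\<forall>j<i. ?a ! j = Zero \<or> c ! j = ?a ! j)"
        by (elim exE)
      then show "\<exists>x y c. w = rev c @ [x, y] \<and> (x = Pos \<or> y = Neg) \<and> length c = i \<and> (\<forall>j<i. ?a ! j = Zero \<or> rev c ! j = ?a ! j)"
        by (intro exI[of _ x] exI[of _ y] exI[of _ "rev c"]) simp
    qed
    finally show ?thesis by auto
  qed
  have "subdiv m i (sub (Cube m) k) = append_cube A ?b"
  proof (intro equalityI subsetI)
    fix w assume "w \<in> subdiv m i (sub (Cube m) k)"
    then have w: "length w = Suc m" "w ! i = Pos \<or> w ! Suc i = Neg" "\<And>j. j < m \<Longrightarrow> k ! j = Zero \<or> join i w ! j = k ! j"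
      using k by (auto simp: subdiv_def bent_def Cube_sub)
    have "w = (take i w @ [w ! i, w ! Suc i]) @ drop (Suc (Suc i)) w"
      using w(1) k(2) by (simp add: Cons_nth_drop_Suc)
    moreover have "take i w @ [w ! i, w ! Suc i] \<in> A"
    proof -
      have "k ! j = Zero \<or> w ! j = k ! j" if "j < i" for j using w(3)[of j] w(1) k that by (simp add: nth_join)
      then show ?thesis unfolding Aiff using w(1,2) k(2) by (intro exI[of _ "take i w"]) auto
    qed
    moreover have "?b ! j = Zero \<or> drop (Suc (Suc i)) w ! j = ?b ! j" if "j < length ?b" for j
      using w(3)[of "Suc (i + j)"] w(1) k that by (simp add: nth_join)
    ultimately show "w \<in> append_cube A ?b" unfolding append_cube_def using w(1) k
      by (intro CollectI exI[of _ "take i w @ [w ! i, w ! Suc i]"] exI[of _ "drop (Suc (Suc i)) w"]) auto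
  next
    fix w assume "w \<in> append_cube A ?b"
    then obtain c x y d where w: "w = (c @ [x, y]) @ d" "length c = i" "\<forall>j<i. k ! j = Zero \<or> c ! j = k ! j" "x = Pos \<or> y = Neg"
        "length d = length ?b" "\<forall>j<length ?b. ?b ! j = Zero \<or> d ! j = ?b ! j"
      unfolding append_cube_def Aiff by blast
    have len: "length w = Suc m" using w k by simp
    have "k ! j = Zero \<or> join i w ! j = k ! j" if j: "j < m" for j
    proof -
      consider "j < i" | "j = i" | j' where "j = Suc (i + j')" using less_imp_Suc_add by (metis linorder_neqE_nat)
      then show ?thesis
      proof cases
        case 1 then show ?thesis using w(3) len k(2) w(1,2) by (simp add: nth_join nth_append)
      next
        case 2 then show ?thesis using k by simp
      next
        case 3 then show ?thesis using w(6)[rule_format, of j'] w(1,2) len j k by (simp add: nth_join nth_append)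
      qed
    qed
    moreover have "bent i w" using w(1,2,4) by (auto simp: bent_def nth_append)
    ultimately show "w \<in> subdiv m i (sub (Cube m) k)" using len k by (simp add: subdiv_def Cube_sub)
  qed
  moreover have "append_cube A ?b \<in> cells (Cube (2 + i + length ?b))" by (rule append_cube_cells[OF A])
  moreover have "2 + i + length ?b = Suc m" using k by simp
  ultimately show ?thesis by simp
qed

lemma bent_letter:
  assumes "length w = Suc m" "i < m" "bent i w"
  shows "w ! Suc i = Neg \<Longrightarrow> \<exists>u. length u = m \<and> w = ins (Suc i) Neg u"
    and "w ! i = Pos \<Longrightarrow> \<exists>u. length u = m \<and> w = ins i Pos u"
proof -
  have "\<exists>u. length u = m \<and> w = ins j (w ! j) u" if "j < Suc m" for j
  proof (intro exI conjI)
    show "length (take j w @ drop (Suc j) w) = m" using assms(1) that by simp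
    show "w = ins j (w ! j) (take j w @ drop (Suc j) w)" using assms(1) that by (simp add: ins_def Cons_nth_drop_Suc)
  qed
  from this[of "Suc i"] this[of i]
  show "w ! Suc i = Neg \<Longrightarrow> \<exists>u. length u = m \<and> w = ins (Suc i) Neg u"
    "w ! i = Pos \<Longrightarrow> \<exists>u. length u = m \<and> w = ins i Pos u" using assms(2) by auto
qed

lemma ins_bd_iff:
  assumes "length k = m" "i \<le> m" "\<alpha> \<noteq> Zero" "length c = m"
  shows "ins i \<alpha> c \<in> bd (Cube (Suc m)) s p (sub (Cube (Suc m)) (ins i \<alpha> k)) \<longleftrightarrow> c \<in> bd (Cube m) s p (sub (Cube m) k)"
proof -
  have inj: "c' = c" if "ins i \<alpha> c' = ins i \<alpha> c" "length c' = m" for c'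
  proof (rule nth_equalityI)
    fix j assume "j < length c'"
    show "c' ! j = c ! j" using nth_ins_delta[of i c' \<alpha> j] nth_ins_delta[of i c \<alpha> j] that assms by simp
  qed (use that assms in simp)
  let ?Y = "bd (Cube m) s p (sub (Cube m) k)"
  have "ins i \<alpha> c \<in> ins i \<alpha> ` ?Y \<longleftrightarrow> c \<in> ?Y"
  proof
    assume "ins i \<alpha> c \<in> ins i \<alpha> ` ?Y"
    then obtain c' where c': "c' \<in> ?Y" "ins i \<alpha> c' = ins i \<alpha> c" by force
    then have "length c' = m" using assms(1) by (simp add: bd_iff Cube_sub)
    then show "c \<in> ?Y" using inj c' by blast
  qed blast
  then show ?thesis using ins_bd[OF assms(1-3), of s p] ins_sub[OF assms(1-3)] by simp
qed

text \<open>An alternating set containing \<open>i\<close> allows a zero there and forbids only one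
  of the two signs, so it stays alternating at one of the two ends. This settles the point at which
  the interval is divided.\<close>

lemma Zero_bd_iff:
  assumes k: "length k = m" "i < m" "k ! i = Zero" and c: "length c = m" "c ! i = Zero"
  shows "c \<in> bd (Cube m) s p (sub (Cube m) k) \<longleftrightarrow>
    c[i := Neg] \<in> bd (Cube m) s p (sub (Cube m) k) \<and> c[i := Pos] \<in> bd (Cube m) s p (sub (Cube m) k)"
proof -
  have s: "c[i := \<alpha>] \<in> sub (Cube m) k \<longleftrightarrow> c \<in> sub (Cube m) k" for \<alpha>
    using k c by (auto simp: Cube_sub nth_list_update)
  have "alternating s c Z \<longleftrightarrow> alternating s (c[i := Neg]) Z \<or> alternating s (c[i := Pos]) Z" if "Z \<subseteq> zs k" for Z
  proof (cases "i \<in> Z")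
    case True
    have "alternating s (c[i := \<alpha>]) Z \<longleftrightarrow> \<alpha> \<noteq> bsgn s (pos Z i) \<and> alternating s c (Z)" for \<alpha>
      using True k c zs_less that by (auto simp: alternating_def nth_list_update)
    moreover have "Neg \<noteq> bsgn s (pos Z i) \<or> Pos \<noteq> bsgn s (pos Z i)" by (auto simp: bsgn_def)
    ultimately show ?thesis by blast
  next
    case False
    then have "c[i := \<alpha>] ! z = c ! z" if "z \<in> Z" for z \<alpha> using that by (metis nth_list_update_neq)
    then have "alternating s (c[i := \<alpha>]) Z \<longleftrightarrow> alternating s c Z" for \<alpha>
      by (simp add: alternating_def)
    then show ?thesis by blast
  qed
  then show ?thesis unfolding cube_bd_atom[OF k(1)] s by blast
qed

lemma ins_sub_iff:
  assumes "length k = m" "i \<le> m" "\<alpha> \<noteq> Zero" "length c = m"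
  shows "ins i \<alpha> c \<in> sub (Cube (Suc m)) (ins i \<alpha> k) \<longleftrightarrow> c \<in> sub (Cube m) k"
proof -
  have inj: "inj_on (ins i \<alpha>) {c. length c = m}"
  proof (rule inj_onI)
    fix x y assume a: "x \<in> {c. length c = m}" "y \<in> {c. length c = m}" "ins i \<alpha> x = ins i \<alpha> y"
    then have "take i x = take i y \<and> drop i x = drop i y" using assms(2) by (simp add: ins_def)
    then show "x = y" by (metis append_take_drop_id)
  qed
  have "sub (Cube m) k \<subseteq> {c. length c = m}" using assms(1) by (auto simp: Cube_sub)
  then show ?thesis
    using inj_on_image_mem_iff[OF inj, of c "sub (Cube m) k"] assms(4) ins_sub[OF assms(1-3)] by auto
qed

text \<open>If the letter at \<open>i\<close> is constant, subdividing doubles it. If it is a zero,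
  the subdivided face is the union of two copies of \<open>k\<close>, one for each half, and
  boundaries can be found in each copy.\<close>

lemma subdiv_bd_atom:
  assumes k: "length k = m" "i < m"
  shows "subdiv m i (sub (Cube m) k) \<in> cells (Cube (Suc m)) \<and>
    subdiv m i (bd (Cube m) s p (sub (Cube m) k)) = bd (Cube (Suc m)) s p (subdiv m i (sub (Cube m) k))"
proof (cases "k ! i = Zero")
  case False
  have *: "subdiv m i X = ins i (k ! i) ` X" if X: "X \<subseteq> sub (Cube m) k" for X
  proof (intro equalityI subsetI)
    fix w assume "w \<in> subdiv m i X"
    then have w: "length w = Suc m" "bent i w" "join i w \<in> X" by (auto simp: subdiv_def)
    then have "join i w \<in> sub (Cube m) k" using X by blast
    then have "join i w ! i = k ! i" using k False by (auto simp: Cube_sub)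
    then have "w ! i = k ! i \<and> w ! Suc i = k ! i"
      using w(1,2) k False by (auto simp: nth_join bent_def split: if_splits)
    then have "w = ins i (k ! i) (join i w)"
      using w(1) k False by (cases "k ! i"; intro nth_equalityI) (auto simp: nth_ins nth_join not_less_iff_gr_or_eq)
    then show "w \<in> ins i (k ! i) ` X" using w(3) by blast
  next
    fix w assume "w \<in> ins i (k ! i) ` X"
    then obtain u where u: "u \<in> X" "w = ins i (k ! i) u" by auto
    have "u \<in> sub (Cube m) k" using u(1) X by blast
    then have ul: "length u = m" "u ! i = k ! i" using k False by (auto simp: Cube_sub)
    have wi: "w ! i = k ! i" "w ! Suc i = k ! i" using ul u(2) k by (auto simp: nth_ins)
    have "join i w = u" using ul u(2) k False wi by (intro nth_equalityI) (auto simp: nth_join nth_ins, (cases "k ! i"; auto)+)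
    moreover have "bent i w" using wi False by (cases "k ! i") (auto simp: bent_def)
    ultimately show "w \<in> subdiv m i X" using u ul by (simp add: subdiv_def)
  qed
  have "ins i (k ! i) ` sub (Cube m) k \<in> cells (Cube (Suc m))" using ins_sub[of k m i "k ! i"] k False by (auto intro!: cells.atom)
  then show ?thesis using *[OF order_refl] *[OF bd_subset] ins_bd[of k m i "k ! i" s p] k False by simp
next
  case True
  let ?K = "Cube m" and ?L = "Cube (Suc m)"
  let ?A = "sub ?L (ins (Suc i) Neg k)" and ?B = "sub ?L (ins i Pos k)"
  have AB: "w \<in> subdiv m i (sub ?K k) \<longleftrightarrow> w \<in> ?A \<or> w \<in> ?B" for w
  proof
    assume "w \<in> subdiv m i (sub ?K k)"
    then have w: "length w = Suc m" "bent i w" "\<And>j. j < m \<Longrightarrow> k ! j = Zero \<or> join i w ! j = k ! j"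
      using k by (auto simp: subdiv_def Cube_sub)
    have lo: "k ! j = Zero \<or> w ! j = k ! j" if "j < i" for j using w(3)[of j] that w(1) k by (simp add: nth_join)
    have hi: "k ! j = Zero \<or> w ! Suc j = k ! j" if "i < j" "j < m" for j using w(3)[of j] that w(1) k by (simp add: nth_join)
    have "ins (Suc i) Neg k ! j = Zero \<or> w ! j = ins (Suc i) Neg k ! j" if "w ! Suc i = Neg" "j < Suc m" for j
    proof -
      have "Suc i \<le> length k" using k by simp
      note n = nth_ins[OF this]
      consider "j < i" | "j = i" | "j = Suc i" | "Suc i < j" by linarith
      then show ?thesis using lo[of j] hi[of "j - 1"] that k True by cases (auto simp: n)
    qed
    moreover have "ins i Pos k ! j = Zero \<or> w ! j = ins i Pos k ! j" if "w ! i = Pos" "j < Suc m" for j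
    proof -
      consider "j < i" | "j = i" | "j = Suc i" | "Suc i < j" by linarith
      then show ?thesis using lo[of j] hi[of "j - 1"] that k True by cases (auto simp: nth_ins)
    qed
    ultimately show "w \<in> ?A \<or> w \<in> ?B" using w(1,2) k unfolding bent_def Cube_sub by auto
  next
    assume "w \<in> ?A \<or> w \<in> ?B"
    then have w: "length w = Suc m" using k by (auto simp: Cube_sub)
    have cond: "(\<forall>j<Suc m. ins (Suc i) Neg k ! j = Zero \<or> w ! j = ins (Suc i) Neg k ! j) \<or>
        (\<forall>j<Suc m. ins i Pos k ! j = Zero \<or> w ! j = ins i Pos k ! j)"
      using \<open>w \<in> ?A \<or> w \<in> ?B\<close> k by (auto simp: Cube_sub)
    have lo: "k ! j = Zero \<or> w ! j = k ! j" if "j < i" for j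
      using cond that k by (auto simp: nth_ins dest!: spec[of _ j])
    have hi: "k ! j = Zero \<or> w ! Suc j = k ! j" if "i < j" "j < m" for j
      using cond that k by (auto simp: nth_ins dest!: spec[of _ "Suc j"])
    have "w ! i = Pos \<or> w ! Suc i = Neg"
      using cond
    proof
      assume "\<forall>j<Suc m. ins (Suc i) Neg k ! j = Zero \<or> w ! j = ins (Suc i) Neg k ! j"
      from this[rule_format, of "Suc i"] show ?thesis using k by (simp add: nth_ins)
    next
      assume "\<forall>j<Suc m. ins i Pos k ! j = Zero \<or> w ! j = ins i Pos k ! j"
      from this[rule_format, of i] show ?thesis using k by (simp add: nth_ins)
    qed
    then have "bent i w" by (simp add: bent_def)
    moreover have "k ! j = Zero \<or> join i w ! j = k ! j" if "j < m" for j
      using lo[of j] hi[of j] that w k True by (cases j i rule: linorder_cases) (auto simp: nth_join)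
    ultimately show "w \<in> subdiv m i (sub ?K k)" using w k by (simp add: subdiv_def Cube_sub)
  qed
  \<comment> \<open>A face containing \<open>w\<close> lies in one of the halves, and then so does
    \<open>w\<close>; hence the halves can be tested separately.\<close>
  have bdAB: "w \<in> bd ?L s p (subdiv m i (sub ?K k)) \<longleftrightarrow> w \<in> subdiv m i (sub ?K k) \<and>
      (w \<in> ?A \<longrightarrow> w \<in> bd ?L s p ?A) \<and> (w \<in> ?B \<longrightarrow> w \<in> bd ?L s p ?B)" for w
  proof -
    have "w \<in> sub ?L b \<Longrightarrow> b \<in> ?A \<Longrightarrow> w \<in> ?A" "w \<in> sub ?L b \<Longrightarrow> b \<in> ?B \<Longrightarrow> w \<in> ?B" for b
      using cube.sub_trans[of "ins (Suc i) Neg k" "Suc m" b w] cube.sub_trans[of "ins i Pos k" "Suc m" b w] k by auto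
    then show ?thesis using AB unfolding bd_iff[of w] by blast
  qed
  have "w \<in> subdiv m i (bd ?K s p (sub ?K k)) \<longleftrightarrow> w \<in> bd ?L s p (subdiv m i (sub ?K k))" for w
  proof (cases "length w = Suc m \<and> bent i w")
    case False then show ?thesis using bd_subset[of ?L s p "subdiv m i (sub ?K k)"] by (auto simp: subdiv_def)
  next
    case wb: True
    then have w: "length w = Suc m" "bent i w" by auto
    have wi: "w ! Suc i = Neg" if "w \<in> ?A" using that k by (auto simp: Cube_sub nth_ins dest!: spec[of _ "Suc i"])
    have wi': "w ! i = Pos" if "w \<in> ?B" using that k by (auto simp: Cube_sub nth_ins dest!: spec[of _ i])
    have L: "w \<in> subdiv m i X \<longleftrightarrow> join i w \<in> X" for X using w by (simp add: subdiv_def)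
    have A: "u \<in> bd ?K s p (sub ?K k) \<longleftrightarrow> w \<in> bd ?L s p ?A" if "w = ins (Suc i) Neg u" "length u = m" for u
      using ins_bd_iff[of k m "Suc i" Neg u s p] that k by simp
    have B: "u \<in> bd ?K s p (sub ?K k) \<longleftrightarrow> w \<in> bd ?L s p ?B" if "w = ins i Pos u" "length u = m" for u
      using ins_bd_iff[of k m i Pos u s p] that k by simp
    consider (a) "w ! Suc i = Neg" "w ! i \<noteq> Pos" | (b) "w ! i = Pos" "w ! Suc i \<noteq> Neg" | (c) "w ! i = Pos" "w ! Suc i = Neg"
      using w(2) by (auto simp: bent_def)
    then show ?thesis
    proof cases
      case a
      then obtain u where u: "length u = m" "w = ins (Suc i) Neg u" using bent_letter(1)[OF w(1) k(2) w(2)] by auto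
      have "join i w = u"
      proof (rule nth_equalityI)
        fix j assume "j < length (join i w)"
        show "join i w ! j = u ! j"
          using u w(1) k a by (cases j i rule: linorder_cases; cases "u ! i") (auto simp: nth_join nth_ins)
      qed (use u k in auto)
      moreover have "w \<notin> ?B" using wi' a by blast
      moreover have "w \<in> ?A" if "w \<in> subdiv m i (sub ?K k)" using that AB \<open>w \<notin> ?B\<close> by blast
      ultimately show ?thesis
        using A[OF u(2,1)] L bdAB[of w] AB[of w] bd_subset[of ?L s p ?A] bd_subset[of ?K s p "sub ?K k"] by blast
    next
      case b
      then obtain u where u: "length u = m" "w = ins i Pos u" using bent_letter(2)[OF w(1) k(2) w(2)] by auto
      have "join i w = u"
      proof (rule nth_equalityI)
        fix j assume "j < length (join i w)"
        show "join i w ! j = u ! j"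
          using u w(1) k b by (cases j i rule: linorder_cases; cases "u ! i") (auto simp: nth_join nth_ins)
      qed (use u k in auto)
      moreover have "w \<notin> ?A" using wi b by blast
      ultimately show ?thesis
        using B[OF u(2,1)] L bdAB[of w] AB[of w] bd_subset[of ?L s p ?B] bd_subset[of ?K s p "sub ?K k"] by blast
    next
      \<comment> \<open>At the division point \<open>+-\<close> the letter is \<open>+\<close> in
        the first half and \<open>-\<close> in the second, while \<open>join\<close> has a zero
        there.\<close>
      case c
      obtain u where u: "length u = m" "w = ins (Suc i) Neg u" using bent_letter(1)[OF w(1) k(2) w(2)] c by auto
      obtain v where v: "length v = m" "w = ins i Pos v" using bent_letter(2)[OF w(1) k(2) w(2)] c by auto
      let ?j = "join i w"
      have j: "length ?j = m" "?j ! i = Zero" using w(1) k c by (auto simp: nth_join)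
      have "u ! l = w ! l" if "l \<le> i" for l using u that k by (simp add: nth_ins)
      moreover have "u ! l = w ! Suc l" if "i < l" for l using u that k by (simp add: nth_ins)
      ultimately have "?j[i := Pos] = u"
        using u(1) w(1) j(1) k c by (intro nth_equalityI) (auto simp: nth_join nth_list_update not_less_iff_gr_or_eq)
      moreover have "v ! l = w ! l" if "l < i" for l using v that k by (simp add: nth_ins)
      moreover have "v ! l = w ! Suc l" if "i \<le> l" for l using v that k by (simp add: nth_ins)
      ultimately have jj: "?j[i := Pos] = u" "?j[i := Neg] = v"
        using v(1) w(1) j(1) k c by (auto intro!: nth_equalityI simp: nth_join nth_list_update not_less_iff_gr_or_eq)
      have "?j \<in> bd ?K s p (sub ?K k) \<longleftrightarrow> w \<in> bd ?L s p ?A \<and> w \<in> bd ?L s p ?B"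
        using Zero_bd_iff[OF k True j, of s p] A[OF u(2,1)] B[OF v(2,1)] jj by auto
      moreover have "w \<in> ?A \<longleftrightarrow> w \<in> ?B"
      proof -
        have "w \<in> ?A \<longleftrightarrow> u \<in> sub ?K k" using ins_sub_iff[of k m "Suc i" Neg u] u k by simp
        moreover have "w \<in> ?B \<longleftrightarrow> v \<in> sub ?K k" using ins_sub_iff[of k m i Pos v] v k by simp
        moreover have "u \<in> sub ?K k \<longleftrightarrow> v \<in> sub ?K k"
          unfolding jj[symmetric] using k j True by (auto simp: Cube_sub nth_list_update)
        ultimately show ?thesis by simp
      qed
      ultimately show ?thesis using L bdAB[of w] AB[of w] bd_subset[of ?L s p ?A] by blast
    qed
  qed
  then show ?thesis using subdiv_zero_cells[OF k True] by blast
qed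

lemma preimage_cell_map:
  assumes K: "pasting K" and L: "pasting L"
    and \<rho>: "\<And>w. w \<in> S \<Longrightarrow> w \<in> sub L w" "\<And>w l. l \<in> S \<Longrightarrow> w \<in> sub L l \<Longrightarrow> w \<in> S \<and> \<rho> w \<in> sub K (\<rho> l)"
    and atom: "\<And>a. a \<in> faces K \<Longrightarrow> {w\<in>S. \<rho> w \<in> sub K a} \<in> cells L"
      "\<And>a s p. a \<in> faces K \<Longrightarrow> {w\<in>S. \<rho> w \<in> bd K s p (sub K a)} = bd L s p {w\<in>S. \<rho> w \<in> sub K a}"
  shows "cell_map K L (\<lambda>X. {w\<in>S. \<rho> w \<in> X})"
proof -
  interpret K: pasting K by fact
  have bdS: "{w\<in>S. \<rho> w \<in> bd K s p X} = bd L s p {w\<in>S. \<rho> w \<in> X}" if "X \<in> cells K" for X s p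
    using preimage_bd[OF K.cells_down[OF that] K.cells_faces[OF that] \<rho> K.sub_self atom(2)] by blast
  have "{w\<in>S. \<rho> w \<in> X} \<in> cells L" if "X \<in> cells K" for X
    using that
  proof (induction rule: cells_induct)
    case (bd X s p) then show ?case using bdS[OF bd(1)] cells_bd by simp
  next
    case (comp X Y p)
    have "{w\<in>S. \<rho> w \<in> X \<union> Y} = {w\<in>S. \<rho> w \<in> X} \<union> {w\<in>S. \<rho> w \<in> Y}" by auto
    moreover have "bd L False p {w\<in>S. \<rho> w \<in> X} = bd L True p {w\<in>S. \<rho> w \<in> Y}"
      using bdS[OF comp(1), of False p] bdS[OF comp(2), of True p] comp(3) by simp
    ultimately show ?case using cells_comp[OF comp(4,5)] by simp
  qed (rule atom(1))
  then show ?thesis using bdS unfolding cell_map_def by auto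
qed

lemma cell_map_subdiv:
  assumes "i < m"
  shows "cell_map (Cube m) (Cube (Suc m)) (subdiv m i)"
proof -
  have "cell_map (Cube m) (Cube (Suc m)) (\<lambda>X. {w \<in> {w. length w = Suc m \<and> bent i w}. join i w \<in> X})"
  proof (rule preimage_cell_map[OF cube.pasting_axioms cube.pasting_axioms])
    fix w l assume l: "l \<in> {w. length w = Suc m \<and> bent i w}" and w: "w \<in> sub (Cube (Suc m)) l"
    then have wl: "length w = Suc m" "\<And>j. j < Suc m \<Longrightarrow> l ! j = Zero \<or> w ! j = l ! j" by (auto simp: Cube_sub)
    have "l ! i = Zero \<or> w ! i = l ! i" "l ! Suc i = Zero \<or> w ! Suc i = l ! Suc i" "l ! i = Pos \<or> l ! Suc i = Neg"
      using l wl(2)[of i] wl(2)[of "Suc i"] assms by (simp_all add: bent_def)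
    then have b: "bent i w" unfolding bent_def by (elim disjE) simp_all
    have "join i l ! j = Zero \<or> join i w ! j = join i l ! j" if "j < m" for j
    proof (cases j i rule: linorder_cases)
      case less then show ?thesis using wl(2)[of j] wl(1) l that assms by (simp add: nth_join)
    next
      case equal
      have "l ! i = Zero \<or> w ! i = l ! i" "l ! Suc i = Zero \<or> w ! Suc i = l ! Suc i"
        "l ! i = Pos \<or> l ! Suc i = Neg" "w ! i = Pos \<or> w ! Suc i = Neg"
        using wl(2)[of i] wl(2)[of "Suc i"] assms l b by (auto simp: bent_def)
      then show ?thesis using equal wl(1) l assms
        by (cases "l ! i"; cases "l ! Suc i") (auto simp: nth_join)
    next
      case greater then show ?thesis using wl(2)[of "Suc j"] wl(1) l that assms by (simp add: nth_join)
    qed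
    then show "w \<in> {w. length w = Suc m \<and> bent i w} \<and> join i w \<in> sub (Cube m) (join i l)"
      using b wl l assms by (simp add: Cube_sub)
  next
    fix a :: "sign list" assume "a \<in> faces (Cube m)"
    then have a: "length a = m" by simp
    show "{w \<in> {w. length w = Suc m \<and> bent i w}. join i w \<in> sub (Cube m) a} \<in> cells (Cube (Suc m))"
      using subdiv_bd_atom[OF a assms] unfolding subdiv_def by blast
    show "{w \<in> {w. length w = Suc m \<and> bent i w}. join i w \<in> bd (Cube m) s p (sub (Cube m) a)} =
        bd (Cube (Suc m)) s p {w \<in> {w. length w = Suc m \<and> bent i w}. join i w \<in> sub (Cube m) a}" for s p
      using subdiv_bd_atom[OF a assms, of s p] unfolding subdiv_def by blast
  qed (simp add: Cube_sub)
  then show ?thesis unfolding subdiv_def .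
qed

subsection \<open>Subdividing the cube into a simplex\<close>

text \<open>
  The word \<open>w\<close> lies in the face of \<open>\<Delta>\<^sup>n\<close> spanned by the positions at which \<open>w\<close>, read as \<open>- w +\<close>, passes from
  \<open>-\<close> or \<open>0\<close> to \<open>0\<close> or \<open>+\<close>.  This presents \<open>I\<^sup>n\<close> as a subdivision of \<open>\<Delta>\<^sup>n\<close>.
\<close>

definition breaks :: "sign list \<Rightarrow> nat set" where
  "breaks w = {t. t \<le> length w \<and> (t = 0 \<or> w ! (t - 1) \<noteq> Pos) \<and> (t = length w \<or> w ! t \<noteq> Neg)}"

definition real_cube :: "nat \<Rightarrow> nat set set \<Rightarrow> sign list set" where
  "real_cube n X = {w \<in> {w. length w = n}. breaks w \<in> X}"

text \<open>The first place from \<open>a\<close> on that is the end or carries a letter other than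
  \<open>-\<close> is a break: it is \<open>a\<close> itself or comes right after a
  \<open>-\<close>.\<close>

lemma break_between:
  assumes "a \<le> b" "b \<le> length w" "a = 0 \<or> w ! (a - 1) \<noteq> Pos" "b = length w \<or> w ! b \<noteq> Neg"
  shows "\<exists>t\<in>breaks w. a \<le> t \<and> t \<le> b"
proof -
  let ?P = "\<lambda>t. a \<le> t \<and> (t = length w \<or> w ! t \<noteq> Neg)"
  define t where "t = (LEAST t. ?P t)"
  have P: "?P t" unfolding t_def by (rule LeastI[of ?P b]) (use assms in auto)
  have tb: "t \<le> b" unfolding t_def by (rule Least_le) (use assms in auto)
  have "t = 0 \<or> w ! (t - 1) \<noteq> Pos"
  proof (cases "t = a")
    case True then show ?thesis using assms by simp
  next
    case False
    then have "\<not> ?P (t - 1)" unfolding t_def using P not_less_Least[of "t - 1" ?P] by (auto simp: t_def[symmetric])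
    then show ?thesis using False P by auto
  qed
  then show ?thesis using P tb assms by (intro bexI[of _ t]) (auto simp: breaks_def)
qed

lemma breaks_nonempty: "breaks w \<noteq> {}"
  using break_between[of 0 "length w" w] by auto

lemma breaks_subset: "breaks w \<subseteq> {0..length w}"
  by (auto simp: breaks_def)

lemma breaks_mono: "w \<in> sub (Cube n) l \<Longrightarrow> breaks w \<subseteq> breaks l"
proof
  fix t assume w: "w \<in> sub (Cube n) l" and t: "t \<in> breaks w"
  have *: "l ! j = Zero \<or> w ! j = l ! j" if "j < length l" for j using w that by (simp add: Cube_sub)
  have len: "length w = length l" using w by (simp add: Cube_sub)
  have "t = 0 \<or> l ! (t - 1) \<noteq> Pos" using t *[of "t - 1"] len by (cases t) (auto simp: breaks_def)
  moreover have "t = length l \<or> l ! t \<noteq> Neg" using t *[of t] len by (auto simp: breaks_def)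
  ultimately show "t \<in> breaks l" using t len by (simp add: breaks_def)
qed

lemma set_chain:
  assumes "finite Z" "card Z = Suc q"
  obtains z where "\<forall>i<q. z i < z (Suc i)" "Z = z ` {..q}" "\<forall>i\<le>q. pos Z (z i) = i"
proof -
  have "\<forall>i\<in>{..q}. \<exists>x. x \<in> Z \<and> pos Z x = i" using pos_surj[OF assms(1)] assms(2) by (auto simp: Bex_def less_Suc_eq_le)
  then obtain z where z: "\<forall>i\<in>{..q}. z i \<in> Z \<and> pos Z (z i) = i" by metis
  have "z i < z (Suc i)" if "i < q" for i
  proof (rule ccontr)
    assume "\<not> z i < z (Suc i)"
    then have "{y \<in> Z. y < z (Suc i)} \<subseteq> {y \<in> Z. y < z i}" by auto
    then have "pos Z (z (Suc i)) \<le> pos Z (z i)" unfolding pos_def using assms(1) by (intro card_mono) auto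
    then show False using z that by (auto simp: Suc_le_eq)
  qed
  moreover have "inj_on z {..q}" using z by (intro inj_onI) metis
  then have "Z = z ` {..q}" using assms z by (intro card_subset_eq[symmetric]) (auto simp: card_image)
  ultimately show ?thesis using that z by auto
qed

text \<open>This is \<open>cube_bd_atom\<close> in the vertex figure. For a word without
  \<open>+\<close>, alternation restricts only the positions of one parity and asks there for
  membership.\<close>

lemma Delta_bd_iff:
  assumes "\<sigma> \<subseteq> {0..n}" "\<rho> \<subseteq> \<sigma>" "\<rho> \<noteq> {}"
  shows "\<rho> \<in> bd (Delta n) s p (sub (Delta n) \<sigma>) \<longleftrightarrow>
    (\<forall>Z\<subseteq>\<sigma>. card Z = Suc (Suc p) \<longrightarrow> (\<exists>z\<in>Z. even (pos Z z) = s \<and> z \<notin> \<rho>))"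
proof -
  let ?w = "word (Suc n)"
  have sz: "\<sigma> \<subseteq> {..<Suc n}" "\<rho> \<subseteq> {..<Suc n}" using assms by auto
  have z: "zs (?w \<sigma>) = \<sigma>" by (rule zs_word[OF sz(1)])
  have "bd (Cube (Suc n)) s (Suc p) (sub (Cube (Suc n)) (?w \<sigma>)) \<subseteq> faces (Cube (Suc n))" by (auto simp: bd_iff Cube_sub)
  from col_iff[OF this, of \<rho>]
  have "\<rho> \<in> bd (Delta n) s p (sub (Delta n) \<sigma>) \<longleftrightarrow> ?w \<rho> \<in> bd (Cube (Suc n)) s (Suc p) (sub (Cube (Suc n)) (?w \<sigma>))"
    using Delta_bd_atom[OF assms(1), of s p] sz(2) assms(3) by simp
  also have "\<dots> \<longleftrightarrow> (\<forall>Z\<subseteq>\<sigma>. card Z = Suc (Suc p) \<longrightarrow> \<not> alternating s (?w \<rho>) Z)"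
    using cube_bd_atom[of "?w \<sigma>" "Suc n" "?w \<rho>" s "Suc p"] simplex_sub_word[OF assms(1), of \<rho>] assms z by auto
  also have "\<dots> \<longleftrightarrow> (\<forall>Z\<subseteq>\<sigma>. card Z = Suc (Suc p) \<longrightarrow> (\<exists>z\<in>Z. even (pos Z z) = s \<and> z \<notin> \<rho>))"
  proof -
    have "?w \<rho> ! z = bsgn s (pos Z z) \<longleftrightarrow> even (pos Z z) = s \<and> z \<notin> \<rho>" if "Z \<subseteq> \<sigma>" "z \<in> Z" for Z z
    proof -
      have "z < Suc n" using that sz(1) by auto
      then show ?thesis by (auto simp: bsgn_def)
    qed
    then show ?thesis unfolding alternating_def by blast
  qed
  finally show ?thesis .
qed

text \<open>The tests by p + 1 letters of \<open>w\<close> and by p + 2 vertices of the simplex are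
  converted into each other. The chosen letters cut the word into p + 2 intervals, and those of the
  restricted parity have ends that force a break by \<open>break_between\<close>; in the other
  intervals any point will do.\<close>

lemma real_cube_top_bd:
  assumes w: "length w = n"
  shows "w \<in> bd (Cube n) s p (sub (Cube n) (replicate n Zero)) \<longleftrightarrow> breaks w \<in> bd (Delta n) s p (sub (Delta n) {0..n})"
proof -
  have zz: "zs (replicate n Zero) = {..<n}" by (auto simp: zs_def)
  have ws: "w \<in> sub (Cube n) (replicate n Zero)" using w by (simp add: Cube_sub)
  have "(\<exists>Z\<subseteq>{..<n}. card Z = Suc p \<and> alternating s w Z) \<longleftrightarrow>
    (\<exists>Z\<subseteq>{0..n}. card Z = Suc (Suc p) \<and> (\<forall>z\<in>Z. even (pos Z z) = s \<longrightarrow> z \<in> breaks w))" (is "?L \<longleftrightarrow> ?R")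
  proof
    assume ?L
    then obtain Z where Z: "Z \<subseteq> {..<n}" "card Z = Suc p" "alternating s w Z" by blast
    obtain z where z: "\<forall>i<p. z i < z (Suc i)" "Z = z ` {..p}" "\<forall>i\<le>p. pos Z (z i) = i"
      using set_chain[OF finite_subset[OF Z(1)] Z(2)] by auto
    have zn: "z i < n" if "i \<le> p" for i using Z(1) z(2) that by auto
    have up: "w ! z i \<noteq> Neg" if "i \<le> p" "even i = s" for i
      using Z(3) z(2,3) that unfolding alternating_def bsgn_def by (metis atMost_iff image_eqI)
    have dn: "w ! z i \<noteq> Pos" if "i \<le> p" "even i \<noteq> s" for i
      using Z(3) z(2,3) that unfolding alternating_def bsgn_def by (metis atMost_iff image_eqI)
    define lo where "lo i = (if i = 0 then 0 else Suc (z (i - 1)))" for i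
    define hi where "hi i = (if i \<le> p then z i else n)" for i
    have lohi: "lo i \<le> hi i" "hi i \<le> n" if "i \<le> Suc p" for i
      using z(1) zn that by (cases i; auto simp: lo_def hi_def Suc_le_eq less_imp_le le_Suc_eq)+
    have hilo: "hi i < lo (Suc i)" if "i \<le> p" for i using that by (simp add: lo_def hi_def)
    have "\<exists>t. lo i \<le> t \<and> t \<le> hi i \<and> (even i = s \<longrightarrow> t \<in> breaks w)" if i: "i \<le> Suc p" for i
    proof (cases "even i = s")
      case True
      have "lo i = 0 \<or> w ! (lo i - 1) \<noteq> Pos" using dn[of "i - 1"] True i by (cases i) (auto simp: lo_def)
      moreover have "hi i = length w \<or> w ! hi i \<noteq> Neg" using up[of i] True w by (auto simp: hi_def)
      ultimately show ?thesis using break_between[of "lo i" "hi i" w] lohi[OF i] w by blast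
    next
      case False then show ?thesis using lohi[OF i] by blast
    qed
    then obtain t where t: "\<And>i. i \<le> Suc p \<Longrightarrow> lo i \<le> t i \<and> t i \<le> hi i \<and> (even i = s \<longrightarrow> t i \<in> breaks w)" by metis
    have mono: "\<forall>i<Suc p. t i < t (Suc i)"
    proof (intro allI impI)
      fix i assume "i < Suc p"
      then show "t i < t (Suc i)" using t[of i] t[of "Suc i"] hilo[of i] by simp
    qed
    have "t i \<le> n" if "i \<le> Suc p" for i using t[OF that] lohi[OF that] by simp
    then show ?R using chain_pos[OF mono] t by (intro exI[of _ "t ` {..Suc p}"]) auto
  next
    assume ?R
    then obtain Z where Z: "Z \<subseteq> {0..n}" "card Z = Suc (Suc p)" "\<forall>z\<in>Z. even (pos Z z) = s \<longrightarrow> z \<in> breaks w" by blast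
    obtain t where t: "\<forall>i<Suc p. t i < t (Suc i)" "Z = t ` {..Suc p}" "\<forall>i\<le>Suc p. pos Z (t i) = i"
      using set_chain[OF finite_subset[OF Z(1)] Z(2)] by auto
    have tn: "t i \<le> n" if "i \<le> Suc p" for i using Z(1) t(2) that by auto
    have tb: "t i \<in> breaks w" if "i \<le> Suc p" "even i = s" for i
      using Z(3) t(2,3) that by (metis atMost_iff image_eqI)
    \<comment> \<open>A break is followed by a letter other than \<open>-\<close> and preceded by
      one other than \<open>+\<close>. The parity decides which of these two letters is taken, and
      both give one letter between consecutive points.\<close>
    define z where "z i = (if even i = s then t i else t (Suc i) - 1)" for i
    have lt: "t i < t (Suc i)" if "i \<le> p" for i using t(1) that by simp
    have z1: "t i \<le> z i" "z i < t (Suc i)" if "i \<le> p" for i using lt[OF that] by (auto simp: z_def)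
    have mono: "\<forall>i<p. z i < z (Suc i)"
    proof (intro allI impI)
      fix i assume "i < p"
      then show "z i < z (Suc i)" using z1[of i] z1[of "Suc i"] by simp
    qed
    have zn: "z i < n" if "i \<le> p" for i using z1(2)[OF that] tn[of "Suc i"] that by simp
    have "w ! z i \<noteq> bsgn s i" if i: "i \<le> p" for i
    proof (cases "even i = s")
      case True
      have "t i \<in> breaks w" "t i \<noteq> n" using tb[of i] True i lt[OF i] tn[of "Suc i"] by auto
      then show ?thesis using True w by (auto simp: z_def breaks_def bsgn_def)
    next
      case False
      have "t (Suc i) \<in> breaks w" "t (Suc i) \<noteq> 0" using tb[of "Suc i"] False i lt[OF i] by auto
      then show ?thesis using False by (auto simp: z_def breaks_def bsgn_def)
    qed
    then show ?L using chain_pos[OF mono] zn by (intro exI[of _ "z ` {..p}"]) (auto simp: alternating_def)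
  qed
  then have "(\<forall>Z\<subseteq>{..<n}. card Z = Suc p \<longrightarrow> \<not> alternating s w Z) \<longleftrightarrow>
    (\<forall>Z\<subseteq>{0..n}. card Z = Suc (Suc p) \<longrightarrow> (\<exists>z\<in>Z. even (pos Z z) = s \<and> z \<notin> breaks w))" by blast
  then show ?thesis
    using cube_bd_atom[of "replicate n Zero" n w s p] zz ws Delta_bd_iff[of "{0..n}" n "breaks w" s p]
      breaks_nonempty[of w] breaks_subset[of w] w by auto
qed

lemma delta_image_iff: "A = delta i ` B \<longleftrightarrow> i \<notin> A \<and> (\<forall>t. delta i t \<in> A \<longleftrightarrow> t \<in> B)"
proof
  assume "i \<notin> A \<and> (\<forall>t. delta i t \<in> A \<longleftrightarrow> t \<in> B)"
  moreover have "x = i \<or> (\<exists>t. x = delta i t)" for x using delta_cases[of x "max x i" i] by auto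
  ultimately show "A = delta i ` B" by (auto simp: image_iff) metis
next
  assume "A = delta i ` B"
  moreover have "i \<noteq> delta i x" for x by (simp add: delta_def)
  ultimately show "i \<notin> A \<and> (\<forall>t. delta i t \<in> A \<longleftrightarrow> t \<in> B)" by auto
qed

lemma breaks_ins_0: "breaks (ins 0 Neg u) = delta 0 ` breaks u"
  unfolding delta_image_iff by (auto simp: breaks_def delta_def nth_ins)

lemma breaks_ins_end: "breaks (ins (length u) Pos u) = delta (Suc (length u)) ` breaks u"
  unfolding delta_image_iff by (auto simp: breaks_def delta_def nth_ins)

lemma breaks_join:
  assumes "length w = Suc m" "i < m" "bent i w"
  shows "breaks w = delta (Suc i) ` breaks (join i w)"
  unfolding delta_image_iff
proof (intro conjI allI)
  show "Suc i \<notin> breaks w" using assms by (auto simp: breaks_def bent_def)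
  fix t
  have lj: "length (join i w) = m" using assms by simp
  consider "t < i" | "t = i" | "t = Suc i" | "Suc i < t" by linarith
  then show "delta (Suc i) t \<in> breaks w \<longleftrightarrow> t \<in> breaks (join i w)"
    by cases (use assms lj in \<open>auto simp: breaks_def delta_def nth_join bent_def\<close>)
qed

lemma not_break_0: "length w = Suc m \<Longrightarrow> 0 \<notin> breaks w \<Longrightarrow> \<exists>u. length u = m \<and> w = ins 0 Neg u"
  by (cases w) (auto simp: breaks_def ins_def)

lemma not_break_end: "length w = Suc m \<Longrightarrow> Suc m \<notin> breaks w \<Longrightarrow> \<exists>u. length u = m \<and> w = ins m Pos u"
  by (cases w rule: rev_cases) (auto simp: breaks_def ins_def nth_append)

lemma not_break_mid: "length w = Suc m \<Longrightarrow> i < m \<Longrightarrow> Suc i \<notin> breaks w \<Longrightarrow> bent i w"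
  by (auto simp: breaks_def bent_def)

lemma delta_image_inj: "(delta i ` A = delta i ` B) \<longleftrightarrow> A = B"
  by (rule inj_image_eq_iff) (simp add: inj_def)

text \<open>Omitting the vertex \<open>i\<close> leaves the words without a break at
  \<open>i\<close>. Such a word starts with \<open>-\<close>, ends with \<open>+\<close>, or is bent
  there, and each case is a map of cells obtained before.\<close>

lemma real_cube_delta:
  assumes i: "i \<le> Suc m"
  shows "\<exists>\<Phi>. cell_map (Cube m) (Cube (Suc m)) \<Phi> \<and>
    (\<forall>X. real_cube (Suc m) (((`) (delta i)) ` X) = \<Phi> (real_cube m X))"
proof -
  have no: "i \<notin> breaks w" if "w \<in> real_cube n (((`) (delta i)) ` X)" for w X n
  proof -
    have "i \<noteq> delta i x" for x by (simp add: delta_def)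
    then show ?thesis using that by (auto simp: real_cube_def)
  qed
  consider "i = 0" | "i = Suc m" | i' where "i = Suc i'" "i' < m" using i by (cases i) (auto simp: le_less)
  then show ?thesis
  proof cases
    case 1
    have "real_cube (Suc m) (((`) (delta i)) ` X) = ins 0 Neg ` real_cube m X" for X
    proof (intro equalityI subsetI)
      fix w assume w: "w \<in> real_cube (Suc m) (((`) (delta i)) ` X)"
      then obtain u where u: "length u = m" "w = ins 0 Neg u" using not_break_0[of w m] no[OF w] 1 by (auto simp: real_cube_def)
      then show "w \<in> ins 0 Neg ` real_cube m X"
        using w 1 breaks_ins_0[of u] by (auto simp: real_cube_def delta_image_inj)
    qed (use 1 in \<open>auto simp: real_cube_def breaks_ins_0\<close>)
    then show ?thesis using cell_map_ins[of 0 m Neg] by (intro exI[of _ "(`) (ins 0 Neg)"]) auto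
  next
    case 2
    have "real_cube (Suc m) (((`) (delta i)) ` X) = ins m Pos ` real_cube m X" for X
    proof (intro equalityI subsetI)
      fix w assume w: "w \<in> real_cube (Suc m) (((`) (delta i)) ` X)"
      then obtain u where u: "length u = m" "w = ins m Pos u" using not_break_end[of w m] no[OF w] 2 by (auto simp: real_cube_def)
      then show "w \<in> ins m Pos ` real_cube m X"
        using w 2 breaks_ins_end[of u] by (auto simp: real_cube_def delta_image_inj)
    next
      fix w assume "w \<in> ins m Pos ` real_cube m X"
      then obtain u where u: "length u = m" "breaks u \<in> X" "w = ins m Pos u" by (auto simp: real_cube_def)
      then show "w \<in> real_cube (Suc m) (((`) (delta i)) ` X)" using 2 breaks_ins_end[of u] by (auto simp: real_cube_def)
    qed
    then show ?thesis using cell_map_ins[of m m Pos] by (intro exI[of _ "(`) (ins m Pos)"]) auto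
  next
    case 3
    have "real_cube (Suc m) (((`) (delta i)) ` X) = subdiv m i' (real_cube m X)" for X
    proof (intro equalityI subsetI)
      fix w assume w: "w \<in> real_cube (Suc m) (((`) (delta i)) ` X)"
      then have len: "length w = Suc m" by (simp add: real_cube_def)
      have b: "bent i' w" using not_break_mid[OF len 3(2)] no[OF w] 3 by auto
      show "w \<in> subdiv m i' (real_cube m X)"
        using w b len 3 breaks_join[OF len 3(2) b] by (auto simp: real_cube_def subdiv_def delta_image_inj)
    next
      fix w assume "w \<in> subdiv m i' (real_cube m X)"
      then have "length w = Suc m" "bent i' w" "breaks (join i' w) \<in> X" by (auto simp: real_cube_def subdiv_def)
      then show "w \<in> real_cube (Suc m) (((`) (delta i)) ` X)" using 3 breaks_join[of w m i'] by (auto simp: real_cube_def)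
    qed
    then show ?thesis using cell_map_subdiv[OF 3(2)] by blast
  qed
qed

text \<open>Induction on n: the full simplex is the full cube, and a proper face omits a vertex and
  comes from one dimension lower.\<close>

lemma real_cube_atom:
  "\<sigma> \<in> faces (Delta n) \<Longrightarrow> real_cube n (sub (Delta n) \<sigma>) \<in> cells (Cube n) \<and>
    (\<forall>s p. real_cube n (bd (Delta n) s p (sub (Delta n) \<sigma>)) = bd (Cube n) s p (real_cube n (sub (Delta n) \<sigma>)))"
proof (induction n arbitrary: \<sigma>)
  case (0 \<sigma>)
  then have "\<sigma> = {0..0}" by auto
  moreover have "real_cube 0 (sub (Delta 0) {0..0}) = sub (Cube 0) (replicate 0 Zero)"
    using breaks_nonempty breaks_subset by (fastforce simp: real_cube_def Cube_sub)
  moreover have "bd (Cube 0) s p (sub (Cube 0) (replicate 0 Zero)) = real_cube 0 (bd (Delta 0) s p (sub (Delta 0) {0..0}))" for s p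
    using real_cube_top_bd[of _ 0 s p] by (auto simp: real_cube_def bd_iff[of _ "Cube 0"] Cube_sub)
  ultimately show ?case using cells.atom[of "replicate 0 Zero" "Cube 0"] by simp
next
  case (Suc m \<sigma>)
  show ?case
  proof (cases "\<sigma> = {0..Suc m}")
    case True
    have e: "real_cube (Suc m) (sub (Delta (Suc m)) {0..Suc m}) = sub (Cube (Suc m)) (replicate (Suc m) Zero)"
    proof -
      have "breaks w \<subseteq> {0..Suc m}" if "length w = Suc m" for w using breaks_subset[of w] that by simp
      then have "breaks w \<in> sub (Delta (Suc m)) {0..Suc m}" if "length w = Suc m" for w
        using breaks_nonempty that by simp
      then show ?thesis unfolding real_cube_def by (auto simp: Cube_sub simp del: replicate_Suc Delta_sub)
    qed
    have "real_cube (Suc m) (bd (Delta (Suc m)) s p (sub (Delta (Suc m)) {0..Suc m})) =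
        bd (Cube (Suc m)) s p (sub (Cube (Suc m)) (replicate (Suc m) Zero))" for s p
    proof (intro set_eqI)
      fix w
      have "w \<in> bd (Cube (Suc m)) s p (sub (Cube (Suc m)) (replicate (Suc m) Zero)) \<Longrightarrow> length w = Suc m"
        by (simp add: bd_iff Cube_sub)
      then show "w \<in> real_cube (Suc m) (bd (Delta (Suc m)) s p (sub (Delta (Suc m)) {0..Suc m})) \<longleftrightarrow>
          w \<in> bd (Cube (Suc m)) s p (sub (Cube (Suc m)) (replicate (Suc m) Zero))"
        using real_cube_top_bd[of w "Suc m" s p] by (auto simp: real_cube_def simp del: Delta_sub replicate_Suc)
    qed
    then show ?thesis unfolding True e using cells.atom[of "replicate (Suc m) Zero" "Cube (Suc m)"] by simp
  next
    case False
    then obtain i where i: "i \<le> Suc m" "i \<notin> \<sigma>" using Suc.prems by auto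
    define \<tau> where "\<tau> = {t. delta i t \<in> \<sigma>}"
    have st: "\<sigma> = delta i ` \<tau>" unfolding delta_image_iff using i by (simp add: \<tau>_def)
    have t: "\<tau> \<in> faces (Delta m)"
    proof -
      have "t \<le> m" if "delta i t \<in> \<sigma>" for t using that Suc.prems i by (force simp: delta_def split: if_splits)
      moreover have "\<tau> \<noteq> {}" using st Suc.prems by auto
      ultimately show ?thesis by (auto simp: \<tau>_def)
    qed
    note IH = Suc.IH[OF t]
    obtain \<Phi> where F: "cell_map (Cube m) (Cube (Suc m)) \<Phi>" "\<And>X. real_cube (Suc m) (((`) (delta i)) ` X) = \<Phi> (real_cube m X)"
      using real_cube_delta[OF i(1)] by blast
    note d = cell_mapD(2)[OF cell_map_delta[OF i(1)] cells.atom[OF t]]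
    have "sub (Delta (Suc m)) \<sigma> = ((`) (delta i)) ` sub (Delta m) \<tau>" unfolding st by (rule Delta_sub_image[symmetric])
    then show ?thesis
      using IH F d cell_mapD(1,2)[OF F(1), of "real_cube m (sub (Delta m) \<tau>)"] by (metis (no_types, lifting))
  qed
qed

lemma cell_map_real_cube: "cell_map (Delta n) (Cube n) (real_cube n)"
  unfolding real_cube_def
proof (rule preimage_cell_map[OF simplex.pasting_axioms cube.pasting_axioms])
  fix w l assume "l \<in> {w. length w = n}" "w \<in> sub (Cube n) l"
  then show "w \<in> {w. length w = n} \<and> breaks w \<in> sub (Delta n) (breaks l)"
    using breaks_mono breaks_nonempty by (auto simp: Cube_sub)
qed (use real_cube_atom in \<open>auto simp: real_cube_def Cube_sub simp del: Delta_sub\<close>)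

subsection \<open>Cones over cells of a simplex\<close>

text \<open>Purity is inherited from cubes; in a composite along order 0 at most one factor
  survives.\<close>

lemma col_pure:
  assumes "X \<in> pure (Cube (Suc n))" "col X \<noteq> {}"
  shows "col X \<in> pure (Delta n)"
  using assms
proof (induction rule: pure.induct)
  case (atom k)
  then have k: "length k = Suc n" "Pos \<notin> set k" using col_sub_Pos by auto
  then have c: "col (sub (Cube (Suc n)) k) = sub (Delta n) (zs k)" by (rule col_sub_no_Pos)
  then have "zs k \<in> faces (Delta n)" using atom(2) k(1) by (auto dest: zs_less)
  then show ?case unfolding c by (rule pure.atom)
next
  case (comp X Y p)
  have X: "X \<in> cells (Cube (Suc n))" and Y: "Y \<in> cells (Cube (Suc n))" using pure_cells[OF comp(1)] pure_cells[OF comp(2)] .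
  show ?case
  proof (cases "col X = {} \<or> col Y = {}")
    case True
    then have "col (X \<union> Y) = col X \<and> col X \<noteq> {} \<or> col (X \<union> Y) = col Y \<and> col Y \<noteq> {}"
      using comp.prems unfolding col_Un by blast
    then show ?thesis using comp.IH by (elim disjE) simp_all
  next
    case False
    then have ne: "col X \<noteq> {}" "col Y \<noteq> {}" by auto
    have "p \<noteq> 0"
    proof
      assume "p = 0"
      then have "negs (Suc n) \<in> bd (Cube (Suc n)) False 0 X"
        using comp(3) col_cells(1)[OF Y ne(2)] negs_bd[of 0 True "Suc n" Y] by simp
      then show False using negs_tgt[OF X] ne(1) by simp
    qed
    then obtain q where q: "p = Suc q" by (cases p) auto
    have "bd (Delta n) False q (col X) = bd (Delta n) True q (col Y)"
      using comp(3) col_bd[OF cube.cells_faces[OF X]] col_bd[OF cube.cells_faces[OF Y]] q by metis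
    then show ?thesis unfolding col_Un using comp ne by (intro pure.comp) auto
  qed
qed

lemma simplex_pure: "X \<in> cells (Delta n) \<Longrightarrow> X \<in> pure (Delta n)"
proof (rule cells_pure[OF simplex.pasting_axioms])
  fix \<sigma> and s p assume s: "\<sigma> \<in> faces (Delta n)"
  then have s': "\<sigma> \<subseteq> {0..n}" by simp
  have "bd (Delta n) s p (sub (Delta n) \<sigma>) \<noteq> {}"
    by (rule simplex.cells_nonempty[OF cells_bd[OF cells.atom[OF s]]])
  then show "bd (Delta n) s p (sub (Delta n) \<sigma>) \<in> pure (Delta n)"
    unfolding Delta_bd_atom[OF s'] by (intro col_pure cube_pure cells_bd cells.atom) simp_all
qed

text \<open>The apex is the new largest vertex, which is initial, so the cone starts at the apex and
  its 0-target is that of the base.\<close>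

definition cone :: "nat \<Rightarrow> nat set set \<Rightarrow> nat set set" where
  "cone n X = insert {Suc n} (X \<union> insert (Suc n) ` X)"

text \<open>The apex is the last entry of each set containing it. It leaves the other positions
  unchanged, and its own position is the size of the base face, whence the dependence on the parity
  of r.\<close>

lemma cone_bd:
  assumes X: "X \<in> cells (Delta n)"
  defines "K \<equiv> Delta n" and "L \<equiv> Delta (Suc n)"
  shows "{Suc n} \<in> bd L s r (cone n X) \<longleftrightarrow> r > 0 \<or> s"
    and "c \<in> X \<Longrightarrow> insert (Suc n) c \<in> bd L s r (cone n X) \<longleftrightarrow> r > 0 \<and> c \<in> bd K s (r - 1) X"
    and "c \<in> X \<Longrightarrow> c \<in> bd L s r (cone n X) \<longleftrightarrow>
      (if even r \<noteq> s then c \<in> bd K s r X else r > 0 \<and> c \<in> bd K s (r - 1) X)"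
proof -
  let ?v = "Suc n"
  have X': "t \<subseteq> {0..n}" "t \<noteq> {}" "finite t" "?v \<notin> t" "card t > 0" "card (insert ?v t) = Suc (card t)" if "t \<in> X" for t
  proof -
    show t: "t \<subseteq> {0..n}" "t \<noteq> {}" using simplex.cells_faces[OF X] that by auto
    show f: "finite t" using t(1) finite_subset by blast
    show "?v \<notin> t" using t(1) by auto
    then show "card t > 0" "card (insert ?v t) = Suc (card t)" using f t(2) by (auto simp: card_gt_0_iff)
  qed
  have S: "\<rho> \<in> Sub L (fbd L s t) \<longleftrightarrow> (\<exists>u\<in>t - \<rho>. even (pos t u) = s)" if "t \<in> X" "\<rho> \<subseteq> t" "\<rho> \<noteq> {}" for \<rho> t
    unfolding L_def using X'[OF that(1)] that by (intro Delta_Sub_fbd) auto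
  have S': "\<rho> \<in> Sub L (fbd L s (insert ?v t)) \<longleftrightarrow> (\<exists>u\<in>t - \<rho>. even (pos t u) = s) \<or> (?v \<notin> \<rho> \<and> even (card t) = s)"
    if "t \<in> X" "\<rho> \<subseteq> insert ?v t" "\<rho> \<noteq> {}" for \<rho> t
  proof -
    note t = X'[OF that(1)]
    have "{y \<in> insert ?v t. y < u} = {y \<in> t. y < u}" if "u \<in> t" for u using t(1) that by auto
    moreover have "{y \<in> insert ?v t. y < ?v} = t" using t(1) by auto
    ultimately have p: "pos (insert ?v t) u = pos t u" if "u \<in> t" for u using that by (simp add: pos_def)
    have p': "pos (insert ?v t) ?v = card t" unfolding pos_def \<open>{y \<in> insert ?v t. y < ?v} = t\<close> by (rule refl)
    have "\<rho> \<in> Sub L (fbd L s (insert ?v t)) \<longleftrightarrow> (\<exists>u\<in>insert ?v t - \<rho>. even (pos (insert ?v t) u) = s)"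
      unfolding L_def using that t(3) by (intro Delta_Sub_fbd) auto
    also have "\<dots> \<longleftrightarrow> (\<exists>u\<in>t - \<rho>. even (pos t u) = s) \<or> (?v \<notin> \<rho> \<and> even (card t) = s)"
    proof -
      have "insert ?v t - \<rho> = (if ?v \<in> \<rho> then {} else {?v}) \<union> (t - \<rho>)" by auto
      then show ?thesis using p p' by (simp add: ball_Un bex_Un) blast
    qed
    finally show ?thesis .
  qed
  have KI: "c \<in> bd K s r X \<longleftrightarrow> card c \<le> Suc r \<and> (\<forall>t\<in>X. card t = Suc (Suc r) \<and> c \<subseteq> t \<longrightarrow> (\<exists>u\<in>t - c. even (pos t u) = s))"
    if "c \<in> X" for c r
  proof -
    have "(\<forall>t\<in>X. fdim K t = Suc r \<and> c \<in> sub K t \<longrightarrow> c \<in> Sub K (fbd K s t)) \<longleftrightarrow>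
      (\<forall>t\<in>X. card t = Suc (Suc r) \<and> c \<subseteq> t \<longrightarrow> (\<exists>u\<in>t - c. even (pos t u) = s))"
    proof (rule ball_cong[OF refl])
      fix t assume t: "t \<in> X"
      have "c \<subseteq> t \<Longrightarrow> c \<in> Sub K (fbd K s t) \<longleftrightarrow> (\<exists>u\<in>t - c. even (pos t u) = s)"
        unfolding K_def using X'(2)[OF that] X'(3)[OF t] by (intro Delta_Sub_fbd) auto
      moreover have "fdim K t = Suc r \<longleftrightarrow> card t = Suc (Suc r)" "c \<in> sub K t \<longleftrightarrow> c \<subseteq> t"
        using X'(5)[OF t] X'(2)[OF that] by (auto simp: K_def)
      ultimately show "(fdim K t = Suc r \<and> c \<in> sub K t \<longrightarrow> c \<in> Sub K (fbd K s t)) \<longleftrightarrow>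
        (card t = Suc (Suc r) \<and> c \<subseteq> t \<longrightarrow> (\<exists>u\<in>t - c. even (pos t u) = s))" by blast
    qed
    moreover have "fdim K c \<le> r \<longleftrightarrow> card c \<le> Suc r" by (auto simp: K_def)
    ultimately show ?thesis unfolding bd_iff using that by blast
  qed
  have LI: "\<rho> \<in> bd L s r (cone n X) \<longleftrightarrow> card \<rho> \<le> Suc r \<and>
      (\<forall>t\<in>X. card t = Suc (Suc r) \<and> \<rho> \<subseteq> t \<longrightarrow> (\<exists>u\<in>t - \<rho>. even (pos t u) = s)) \<and>
      (\<forall>t\<in>X. card t = Suc r \<and> \<rho> \<subseteq> insert ?v t \<longrightarrow> (\<exists>u\<in>t - \<rho>. even (pos t u) = s) \<or> (?v \<notin> \<rho> \<and> odd r = s))"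
    if r: "\<rho> \<in> cone n X" "\<rho> \<noteq> {}" for \<rho>
  proof -
    have "fdim L \<rho> \<le> r \<longleftrightarrow> card \<rho> \<le> Suc r" by (auto simp: L_def)
    moreover have "fdim L {?v} \<noteq> Suc r" by (simp add: L_def)
    moreover have "(fdim L t = Suc r \<and> \<rho> \<in> sub L t \<longrightarrow> \<rho> \<in> Sub L (fbd L s t)) \<longleftrightarrow>
        (card t = Suc (Suc r) \<and> \<rho> \<subseteq> t \<longrightarrow> (\<exists>u\<in>t - \<rho>. even (pos t u) = s))" if t: "t \<in> X" for t
    proof -
      have "fdim L t = Suc r \<longleftrightarrow> card t = Suc (Suc r)" "\<rho> \<in> sub L t \<longleftrightarrow> \<rho> \<subseteq> t"
        using X'(5)[OF t] r(2) by (auto simp: L_def)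
      then show ?thesis using S[OF t _ r(2)] by blast
    qed
    moreover have "(fdim L (insert ?v t) = Suc r \<and> \<rho> \<in> sub L (insert ?v t) \<longrightarrow> \<rho> \<in> Sub L (fbd L s (insert ?v t))) \<longleftrightarrow>
        (card t = Suc r \<and> \<rho> \<subseteq> insert ?v t \<longrightarrow> (\<exists>u\<in>t - \<rho>. even (pos t u) = s) \<or> (?v \<notin> \<rho> \<and> odd r = s))" if t: "t \<in> X" for t
    proof -
      have "fdim L (insert ?v t) = Suc r \<longleftrightarrow> card t = Suc r" "\<rho> \<in> sub L (insert ?v t) \<longleftrightarrow> \<rho> \<subseteq> insert ?v t"
        using X'(6)[OF t] r(2) by (auto simp: L_def)
      moreover have "card t = Suc r \<Longrightarrow> even (card t) = odd r" by simp
      ultimately show ?thesis using S'[OF t _ r(2)] by auto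
    qed
    ultimately show ?thesis unfolding bd_iff using r(1)
      by (simp add: cone_def[of n X] ball_Un all_conj_distrib)
  qed
  obtain x where x: "x \<in> X" "card x = 1"
  proof -
    obtain t where t: "t \<in> X" using simplex.cells_nonempty[OF X] by auto
    then obtain u where "u \<in> t" using X'(2) by blast
    then have "{u} \<in> sub (Delta n) t" by simp
    then have "{u} \<in> X" using simplex.cells_down[OF X] t unfolding down_def by blast
    then show ?thesis using that by simp
  qed
  show "{?v} \<in> bd L s r (cone n X) \<longleftrightarrow> r > 0 \<or> s"
  proof -
    have "{?v} \<in> bd L s r (cone n X) \<longleftrightarrow> (\<forall>t\<in>X. card t = Suc r \<longrightarrow> (\<exists>u\<in>t. even (pos t u) = s))"
      using LI[of "{?v}"] X'(4) by (auto simp: cone_def)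
    also have "\<dots> \<longleftrightarrow> r > 0 \<or> s"
    proof
      assume a: "\<forall>t\<in>X. card t = Suc r \<longrightarrow> (\<exists>u\<in>t. even (pos t u) = s)"
      show "r > 0 \<or> s"
      proof (rule ccontr)
        assume n: "\<not> (r > 0 \<or> s)"
        then obtain u where "u \<in> x" "odd (pos x u)" using a x by auto
        moreover obtain y where "x = {y}" using x(2) card_1_singletonE by blast
        moreover have "{z. z = y \<and> z < y} = {}" by auto
        ultimately show False by (simp add: pos_def)
      qed
    next
      assume rs: "r > 0 \<or> s"
      show "\<forall>t\<in>X. card t = Suc r \<longrightarrow> (\<exists>u\<in>t. even (pos t u) = s)"
      proof (intro ballI impI)
        fix t assume t: "t \<in> X" "card t = Suc r"
        have "(if s then 0 else 1) < card t" using rs t(2) by (cases s) auto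
        then obtain u where "u \<in> t" "pos t u = (if s then 0 else 1)"
          using pos_surj[OF X'(3)[OF t(1)]] by blast
        then show "\<exists>u\<in>t. even (pos t u) = s" by (intro bexI[of _ u]) (cases s; simp)
      qed
    qed
    finally show ?thesis .
  qed
  show "insert ?v c \<in> bd L s r (cone n X) \<longleftrightarrow> r > 0 \<and> c \<in> bd K s (r - 1) X" if c: "c \<in> X"
  proof -
    have "insert ?v c \<in> bd L s r (cone n X) \<longleftrightarrow> card c \<le> r \<and> (\<forall>t\<in>X. card t = Suc r \<and> c \<subseteq> t \<longrightarrow> (\<exists>u\<in>t - c. even (pos t u) = s))"
      using LI[of "insert ?v c"] X'(4) X'(4,6)[OF c] c by (auto simp: cone_def subset_insert_iff)
    then show ?thesis using KI[OF c, of "r - 1"] X'(5)[OF c] by (cases r) auto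
  qed
  show "c \<in> bd L s r (cone n X) \<longleftrightarrow>
      (if even r \<noteq> s then c \<in> bd K s r X else r > 0 \<and> c \<in> bd K s (r - 1) X)" if c: "c \<in> X"
  proof -
    have e: "c \<in> bd L s r (cone n X) \<longleftrightarrow> c \<in> bd K s r X \<and>
      (\<forall>t\<in>X. card t = Suc r \<and> c \<subseteq> t \<longrightarrow> (\<exists>u\<in>t - c. even (pos t u) = s) \<or> odd r = s)"
    proof -
      have "c \<subseteq> insert ?v t \<longleftrightarrow> c \<subseteq> t" for t using X'(4)[OF c] by auto
      moreover have "c \<in> cone n X" using c by (simp add: cone_def)
      ultimately show ?thesis using LI[of c] KI[OF c, of r] X'(2,4)[OF c] by simp
    qed
    show ?thesis
    proof (cases "even r = s")
      case False then show ?thesis using e by auto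
    next
      case True
      then have e': "c \<in> bd L s r (cone n X) \<longleftrightarrow> c \<in> bd K s r X \<and>
        (\<forall>t\<in>X. card t = Suc r \<and> c \<subseteq> t \<longrightarrow> (\<exists>u\<in>t - c. even (pos t u) = s))" using e by auto
      have "c \<in> bd K s r X \<and> (\<forall>t\<in>X. card t = Suc r \<and> c \<subseteq> t \<longrightarrow> (\<exists>u\<in>t - c. even (pos t u) = s)) \<longleftrightarrow>
        r > 0 \<and> c \<in> bd K s (r - 1) X" (is "?A \<longleftrightarrow> ?B")
      proof
        assume A: ?A
        then have "card c \<noteq> Suc r" using c by auto
        moreover have "card c \<le> Suc r" using A KI[OF c] by simp
        ultimately have "r > 0" "card c \<le> r" using X'(5)[OF c] by auto
        then show ?B using A KI[OF c, of "r - 1"] by simp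
      next
        assume B: ?B
        then have "c \<in> bd K s r X"
          using simplex.bd_bd[OF X, of "r - 1" r s s] bd_subset[of K s "r - 1" "bd K s r X"] by (auto simp: K_def)
        then show ?A using B KI[OF c, of "r - 1"] by simp
      qed
      then show ?thesis using e' True by simp
    qed
  qed
qed

lemma cone_atom: "\<sigma> \<in> faces (Delta n) \<Longrightarrow> cone n (sub (Delta n) \<sigma>) = sub (Delta (Suc n)) (insert (Suc n) \<sigma>)"
proof (intro equalityI subsetI)
  fix \<rho> assume "\<rho> \<in> sub (Delta (Suc n)) (insert (Suc n) \<sigma>)"
  then have r: "\<rho> - {Suc n} \<subseteq> \<sigma>" "\<rho> \<noteq> {}" by auto
  show "\<rho> \<in> cone n (sub (Delta n) \<sigma>)"
  proof (cases "\<rho> - {Suc n} = {}")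
    case True then have "\<rho> = {Suc n}" using r(2) by auto
    then show ?thesis by (simp add: cone_def)
  next
    case False
    then have "\<rho> - {Suc n} \<in> sub (Delta n) \<sigma>" using r by simp
    moreover have "\<rho> = \<rho> - {Suc n} \<or> \<rho> = insert (Suc n) (\<rho> - {Suc n})" by auto
    ultimately have "\<rho> \<in> sub (Delta n) \<sigma> \<or> \<rho> \<in> insert (Suc n) ` sub (Delta n) \<sigma>" by (metis imageI)
    then show ?thesis by (simp add: cone_def del: Delta_sub)
  qed
qed (auto simp: cone_def)

text \<open>The base is the face omitting the last vertex, and \<open>delta (Suc n)\<close> fixes
  all smaller numbers.\<close>

lemma cell_map_base: "cell_map (Delta n) (Delta (Suc n)) (\<lambda>X. X)"
proof -
  have "((`) (delta (Suc n))) ` X = X" if "X \<in> cells (Delta n)" for X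
  proof -
    have "delta (Suc n) ` t = t" if "t \<in> X" for t
    proof -
      have "t \<subseteq> {0..n}" using simplex.cells_faces[OF \<open>X \<in> cells (Delta n)\<close>] that by auto
      then have "\<forall>u\<in>t. delta (Suc n) u = u" by (auto simp: delta_def)
      then show ?thesis by simp
    qed
    then show ?thesis by simp
  qed
  note e = this
  have d: "cell_map (Delta n) (Delta (Suc n)) ((`) ((`) (delta (Suc n))))" by (rule cell_map_delta) simp
  show ?thesis
    unfolding cell_map_def
  proof (intro conjI ballI allI)
    fix X s p assume X: "X \<in> cells (Delta n)"
    show "X \<in> cells (Delta (Suc n))" using cell_mapD(1)[OF d X] unfolding e[OF X] .
    show "bd (Delta n) s p X = bd (Delta (Suc n)) s p X"
      using cell_mapD(2)[OF d X, of s p] unfolding e[OF X] e[OF cells_bd[OF X]] .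
  qed (rule refl)
qed

lemma apex_cell: "{{Suc n}} \<in> cells (Delta (Suc n))" "bd (Delta (Suc n)) s p {{Suc n}} = {{Suc n}}"
proof -
  have "sub (Delta (Suc n)) {Suc n} = {{Suc n}}" by auto
  then show "{{Suc n}} \<in> cells (Delta (Suc n))" using cells.atom[of "{Suc n}" "Delta (Suc n)"] by simp
  show "bd (Delta (Suc n)) s p {{Suc n}} = {{Suc n}}" by (rule bd_low) simp
qed

interpretation cone: cylinder "Delta n" "Delta (Suc n)" "cone n" "\<lambda>b N. if b then {{Suc n}} else N" "cells (Delta (Suc n))" n
  for n
proof
  fix X assume X: "X \<in> cells (Delta n)"
  show "X \<in> pure (Delta n)" by (rule simplex_pure[OF X])
  have mem: "\<rho> \<in> cone n Y \<longleftrightarrow> \<rho> = {Suc n} \<or> \<rho> \<in> Y \<or> (\<exists>c\<in>Y. \<rho> = insert (Suc n) c)" for \<rho> Y by (auto simp: cone_def)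
  have ext: "A = B" if A: "A \<subseteq> cone n X" and B: "B \<subseteq> cone n X" and 1: "{Suc n} \<in> A \<longleftrightarrow> {Suc n} \<in> B"
    and 2: "\<And>c. c \<in> X \<Longrightarrow> insert (Suc n) c \<in> A \<longleftrightarrow> insert (Suc n) c \<in> B" and 3: "\<And>c. c \<in> X \<Longrightarrow> c \<in> A \<longleftrightarrow> c \<in> B" for A B
  proof (rule set_eqI)
    fix \<rho> show "\<rho> \<in> A \<longleftrightarrow> \<rho> \<in> B"
    proof (cases "\<rho> \<in> cone n X")
      case True then show ?thesis using 1 2 3 unfolding mem by blast
    next
      case False then show ?thesis using A B by blast
    qed
  qed
  have X': "t \<noteq> {}" "Suc n \<notin> t" if "t \<in> X" for t
  proof -
    have "t \<in> faces (Delta n)" using simplex.cells_faces[OF X] that by blast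
    then show "t \<noteq> {}" "Suc n \<notin> t" by auto
  qed
  have ns: "{Suc n} \<notin> X" "insert (Suc n) c \<notin> X" for c using X' by blast+
  have inj: "insert (Suc n) c = insert (Suc n) d \<longleftrightarrow> c = d" "insert (Suc n) c \<noteq> {Suc n}" "c \<noteq> {Suc n}" "c \<noteq> insert (Suc n) d"
    if "c \<in> X" "d \<in> X" for c d using X'[OF that(1)] X'[OF that(2)] by (auto simp: insert_ident)
  have mem1: "{Suc n} \<in> cone n Y" for Y by (simp add: cone_def)
  have mem2: "insert (Suc n) c \<in> cone n Y \<longleftrightarrow> c \<in> Y" if "c \<in> X" "Y \<subseteq> X" for c Y
    using inj(1,2)[OF that(1)] that ns unfolding mem by blast
  have mem3: "c \<in> cone n Y \<longleftrightarrow> c \<in> Y" if "c \<in> X" "Y \<subseteq> X" for c Y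
    using inj(3,4)[OF that(1)] that unfolding mem by blast
  have bs: "bd (Delta (Suc n)) s r (cone n X) \<subseteq> cone n X" for s r by (rule bd_subset)
  note b = bd_subset[of "Delta n" _ _ X]
  show "bd (Delta (Suc n)) s 0 (cone n X) = (if s then {{Suc n}} else bd (Delta n) s 0 X)" for s
  proof (rule ext[OF bs])
    show "(if s then {{Suc n}} else bd (Delta n) s 0 X) \<subseteq> cone n X" using b[of s 0] by (auto simp: cone_def)
    show "{Suc n} \<in> bd (Delta (Suc n)) s 0 (cone n X) \<longleftrightarrow> {Suc n} \<in> (if s then {{Suc n}} else bd (Delta n) s 0 X)"
      using cone_bd(1)[OF X, of s 0] b[of s 0] ns(1) by auto
    fix c assume c: "c \<in> X"
    show "insert (Suc n) c \<in> bd (Delta (Suc n)) s 0 (cone n X) \<longleftrightarrow> insert (Suc n) c \<in> (if s then {{Suc n}} else bd (Delta n) s 0 X)"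
      using cone_bd(2)[OF X c, of s 0] b[of s 0] ns(2)[of c] inj(2)[OF c c] by auto
    show "c \<in> bd (Delta (Suc n)) s 0 (cone n X) \<longleftrightarrow> c \<in> (if s then {{Suc n}} else bd (Delta n) s 0 X)"
      using cone_bd(3)[OF X c, of s 0] inj(3)[OF c c] by auto
  qed
  show "bd (Delta (Suc n)) s (Suc r) (cone n X) =
      cone n (bd (Delta n) s r X) \<union> (if odd r = s then {{Suc n}} else bd (Delta n) s (Suc r) X)" for s r
  proof (rule ext[OF bs])
    let ?N = "if odd r = s then {{Suc n}} else bd (Delta n) s (Suc r) X"
    have "cone n (bd (Delta n) s r X) \<subseteq> cone n X" using b[of s r] by (auto simp: cone_def)
    then show "cone n (bd (Delta n) s r X) \<union> ?N \<subseteq> cone n X" using b[of s "Suc r"] by (auto simp: cone_def)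
    show "{Suc n} \<in> bd (Delta (Suc n)) s (Suc r) (cone n X) \<longleftrightarrow> {Suc n} \<in> cone n (bd (Delta n) s r X) \<union> ?N"
      using cone_bd(1)[OF X, of s "Suc r"] mem1 by blast
    fix c assume c: "c \<in> X"
    have "insert (Suc n) c \<notin> ?N" using b[of s "Suc r"] ns(2)[of c] inj(2)[OF c c] by auto
    then show "insert (Suc n) c \<in> bd (Delta (Suc n)) s (Suc r) (cone n X) \<longleftrightarrow> insert (Suc n) c \<in> cone n (bd (Delta n) s r X) \<union> ?N"
      using cone_bd(2)[OF X c, of s "Suc r"] mem2[OF c b] by simp
    have "bd (Delta n) s r X \<subseteq> bd (Delta n) s (Suc r) X"
      using simplex.bd_bd[OF X, of r "Suc r" s s] bd_subset[of "Delta n" s r "bd (Delta n) s (Suc r) X"] by simp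
    then show "c \<in> bd (Delta (Suc n)) s (Suc r) (cone n X) \<longleftrightarrow> c \<in> cone n (bd (Delta n) s r X) \<union> ?N"
      using cone_bd(3)[OF X c, of s "Suc r"] mem3[OF c b, of s r] inj(3)[OF c c] by auto
  qed
  show "(if b then {{Suc n}} else X) \<in> cells (Delta (Suc n))" for b
    using apex_cell(1) cell_mapD(1)[OF cell_map_base X] by simp
  show "(if b then {{Suc n}} else X) \<subseteq> cone n X" for b by (auto simp: cone_def)
next
  fix \<sigma> assume s: "\<sigma> \<in> faces (Delta n)"
  then show "fdim (Delta n) \<sigma> \<le> n" using card_mono[of "{0..n}" \<sigma>] by simp
  have "insert (Suc n) \<sigma> \<in> faces (Delta (Suc n))" using s by auto
  then show "cone n (sub (Delta n) \<sigma>) \<in> cells (Delta (Suc n))" unfolding cone_atom[OF s] by (rule cells.atom)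
next
  fix b
  show "cell_map (Delta n) (Delta (Suc n)) (\<lambda>N. if b then {{Suc n}} else N)"
    using cell_map_base[of n] apex_cell[of n] unfolding cell_map_def by (cases b) simp_all
next
  fix c X r assume c: "c \<in> cone n X" and d: "\<And>a. a \<in> X \<Longrightarrow> fdim (Delta n) a \<le> r"
  show "fdim (Delta (Suc n)) c \<le> Suc r"
  proof -
    consider "c = {Suc n}" | "c \<in> X" | a where "a \<in> X" "c = insert (Suc n) a" using c unfolding cone_def by blast
    then show ?thesis
    proof cases
      case 3
      have "card c \<le> Suc (card a)" unfolding 3 by (cases "finite a") (simp_all add: card_insert_if)
      then show ?thesis using d[OF 3(1)] by simp
    qed (use d[of c] in simp_all)
  qed
qed (auto simp: cone_def intro: cells_comp)

subsection \<open>Cubes that collapse onto a simplex\<close>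

text \<open>For q = p the matching condition makes the two factors equal; otherwise sources and
  targets of order q distribute over the composition along p.\<close>

lemma thin_cmp:
  assumes "omega C" and a: "a \<in> carr C" "src C q a = a" "tgt C q a = a"
    and b: "b \<in> carr C" "src C q b = b" "tgt C q b = b" and m: "tgt C p a = src C p b"
  shows "src C q (cmp C p a b) = cmp C p a b \<and> tgt C q (cmp C p a b) = cmp C p a b"
proof -
  interpret omega C by fact
  show ?thesis
  proof (cases "q = p")
    case True
    then have "a = b" using a b m by simp
    moreover have "cmp C p a a = a" using unit_src[OF a(1), of p] a(2) True by simp
    ultimately show ?thesis using a by simp
  next
    case False then show ?thesis using bd_cmp[OF False a(1) b(1) m] a b by simp
  qed
qed

definition fill :: "sign \<Rightarrow> sign list \<Rightarrow> sign list" where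
  "fill \<alpha> k = map (\<lambda>a. if a = Zero then \<alpha> else a) k"

lemma cube_bd_0:
  assumes k: "length k = m"
  shows "bd (Cube m) s 0 (sub (Cube m) k) = {fill (if s then Neg else Pos) k}"
proof -
  let ?\<alpha> = "if s then Neg else Pos"
  have "c \<in> bd (Cube m) s 0 (sub (Cube m) k) \<longleftrightarrow> c = fill ?\<alpha> k" for c
  proof -
    have "(\<forall>Z\<subseteq>zs k. card Z = Suc 0 \<longrightarrow> \<not> alternating s c Z) \<longleftrightarrow> (\<forall>j\<in>zs k. c ! j = ?\<alpha>)"
    proof -
      have "alternating s c {j} \<longleftrightarrow> c ! j \<noteq> ?\<alpha>" for j
      proof -
        have "{y \<in> {j}. y < j} = {}" by auto
        then have "pos {j} j = 0" unfolding pos_def by simp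
        then show ?thesis by (simp add: alternating_def bsgn_def)
      qed
      moreover have "(\<forall>Z\<subseteq>zs k. card Z = Suc 0 \<longrightarrow> \<not> alternating s c Z) \<longleftrightarrow> (\<forall>j\<in>zs k. \<not> alternating s c {j})"
      proof (intro iffI ballI allI impI)
        fix Z assume "\<forall>j\<in>zs k. \<not> alternating s c {j}" "Z \<subseteq> zs k" "card Z = Suc 0"
        then show "\<not> alternating s c Z" by (auto simp: card_Suc_eq)
      next
        fix j assume "\<forall>Z\<subseteq>zs k. card Z = Suc 0 \<longrightarrow> \<not> alternating s c Z" "j \<in> zs k"
        from this(1)[rule_format, of "{j}"] this(2) show "\<not> alternating s c {j}" by simp
      qed
      ultimately show ?thesis by simp
    qed
    then have "c \<in> bd (Cube m) s 0 (sub (Cube m) k) \<longleftrightarrow> c \<in> sub (Cube m) k \<and> (\<forall>j\<in>zs k. c ! j = ?\<alpha>)"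
      using cube_bd_atom[OF k, of c s 0] by simp
    also have "\<dots> \<longleftrightarrow> length c = length k \<and> (\<forall>j<length k. c ! j = (if k ! j = Zero then ?\<alpha> else k ! j))"
      by (auto simp: Cube_sub zs_def)
    also have "\<dots> \<longleftrightarrow> c = fill ?\<alpha> k" unfolding fill_def by (auto simp: list_eq_iff_nth_eq)
    finally show ?thesis .
  qed
  then show ?thesis by blast
qed

lemma breaks_replicate: "breaks (negs m) = {m}"
proof -
  have "t = 0 \<or> negs m ! (t - 1) \<noteq> Pos" "t = m \<or> negs m ! t = Neg" if "t \<le> m" for t
    using that by (auto simp: le_less)
  then show ?thesis unfolding breaks_def length_replicate by auto
qed

lemma breaks_word: "length w = m \<Longrightarrow> Pos \<notin> set w \<Longrightarrow> breaks w = insert m (zs w)"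
proof -
  assume w: "length w = m" "Pos \<notin> set w"
  then have "w ! j \<noteq> Pos" if "j < m" for j using that nth_mem by metis
  then have "t = 0 \<or> w ! (t - 1) \<noteq> Pos" if "t \<le> m" for t using that by (cases t) auto
  then have "breaks w = {t. t \<le> m \<and> (t = m \<or> w ! t \<noteq> Neg)}" unfolding breaks_def w(1) by blast
  moreover have "w ! t \<noteq> Neg \<longleftrightarrow> w ! t = Zero" if "t < m" for t
    using \<open>\<And>j. j < m \<Longrightarrow> w ! j \<noteq> Pos\<close>[OF that] by (cases "w ! t") auto
  ultimately show ?thesis using w(1) by (auto simp: zs_def le_less)
qed

locale flat_cube = omega +
  fixes n :: nat and y :: "sign list set \<Rightarrow> 'a"
  assumes y: "y \<in> functors (cell_cat (Cube (Suc n))) C"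
    and corner: "corner_edge (Suc n) u \<Longrightarrow> Defs.dim C (y u) = 1"
    and flat: "i \<le> n \<Longrightarrow> X \<in> cells (Cube n) \<Longrightarrow> Defs.dim C (y (ins i Pos ` X)) = 0"
begin

lemmas y_carr = functorD(1)[OF y] and y_src = functorD(2)[OF y] and y_tgt = functorD(3)[OF y]
  and y_comp = functorD(4)[OF y]

definition pt :: 'a where "pt = y {replicate (Suc n) Pos}"

text \<open>The face lies in one of the positive faces of the cube, where all values are
  0-dimensional and thus fixed by every source and target.\<close>

lemma Pos_0:
  assumes k: "length k = Suc n" "Pos \<in> set k"
  shows "y (bd (Cube (Suc n)) s p (sub (Cube (Suc n)) k)) = y (sub (Cube (Suc n)) k)"
    "Defs.dim C (y (sub (Cube (Suc n)) k)) = 0"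
proof -
  have kc: "sub (Cube (Suc n)) k \<in> cells (Cube (Suc n))" using k by (intro cells.atom) simp
  obtain i where i: "i < Suc n" "k ! i = Pos" using k by (auto simp: in_set_conv_nth)
  let ?u = "take i k @ drop (Suc i) k"
  have u: "length ?u = n" using i k by simp
  have "k = ins i Pos ?u" using i k id_take_nth_drop[of i k] by (simp add: ins_def)
  then have "sub (Cube (Suc n)) k = ins i Pos ` sub (Cube n) ?u" using ins_sub[OF u, of i Pos] i by simp
  then show d: "Defs.dim C (y (sub (Cube (Suc n)) k)) = 0"
    using flat[of i "sub (Cube n) ?u"] cells.atom[of ?u "Cube n"] u i by simp
  show "y (bd (Cube (Suc n)) s p (sub (Cube (Suc n)) k)) = y (sub (Cube (Suc n)) k)"
    using point_fixed[OF y_carr[OF kc] d, of p] y_src[OF kc, of p] y_tgt[OF kc, of p] by (cases s) simp_all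
qed

text \<open>The word \<open>k\<close> is joined to \<open>+\<cdots>+\<close> by the faces obtained by raising its \<open>0\<close>s to \<open>-\<close>, its \<open>-\<close>s to \<open>0\<close>, and these to \<open>+\<close>.\<close>

lemma Pos_pt:
  assumes k: "length k = Suc n" "Pos \<in> set k"
  shows "y (sub (Cube (Suc n)) k) = pt"
proof -
  let ?v = "fill Neg k" and ?K = "Cube (Suc n)"
  define l where "l = map (\<lambda>a. if a = Neg then Zero else a) ?v"
  have l: "length l = Suc n" "Pos \<in> set l" using k by (force simp: l_def fill_def)+
  have fl: "fill Neg l = ?v" "fill Pos l = replicate (Suc n) Pos"
  proof -
    have "a \<noteq> Neg" if "a \<in> set l" for a using that by (auto simp: l_def split: if_splits)
    then have "(if a = Zero then Pos else a) = Pos" if "a \<in> set l" for a using that by (cases a) auto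
    then show "fill Pos l = replicate (Suc n) Pos" unfolding fill_def l(1)[symmetric] map_replicate_const[symmetric]
      by (intro map_cong) auto
    show "fill Neg l = ?v" by (auto simp: l_def fill_def)
  qed
  have "y (sub ?K k) = y {?v}" using Pos_0(1)[OF k, of True 0] cube_bd_0[OF k(1), of True] by simp
  also have "\<dots> = y (sub ?K l)" using Pos_0(1)[OF l, of True 0] cube_bd_0[OF l(1), of True] fl by simp
  also have "\<dots> = pt" using Pos_0(1)[OF l, of False 0] cube_bd_0[OF l(1), of False] fl by (simp add: pt_def)
  finally show ?thesis .
qed

lemma pt: "pt \<in> carr C" "src C p pt = pt" "tgt C p pt = pt"
proof -
  let ?k = "replicate (Suc n) Pos"
  have k: "length ?k = Suc n" "Pos \<in> set ?k" by simp_all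
  have kc: "sub (Cube (Suc n)) ?k \<in> cells (Cube (Suc n))" using k by (intro cells.atom) simp
  show "pt \<in> carr C" using y_carr[OF kc] Pos_pt[OF k] by simp
  then show "src C p pt = pt" "tgt C p pt = pt"
    using point_fixed[of pt p] Pos_0(2)[OF k] Pos_pt[OF k] by simp_all
qed

text \<open>Faces with a \<open>+\<close> count as degenerate whatever their dimension. The
  induction is over pure cells, because a boundary can satisfy the hypothesis when the cell does
  not.\<close>

lemma thin:
  assumes "X \<in> pure (Cube (Suc n))" "\<And>w. w \<in> X \<Longrightarrow> card (zs w) > q \<Longrightarrow> Pos \<in> set w"
  shows "src C q (y X) = y X \<and> tgt C q (y X) = y X"
  using assms
proof (induction rule: pure.induct)
  case (atom k)
  have k: "length k = Suc n" using atom(1) by simp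
  have kc: "sub (Cube (Suc n)) k \<in> cells (Cube (Suc n))" using atom(1) by (rule cells.atom)
  show ?case
  proof (cases "Pos \<in> set k")
    case True then show ?thesis using Pos_pt[OF k] pt by simp
  next
    case False
    have "k \<in> sub (Cube (Suc n)) k" by (simp add: Cube_sub)
    then have kq: "card (zs k) \<le> q" using atom(2) False by (meson not_le_imp_less)
    have "fdim (Cube (Suc n)) a \<le> q" if a: "a \<in> sub (Cube (Suc n)) k" for a
    proof -
      have "zs a \<subseteq> zs k" using a by (auto simp: Cube_sub zs_def)
      then have "card (zs a) \<le> card (zs k)" using finite_subset[OF zs_subset[of k]] by (intro card_mono) auto
      then show ?thesis using kq by simp
    qed
    then have "bd (Cube (Suc n)) s q (sub (Cube (Suc n)) k) = sub (Cube (Suc n)) k" for s by (rule bd_low)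
    then show ?thesis using y_src[OF kc, of q] y_tgt[OF kc, of q] by simp
  qed
next
  case (comp X Y p)
  have X: "X \<in> cells (Cube (Suc n))" and Y: "Y \<in> cells (Cube (Suc n))" using pure_cells[OF comp(1)] pure_cells[OF comp(2)] .
  have "src C q (y X) = y X \<and> tgt C q (y X) = y X" "src C q (y Y) = y Y \<and> tgt C q (y Y) = y Y"
    using comp.IH comp.prems by blast+
  moreover have "tgt C p (y X) = src C p (y Y)" using y_tgt[OF X, of p] y_src[OF Y, of p] comp(3) by simp
  ultimately show ?case
    unfolding y_comp[OF X Y comp(3)] using thin_cmp[OF omega_axioms] y_carr[OF X] y_carr[OF Y] by blast
qed

lemma all_Pos:
  assumes "X \<in> pure (Cube (Suc n))" "\<And>w. w \<in> X \<Longrightarrow> Pos \<in> set w"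
  shows "y X = pt"
  using assms
proof (induction rule: pure.induct)
  case (atom k)
  have "k \<in> sub (Cube (Suc n)) k" by (simp add: Cube_sub)
  then show ?case using atom by (intro Pos_pt) auto
next
  case (comp X Y p)
  have X: "X \<in> cells (Cube (Suc n))" and Y: "Y \<in> cells (Cube (Suc n))" using pure_cells[OF comp(1)] pure_cells[OF comp(2)] .
  have "y X = pt" "y Y = pt" using comp.IH comp.prems by blast+
  then show ?case unfolding y_comp[OF X Y comp(3)] using unit_src[OF pt(1), of p] pt(2) by simp
qed

lemma unit_left: "X \<in> cells (Cube (Suc n)) \<Longrightarrow> Y \<in> cells (Cube (Suc n)) \<Longrightarrow>
    bd (Cube (Suc n)) False p X = bd (Cube (Suc n)) True p Y \<Longrightarrow> src C p (y X) = y X \<and> tgt C p (y X) = y X \<Longrightarrow> y (X \<union> Y) = y Y"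
  and unit_right: "X \<in> cells (Cube (Suc n)) \<Longrightarrow> Y \<in> cells (Cube (Suc n)) \<Longrightarrow>
    bd (Cube (Suc n)) False p X = bd (Cube (Suc n)) True p Y \<Longrightarrow> src C p (y Y) = y Y \<and> tgt C p (y Y) = y Y \<Longrightarrow> y (X \<union> Y) = y X"
proof -
  assume X: "X \<in> cells (Cube (Suc n))" and Y: "Y \<in> cells (Cube (Suc n))" and m: "bd (Cube (Suc n)) False p X = bd (Cube (Suc n)) True p Y"
  have t: "tgt C p (y X) = src C p (y Y)" using y_tgt[OF X, of p] y_src[OF Y, of p] m by simp
  show "src C p (y X) = y X \<and> tgt C p (y X) = y X \<Longrightarrow> y (X \<union> Y) = y Y"
    using y_comp[OF X Y m] unit_src[OF y_carr[OF Y], of p] t by simp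
  show "src C p (y Y) = y Y \<and> tgt C p (y Y) = y Y \<Longrightarrow> y (X \<union> Y) = y X"
    using y_comp[OF X Y m] unit_tgt[OF y_carr[OF X], of p] t by simp
qed

text \<open>In a composite with \<open>col\<close> a full face, one factor has the same \<open>col\<close>, and the faces of the other without \<open>+\<close>
  lie in the interface.\<close>

lemma col_atom_value:
  assumes "X \<in> pure (Cube (Suc n))" "col X = sub (Delta n) \<sigma>" "\<sigma> \<in> faces (Delta n)"
  shows "y X = y (sub (Cube (Suc n)) (word (Suc n) \<sigma>))"
  using assms
proof (induction rule: pure.induct)
  case (atom k)
  have k: "length k = Suc n" using atom(1) by simp
  have "\<sigma> \<in> col (sub (Cube (Suc n)) k)" using atom by simp
  then have np: "Pos \<notin> set k" using col_sub_Pos by blast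
  then have "sub (Delta n) (zs k) = sub (Delta n) \<sigma>" using col_sub_no_Pos[OF k np, of n] atom(2) by simp
  moreover have "\<sigma> \<in> sub (Delta n) \<sigma>" using atom(3) by simp
  ultimately have "\<sigma> \<in> sub (Delta n) (zs k)" and e: "sub (Delta n) (zs k) = sub (Delta n) \<sigma>" by simp_all
  then have \<sigma>: "\<sigma> \<subseteq> zs k" "\<sigma> \<noteq> {}" by simp_all
  then have "zs k \<in> sub (Delta n) (zs k)" by auto
  then have "zs k \<subseteq> \<sigma>" unfolding e by simp
  then have "zs k = \<sigma>" using \<sigma>(1) by blast
  then show ?case using word_zs[OF k np] by simp
next
  case (comp X Y p)
  let ?K = "Cube (Suc n)"
  have X: "X \<in> cells ?K" and Y: "Y \<in> cells ?K" using pure_cells[OF comp(1)] pure_cells[OF comp(2)] .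
  have I: "X \<inter> Y = bd ?K True p Y" using cube.comp_inter[OF X Y, of True p] comp(3) by simp
  have full: "col A = sub (Delta n) \<sigma>" if A: "A \<in> cells ?K" "\<sigma> \<in> col A" "A \<subseteq> X \<union> Y" for A
  proof -
    have "col A \<in> cells (Delta n)" using col_cells(2)[OF A(1)] A(2) by auto
    then have "sub (Delta n) \<sigma> \<subseteq> col A" using simplex.cells_down A(2) unfolding down_def by blast
    moreover have "col A \<subseteq> sub (Delta n) \<sigma>" using col_mono[OF A(3)] comp.prems(1) by blast
    ultimately show ?thesis by blast
  qed
  have th: "src C p (y B) = y B \<and> tgt C p (y B) = y B"
    if A: "A \<in> cells ?K" "col A = sub (Delta n) \<sigma>" and B: "B \<in> pure ?K" "B \<subseteq> X \<union> Y" "A \<inter> B = X \<inter> Y" for A B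
  proof (rule thin[OF B(1)])
    fix w assume w: "w \<in> B" "p < card (zs w)"
    show "Pos \<in> set w"
    proof (rule ccontr)
      assume np: "Pos \<notin> set w"
      have len: "length w = Suc n" using cube.cells_faces[OF pure_cells[OF B(1)]] w(1) by auto
      have "zs w \<noteq> {}" using w(2) by auto
      then have "zs w \<in> col B" using w(1) np unfolding col_def by blast
      then have "zs w \<in> col A" using col_mono[OF B(2)] comp.prems(1) A(2) by blast
      then have "w \<in> A" using col_iff[OF cube.cells_faces[OF A(1)]] word_zs[OF len np] by simp
      then have "w \<in> bd ?K True p Y" using w(1) B(3) I by blast
      then show False using w(2) bd_dim[of w ?K True p Y] by simp
    qed
  qed
  have "\<sigma> \<in> col X \<or> \<sigma> \<in> col Y" using comp.prems unfolding col_Un by auto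
  then show ?case
  proof
    assume "\<sigma> \<in> col X"
    then have c: "col X = sub (Delta n) \<sigma>" using full[OF X] by blast
    have "y (X \<union> Y) = y X" by (rule unit_right[OF X Y comp(3) th[OF X c comp(2)]]) auto
    then show ?thesis using comp.IH(1)[OF c comp.prems(2)] by simp
  next
    assume "\<sigma> \<in> col Y"
    then have c: "col Y = sub (Delta n) \<sigma>" using full[OF Y] by blast
    have "y (X \<union> Y) = y Y" by (rule unit_left[OF X Y comp(3) th[OF Y c comp(1)]]) auto
    then show ?thesis using comp.IH(2)[OF c comp.prems(2)] by simp
  qed
qed

section \<open>Reconstruction of the functor on the simplex\<close>

abbreviation "K \<equiv> Delta n"
abbreviation "L \<equiv> Delta (Suc n)"
abbreviation "I \<equiv> Cube (Suc n)"
abbreviation "R \<equiv> real_cube (Suc n)"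
abbreviation "\<beta> \<equiv> \<lambda>b N. if b then {{Suc n}} else N"

lemmas R_cell = cell_mapD(1)[OF cell_map_real_cube[of "Suc n"]] and R_bd = cell_mapD(2)[OF cell_map_real_cube[of "Suc n"]]
  and R_Un = cell_mapD(3)[OF cell_map_real_cube[of "Suc n"]]

lemma z_src: "A \<in> cells L \<Longrightarrow> y (R (bd L True p A)) = src C p (y (R A))"
  and z_tgt: "A \<in> cells L \<Longrightarrow> y (R (bd L False p A)) = tgt C p (y (R A))"
  and z_comp: "A \<in> cells L \<Longrightarrow> B \<in> cells L \<Longrightarrow> bd L False p A = bd L True p B \<Longrightarrow> y (R (A \<union> B)) = cmp C p (y (R A)) (y (R B))"
  and z_carr: "A \<in> cells L \<Longrightarrow> y (R A) \<in> carr C"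
proof -
  assume A: "A \<in> cells L"
  show "y (R (bd L True p A)) = src C p (y (R A))" "y (R (bd L False p A)) = tgt C p (y (R A))" "y (R A) \<in> carr C"
    using R_bd[OF A] y_src[OF R_cell[OF A]] y_tgt[OF R_cell[OF A]] y_carr[OF R_cell[OF A]] by simp_all
  assume B: "B \<in> cells L" and m: "bd L False p A = bd L True p B"
  have "bd I False p (R A) = bd I True p (R B)" using R_bd[OF A, of False p] R_bd[OF B, of True p] m by simp
  then show "y (R (A \<union> B)) = cmp C p (y (R A)) (y (R B))"
    unfolding R_Un[OF A B] by (rule y_comp[OF R_cell[OF A] R_cell[OF B]])
qed

lemma R_apex: "R {{Suc n}} = {negs (Suc n)}"
proof (intro equalityI subsetI)
  fix w assume "w \<in> R {{Suc n}}"
  then have w: "length w = Suc n" "breaks w = {Suc n}" by (auto simp: real_cube_def)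
  have "w ! j = Neg" if "j < Suc n" for j
    using that
  proof (induction j)
    case 0
    have "0 \<notin> breaks w" using w(2) by simp
    then show ?case using w(1) by (auto simp: breaks_def)
  next
    case (Suc j)
    have "Suc j \<notin> breaks w" using w(2) Suc.prems by simp
    then show ?case using w(1) Suc by (auto simp: breaks_def)
  qed
  then show "w \<in> {negs (Suc n)}" using all_Neg_iff[OF w(1)] by simp
qed (use breaks_replicate[of "Suc n"] in \<open>simp add: real_cube_def del: replicate_Suc\<close>)

text \<open>The base omits the last vertex, so its words have no break at the end and their last
  letter is \<open>+\<close>.\<close>

lemma base_Pos:
  assumes N: "N \<in> cells K" and w: "w \<in> R N"
  shows "Pos \<in> set w"
proof -
  have len: "length w = Suc n" and b: "breaks w \<in> N" using w by (auto simp: real_cube_def)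
  have "breaks w \<in> faces K" using simplex.cells_faces[OF N] b by blast
  then have "Suc n \<notin> breaks w" by auto
  then obtain u where "length u = n" "w = ins n Pos u" using not_break_end[OF len] by blast
  then show ?thesis by (simp add: ins_end)
qed

lemma base_cell: "N \<in> cells K \<Longrightarrow> N \<in> cells L"
  using cell_mapD(1)[OF cell_map_base] .

text \<open>Beyond the cone over a boundary of order r - 1, whose dimension is at most r, the set
  \<open>U\<close> contains only the apex, which is a single word, or the base, all of whose words
  have a \<open>+\<close>.\<close>

lemma U_thin:
  assumes N: "N \<in> cells K"
  shows "src C r (y (R (cone.U n s r N))) = y (R (cone.U n s r N)) \<and> tgt C r (y (R (cone.U n s r N))) = y (R (cone.U n s r N))"
proof (rule thin)
  show "R (cone.U n s r N) \<in> pure I" by (intro cube_pure R_cell cone.U_in_Q[OF N])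
  fix w assume w: "w \<in> R (cone.U n s r N)" and d: "r < card (zs w)"
  have apex: "w \<notin> R {{Suc n}}" using d by (auto simp: R_apex simp del: replicate_Suc)
  show "Pos \<in> set w"
  proof (cases r)
    case 0
    then have "w \<in> R (\<beta> s N)" using w by simp
    then show ?thesis using apex base_Pos[OF N] by (cases s) auto
  next
    case (Suc r')
    let ?E = "cone n (bd K s r' N)"
    have "w \<notin> R ?E"
    proof
      assume "w \<in> R ?E"
      moreover have E: "?E \<in> cells L" by (rule cone.E_Q[OF cells_bd[OF N]])
      moreover have "bd L True r ?E = ?E"
      proof (rule bd_low)
        fix a assume "a \<in> ?E"
        then show "fdim L a \<le> r" unfolding Suc by (rule cone.E_dim) (rule bd_dim)
      qed
      ultimately have "w \<in> bd I True r (R ?E)" using R_bd[OF E, of True r] by simp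
      then show False using bd_dim[of w I True r "R ?E"] d by simp
    qed
    moreover have "cone.U n s r N = ?E \<union> \<beta> (odd r' = s) N" unfolding Suc by (rule cone.U.simps(2))
    ultimately have "w \<in> R (\<beta> (odd r' = s) N)" using w by (auto simp: real_cube_def)
    then show ?thesis using apex base_Pos[OF N] by (cases "odd r' = s") auto
  qed
qed

text \<open>By \<open>U_Suc\<close> the set is a composite along order r of the cone with a piece
  that \<open>y\<close> sends to a unit of this order.\<close>

lemma value_U:
  assumes N: "N \<in> cells K"
  shows "y (R (cone.U n s (Suc r) N)) = y (R (cone n (bd K s r N)))"
proof -
  let ?E = "cone n (bd K s r N)" and ?V = "cone.U n (\<not> s) r N"
  have E: "?E \<in> cells L" and V: "?V \<in> cells L" using cone.E_Q[OF cells_bd[OF N]] cone.U_in_Q[OF N] by auto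
  have "\<forall>q\<ge>r. \<forall>s'. bd L s' q ?V = cone.U n (\<not> s) r (bd K s' q N)"
    using cone.U_Q[OF cone.E_good N, where r=r and s="\<not> s"] by blast
  then have m: "bd L (\<not> s) r ?E = bd L s r ?V" by (intro cone.U_step[OF N E V]) blast
  have u: "cone.U n s (Suc r) N = ?E \<union> ?V" by (rule cone.U_Suc[OF N])
  note t = U_thin[OF N, where r=r and s="\<not> s"]
  have mR: "bd I (\<not> s) r (R ?E) = bd I s r (R ?V)" using m R_bd[OF E, of "\<not> s" r] R_bd[OF V, of s r] by simp
  show ?thesis
  proof (cases s)
    case True
    then show ?thesis unfolding u R_Un[OF E V] using unit_right[OF R_cell[OF E] R_cell[OF V], of r] mR t by simp
  next
    case False
    then show ?thesis unfolding u R_Un[OF E V] using unit_left[OF R_cell[OF V] R_cell[OF E], of r] mR t by (simp add: Un_commute)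
  qed
qed

text \<open>The cone raises dimensions by one, and this matches the shift of orders in
  \<open>path_cat\<close>.\<close>

definition x :: "nat set set \<Rightarrow> 'a" where
  "x = (\<lambda>W\<in>cells K. y (R (cone n W)))"

lemma x_apply: "W \<in> cells K \<Longrightarrow> x W = y (R (cone n W))"
  by (simp add: x_def)

text \<open>Here the corner condition enters. The 1-source of the subdivided cone starts at the
  vertex and ends in words with a \<open>+\<close>, so it is a corner edge and its value has
  dimension 1.\<close>

lemma x_dim:
  assumes W: "W \<in> cells K"
  shows "Defs.dim C (x W) > 0"
proof (rule ccontr)
  assume "\<not> Defs.dim C (x W) > 0"
  then have d: "Defs.dim C (x W) = 0" by simp
  let ?A = "cone n W"
  define u where "u = bd I True 1 (R ?A)"
  have A: "?A \<in> cells L" by (rule cone.E_Q[OF W])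
  note RA = R_cell[OF A]
  have "corner_edge (Suc n) u"
    unfolding corner_edge_def
  proof (intro conjI)
    show "u \<in> cells I" unfolding u_def by (rule cells_bd[OF RA])
    show "bd I True 1 u = u" "bd I False 1 u = u" unfolding u_def by (simp_all add: bd_bd_ge)
    have "bd I True 0 u = R (bd L True 0 ?A)" unfolding u_def using cube.bd_bd[OF RA, of 0 1] R_bd[OF A, of True 0] by simp
    also have "bd L True 0 ?A = {{Suc n}}" using cone.bd_E_0[OF W, of True] by simp
    finally show "bd I True 0 u = {negs (Suc n)}" unfolding R_apex .
    have "bd I False 0 u = R (bd L False 0 ?A)" unfolding u_def using cube.bd_bd[OF RA, of 0 1] R_bd[OF A, of False 0] by simp
    also have "bd L False 0 ?A = bd K False 0 W" using cone.bd_E_0[OF W, of False] by simp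
    finally show "negs (Suc n) \<notin> bd I False 0 u" using base_Pos[OF cells_bd[OF W, of False 0], of "negs (Suc n)"] by auto
  qed
  then have "Defs.dim C (y u) = 1" by (rule corner)
  moreover have "y u = src C 1 (x W)" unfolding u_def x_apply[OF W] by (rule y_src[OF RA])
  moreover have "x W \<in> carr C" using z_carr[OF A] x_apply[OF W] by simp
  ultimately show False using point_fixed[of "x W" 1] d by simp
qed

lemma x_bd:
  assumes W: "W \<in> cells K"
  shows "x (bd K True q W) = src C (Suc q) (x W)" "x (bd K False q W) = tgt C (Suc q) (x W)"
proof -
  let ?A = "cone n W"
  have A: "?A \<in> cells L" by (rule cone.E_Q[OF W])
  have e: "y (R (bd L s (Suc q) ?A)) = x (bd K s q W)" for s
  proof -
    have "bd L s (Suc q) ?A = cone.U n s (Suc q) (bd K s (Suc q) W)" by (rule cone.bd_E[OF W])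
    then have "y (R (bd L s (Suc q) ?A)) = y (R (cone n (bd K s q (bd K s (Suc q) W))))"
      using value_U[OF cells_bd[OF W]] by simp
    then show ?thesis using simplex.bd_bd[OF W, of q "Suc q" s s] x_apply[OF cells_bd[OF W]] by simp
  qed
  show "x (bd K True q W) = src C (Suc q) (x W)" "x (bd K False q W) = tgt C (Suc q) (x W)"
    using e[of True] e[of False] z_src[OF A, of "Suc q"] z_tgt[OF A, of "Suc q"] x_apply[OF W] by simp_all
qed

text \<open>The four pieces given by \<open>comp_E\<close> reduce to two, as \<open>V\<close> and
  \<open>W\<close> are sent to units of order p. What remains is a composite along order p + 1, the
  one of the path category.\<close>

lemma x_comp:
  assumes X: "X \<in> cells K" and Y: "Y \<in> cells K" and m: "bd K False p X = bd K True p Y"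
  shows "x (X \<union> Y) = cmp C (Suc p) (x X) (x Y)"
proof -
  let ?V = "cone.U n False p (bd K True (Suc p) Y)" and ?W = "cone.U n True p (bd K False (Suc p) X)"
  have EX: "cone n X \<in> cells L" and EY: "cone n Y \<in> cells L" using cone.E_Q X Y by auto
  note c = cone.comp_E[OF X EX Y EY m cone.E_good]
  have R_match: "bd I False q (R A) = bd I True q (R B)" if "A \<in> cells L" "B \<in> cells L" "bd L False q A = bd L True q B" for A B q
    using that R_bd[OF that(1), of False q] R_bd[OF that(2), of True q] by simp
  have 1: "y (R (cone n X \<union> ?V)) = x X"
    unfolding R_Un[OF EX c(1)] x_apply[OF X]
    by (rule unit_right[OF R_cell[OF EX] R_cell[OF c(1)] R_match[OF EX c(1,3)] U_thin[OF cells_bd[OF Y]]])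
  have 2: "y (R (?W \<union> cone n Y)) = x Y"
    unfolding R_Un[OF c(2) EY] x_apply[OF Y]
    by (rule unit_left[OF R_cell[OF c(2)] R_cell[OF EY] R_match[OF c(2) EY c(4)] U_thin[OF cells_bd[OF X]]])
  have "x (X \<union> Y) = y (R (cone n (X \<union> Y)))" by (rule x_apply[OF cells_comp[OF X Y m]])
  also have "\<dots> = cmp C (Suc p) (y (R (cone n X \<union> ?V))) (y (R (?W \<union> cone n Y)))"
    unfolding c(6) by (rule z_comp[OF cells_comp[OF EX c(1,3)] cells_comp[OF c(2) EY c(4)] c(5)])
  finally show ?thesis unfolding 1 2 .
qed

lemma x_functor: "x \<in> functors (cell_cat K) (path_cat C)"
  unfolding functors_cell_iff
proof (intro conjI ballI allI impI)
  show "x \<in> cells K \<rightarrow>\<^sub>E carr (path_cat C)"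
    using x_dim z_carr[OF cone.E_Q] x_apply by (auto simp: x_def)
qed (simp_all add: x_bd x_comp)

text \<open>A word without \<open>+\<close> has its breaks at the zeros and at the end, which is the
  apex. So among these words the cone selects those whose zeros lie in the face.\<close>

lemma col_R_cone:
  assumes s: "\<sigma> \<in> faces K"
  shows "col (R (cone n (sub K \<sigma>))) = sub K \<sigma>"
proof -
  have mem: "w \<in> R (cone n (sub K \<sigma>)) \<longleftrightarrow> zs w \<subseteq> \<sigma>" if w: "length w = Suc n" "Pos \<notin> set w" for w
  proof -
    have "Suc n \<notin> zs w" using w(1) zs_less[of "Suc n" w] by auto
    then have "insert (Suc n) (zs w) \<subseteq> insert (Suc n) \<sigma> \<longleftrightarrow> zs w \<subseteq> \<sigma>" by auto
    then show ?thesis unfolding cone_atom[OF s] real_cube_def using w(1) breaks_word[OF w] by simp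
  qed
  have R: "R (cone n (sub K \<sigma>)) \<subseteq> faces I" by (auto simp: real_cube_def)
  show ?thesis
  proof (intro set_eqI)
    fix \<tau>
    have "\<tau> \<in> col (R (cone n (sub K \<sigma>))) \<longleftrightarrow> \<tau> \<subseteq> {..<Suc n} \<and> \<tau> \<noteq> {} \<and> \<tau> \<subseteq> \<sigma>"
      using col_iff[OF R, of \<tau>] mem[of "word (Suc n) \<tau>"] zs_word[of \<tau> "Suc n"] by auto
    moreover have "\<sigma> \<subseteq> {..<Suc n}" using s by auto
    ultimately show "\<tau> \<in> col (R (cone n (sub K \<sigma>))) \<longleftrightarrow> \<tau> \<in> sub K \<sigma>" by auto
  qed
qed

text \<open>Faces with a \<open>+\<close> share the value \<open>pt\<close>, which is also the
  0-target of the cones; the faces through the vertex are the subject of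
  \<open>col_atom_value\<close>; the vertex itself is the apex of the cones.\<close>

lemma h_x: "h_map C n x = y"
proof (rule functor_eqI[OF h_map_functor[OF x_functor] y])
  fix k assume "k \<in> faces I"
  then have k: "length k = Suc n" and kc: "sub I k \<in> cells I" by (simp, rule cells.atom)
  have h: "h_map C n x (sub I k) = h_val C n x k" using h_map_apply[OF x_functor kc] hv_atom[OF k] by simp
  consider (P) "Pos \<in> set k" | (Z) "Pos \<notin> set k" "zs k \<noteq> {}" | (N) "Pos \<notin> set k" "zs k = {}" by blast
  then show "h_map C n x (sub I k) = y (sub I k)"
  proof cases
    case P
    have s: "sub K {0} \<in> cells K" by (rule cells.atom) simp
    have A: "cone n (sub K {0}) \<in> cells L" by (rule cone.E_Q[OF s])
    have N: "bd K False 0 (sub K {0}) \<in> cells K" by (rule cells_bd[OF s])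
    have "h_val C n x k = tgt C 0 (x (sub K {0}))" using P by (simp add: h_val_def)
    also have "\<dots> = y (R (bd K False 0 (sub K {0})))"
      unfolding x_apply[OF s] z_tgt[OF A, symmetric] using cone.bd_E_0[OF s, of False] by simp
    also have "\<dots> = pt" using all_Pos[OF cube_pure[OF R_cell[OF base_cell[OF N]]] base_Pos[OF N]] by simp
    finally show ?thesis using h Pos_pt[OF k P] by simp
  next
    case Z
    have s: "zs k \<in> faces K" using Z(2) k by (auto dest: zs_less)
    have sc: "sub K (zs k) \<in> cells K" by (rule cells.atom[OF s])
    have "Zero \<in> set k" using Z(2) by (auto simp: zs_def in_set_conv_nth)
    then have "h_val C n x k = x (sub K (zs k))" using Z(1) by (simp add: h_val_def zs_def)
    also have "\<dots> = y (sub I (word (Suc n) (zs k)))"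
      unfolding x_apply[OF sc] by (rule col_atom_value[OF cube_pure[OF R_cell[OF cone.E_Q[OF sc]]] col_R_cone[OF s] s])
    finally show ?thesis using h word_zs[OF k Z(1)] by simp
  next
    case N
    have s: "sub K {n} \<in> cells K" by (rule cells.atom) simp
    have A: "cone n (sub K {n}) \<in> cells L" by (rule cone.E_Q[OF s])
    have "Zero \<notin> set k" using N(2) by (auto simp: zs_def in_set_conv_nth)
    then have "h_val C n x k = src C 0 (x (sub K {n}))" using N(1) by (simp add: h_val_def)
    also have "\<dots> = y (R {{Suc n}})"
      unfolding x_apply[OF s] z_src[OF A, symmetric] using cone.bd_E_0[OF s, of True] by simp
    finally show ?thesis using h negs_no_zeros[OF k N] R_apex sub_negs[of "Suc n"] by simp
  qed
qed

end

lemma (in omega) h_image: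
  "h_map C n ` simp (globular_nerve C) n =
    {y \<in> simp (corner_nerve C) n. \<forall>i\<in>{1..n + 1}. \<forall>X\<in>cells (Cube n). cube_face C n Pos i y X \<in> mors C 0}"
proof (intro equalityI subsetI)
  fix y assume a: "y \<in> {y \<in> simp (corner_nerve C) n. \<forall>i\<in>{1..n + 1}. \<forall>X\<in>cells (Cube n). cube_face C n Pos i y X \<in> mors C 0}"
  then have y: "y \<in> functors (cell_cat (Cube (Suc n))) C" by (simp add: corner_simp)
  have "flat_cube C n y"
  proof (unfold_locales)
    show "y \<in> functors (cell_cat (Cube (Suc n))) C" by (rule y)
    show "Defs.dim C (y u) = 1" if "corner_edge (Suc n) u" for u using a that by (simp add: corner_simp)
    show "Defs.dim C (y (ins i Pos ` X)) = 0" if "i \<le> n" "X \<in> cells (Cube n)" for i X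
    proof -
      have "cube_face C n Pos (Suc i) y X \<in> mors C 0" using a that by simp
      then show ?thesis using cube_face_pb[of i n Pos, OF _ _ y] that by (simp add: pb_apply mors_def)
    qed
  qed
  then show "y \<in> h_map C n ` simp (globular_nerve C) n"
    using flat_cube.h_x flat_cube.x_functor by (metis globular_simp imageI)
qed (auto simp: h_map_corner h_image_faces)

theorem theorem6p4:
  fixes C :: "'a ocat"
  assumes "omega_category C" and "non_contracting C"
  shows "(\<forall>n. \<forall>x \<in> functors (cell_cat (Delta n)) (path_cat C).
            \<exists>!F. F \<in> functors (cell_cat (Cube (n + 1))) C \<and>
                 (\<forall>k \<in> faces (Cube (n + 1)). F (sub (Cube (n + 1)) k) = h_val C n x k)) \<and>
         simplicial_map (globular_nerve C) (corner_nerve C) (h_map C) \<and>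
         aug_simplicial_map (globular_nerve C) (corner_nerve C) (h_map C) (\<lambda>(a, b). a) \<and>
         (\<forall>n. inj_on (h_map C n) (simp (globular_nerve C) n) \<and>
            h_map C n ` simp (globular_nerve C) n =
              {y \<in> simp (corner_nerve C) n. \<forall>i \<in> {1..n + 1}.
                 \<forall>X \<in> carr (cell_cat (Cube n)). cube_face C n Pos i y X \<in> mors C 0})"
proof -
  interpret omega C by (rule omega.intro) fact
  have "carr (cell_cat (Cube n)) = cells (Cube n)" for n by (simp add: cell_cat_def)
  then show ?thesis using h_unique h_simplicial h_augmented h_inj h_image by simp
qed

end
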